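(* For the voting rule Borda, Bribery is $\mathrm{NP}$-complete (under polynomial-time many-one reductions) with a bribe limit of 2 (i.e., restricted to instances with $k=2$), but Conformant Bribery with a bribe limit of 2 is in $\mathrm{P}$.
   Context: An election $(C,V)$ consists of a finite set of candidates $C$ and a finite collection (multiset, listed explicitly) of voters $V$; each voter has a vote, which is a strict total order over $C$. Borda: in an election with $m$ candidates, a candidate receives $m-i$ points from each vote in which it is ranked $i$th (scoring vector $\langle m-1,m-2,\dots,1,0\rangle$). The winners are all candidates with the highest total score (several winners are allowed). Borda Bribery. Given: an election $(C,V)$, a bribe limit $k\ge 0$, and a preferred candidate $p\in C$. Question: does there exist a subcollection of at most $k$ voters in $V$ whose votes can be changed (to arbitrary strict total orders over $C$) such that $p$ is a Borda winner of the resulting election? Borda Conformant Bribery. Same input. Question: does there exist a way to set the votes of a subcollection of at most $k$ voters in $V$ to votes that occur in (the original) $V$ such that $p$ is a Borda winner of the resulting election? *)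

theory Defs
  imports "HOL-Combinatorics.Multiset_Permutations" "HOL-Computational_Algebra.Polynomial"
begin

section \<open>Elections and bribery under Borda\<close>

text \<open>
  A strict total order over a finite candidate set \<open>C\<close> is given by listing \<open>C\<close> from the most to the
  least preferred candidate, so the votes over \<open>C\<close> are the members of \<^term>\<open>permutations_of_set C\<close>;
  lemma \<open>bij_betw_vote_order\<close> below is the correspondence. The voter collection is a list of votes,
  and voters are identified with positions in that list.
\<close>

definition vote_order :: "'a list \<Rightarrow> ('a \<times> 'a) set" where
  "vote_order v = {(v ! i, v ! j) | i j. i < j \<and> j < length v}"

definition election :: "'a set \<Rightarrow> 'a list list \<Rightarrow> bool" where
  "election C V \<longleftrightarrow> finite C \<and> set V \<subseteq> permutations_of_set C"

text \<open>1 for the top candidate, \<^term>\<open>card C\<close> for the last one.\<close>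

definition vote_rank :: "'a list \<Rightarrow> 'a \<Rightarrow> nat" where
  "vote_rank v c = Suc (length (takeWhile (\<lambda>d. d \<noteq> c) v))"

definition borda_score :: "'a set \<Rightarrow> 'a list list \<Rightarrow> 'a \<Rightarrow> nat" where
  "borda_score C V c = (\<Sum>v\<leftarrow>V. card C - vote_rank v c)"

definition borda_winners :: "'a set \<Rightarrow> 'a list list \<Rightarrow> 'a set" where
  "borda_winners C V = {c \<in> C. \<forall>d\<in>C. borda_score C V d \<le> borda_score C V c}"

text \<open>The lists obtainable from \<open>V\<close> by setting the votes of at most \<open>k\<close> voters to members of \<open>A\<close>.\<close>

definition bribed :: "'a list set \<Rightarrow> nat \<Rightarrow> 'a list list \<Rightarrow> 'a list list set" where
  "bribed A k V = {W. length W = length V \<and>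
     (\<exists>S \<subseteq> {..<length V}. card S \<le> k \<and>
        (\<forall>i<length V. if i \<in> S then W ! i \<in> A else W ! i = V ! i))}"

definition borda_bribable :: "'a set \<Rightarrow> 'a list list \<Rightarrow> nat \<Rightarrow> 'a \<Rightarrow> bool" where
  "borda_bribable C V k p \<longleftrightarrow> (\<exists>W \<in> bribed (permutations_of_set C) k V. p \<in> borda_winners C W)"

definition borda_conformant_bribable :: "'a set \<Rightarrow> 'a list list \<Rightarrow> nat \<Rightarrow> 'a \<Rightarrow> bool" where
  "borda_conformant_bribable C V k p \<longleftrightarrow> (\<exists>W \<in> bribed (set V) k V. p \<in> borda_winners C W)"

lemma vote_order_Cons: "vote_order (x # v) = {x} \<times> set v \<union> vote_order v"
proof (rule set_eqI, clarify)
  fix a b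
  show "(a, b) \<in> vote_order (x # v) \<longleftrightarrow> (a, b) \<in> {x} \<times> set v \<union> vote_order v"
  proof
    assume "(a, b) \<in> vote_order (x # v)"
    then obtain i j where ij: "a = (x # v) ! i" "b = (x # v) ! j" "i < j" "j < length (x # v)"
      by (auto simp: vote_order_def)
    then obtain j' where j': "j = Suc j'" by (cases j) auto
    show "(a, b) \<in> {x} \<times> set v \<union> vote_order v"
      using ij j' by (cases i) (auto simp: vote_order_def)
  next
    assume "(a, b) \<in> {x} \<times> set v \<union> vote_order v"
    then consider j where "a = x" "j < length v" "b = v ! j"
      | i j where "i < j" "j < length v" "a = v ! i" "b = v ! j"
      by (auto simp: vote_order_def in_set_conv_nth)
    then show "(a, b) \<in> vote_order (x # v)"
    proof cases
      case 1
      then have "a = (x # v) ! 0 \<and> b = (x # v) ! Suc j \<and> 0 < Suc j \<and> Suc j < length (x # v)"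
        by simp
      then show ?thesis unfolding vote_order_def by blast
    next
      case 2
      then have "a = (x # v) ! Suc i \<and> b = (x # v) ! Suc j \<and> Suc i < Suc j \<and>
          Suc j < length (x # v)"
        by simp
      then show ?thesis unfolding vote_order_def by blast
    qed
  qed
qed

lemma card_above_vote_order:
  assumes "distinct v" "i < length v"
  shows "card {b. (b, v ! i) \<in> vote_order v} = i"
proof -
  have "{b. (b, v ! i) \<in> vote_order v} = (!) v ` {..<i}"
    using assms by (auto simp: vote_order_def nth_eq_iff_index_eq)
  moreover have "inj_on ((!) v) {..<i}"
    using assms by (auto simp: inj_on_def nth_eq_iff_index_eq)
  ultimately show ?thesis by (simp add: card_image)
qed

lemma strict_linear_order_on_vote_order:
  assumes "v \<in> permutations_of_set C"
  shows "vote_order v \<subseteq> C \<times> C \<and> strict_linear_order_on C (vote_order v)"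
proof -
  from assms have C: "C = set v" and d: "distinct v"
    by (auto simp: permutations_of_set_def)
  have "trans (vote_order v)"
  proof (rule transI)
    fix x y z
    assume "(x, y) \<in> vote_order v" "(y, z) \<in> vote_order v"
    then obtain i j j' l where ij: "x = v ! i" "y = v ! j" "i < j" "j < length v"
      and jl: "y = v ! j'" "z = v ! l" "j' < l" "l < length v"
      unfolding vote_order_def by blast
    then have "j = j'" using d by (simp add: nth_eq_iff_index_eq)
    with ij jl have "i < l" by simp
    with ij jl show "(x, z) \<in> vote_order v" unfolding vote_order_def by blast
  qed
  moreover have "irrefl (vote_order v)"
    using d by (auto simp: irrefl_def vote_order_def nth_eq_iff_index_eq)
  moreover have "total_on C (vote_order v)"
  proof (rule total_onI)
    fix x y
    assume "x \<in> C" "y \<in> C" "x \<noteq> y"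
    then obtain i j where ij: "x = v ! i" "i < length v" "y = v ! j" "j < length v"
      unfolding C in_set_conv_nth by blast
    with \<open>x \<noteq> y\<close> have "i < j \<or> j < i" by (metis linorder_neqE_nat)
    with ij show "(x, y) \<in> vote_order v \<or> (y, x) \<in> vote_order v"
      unfolding vote_order_def by blast
  qed
  moreover have "vote_order v \<subseteq> C \<times> C"
    by (auto simp: vote_order_def C)
  ultimately show ?thesis by (simp add: strict_linear_order_on_def)
qed

lemma strict_linear_order_is_vote_order:
  assumes "finite C" "r \<subseteq> C \<times> C" "strict_linear_order_on C r"
  shows "\<exists>v \<in> permutations_of_set C. vote_order v = r"
  using assms
proof (induction "card C" arbitrary: C r)
  case 0
  then show ?case by (auto simp: vote_order_def)
next
  case (Suc n)
  have r: "trans r" "irrefl r" "total_on C r"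
    using Suc.prems by (auto simp: strict_linear_order_on_def)
  have "finite r" using Suc.prems by (meson finite_SigmaI finite_subset)
  moreover have "acyclic r" using r by (simp add: acyclic_irrefl)
  ultimately have "wf r" by (rule finite_acyclic_wf)
  moreover have "C \<noteq> {}" using Suc.hyps by auto
  ultimately obtain m where m: "m \<in> C" "\<And>y. (y, m) \<in> r \<Longrightarrow> y \<notin> C"
    by (metis ex_in_conv wfE_min)
  let ?C = "C - {m}" and ?r = "r \<inter> (C - {m}) \<times> (C - {m})"
  have "strict_linear_order_on ?C ?r"
    using r unfolding strict_linear_order_on_def trans_def irrefl_def total_on_def by blast
  moreover have "n = card ?C" using Suc.hyps m Suc.prems by simp
  ultimately obtain v where v: "v \<in> permutations_of_set ?C" "vote_order v = ?r"
    using Suc.hyps(1)[of ?C ?r] Suc.prems by auto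
  then have "m # v \<in> permutations_of_set C"
    using m by (auto simp: permutations_of_set_def)
  moreover have "r = {m} \<times> ?C \<union> ?r"
    using Suc.prems(2) m r unfolding total_on_def irrefl_def by blast
  then have "vote_order (m # v) = r"
    using v by (simp add: vote_order_Cons permutations_of_set_def)
  ultimately show ?case by blast
qed

lemma bij_betw_vote_order:
  assumes "finite C"
  shows "bij_betw vote_order (permutations_of_set C)
           {r. r \<subseteq> C \<times> C \<and> strict_linear_order_on C r}"
proof (rule bij_betw_imageI)
  show "inj_on vote_order (permutations_of_set C)"
  proof (rule inj_onI)
    fix v w
    assume "v \<in> permutations_of_set C" "w \<in> permutations_of_set C"
      and eq: "vote_order v = vote_order w"
    then have vw: "distinct v" "distinct w" "set v = set w"
      by (auto simp: permutations_of_set_def)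
    show "v = w"
    proof (rule nth_equalityI)
      show "length v = length w" using vw by (metis distinct_card)
      fix i assume i: "i < length v"
      then obtain j where j: "j < length w" "v ! i = w ! j"
        using vw by (metis in_set_conv_nth)
      have "i = j"
        using card_above_vote_order[OF vw(1) i] card_above_vote_order[OF vw(2) j(1)] eq j
        by simp
      with j show "v ! i = w ! i" by simp
    qed
  qed
  show "vote_order ` permutations_of_set C = {r. r \<subseteq> C \<times> C \<and> strict_linear_order_on C r}"
    (is "_ = ?R")
  proof (intro equalityI subsetI)
    fix r assume "r \<in> vote_order ` permutations_of_set C"
    then show "r \<in> ?R" using strict_linear_order_on_vote_order by auto
  next
    fix r assume "r \<in> ?R"
    then show "r \<in> vote_order ` permutations_of_set C"
      using strict_linear_order_is_vote_order[OF assms, of r] by blast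
  qed
qed


section \<open>Decision problems as sets of instances\<close>

record bribery_input =
  candidates :: "nat list"
  voters :: "nat list list"
  bribe_limit :: nat
  preferred :: nat

definition valid_input :: "bribery_input \<Rightarrow> bool" where
  "valid_input I \<longleftrightarrow> distinct (candidates I) \<and> election (set (candidates I)) (voters I) \<and>
     preferred I \<in> set (candidates I)"

definition Borda_Bribery :: "bribery_input set" where
  "Borda_Bribery = {I. valid_input I \<and>
     borda_bribable (set (candidates I)) (voters I) (bribe_limit I) (preferred I)}"

definition Borda_Conformant_Bribery :: "bribery_input set" where
  "Borda_Conformant_Bribery = {I. valid_input I \<and>
     borda_conformant_bribable (set (candidates I)) (voters I) (bribe_limit I) (preferred I)}"


section \<open>Encoding of instances as bit strings\<close>

text \<open>
  Every item of a list is announced by \<^term>\<open>True\<close> and the list is closed by \<^term>\<open>False\<close>, which is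
  self-delimiting whenever the encoding of the items is. Numbers are written in binary, least
  significant bit first and without leading zeros.
\<close>

definition enc_list :: "('a \<Rightarrow> bool list) \<Rightarrow> 'a list \<Rightarrow> bool list" where
  "enc_list f xs = concat (map (\<lambda>x. True # f x) xs) @ [False]"

fun binary :: "nat \<Rightarrow> bool list" where
  "binary n = (if n = 0 then [] else odd n # binary (n div 2))"

declare binary.simps [simp del]

definition enc_nat :: "nat \<Rightarrow> bool list" where
  "enc_nat n = enc_list (\<lambda>b. [b]) (binary n)"

definition enc_input :: "bribery_input \<Rightarrow> bool list" where
  "enc_input I = enc_list enc_nat (candidates I) @ enc_list (enc_list enc_nat) (voters I) @
     enc_nat (bribe_limit I) @ enc_nat (preferred I)"

definition enc_pair :: "bool list \<Rightarrow> bool list \<Rightarrow> bool list" where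
  "enc_pair x y = enc_list (\<lambda>b. [b]) x @ y"

definition prefix_free :: "('a \<Rightarrow> bool list) \<Rightarrow> bool" where
  "prefix_free f \<longleftrightarrow> (\<forall>x y s t. f x @ s = f y @ t \<longrightarrow> x = y \<and> s = t)"

lemma prefix_freeD: "prefix_free f \<Longrightarrow> f x @ s = f y @ t \<Longrightarrow> x = y \<and> s = t"
  by (auto simp: prefix_free_def)

lemma prefix_free_enc_list:
  assumes "prefix_free f"
  shows "prefix_free (enc_list f)"
proof -
  have "xs = ys \<and> s = t" if "enc_list f xs @ s = enc_list f ys @ t" for xs ys s t
    using that
  proof (induction xs arbitrary: ys)
    case Nil
    then show ?case by (cases ys) (auto simp: enc_list_def)
  next
    case (Cons x xs)
    show ?case
    proof (cases ys)
      case Nil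
      with Cons.prems show ?thesis by (simp add: enc_list_def)
    next
      case (Cons y ys')
      with Cons.prems have "f x @ (enc_list f xs @ s) = f y @ (enc_list f ys' @ t)"
        by (simp add: enc_list_def)
      from prefix_freeD[OF assms this] Cons.IH[of ys'] Cons show ?thesis by auto
    qed
  qed
  then show ?thesis unfolding prefix_free_def by blast
qed

lemma binary_inject: "binary m = binary n \<Longrightarrow> m = n"
proof (induction m arbitrary: n rule: binary.induct)
  case (1 m)
  show ?case
  proof (cases "m = 0 \<or> n = 0")
    case True
    with "1.prems" show ?thesis
      by (auto simp: binary.simps[of m] binary.simps[of n] split: if_splits)
  next
    case False
    with "1.prems" have "odd m = odd n" "binary (m div 2) = binary (n div 2)"
      by (simp_all add: binary.simps[of m] binary.simps[of n])
    with "1.IH" False have "m div 2 = n div 2" by blast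
    with \<open>odd m = odd n\<close> show ?thesis
      by (metis bit_eq_rec)
  qed
qed

lemma prefix_free_bit: "prefix_free (\<lambda>b. [b])"
  by (simp add: prefix_free_def)

lemma prefix_free_enc_nat: "prefix_free enc_nat"
  unfolding prefix_free_def
proof (intro allI impI)
  fix m n s t
  assume "enc_nat m @ s = enc_nat n @ t"
  then have "binary m = binary n \<and> s = t"
    unfolding enc_nat_def by (rule prefix_freeD[OF prefix_free_enc_list[OF prefix_free_bit]])
  then show "m = n \<and> s = t" using binary_inject by simp
qed

lemma inj_enc_input: "inj enc_input"
proof (rule injI)
  fix I J :: bribery_input
  assume eq: "enc_input I = enc_input J"
  note names = prefix_free_enc_nat
  note votes = prefix_free_enc_list[OF names]
  from eq have c1: "candidates I = candidates J \<and>
      enc_list (enc_list enc_nat) (voters I) @ enc_nat (bribe_limit I) @ enc_nat (preferred I) =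
      enc_list (enc_list enc_nat) (voters J) @ enc_nat (bribe_limit J) @ enc_nat (preferred J)"
    unfolding enc_input_def by (rule prefix_freeD[OF votes])
  from conjunct2[OF c1] have c2: "voters I = voters J \<and>
      enc_nat (bribe_limit I) @ enc_nat (preferred I) = enc_nat (bribe_limit J) @ enc_nat (preferred J)"
    by (rule prefix_freeD[OF prefix_free_enc_list[OF votes]])
  from conjunct2[OF c2] have c3: "bribe_limit I = bribe_limit J \<and>
      enc_nat (preferred I) = enc_nat (preferred J)"
    by (rule prefix_freeD[OF names])
  then have "enc_nat (preferred I) @ [] = enc_nat (preferred J) @ []" by simp
  then have "preferred I = preferred J \<and> ([] :: bool list) = []"
    by (rule prefix_freeD[OF names])
  with c1 c2 c3 show "I = J" by simp
qed

lemma enc_pair_inject: "enc_pair x y = enc_pair x' y' \<longleftrightarrow> x = x' \<and> y = y'"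
proof
  assume "enc_pair x y = enc_pair x' y'"
  then show "x = x' \<and> y = y'"
    unfolding enc_pair_def by (rule prefix_freeD[OF prefix_free_enc_list[OF prefix_free_bit]])
qed simp


section \<open>Deterministic multitape Turing machines\<close>

text \<open>
  States are \<open>0, \<dots>, num_states M\<close>, where 0 is initial and \<^term>\<open>num_states M\<close> is the halting state.
  The tape alphabet is \<open>{..<num_symbols M}\<close>; symbol 0 is the blank, and 1 and 2 are the bits.
  Tapes are infinite in both directions. Tape 0 initially holds the input, tape 1 finally holds
  the output.
\<close>

datatype direction = Left | Stay | Right

record tm =
  num_tapes :: nat
  num_symbols :: nat
  num_states :: nat
  delta :: "nat \<Rightarrow> nat list \<Rightarrow> nat \<times> (nat \<times> direction) list"

definition wf_tm :: "tm \<Rightarrow> bool" where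
  "wf_tm M \<longleftrightarrow> num_tapes M \<ge> 2 \<and> num_symbols M \<ge> 3 \<and>
     (\<forall>q<num_states M. \<forall>as. length as = num_tapes M \<and> set as \<subseteq> {..<num_symbols M} \<longrightarrow>
        (case delta M q as of (q', acts) \<Rightarrow> q' \<le> num_states M \<and> length acts = num_tapes M \<and>
           fst ` set acts \<subseteq> {..<num_symbols M}))"

text \<open>Cell contents and head position.\<close>

type_synonym tape = "(int \<Rightarrow> nat) \<times> int"

type_synonym config = "nat \<times> tape list"

primrec move_head :: "direction \<Rightarrow> int \<Rightarrow> int" where
  "move_head Left h = h - 1"
| "move_head Stay h = h"
| "move_head Right h = h + 1"

definition tape_read :: "tape \<Rightarrow> nat" where
  "tape_read t = fst t (snd t)"

definition tape_act :: "nat \<times> direction \<Rightarrow> tape \<Rightarrow> tape" where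
  "tape_act a t = ((fst t)(snd t := fst a), move_head (snd a) (snd t))"

definition tm_step :: "tm \<Rightarrow> config \<Rightarrow> config" where
  "tm_step M c = (case c of (q, ts) \<Rightarrow>
     if q < num_states M then
       (case delta M q (map tape_read ts) of (q', acts) \<Rightarrow> (q', map2 tape_act acts ts))
     else c)"

definition tape_word :: "bool list \<Rightarrow> int \<Rightarrow> nat" where
  "tape_word w i =
     (if 0 \<le> i \<and> i < int (length w) then if w ! nat i then 2 else 1 else 0)"

definition init_config :: "tm \<Rightarrow> bool list \<Rightarrow> config" where
  "init_config M x = (0, (tape_word x, 0) # replicate (num_tapes M - 1) (tape_word [], 0))"

definition halted_with :: "tm \<Rightarrow> bool list \<Rightarrow> config \<Rightarrow> bool" where
  "halted_with M y c \<longleftrightarrow> fst c = num_states M \<and> fst (snd c ! 1) = tape_word y"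

definition computes_in_time :: "tm \<Rightarrow> (bool list \<Rightarrow> bool list) \<Rightarrow> (nat \<Rightarrow> nat) \<Rightarrow> bool" where
  "computes_in_time M f T \<longleftrightarrow>
     (\<forall>x. \<exists>n \<le> T (length x). halted_with M (f x) ((tm_step M ^^ n) (init_config M x)))"


section \<open>Complexity classes\<close>

type_synonym language = "bool list set"

definition poly_time_computable :: "(bool list \<Rightarrow> bool list) \<Rightarrow> bool" where
  "poly_time_computable f \<longleftrightarrow>
     (\<exists>M (T :: nat poly). wf_tm M \<and> computes_in_time M f (poly T))"

definition class_P :: "language set" where
  "class_P = {L. poly_time_computable (\<lambda>x. [x \<in> L])}"

definition class_NP :: "language set" where
  "class_NP = {L. \<exists>R \<in> class_P. \<exists>T :: nat poly. \<forall>x.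
     x \<in> L \<longleftrightarrow> (\<exists>u. length u \<le> poly T (length x) \<and> enc_pair x u \<in> R)}"

definition poly_many_one_reducible :: "language \<Rightarrow> language \<Rightarrow> bool" where
  "poly_many_one_reducible A B \<longleftrightarrow>
     (\<exists>f. poly_time_computable f \<and> (\<forall>x. x \<in> A \<longleftrightarrow> f x \<in> B))"

definition NP_complete :: "language \<Rightarrow> bool" where
  "NP_complete B \<longleftrightarrow> B \<in> class_NP \<and> (\<forall>A \<in> class_NP. poly_many_one_reducible A B)"

end

theory Submission
  imports Defs
begin

text \<open>
  Bribing two of the voters means choosing two positions in the list of votes and two new votes. A
  conformant bribe is thus one of polynomially many quadruples of voters, while in general the two new
  votes form a certificate.

  For the hardness, two voters rank the preferred candidate \<open>p\<close> last, and all the other voters come in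
  pairs of almost opposite votes that fix the score differences to \<open>p\<close> at will. The scores are such that
  \<open>p\<close> can only win if exactly the two special voters are bribed and rank \<open>p\<close> first. The scores are then
  so tight that the two new votes are permutations of the other candidates with prescribed sums of
  positions; reversing one of them, these are two permutations with prescribed differences. If all
  differences are multiples of \<open>n\<close>, every residue class modulo \<open>n\<close> is permuted, and the differences in
  each class cancel: \<open>n\<close> jumps back of the same size \<open>n * B\<close> make this the problem of packing items into
  \<open>n\<close> bins of size \<open>B\<close> without gaps. As all the numbers are polynomially bounded, the packing problem is
  hard in unary; it encodes the choice of a set with prescribed numbers of elements in the classes of
  three partitions, which in turn encodes the satisfiability of clauses, and clauses describe the computations
  of a Turing machine.

  That the reductions and the verifiers run in polynomial time is derived from closure properties of a
  class of functions into the natural numbers, built from bounded loops over counters, which are compiled to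
  Turing machines.
\<close>

section \<open>A command language for tapes\<close>

text \<open>Scores enter an election as numbers of voters, so only numbers that are polynomially
  bounded can be realised; hence the detour over packing problems that are hard in unary. The
  tightness is an averaging argument. The total score depends only on the size of the election, a
  winner reaches at least the average, and \<open>p\<close> starts exactly \<open>2 * m\<close>
  points below it, where \<open>m\<close> is both the number of rivals and the most that one bribe
  can gain. A winning \<open>p\<close> therefore has exactly the average score, and all inequalities
  become equations. In the packing step a bin is a closed tour through one residue class: its items
  climb from level 0 to level \<open>B\<close>, and the jump back closes the tour. P and NP are
  defined by concrete Turing machines, so polynomial time has to be witnessed by a machine. To avoid
  programming, a string is described by arithmetic formulas for its length and for each single bit,
  and only these formulas are compiled. Numbers are unary there, which suffices for everything that
  is counted; candidate names and the bribe limit, which may be exponentially large, are only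
  compared as bit strings.\<close>

datatype com =
    Move nat direction
  | Write nat nat
  | Seq com com
  | Cond nat nat com com
  | Until nat nat com

primrec wfc :: "nat \<Rightarrow> com \<Rightarrow> bool" where
  "wfc K (Move i d) \<longleftrightarrow> i < K"
| "wfc K (Write i a) \<longleftrightarrow> i < K \<and> a < 3"
| "wfc K (Seq c1 c2) \<longleftrightarrow> wfc K c1 \<and> wfc K c2"
| "wfc K (Cond i a c1 c2) \<longleftrightarrow> i < K \<and> wfc K c1 \<and> wfc K c2"
| "wfc K (Until i a c) \<longleftrightarrow> i < K \<and> wfc K c"

text \<open>The control is the stack of commands still to be executed. Unfolding a compound command
  takes a silent step of its own, so the next stack depends only on the present one and the scanned
  symbols, as a transition function requires.\<close>

fun next_ctl :: "com list \<Rightarrow> nat list \<Rightarrow> com list" where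
  "next_ctl [] as = []"
| "next_ctl (Move i d # k) as = k"
| "next_ctl (Write i a # k) as = k"
| "next_ctl (Seq c1 c2 # k) as = c1 # c2 # k"
| "next_ctl (Cond i a c1 c2 # k) as = (if as ! i = a then c1 else c2) # k"
| "next_ctl (Until i a c # k) as = (if as ! i = a then k else c # Until i a c # k)"

fun ctl_act :: "com list \<Rightarrow> nat \<Rightarrow> nat \<Rightarrow> nat \<times> direction" where
  "ctl_act (Move i d # k) j s = (s, if j = i then d else Stay)"
| "ctl_act (Write i a # k) j s = (if j = i then a else s, Stay)"
| "ctl_act k j s = (s, Stay)"

definition cstep :: "com list \<times> tape list \<Rightarrow> com list \<times> tape list" where
  "cstep c = (case c of (k, ts) \<Rightarrow> (next_ctl k (map tape_read ts),
     map (\<lambda>j. tape_act (ctl_act k j (tape_read (ts ! j))) (ts ! j)) [0..<length ts]))"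

text \<open>The control stacks that occur while \<open>c\<close> runs on top of \<open>k\<close>; being finitely many, they serve
  as the states of a Turing machine.\<close>

primrec conts :: "com \<Rightarrow> com list \<Rightarrow> com list set" where
  "conts (Move i d) k = {Move i d # k}"
| "conts (Write i a) k = {Write i a # k}"
| "conts (Seq c1 c2) k = insert (Seq c1 c2 # k) (conts c1 (c2 # k) \<union> conts c2 k)"
| "conts (Cond i a c1 c2) k = insert (Cond i a c1 c2 # k) (conts c1 k \<union> conts c2 k)"
| "conts (Until i a c) k = insert (Until i a c # k) (conts c (Until i a c # k))"

lemma finite_conts: "finite (conts c k)"
  by (induction c arbitrary: k) auto

lemma Cons_in_conts: "c # k \<in> conts c k"
  by (cases c) auto

lemma Nil_notin_conts: "[] \<notin> conts c k"
  by (induction c arbitrary: k) auto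

text \<open>The finite set of stacks is left only towards \<open>k\<close>, when \<open>c\<close> is
  finished, so it can serve as a state set.\<close>

lemma next_ctl_conts: "st \<in> conts c k \<Longrightarrow> next_ctl st as \<in> insert k (conts c k)"
proof (induction c arbitrary: k)
  case (Seq c1 c2)
  then show ?case
    using Cons_in_conts[of c1 "c2 # k"] Cons_in_conts[of c2 k] by fastforce
next
  case (Cond i a c1 c2)
  then show ?case
    using Cons_in_conts[of c1 k] Cons_in_conts[of c2 k] by (auto split: if_splits)
next
  case (Until i a c)
  then show ?case
    using Cons_in_conts[of c "Until i a c # k"] by (auto split: if_splits)
qed auto

lemma wfc_conts:
  assumes "st \<in> conts c k" "wfc K c" "\<And>c'. c' \<in> set k \<Longrightarrow> wfc K c'" "c' \<in> set st"
  shows "wfc K c'"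
  using assms
proof (induction c arbitrary: k)
  case (Seq c1 c2)
  consider "st = Seq c1 c2 # k" | "st \<in> conts c1 (c2 # k)" | "st \<in> conts c2 k"
    using Seq.prems(1) by auto
  then show ?case
  proof cases
    case 1
    with Seq.prems show ?thesis by auto
  next
    case 2
    show ?thesis by (rule Seq.IH(1)[OF 2]) (use Seq.prems in auto)
  next
    case 3
    show ?thesis by (rule Seq.IH(2)[OF 3]) (use Seq.prems in auto)
  qed
next
  case (Cond i a c1 c2)
  consider "st = Cond i a c1 c2 # k" | "st \<in> conts c1 k" | "st \<in> conts c2 k"
    using Cond.prems(1) by auto
  then show ?case
  proof cases
    case 1
    with Cond.prems show ?thesis by auto
  next
    case 2
    show ?thesis by (rule Cond.IH(1)[OF 2]) (use Cond.prems in auto)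
  next
    case 3
    show ?thesis by (rule Cond.IH(2)[OF 3]) (use Cond.prems in auto)
  qed
next
  case (Until i a c)
  consider "st = Until i a c # k" | "st \<in> conts c (Until i a c # k)"
    using Until.prems(1) by auto
  then show ?case
  proof cases
    case 1
    with Until.prems show ?thesis by auto
  next
    case 2
    show ?thesis by (rule Until.IH[OF 2]) (use Until.prems in auto)
  qed
qed auto

lemma length_cstep: "length (snd (cstep c)) = length (snd c)"
  by (simp add: cstep_def split: prod.split)

lemma tape_act_Stay: "tape_act (tape_read t, Stay) t = t"
  by (simp add: tape_act_def tape_read_def)

lemma cstep_Nil: "cstep ([], ts) = ([], ts)"
  by (simp add: cstep_def tape_act_Stay map_nth)

text \<open>The state of a stack is its place in the list \<open>L\<close>. The initial stack comes
  first and gets the number 0. The empty stack is not listed, so the search for it ends at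
  \<open>length L\<close>, which is the halting state.\<close>

lemma com_machine:
  assumes wf: "wfc K c" and K: "K \<ge> 2"
  obtains M where "wf_tm M" "num_tapes M = K"
    "\<And>ts n ts'. length ts = K \<Longrightarrow> (cstep ^^ n) ([c], ts) = ([], ts') \<Longrightarrow>
       (tm_step M ^^ n) (0, ts) = (num_states M, ts')"
proof -
  obtain xs where xs: "set xs = conts c []" using finite_list[OF finite_conts] by blast
  define L where "L = [c] # xs"
  have L: "set L = conts c []" using xs Cons_in_conts[of c "[]"] by (auto simp: L_def)
  define num where "num = (\<lambda>st. length (takeWhile (\<lambda>y. y \<noteq> st) L))"
  have num_L: "L ! num st = st" "num st < length L" if "st \<in> set L" for st
  proof -
    show less: "num st < length L"
      using that unfolding num_def by (induction L) auto
    show "L ! num st = st"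
      using nth_length_takeWhile[of "\<lambda>y. y \<noteq> st" L] less unfolding num_def by simp
  qed
  have num_Nil: "num [] = length L"
  proof -
    have "\<forall>y\<in>set L. y \<noteq> []" using Nil_notin_conts[of c "[]"] L by metis
    then have "takeWhile (\<lambda>y. y \<noteq> []) L = L" by (simp only: takeWhile_eq_all_conv)
    then show ?thesis by (simp only: num_def)
  qed
  have num_0: "num [c] = 0" by (simp add: num_def L_def)
  define M where "M = \<lparr>num_tapes = K, num_symbols = 3, num_states = length L,
    delta = \<lambda>q as. (num (next_ctl (L ! q) as), map (\<lambda>j. ctl_act (L ! q) j (as ! j)) [0..<K])\<rparr>"
  have nxt: "next_ctl st as \<in> insert [] (set L)" if "st \<in> insert [] (set L)" for st as
  proof (cases "st = []")
    case True
    then show ?thesis by simp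
  next
    case False
    then have "st \<in> conts c []" using that L by blast
    then show ?thesis unfolding L by (rule next_ctl_conts)
  qed
  have sym: "fst (ctl_act st j s) < 3" if "\<forall>c\<in>set st. wfc K c" "s < 3" for st j s
    using that by (induction st j s rule: ctl_act.induct) auto
  have "wf_tm M"
    unfolding wf_tm_def
  proof (intro conjI allI impI)
    show "2 \<le> num_tapes M" using K by (simp add: M_def)
    show "3 \<le> num_symbols M" by (simp add: M_def)
    fix q as assume q: "q < num_states M"
      and as: "length as = num_tapes M \<and> set as \<subseteq> {..<num_symbols M}"
    from q have st: "L ! q \<in> set L" by (simp add: M_def)
    have "num (next_ctl (L ! q) as) \<le> length L"
      using nxt[of "L ! q" as] st num_L(2) num_Nil by (metis insert_iff less_imp_le order_refl)
    moreover have "\<forall>c'\<in>set (L ! q). wfc K c'"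
      using wfc_conts[OF _ wf, of "L ! q" "[]"] st L by simp
    then have "fst (ctl_act (L ! q) j (as ! j)) < 3" if "j < K" for j
    proof -
      have "as ! j \<in> set as" using as that by (simp add: M_def)
      then have "as ! j < 3" using as by (auto simp: M_def)
      with sym show ?thesis using \<open>\<forall>c'\<in>set (L ! q). wfc K c'\<close> by blast
    qed
    ultimately show "case delta M q as of (q', acts) \<Rightarrow> q' \<le> num_states M \<and>
        length acts = num_tapes M \<and> fst ` set acts \<subseteq> {..<num_symbols M}"
      by (auto simp: M_def)
  qed
  moreover have "num_tapes M = K" by (simp add: M_def)
  moreover have sim: "\<exists>st ts'. st \<in> insert [] (set L) \<and> length ts' = K \<and>
      (cstep ^^ n) ([c], ts) = (st, ts') \<and> (tm_step M ^^ n) (0, ts) = (num st, ts')"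
    if "length ts = K" for ts n
  proof (induction n)
    case 0
    then show ?case using that num_0 L Cons_in_conts[of c "[]"] by auto
  next
    case (Suc n)
    then obtain st ts' where *: "st \<in> insert [] (set L)" "length ts' = K"
      "(cstep ^^ n) ([c], ts) = (st, ts')" "(tm_step M ^^ n) (0, ts) = (num st, ts')" by blast
    define u where "u = snd (cstep (st, ts'))"
    have u: "length u = K" using length_cstep[of "(st, ts')"] *(2) by (simp add: u_def)
    have cs: "cstep (st, ts') = (next_ctl st (map tape_read ts'), u)"
      by (simp add: u_def cstep_def)
    have "tm_step M (num st, ts') = (num (next_ctl st (map tape_read ts')), u)"
    \<comment> \<open>A finished program stutters on both sides: \<open>cstep\<close> keeps the
      empty stack and \<open>tm_step\<close> keeps a halted configuration.\<close>
    proof (cases "st = []")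
      case True
      have "u = ts'" using cs cstep_Nil[of ts'] True by simp
      then show ?thesis using num_Nil True by (simp add: tm_step_def M_def)
    next
      case False
      then have st: "st \<in> set L" using *(1) by auto
      have "map2 tape_act (map (\<lambda>j. ctl_act st j (map tape_read ts' ! j)) [0..<K]) ts' = u"
        unfolding u_def cstep_def using *(2) by (auto intro!: nth_equalityI)
      then show ?thesis using num_L[OF st] by (simp add: tm_step_def M_def)
    qed
    moreover have "next_ctl st (map tape_read ts') \<in> insert [] (set L)" by (rule nxt[OF *(1)])
    ultimately show ?case using * cs u by auto
  qed
  have "(tm_step M ^^ n) (0, ts) = (num_states M, ts')"
    if "length ts = K" "(cstep ^^ n) ([c], ts) = ([], ts')" for ts n ts'
    using sim[OF that(1), of n] that(2) num_Nil by (auto simp: M_def)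
  ultimately show thesis using that by blast
qed

text \<open>The stack below \<open>c\<close> is arbitrary, which makes runs composable.\<close>

definition runs :: "com \<Rightarrow> tape list \<Rightarrow> nat \<Rightarrow> tape list \<Rightarrow> bool" where
  "runs c ts n ts' \<longleftrightarrow> (\<forall>k. (cstep ^^ n) (c # k, ts) = (k, ts'))"

lemma cstep_silent:
  assumes "\<And>j s. ctl_act k j s = (s, Stay)"
  shows "cstep (k, ts) = (next_ctl k (map tape_read ts), ts)"
  by (simp add: cstep_def assms tape_act_Stay map_nth)

lemma runs_Move:
  assumes "i < length ts"
  shows "runs (Move i d) ts 1 (ts[i := (fst (ts ! i), move_head d (snd (ts ! i)))])"
  unfolding runs_def using assms
  by (auto simp: cstep_def tape_act_def tape_read_def nth_list_update intro!: nth_equalityI)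

lemma runs_Write:
  assumes "i < length ts"
  shows "runs (Write i a) ts 1 (ts[i := ((fst (ts ! i))(snd (ts ! i) := a), snd (ts ! i))])"
  unfolding runs_def using assms
  by (auto simp: cstep_def tape_act_def tape_read_def nth_list_update intro!: nth_equalityI)

lemma runs_Seq:
  assumes "runs c1 ts n1 ts1" "runs c2 ts1 n2 ts2"
  shows "runs (Seq c1 c2) ts (Suc (n1 + n2)) ts2"
  unfolding runs_def
proof
  fix k
  have "(cstep ^^ Suc (n1 + n2)) (Seq c1 c2 # k, ts) = (cstep ^^ (n2 + n1)) (c1 # c2 # k, ts)"
    by (simp only: funpow_Suc_right o_def add.commute) (simp add: cstep_silent)
  also have "\<dots> = (k, ts2)" using assms by (simp add: funpow_add runs_def)
  finally show "(cstep ^^ Suc (n1 + n2)) (Seq c1 c2 # k, ts) = (k, ts2)" .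
qed

lemma runs_Cond:
  assumes "i < length ts" "runs (if tape_read (ts ! i) = a then c1 else c2) ts n ts'"
  shows "runs (Cond i a c1 c2) ts (Suc n) ts'"
  unfolding runs_def
proof
  fix k
  have "(cstep ^^ Suc n) (Cond i a c1 c2 # k, ts) =
      (cstep ^^ n) ((if tape_read (ts ! i) = a then c1 else c2) # k, ts)"
    by (simp only: funpow_Suc_right o_def) (simp add: cstep_silent assms(1))
  then show "(cstep ^^ Suc n) (Cond i a c1 c2 # k, ts) = (k, ts')"
    using assms(2) by (simp add: runs_def)
qed

lemma runs_Until_stop:
  assumes "i < length ts" "tape_read (ts ! i) = a"
  shows "runs (Until i a c) ts 1 ts"
  unfolding runs_def using assms by (simp add: cstep_silent)

lemma runs_Until_step:
  assumes "i < length ts" "tape_read (ts ! i) \<noteq> a"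
    "runs c ts n1 ts1" "runs (Until i a c) ts1 n2 ts2"
  shows "runs (Until i a c) ts (Suc (n1 + n2)) ts2"
  unfolding runs_def
proof
  fix k
  have "(cstep ^^ Suc (n1 + n2)) (Until i a c # k, ts) =
      (cstep ^^ (n2 + n1)) (c # Until i a c # k, ts)"
    by (simp only: funpow_Suc_right o_def add.commute) (simp add: cstep_silent assms)
  also have "\<dots> = (k, ts2)" using assms by (simp add: funpow_add runs_def)
  finally show "(cstep ^^ Suc (n1 + n2)) (Until i a c # k, ts) = (k, ts2)" .
qed


section \<open>Counter programs\<close>

text \<open>Tape 0 holds the input, tape 1 the output; every other tape carries a marker in cell 0 and
  represents a counter by its head position.\<close>

definition tapes :: "nat \<Rightarrow> bool list \<Rightarrow> nat \<Rightarrow> bool list \<Rightarrow> (nat \<Rightarrow> nat) \<Rightarrow> tape list" where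
  "tapes K x h w s = (tape_word x, int h) # (tape_word w, int (length w)) #
     map (\<lambda>r. (tape_word [False], int (s r))) [0..<K]"

text \<open>\<open>h\<close> is the head position on the input, \<open>w\<close> the output written
  so far and \<open>s\<close> the values of the counters. Only an upper bound \<open>T\<close> of
  the number of steps is kept, so that bounds can be weakened at will.\<close>

definition exe :: "nat \<Rightarrow> bool list \<Rightarrow> com \<Rightarrow> nat \<Rightarrow> bool list \<Rightarrow> (nat \<Rightarrow> nat) \<Rightarrow> nat \<Rightarrow>
    nat \<Rightarrow> bool list \<Rightarrow> (nat \<Rightarrow> nat) \<Rightarrow> bool" where
  "exe K x c h w s T h' w' s' \<longleftrightarrow> (\<exists>n\<le>T. runs c (tapes K x h w s) n (tapes K x h' w' s'))"

abbreviation "Inc r \<equiv> Move (r + 2) Right"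
abbreviation "Dec r \<equiv> Move (r + 2) Left"
text \<open>The marker in cell 0 is the symbol 1, the only symbol of
  \<open>tape_word [False]\<close>; a counter is zero iff 1 is scanned.\<close>

abbreviation "While r c \<equiv> Until (r + 2) (Suc 0) c"
abbreviation "InR \<equiv> Move 0 Right"
abbreviation "InL \<equiv> Move 0 Left"
abbreviation "Noop \<equiv> Move 0 Stay"
abbreviation "Emit b \<equiv> Seq (Write 1 (if b then 2 else 1)) (Move 1 Right)"

lemma length_tapes [simp]: "length (tapes K x h w s) = K + 2"
  by (simp add: tapes_def)

lemma nth_tapes [simp]:
  "tapes K x h w s ! 0 = (tape_word x, int h)"
  "tapes K x h w s ! Suc 0 = (tape_word w, int (length w))"
  "r < K \<Longrightarrow> tapes K x h w s ! Suc (Suc r) = (tape_word [False], int (s r))"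
  by (simp_all add: tapes_def)

lemma tapes_update:
  "(tapes K x h w s)[0 := (tape_word x, int h')] = tapes K x h' w s"
  "(tapes K x h w s)[Suc 0 := (tape_word w', int (length w'))] = tapes K x h w' s"
  "r < K \<Longrightarrow> (tapes K x h w s)[Suc (Suc r) := (tape_word [False], int v)] = tapes K x h w (s(r := v))"
  by (auto simp: tapes_def nth_list_update intro!: nth_equalityI)

lemma exe_mono: "exe K x c h w s T h' w' s' \<Longrightarrow> T \<le> T' \<Longrightarrow> exe K x c h w s T' h' w' s'"
  unfolding exe_def by (meson le_trans)

lemma exe_Inc: "r < K \<Longrightarrow> exe K x (Inc r) h w s 1 h w (s(r := Suc (s r)))"
  using runs_Move[of "r + 2" "tapes K x h w s" Right] tapes_update(3)[of r K x h w s "Suc (s r)"]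
  unfolding exe_def by (auto simp: algebra_simps)

lemma exe_Dec: "r < K \<Longrightarrow> s r > 0 \<Longrightarrow> exe K x (Dec r) h w s 1 h w (s(r := s r - 1))"
  using runs_Move[of "r + 2" "tapes K x h w s" Left] tapes_update(3)[of r K x h w s "s r - 1"]
  unfolding exe_def by (auto simp: algebra_simps of_nat_diff)

lemma exe_InR: "exe K x InR h w s 1 (Suc h) w s"
  using runs_Move[of 0 "tapes K x h w s" Right] tapes_update(1)[of K x h w s "Suc h"]
  unfolding exe_def by (auto simp: algebra_simps)

lemma exe_InL: "h > 0 \<Longrightarrow> exe K x InL h w s 1 (h - 1) w s"
  using runs_Move[of 0 "tapes K x h w s" Left] tapes_update(1)[of K x h w s "h - 1"]
  unfolding exe_def by (auto simp: algebra_simps of_nat_diff)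

lemma exe_Noop: "exe K x Noop h w s 1 h w s"
  using runs_Move[of 0 "tapes K x h w s" Stay] tapes_update(1)[of K x h w s "h"]
  unfolding exe_def by auto

lemma exe_Seq:
  assumes "exe K x c1 h w s T1 h1 w1 s1" "exe K x c2 h1 w1 s1 T2 h2 w2 s2" "Suc (T1 + T2) \<le> T"
  shows "exe K x (Seq c1 c2) h w s T h2 w2 s2"
proof -
  obtain n1 n2 where "n1 \<le> T1" "runs c1 (tapes K x h w s) n1 (tapes K x h1 w1 s1)"
    "n2 \<le> T2" "runs c2 (tapes K x h1 w1 s1) n2 (tapes K x h2 w2 s2)"
    using assms unfolding exe_def by blast
  then show ?thesis
    unfolding exe_def using runs_Seq assms(3) by (intro exI[of _ "Suc (n1 + n2)"]) auto
qed

lemma tape_word_snoc: "(tape_word w)(int (length w) := if b then 2 else 1) = tape_word (w @ [b])"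
  by (rule ext) (auto simp: tape_word_def nth_append split: if_splits)

lemma exe_Emit: "exe K x (Emit b) h w s 3 h (w @ [b]) s"
proof -
  let ?ts = "tapes K x h w s"
  let ?ts1 = "?ts[Suc 0 := (tape_word (w @ [b]), int (length w))]"
  have "runs (Write 1 (if b then 2 else 1)) ?ts 1 ?ts1"
    using runs_Write[of 1 ?ts "if b then 2 else 1"] tape_word_snoc[of w b] by (simp split: if_splits)
  moreover have "runs (Move 1 Right) ?ts1 1 (tapes K x h (w @ [b]) s)"
    using runs_Move[of 1 ?ts1 Right] tapes_update(2)[of K x h w s "w @ [b]"] by (simp add: add.commute)
  ultimately have "runs (Emit b) ?ts (Suc (1 + 1)) (tapes K x h (w @ [b]) s)" by (rule runs_Seq)
  then show ?thesis unfolding exe_def by (intro exI[of _ "Suc (1 + 1)"]) simp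
qed

lemma tape_read_counter: "r < K \<Longrightarrow> tape_read (tapes K x h w s ! (r + 2)) = (if s r = 0 then 1 else 0)"
  by (simp add: tape_read_def tape_word_def)

lemma tape_read_input: "tape_read (tapes K x h w s ! 0) = 
   (if h < length x then if x ! h then 2 else 1 else 0)"
  by (simp add: tape_read_def tape_word_def)

lemma exe_IfIn:
  assumes "exe K x (if h < length x \<and> x ! h then c1 else c2) h w s T h' w' s'"
  shows "exe K x (Cond 0 2 c1 c2) h w s (Suc T) h' w' s'"
proof -
  obtain n where n: "n \<le> T" "runs (if h < length x \<and> x ! h then c1 else c2) (tapes K x h w s) n (tapes K x h' w' s')"
    using assms unfolding exe_def by blast
  have "runs (Cond 0 2 c1 c2) (tapes K x h w s) (Suc n) (tapes K x h' w' s')"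
    by (rule runs_Cond) (use n(2) in \<open>auto simp: tape_read_input[of K x h w s, simplified] split: if_splits\<close>)
  then show ?thesis unfolding exe_def using n(1) by (intro exI[of _ "Suc n"]) simp
qed

lemma exe_Until_iterate:
  assumes i: "i < K + 2"
    and step: "\<And>k. k < N \<Longrightarrow> tape_read (tapes K x (H k) (W k) (S k) ! i) \<noteq> a"
      "\<And>k. k < N \<Longrightarrow> exe K x c (H k) (W k) (S k) T (H (Suc k)) (W (Suc k)) (S (Suc k))"
    and stop: "tape_read (tapes K x (H N) (W N) (S N) ! i) = a"
  shows "exe K x (Until i a c) (H 0) (W 0) (S 0) (N * Suc T + 1) (H N) (W N) (S N)"
proof -
  \<comment> \<open>Induction on the number \<open>j\<close> of rounds still to go, because
    \<open>runs_Until_step\<close> prepends one round to the rest of the loop.\<close>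
  have "j \<le> N \<Longrightarrow> exe K x (Until i a c) (H (N - j)) (W (N - j)) (S (N - j)) (j * Suc T + 1) (H N) (W N) (S N)" for j
  proof (induction j)
    case 0
    then show ?case using runs_Until_stop[of i _ a c] stop i unfolding exe_def by auto
  next
    case (Suc j)
    let ?k = "N - Suc j"
    have k: "?k < N" "Suc ?k = N - j" using Suc.prems by auto
    obtain n1 where n1: "n1 \<le> T" "runs c (tapes K x (H ?k) (W ?k) (S ?k)) n1 (tapes K x (H (N-j)) (W (N-j)) (S (N-j)))"
      using step(2)[OF k(1)] k(2) unfolding exe_def by auto
    obtain n2 where n2: "n2 \<le> j * Suc T + 1" "runs (Until i a c) (tapes K x (H (N-j)) (W (N-j)) (S (N-j))) n2 (tapes K x (H N) (W N) (S N))"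
      using Suc.IH Suc.prems unfolding exe_def by auto
    have "runs (Until i a c) (tapes K x (H ?k) (W ?k) (S ?k)) (Suc (n1 + n2)) (tapes K x (H N) (W N) (S N))"
      using runs_Until_step[OF _ _ n1(2) n2(2)] step(1)[OF k(1)] i by simp
    then show ?case unfolding exe_def using n1(1) n2(1) by (intro exI[of _ "Suc (n1 + n2)"]) simp
  qed
  from this[of N] show ?thesis by simp
qed

lemma exe_While:
  assumes "r < K" "\<And>k. k < N \<Longrightarrow> S k r > 0" "S N r = 0"
    and "\<And>k. k < N \<Longrightarrow> exe K x c (H k) (W k) (S k) T (H (Suc k)) (W (Suc k)) (S (Suc k))"
    and "h = H 0" "w = W 0" "s = S 0" "h' = H N" "w' = W N" "s' = S N" "N * Suc T + 1 \<le> T'"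
  shows "exe K x (While r c) h w s T' h' w' s'"
proof -
  have "exe K x (While r c) (H 0) (W 0) (S 0) (N * Suc T + 1) (H N) (W N) (S N)"
    by (rule exe_Until_iterate) (use assms(1-4) in \<open>auto simp: tape_read_counter simp del: add_2_eq_Suc'\<close>)
  then show ?thesis using assms(5-) exe_mono by blast
qed

section \<open>Initialisation of the counter tapes\<close>

primrec put_markers :: "nat \<Rightarrow> com" where
  "put_markers 0 = Noop"
| "put_markers (Suc r) = Seq (put_markers r) (Write (r + 2) 1)"

definition marked :: "nat \<Rightarrow> bool list \<Rightarrow> nat \<Rightarrow> tape list" where
  "marked K x r = (tape_word x, 0) # (tape_word [], 0) #
     map (\<lambda>i. (if i < r then tape_word [False] else tape_word [], 0)) [0..<K]"

lemma marked_update: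
  assumes "r < K"
  shows "(marked K x r)[r + 2 := (tape_word [False], 0)] = marked K x (Suc r)"
proof -
  have "(map f [0..<K])[r := v] = map (f(r := v)) [0..<K]" for f and v :: tape
    using assms by (auto simp: nth_list_update intro!: nth_equalityI)
  then show ?thesis by (auto simp: marked_def less_Suc_eq)
qed

lemma runs_put_markers: "r \<le> K \<Longrightarrow> runs (put_markers r) (marked K x 0) (2 * r + 1) (marked K x r)"
proof (induction r)
  case 0
  have "(marked K x 0)[0 := (tape_word x, 0)] = marked K x 0" by (simp add: marked_def)
  then show ?case using runs_Move[of 0 "marked K x 0" Stay] by (simp add: marked_def)
next
  case (Suc r)
  have "(tape_word [])(0 := 1) = tape_word [False]" by (auto simp: tape_word_def)
  moreover have "marked K x r ! (r + 2) = (tape_word [], 0)" "length (marked K x r) = K + 2"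
    using Suc.prems by (simp_all add: marked_def)
  ultimately have "runs (Write (r + 2) 1) (marked K x r) 1 (marked K x (Suc r))"
    using runs_Write[of "r + 2" "marked K x r" 1] Suc.prems marked_update[of r K x] by simp
  from runs_Seq[OF Suc.IH this] Suc.prems show ?case by simp
qed

lemma wfc_mono: "wfc K c \<Longrightarrow> K \<le> K' \<Longrightarrow> wfc K' c"
  by (induction c) auto

lemma wfc_put_markers: "r \<le> K \<Longrightarrow> wfc (K + 2) (put_markers r)"
  by (induction r) auto

text \<open>All tapes except the input start blank, so a prologue has to write the markers first; it
  adds a constant to the time bound.\<close>

lemma poly_time_computableI:
  assumes "wfc (K + 2) c"
    and "\<And>x. \<exists>h s. exe K x c 0 [] (\<lambda>_. 0) (poly T (length x)) h (f x) s"
  shows "poly_time_computable f"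
proof -
  have "wfc (K + 2) (Seq (put_markers K) c)" using assms(1) wfc_put_markers by simp
  then obtain M where M: "wf_tm M" "num_tapes M = K + 2"
    "\<And>ts n ts'. length ts = K + 2 \<Longrightarrow> (cstep ^^ n) ([Seq (put_markers K) c], ts) = ([], ts') \<Longrightarrow>
       (tm_step M ^^ n) (0, ts) = (num_states M, ts')"
    by (rule com_machine) auto
  have "computes_in_time M f (poly (T + [:2 * K + 2:]))"
    unfolding computes_in_time_def
  proof
    fix x
    have init: "init_config M x = (0, marked K x 0)"
      by (simp add: init_config_def M(2) marked_def map_replicate_const)
    have "map (\<lambda>i. (if i < K then tape_word [False] else tape_word [], 0::int)) [0..<K] =
        map (\<lambda>_. (tape_word [False], 0)) [0..<K]"
      by (rule map_cong) auto
    then have "marked K x K = tapes K x 0 [] (\<lambda>_. 0)"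
      by (simp add: tapes_def marked_def)
    with runs_put_markers[of K K x]
    have 1: "runs (put_markers K) (marked K x 0) (2 * K + 1) (tapes K x 0 [] (\<lambda>_. 0))"
      by simp
    have len: "length (marked K x 0) = K + 2" by (simp add: marked_def)
    obtain h s n where n: "n \<le> poly T (length x)"
      "runs c (tapes K x 0 [] (\<lambda>_. 0)) n (tapes K x h (f x) s)"
      using assms(2)[of x] unfolding exe_def by blast
    from runs_Seq[OF 1 n(2)] have "(cstep ^^ Suc (2 * K + 1 + n)) ([Seq (put_markers K) c], marked K x 0) =
        ([], tapes K x h (f x) s)" unfolding runs_def by blast
    from M(3)[OF len this] have "(tm_step M ^^ Suc (2 * K + 1 + n)) (init_config M x) =
        (num_states M, tapes K x h (f x) s)" unfolding init by simp
    moreover have "Suc (2 * K + 1 + n) \<le> poly (T + [:2 * K + 2:]) (length x)" using n(1) by simp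
    moreover have "halted_with M (f x) (num_states M, tapes K x h (f x) s)"
      by (simp add: halted_with_def)
    ultimately show "\<exists>n\<le>poly (T + [:2 * K + 2:]) (length x).
        halted_with M (f x) ((tm_step M ^^ n) (init_config M x))"
      by (intro exI[of _ "Suc (2 * K + 1 + n)"]) simp
  qed
  with M(1) show ?thesis unfolding poly_time_computable_def by blast
qed


lemma exe_IncI: "r < K \<Longrightarrow> s' = s(r := Suc (s r)) \<Longrightarrow> exe K x (Inc r) h w s 1 h w s'"
  using exe_Inc by blast

lemma exe_DecI: "r < K \<Longrightarrow> s r > 0 \<Longrightarrow> s' = s(r := s r - 1) \<Longrightarrow> exe K x (Dec r) h w s 1 h w s'"
  using exe_Dec by blast

lemma exe_InLI: "h > 0 \<Longrightarrow> h' = h - 1 \<Longrightarrow> exe K x InL h w s 1 h' w s"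
  using exe_InL by blast

lemma exe_IfZero:
  assumes "r < K" "exe K x (if s r = 0 then c1 else c2) h w s T h' w' s'"
  shows "exe K x (Cond (r + 2) (Suc 0) c1 c2) h w s (Suc T) h' w' s'"
proof -
  obtain n where n: "n \<le> T" "runs (if s r = 0 then c1 else c2) (tapes K x h w s) n (tapes K x h' w' s')"
    using assms unfolding exe_def by blast
  have "runs (Cond (r + 2) (Suc 0) c1 c2) (tapes K x h w s) (Suc n) (tapes K x h' w' s')"
    by (rule runs_Cond)
      (use n(2) assms(1) tape_read_counter[of r K x h w s] in \<open>auto simp: simp del: add_2_eq_Suc' split: if_splits\<close>)
  then show ?thesis unfolding exe_def using n(1) by (intro exI[of _ "Suc n"]) simp
qed

section \<open>Moving, clearing and copying counters\<close>

definition mv :: "nat \<Rightarrow> nat \<Rightarrow> com" where "mv r t = While r (Seq (Dec r) (Inc t))"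

definition clr :: "nat \<Rightarrow> com" where "clr r = While r (Dec r)"

text \<open>A counter can only be read by counting it down, so \<open>r\<close> is emptied into
  \<open>t\<close> and \<open>u\<close> at once and then restored from \<open>u\<close>.\<close>

definition cp :: "nat \<Rightarrow> nat \<Rightarrow> nat \<Rightarrow> com" where
  "cp r t u = Seq (While r (Seq (Dec r) (Seq (Inc t) (Inc u)))) (mv u r)"

lemma exe_mv:
  assumes "r < K" "t < K" "r \<noteq> t" "4 * s r + 1 \<le> T" "s' = s(r := 0, t := s t + s r)"
  shows "exe K x (mv r t) h w s T h w s'"
  unfolding mv_def
proof (rule exe_While[where N = "s r" and S = "\<lambda>k. s(r := s r - k, t := s t + k)" and T = 3
      and H = "\<lambda>_. h" and W = "\<lambda>_. w"])
  fix k assume k: "k < s r"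
  show "exe K x (Seq (Dec r) (Inc t)) h w (s(r := s r - k, t := s t + k)) 3
      h w (s(r := s r - Suc k, t := s t + Suc k))"
    by (rule exe_Seq[OF exe_DecI[OF _ _ refl] exe_IncI])
      (use assms k in \<open>auto simp: fun_eq_iff\<close>)
qed (use assms in auto)

lemma exe_clr:
  assumes "r < K" "2 * s r + 1 \<le> T" "s' = s(r := 0)"
  shows "exe K x (clr r) h w s T h w s'"
  unfolding clr_def
proof (rule exe_While[where N = "s r" and S = "\<lambda>k. s(r := s r - k)" and T = 1
      and H = "\<lambda>_. h" and W = "\<lambda>_. w"])
  fix k assume k: "k < s r"
  show "exe K x (Dec r) h w (s(r := s r - k)) 1 h w (s(r := s r - Suc k))"
    by (rule exe_DecI) (use assms k in \<open>auto simp: fun_eq_iff\<close>)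
qed (use assms in auto)

lemma exe_cp:
  assumes "r < K" "t < K" "u < K" "r \<noteq> t" "r \<noteq> u" "t \<noteq> u" "s t = 0" "s u = 0"
    "10 * s r + 3 \<le> T" "s' = s(t := s r)"
  shows "exe K x (cp r t u) h w s T h w s'"
proof -
  have "exe K x (While r (Seq (Dec r) (Seq (Inc t) (Inc u)))) h w s (6 * s r + 1) h w
      (s(r := 0, t := s r, u := s r))"
  proof (rule exe_While[where N = "s r" and S = "\<lambda>k. s(r := s r - k, t := k, u := k)" and T = 5
      and H = "\<lambda>_. h" and W = "\<lambda>_. w"])
    fix k assume k: "k < s r"
    show "exe K x (Seq (Dec r) (Seq (Inc t) (Inc u))) h w (s(r := s r - k, t := k, u := k)) 5
        h w (s(r := s r - Suc k, t := Suc k, u := Suc k))"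
      by (rule exe_Seq[OF exe_DecI[OF _ _ refl] exe_Seq[OF exe_IncI[OF _ refl] exe_IncI]])
        (use assms k in \<open>auto simp: fun_eq_iff\<close>)
  qed (use assms in \<open>auto simp: fun_eq_iff\<close>)
  moreover have "exe K x (mv u r) h w (s(r := 0, t := s r, u := s r)) (4 * s r + 1) h w s'"
    by (rule exe_mv) (use assms in \<open>auto simp: fun_eq_iff\<close>)
  ultimately show ?thesis unfolding cp_def by (rule exe_Seq) (use assms in simp)
qed


section \<open>A class of polynomial-time numerical functions\<close>

abbreviation env_cons :: "nat \<Rightarrow> (nat \<Rightarrow> nat) \<Rightarrow> nat \<Rightarrow> nat" (infixr "##" 65) where
  "i ## e \<equiv> case_nat i e"

text \<open>The summand 2 makes the size at least 2, so that constants and factors are absorbed by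
  raising an exponent. Only the first \<open>m\<close> variables count, as an environment has
  infinitely many.\<close>

definition sz :: "nat \<Rightarrow> bool list \<Rightarrow> (nat \<Rightarrow> nat) \<Rightarrow> nat" where
  "sz m x e = 2 + length x + (\<Sum>i<m. e i)"

definition pb :: "(bool list \<Rightarrow> (nat \<Rightarrow> nat) \<Rightarrow> nat) \<Rightarrow> bool" where
  "pb h \<longleftrightarrow> (\<exists>m d. \<forall>x e. h x e \<le> sz m x e ^ d)"

lemma sz_mono: "m \<le> m' \<Longrightarrow> sz m x e \<le> sz m' x e"
  unfolding sz_def by (auto intro!: sum_mono2)

lemma sz_pow_mono: "m \<le> m' \<Longrightarrow> d \<le> d' \<Longrightarrow> sz m x e ^ d \<le> sz m' x e ^ d'"
proof -
  assume "m \<le> m'" "d \<le> d'"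
  then have "sz m x e ^ d \<le> sz m' x e ^ d" by (intro power_mono sz_mono) auto
  also have "\<dots> \<le> sz m' x e ^ d'" using \<open>d \<le> d'\<close> by (intro power_increasing) (auto simp: sz_def)
  finally show ?thesis .
qed

lemma pb_mono: "pb g \<Longrightarrow> (\<And>x e. f x e \<le> g x e) \<Longrightarrow> pb f"
  unfolding pb_def by (meson le_trans)

lemma pb_sz: "pb (\<lambda>x e. sz m x e ^ d)"
  unfolding pb_def by auto

lemma pb_add:
  assumes "pb f" "pb g"
  shows "pb (\<lambda>x e. f x e + g x e)"
proof -
  obtain m d m' d' where *: "\<And>x e. f x e \<le> sz m x e ^ d" "\<And>x e. g x e \<le> sz m' x e ^ d'"
    using assms unfolding pb_def by blast
  have "f x e + g x e \<le> sz (max m m') x e ^ Suc (max d d')" for x e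
  proof -
    have "f x e \<le> sz (max m m') x e ^ max d d'" "g x e \<le> sz (max m m') x e ^ max d d'"
      using * sz_pow_mono by (meson le_trans max.cobounded1 max.cobounded2)+
    then have "f x e + g x e \<le> 2 * sz (max m m') x e ^ max d d'" by simp
    also have "\<dots> \<le> sz (max m m') x e * sz (max m m') x e ^ max d d'"
      by (rule mult_right_mono) (auto simp: sz_def)
    finally show ?thesis by simp
  qed
  then show ?thesis unfolding pb_def by blast
qed

lemma pb_mult:
  assumes "pb f" "pb g"
  shows "pb (\<lambda>x e. f x e * g x e)"
proof -
  obtain m d m' d' where *: "\<And>x e. f x e \<le> sz m x e ^ d" "\<And>x e. g x e \<le> sz m' x e ^ d'"
    using assms unfolding pb_def by blast
  have "f x e * g x e \<le> sz (max m m') x e ^ (d + d')" for x e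
  proof -
    have "f x e \<le> sz (max m m') x e ^ d" "g x e \<le> sz (max m m') x e ^ d'"
      using * sz_pow_mono by (meson le_trans max.cobounded1 max.cobounded2 le_refl)+
    then show ?thesis by (simp add: power_add mult_le_mono)
  qed
  then show ?thesis unfolding pb_def by blast
qed

lemma pb_const: "pb (\<lambda>x e. c)"
proof -
  have "c \<le> sz 0 x e ^ c" for x e
  proof -
    have "c \<le> 2 ^ c" by (simp add: less_imp_le)
    also have "\<dots> \<le> sz 0 x e ^ c" by (rule power_mono) (auto simp: sz_def)
    finally show ?thesis .
  qed
  then show ?thesis unfolding pb_def by blast
qed

lemma pb_var: "pb (\<lambda>x e. e i)"
proof -
  have "e i \<le> sz (Suc i) x e ^ 1" for x and e :: "nat \<Rightarrow> nat" by (simp add: sz_def)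
  then show ?thesis unfolding pb_def by blast
qed

lemma pb_len: "pb (\<lambda>x e. length x)"
proof -
  have "length x \<le> sz 0 x e ^ 1" for x e by (simp add: sz_def)
  then show ?thesis unfolding pb_def by blast
qed

lemma pb_Suc: "pb f \<Longrightarrow> pb (\<lambda>x e. Suc (f x e))"
  using pb_add[OF pb_const[of 1]] by simp

lemmas pb_intros = pb_const pb_var pb_len pb_Suc pb_add pb_mult

lemma pb_power: "pb f \<Longrightarrow> pb (\<lambda>x e. f x e ^ d)"
  by (induction d) (auto intro: pb_intros)

lemma sum_env_cons: "(\<Sum>k<m. (i ## e) k) \<le> i + (\<Sum>k<m. e k)"
proof (cases m)
  case (Suc n)
  then have "(\<Sum>k<m. (i ## e) k) = i + (\<Sum>k<n. e k)" by (simp add: sum.lessThan_Suc_shift del: sum.lessThan_Suc)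
  then show ?thesis using Suc by simp
qed simp

lemma pb_sum: "(\<And>i. i < (m::nat) \<Longrightarrow> pb (f i)) \<Longrightarrow> pb (\<lambda>x e. \<Sum>i<m. f i x e)"
  by (induction m) (auto intro!: pb_intros)

lemma pb_sz_comp: "(\<And>i. pb (\<lambda>x e. s i x e)) \<Longrightarrow> pb (\<lambda>x e. sz m x (\<lambda>i. s i x e))"
  unfolding sz_def by (intro pb_intros pb_sum)

text \<open>The body of a loop sees two further variables. If these are bounded by \<open>a\<close>
  and \<open>b\<close>, the size grows by at most their sum, which leaves a bound in terms of the
  outer environment alone.\<close>

lemma pb_binder:
  assumes "pb G" "pb a" "pb b"
  obtains H where "pb H" "\<And>x e i v. i \<le> a x e \<Longrightarrow> v \<le> b x e \<Longrightarrow> G x (i ## v ## e) \<le> H x e"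
proof -
  obtain m d where G: "\<And>x e. G x e \<le> sz m x e ^ d"
    using assms unfolding pb_def by blast
  let ?H = "\<lambda>x e. (sz m x e + (a x e + b x e)) ^ d"
  have "G x (i ## v ## e) \<le> ?H x e" if "i \<le> a x e" "v \<le> b x e" for x e i v
  proof -
    have "(\<Sum>k<m. (i ## v ## e) k) \<le> i + (v + (\<Sum>k<m. e k))"
      using sum_env_cons[of i "v ## e" m] sum_env_cons[of v e m] by linarith
    then have "sz m x (i ## v ## e) \<le> sz m x e + (a x e + b x e)"
      using that by (simp add: sz_def)
    then show ?thesis using G[of x "i ## v ## e"] by (meson le_trans power_mono zero_le)
  qed
  moreover have "pb ?H"
    using pb_sz[of m 1] assms by (intro pb_power pb_add) auto
  ultimately show thesis using that by blast
qed

text \<open>Numbers are kept in unary, so only polynomially bounded values may occur; this is the last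
  premise of \<open>loop\<close>. The second argument of a function is the environment of its variables.\<close>

inductive pt :: "(bool list \<Rightarrow> (nat \<Rightarrow> nat) \<Rightarrow> nat) \<Rightarrow> bool" where
  zero: "pt (\<lambda>x e. 0)"
| suc: "pt f \<Longrightarrow> pt (\<lambda>x e. Suc (f x e))"
| var: "pt (\<lambda>x e. e i)"
| len: "pt (\<lambda>x e. length x)"
| bit: "pt f \<Longrightarrow> pt (\<lambda>x e. of_bool (f x e < length x \<and> x ! f x e))"
| loop: "pt n \<Longrightarrow> pt f \<Longrightarrow> pt g \<Longrightarrow> pb h \<Longrightarrow>
    (\<And>x e k. k \<le> n x e \<Longrightarrow> rec_nat (f x e) (\<lambda>i v. g x (i ## v ## e)) k \<le> h x e) \<Longrightarrow>
    pt (\<lambda>x e. rec_nat (f x e) (\<lambda>i v. g x (i ## v ## e)) (n x e))"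

lemma pt_pb: "pt f \<Longrightarrow> pb f"
proof (induction rule: pt.induct)
  case (bit f)
  show ?case by (rule pb_mono[OF pb_const[of 1]]) auto
next
  case (loop n f g h)
  show ?case by (rule pb_mono[OF loop(4)]) (use loop(5) in auto)
qed (auto intro: pb_intros)

text \<open>Variable \<open>i\<close> lives in register \<open>a i\<close>; \<open>a\<close> may
  identify variables, so infinitely many of them fit into the registers below \<open>r0\<close>. The
  registers from \<open>r0\<close> on are zero before the run and, except for the result in
  \<open>r0\<close>, zero again afterwards, with the input head back in cell 0. The bound
  \<open>T\<close> is chosen before the registers and so does not depend on their
  allocation.\<close>

definition compilable :: "(bool list \<Rightarrow> (nat \<Rightarrow> nat) \<Rightarrow> nat) \<Rightarrow> bool" where
  "compilable f \<longleftrightarrow> (\<exists>T. pb T \<and> (\<forall>a r0. (\<forall>i. a i < r0) \<longrightarrow> (\<exists>c K0. wfc (K0 + 2) c \<and> r0 < K0 \<and>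
     (\<forall>K\<ge>K0. \<forall>x w s. (\<forall>r\<ge>r0. s r = 0) \<longrightarrow>
       exe K x c 0 w s (T x (\<lambda>i. s (a i))) 0 w (s(r0 := f x (\<lambda>i. s (a i))))))))"

lemma compilableI:
  assumes "pb T"
    and "\<And>a r0. (\<And>i. a i < r0) \<Longrightarrow> \<exists>c K0. wfc (K0 + 2) c \<and> r0 < K0 \<and>
     (\<forall>K\<ge>K0. \<forall>x w s. (\<forall>r\<ge>r0. s r = 0) \<longrightarrow>
       exe K x c 0 w s (T x (\<lambda>i. s (a i))) 0 w (s(r0 := f x (\<lambda>i. s (a i)))))"
  shows "compilable f"
  using assms unfolding compilable_def by blast

lemma compilableE:
  assumes "compilable f"
  obtains T where "pb T"
    "\<And>a r0. (\<And>i. a i < r0) \<Longrightarrow> \<exists>c K0. wfc (K0 + 2) c \<and> r0 < K0 \<and>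
     (\<forall>K\<ge>K0. \<forall>x w s. (\<forall>r\<ge>r0. s r = 0) \<longrightarrow>
       exe K x c 0 w s (T x (\<lambda>i. s (a i))) 0 w (s(r0 := f x (\<lambda>i. s (a i)))))"
  using assms unfolding compilable_def by blast

lemma wfc_macros [simp]:
  "wfc K (mv r t) \<longleftrightarrow> r + 2 < K \<and> t + 2 < K"
  "wfc K (clr r) \<longleftrightarrow> r + 2 < K"
  "wfc K (cp r t u) \<longleftrightarrow> r + 2 < K \<and> t + 2 < K \<and> u + 2 < K"
  by (auto simp: mv_def clr_def cp_def)

lemma compilable_suc:
  assumes "compilable f"
  shows "compilable (\<lambda>x e. Suc (f x e))"
  using assms
proof (rule compilableE)
  fix T assume T: "pb T" and c: "\<And>a r0. (\<And>i. a i < r0) \<Longrightarrow> \<exists>c K0. wfc (K0 + 2) c \<and> r0 < K0 \<and>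
     (\<forall>K\<ge>K0. \<forall>x w s. (\<forall>r\<ge>r0. s r = 0) \<longrightarrow>
       exe K x c 0 w s (T x (\<lambda>i. s (a i))) 0 w (s(r0 := f x (\<lambda>i. s (a i)))))"
  show ?thesis
  proof (rule compilableI)
    show "pb (\<lambda>x e. T x e + 2)" by (intro pb_intros T)
    fix a :: "nat \<Rightarrow> nat" and r0 assume a: "\<And>i. a i < r0"
    obtain c K0 where c: "wfc (K0 + 2) c" "r0 < K0" "\<And>K x w s. K \<ge> K0 \<Longrightarrow> (\<forall>r\<ge>r0. s r = 0) \<Longrightarrow>
       exe K x c 0 w s (T x (\<lambda>i. s (a i))) 0 w (s(r0 := f x (\<lambda>i. s (a i))))"
      using c[of a, OF a] by blast
    have "exe K x (Seq c (Inc r0)) 0 w s (T x (\<lambda>i. s (a i)) + 2) 0 w (s(r0 := Suc (f x (\<lambda>i. s (a i)))))"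
      if "K \<ge> K0" "\<forall>r\<ge>r0. s r = 0" for K x w s
      by (rule exe_Seq[OF c(3)[OF that] exe_IncI]) (use c(2) that in auto)
    then show "\<exists>c K0. wfc (K0 + 2) c \<and> r0 < K0 \<and>
     (\<forall>K\<ge>K0. \<forall>x w s. (\<forall>r\<ge>r0. s r = 0) \<longrightarrow>
       exe K x c 0 w s (T x (\<lambda>i. s (a i)) + 2) 0 w (s(r0 := Suc (f x (\<lambda>i. s (a i))))))"
      using c(1,2) by (intro exI[of _ "Seq c (Inc r0)"] exI[of _ K0]) auto
  qed
qed

lemma compilable_var: "compilable (\<lambda>x e. e j)"
proof (rule compilableI)
  show "pb (\<lambda>x e. 10 * e j + 3)" by (intro pb_intros)
  fix a :: "nat \<Rightarrow> nat" and r0 assume a: "\<And>i. a i < r0"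
  have "exe K x (cp (a j) r0 (Suc r0)) 0 w s (10 * s (a j) + 3) 0 w (s(r0 := s (a j)))"
    if "K \<ge> r0 + 2" "\<forall>r\<ge>r0. s r = 0" for K x w s
    by (rule exe_cp) (use a[of j] that in auto)
  then show "\<exists>c K0. wfc (K0 + 2) c \<and> r0 < K0 \<and>
     (\<forall>K\<ge>K0. \<forall>x w s. (\<forall>r\<ge>r0. s r = 0) \<longrightarrow>
       exe K x c 0 w s (10 * s (a j) + 3) 0 w (s(r0 := s (a j))))"
    using a[of j] by (intro exI[of _ "cp (a j) r0 (Suc r0)"] exI[of _ "r0 + 2"]) auto
qed

lemma compilable_len: "compilable (\<lambda>x e. length x)"
proof (rule compilableI)
  show "pb (\<lambda>x e. 10 * length x + 3)" by (intro pb_intros)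
  fix a :: "nat \<Rightarrow> nat" and r0 assume a: "\<And>i. a i < r0"
  \<comment> \<open>The second counter records how far the input head has to travel back.\<close>
  let ?c1 = "Until 0 0 (Seq InR (Seq (Inc r0) (Inc (r0 + 1))))"
  let ?c2 = "While (r0 + 1) (Seq (Dec (r0 + 1)) InL)"
  have "exe K x (Seq ?c1 ?c2) 0 w s (10 * length x + 3) 0 w (s(r0 := length x))"
    if K: "K \<ge> r0 + 2" and s: "\<forall>r\<ge>r0. s r = 0" for K x w s
  proof -
    define S where "S k = s(r0 := k, r0 + 1 := k)" for k
    have "exe K x ?c1 0 w (S 0) (length x * Suc 5 + 1) (length x) w (S (length x))"
    proof (rule exe_Until_iterate[where H = "\<lambda>k. k" and W = "\<lambda>_. w" and S = S])
      fix k assume k: "k < length x"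
      then show "tape_read (tapes K x k w (S k) ! 0) \<noteq> 0" by (simp add: tape_read_def tape_word_def)
      show "exe K x (Seq InR (Seq (Inc r0) (Inc (r0 + 1)))) k w (S k) 5 (Suc k) w (S (Suc k))"
        by (rule exe_Seq[OF exe_InR exe_Seq[OF exe_IncI[OF _ refl] exe_IncI]])
          (use K in \<open>auto simp: S_def fun_eq_iff\<close>)
    qed (auto simp: tape_read_def tape_word_def)
    moreover have "S 0 = s" using s by (auto simp: S_def fun_eq_iff)
    moreover have "exe K x ?c2 (length x) w (S (length x)) (4 * length x + 1) 0 w (s(r0 := length x))"
    proof (rule exe_While[where N = "length x" and T = 3 and H = "\<lambda>k. length x - k" and W = "\<lambda>_. w"
          and S = "\<lambda>k. s(r0 := length x, r0 + 1 := length x - k)"])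
      fix k assume k: "k < length x"
      show "exe K x (Seq (Dec (r0 + 1)) InL) (length x - k) w (s(r0 := length x, r0 + 1 := length x - k)) 3
          (length x - Suc k) w (s(r0 := length x, r0 + 1 := length x - Suc k))"
        by (rule exe_Seq[OF exe_DecI[OF _ _ ] exe_InLI]) (use K k in \<open>auto simp: fun_eq_iff\<close>)
    qed (use K s in \<open>auto simp: S_def fun_eq_iff\<close>)
    ultimately show ?thesis by (intro exe_Seq) auto
  qed
  then show "\<exists>c K0. wfc (K0 + 2) c \<and> r0 < K0 \<and>
     (\<forall>K\<ge>K0. \<forall>x w s. (\<forall>r\<ge>r0. s r = 0) \<longrightarrow>
       exe K x c 0 w s (10 * length x + 3) 0 w (s(r0 := length x)))"
    by (intro exI[of _ "Seq ?c1 ?c2"] exI[of _ "r0 + 2"]) auto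
qed

lemma compilable_bit:
  assumes "compilable f" "pb f"
  shows "compilable (\<lambda>x e. of_bool (f x e < length x \<and> x ! f x e))"
  using assms(1)
proof (rule compilableE)
  fix T assume T: "pb T" and c: "\<And>a r0. (\<And>i. a i < r0) \<Longrightarrow> \<exists>c K0. wfc (K0 + 2) c \<and> r0 < K0 \<and>
     (\<forall>K\<ge>K0. \<forall>x w s. (\<forall>r\<ge>r0. s r = 0) \<longrightarrow>
       exe K x c 0 w s (T x (\<lambda>i. s (a i))) 0 w (s(r0 := f x (\<lambda>i. s (a i)))))"
  show ?thesis
  proof (rule compilableI)
    show "pb (\<lambda>x e. T x e + 10 * f x e + 8)" by (intro pb_intros T assms)
    fix a :: "nat \<Rightarrow> nat" and r0 assume a: "\<And>i. a i < r0"
    then have a': "\<And>i. a i < r0 + 1" by (simp add: less_SucI)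
    obtain c K0 where c: "wfc (K0 + 2) c" "r0 + 1 < K0" "\<And>K x w s. K \<ge> K0 \<Longrightarrow> (\<forall>r\<ge>r0+1. s r = 0) \<Longrightarrow>
       exe K x c 0 w s (T x (\<lambda>i. s (a i))) 0 w (s(r0 + 1 := f x (\<lambda>i. s (a i))))"
      using c[of a, OF a'] by blast
    \<comment> \<open>The position in \<open>r0 + 1\<close> is used up on the way to the cell and
      kept in \<open>r0 + 2\<close> for the way back.\<close>
    let ?c1 = "While (r0 + 1) (Seq (Dec (r0 + 1)) (Seq InR (Inc (r0 + 2))))"
    let ?c2 = "Cond 0 2 (Inc r0) Noop"
    let ?c3 = "While (r0 + 2) (Seq (Dec (r0 + 2)) InL)"
    have "exe K x (Seq c (Seq ?c1 (Seq ?c2 ?c3))) 0 w s (T x (\<lambda>i. s (a i)) + 10 * f x (\<lambda>i. s (a i)) + 8) 0 w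
        (s(r0 := of_bool (f x (\<lambda>i. s (a i)) < length x \<and> x ! f x (\<lambda>i. s (a i)))))"
      if K: "K \<ge> K0 + 1" and s: "\<forall>r\<ge>r0. s r = 0" for K x w s
    proof -
      define v where "v = f x (\<lambda>i. s (a i))"
      define b where "b = (of_bool (v < length x \<and> x ! v) :: nat)"
      have 0: "exe K x c 0 w s (T x (\<lambda>i. s (a i))) 0 w (s(r0 + 1 := v))"
        unfolding v_def by (rule c(3)) (use K s in auto)
      have 1: "exe K x ?c1 0 w (s(r0 + 1 := v)) (6 * v + 1) v w (s(r0 + 2 := v))"
      proof (rule exe_While[where N = v and T = 5 and H = "\<lambda>k. k" and W = "\<lambda>_. w"
          and S = "\<lambda>k. s(r0 + 1 := v - k, r0 + 2 := k)"])
        fix k assume k: "k < v"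
        show "exe K x (Seq (Dec (r0 + 1)) (Seq InR (Inc (r0 + 2)))) k w (s(r0 + 1 := v - k, r0 + 2 := k)) 5
          (Suc k) w (s(r0 + 1 := v - Suc k, r0 + 2 := Suc k))"
          by (rule exe_Seq[OF exe_DecI[OF _ _ refl] exe_Seq[OF exe_InR exe_IncI]])
            (use K k c(2) in \<open>auto simp: fun_eq_iff\<close>)
      qed (use K s c(2) in \<open>auto simp: fun_eq_iff\<close>)
      have 2: "exe K x ?c2 v w (s(r0 + 2 := v)) 2 v w (s(r0 := b, r0 + 2 := v))"
      proof -
        have "exe K x (if v < length x \<and> x ! v then Inc r0 else Noop) v w (s(r0 + 2 := v)) 1 v w (s(r0 := b, r0 + 2 := v))"
        proof (cases "v < length x \<and> x ! v")
          case True
          then have "exe K x (Inc r0) v w (s(r0 + 2 := v)) 1 v w (s(r0 := b, r0 + 2 := v))"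
            by (intro exe_IncI) (use K s c(2) in \<open>auto simp: b_def fun_eq_iff\<close>)
          with True show ?thesis by simp
        next
          case False
          then have "s(r0 := b, r0 + 2 := v) = s(r0 + 2 := v)" using s by (auto simp: b_def fun_eq_iff)
          then show ?thesis using False exe_Noop[of K x v w "s(r0 + 2 := v)"] by auto
        qed
        from exe_IfIn[OF this] show ?thesis by (rule exe_mono) simp
      qed
      have 3: "exe K x ?c3 v w (s(r0 := b, r0 + 2 := v)) (4 * v + 1) 0 w (s(r0 := b))"
      proof (rule exe_While[where N = v and T = 3 and H = "\<lambda>k. v - k" and W = "\<lambda>_. w"
          and S = "\<lambda>k. s(r0 := b, r0 + 2 := v - k)"])
        fix k assume k: "k < v"
        show "exe K x (Seq (Dec (r0 + 2)) InL) (v - k) w (s(r0 := b, r0 + 2 := v - k)) 3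
          (v - Suc k) w (s(r0 := b, r0 + 2 := v - Suc k))"
          by (rule exe_Seq[OF exe_DecI[OF _ _ ] exe_InLI]) (use K k c(2) in \<open>auto simp: fun_eq_iff\<close>)
      qed (use K s c(2) in \<open>auto simp: fun_eq_iff\<close>)
      show ?thesis
        using exe_Seq[OF 0 exe_Seq[OF 1 exe_Seq[OF 2 3 le_refl] le_refl] le_refl] 
        unfolding v_def[symmetric] b_def[symmetric] by (rule exe_mono) simp
    qed
    then show "\<exists>c K0. wfc (K0 + 2) c \<and> r0 < K0 \<and>
     (\<forall>K\<ge>K0. \<forall>x w s. (\<forall>r\<ge>r0. s r = 0) \<longrightarrow>
       exe K x c 0 w s (T x (\<lambda>i. s (a i)) + 10 * f x (\<lambda>i. s (a i)) + 8) 0 w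
        (s(r0 := of_bool (f x (\<lambda>i. s (a i)) < length x \<and> x ! f x (\<lambda>i. s (a i))))))"
      using c(1,2) wfc_mono[OF c(1), of "K0 + 1 + 2"]
      by (intro exI[of _ "Seq c (Seq ?c1 (Seq ?c2 ?c3))"] exI[of _ "K0 + 1"]) auto
  qed
qed

text \<open>Register \<open>r0\<close> holds the accumulator, \<open>r0 + 1\<close> the number of
  rounds left, \<open>r0 + 2\<close> the index and \<open>r0 + 3\<close> the result of the body,
  which replaces the accumulator after each round. The two bound variables of the body are therefore
  placed in \<open>r0 + 2\<close> and \<open>r0\<close>.\<close>

lemma compilable_loop:
  assumes "compilable n" "compilable f" "compilable g" "pb n" "pb h"
    and bound: "\<And>x e k. k \<le> n x e \<Longrightarrow> rec_nat (f x e) (\<lambda>i v. g x (i ## v ## e)) k \<le> h x e"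
  shows "compilable (\<lambda>x e. rec_nat (f x e) (\<lambda>i v. g x (i ## v ## e)) (n x e))"
proof -
  obtain Tn where Tn: "pb Tn" and n: "\<And>a r0. (\<And>i. a i < r0) \<Longrightarrow> \<exists>c K0. wfc (K0 + 2) c \<and> r0 < K0 \<and>
     (\<forall>K\<ge>K0. \<forall>x w s. (\<forall>r\<ge>r0. s r = 0) \<longrightarrow>
       exe K x c 0 w s (Tn x (\<lambda>i. s (a i))) 0 w (s(r0 := n x (\<lambda>i. s (a i)))))"
    by (rule compilableE[OF assms(1)]) (rule that, assumption, blast)
  obtain Tf where Tf: "pb Tf" and f: "\<And>a r0. (\<And>i. a i < r0) \<Longrightarrow> \<exists>c K0. wfc (K0 + 2) c \<and> r0 < K0 \<and>
     (\<forall>K\<ge>K0. \<forall>x w s. (\<forall>r\<ge>r0. s r = 0) \<longrightarrow>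
       exe K x c 0 w s (Tf x (\<lambda>i. s (a i))) 0 w (s(r0 := f x (\<lambda>i. s (a i)))))"
    by (rule compilableE[OF assms(2)]) (rule that, assumption, blast)
  obtain Tg where Tg: "pb Tg" and g: "\<And>a r0. (\<And>i. a i < r0) \<Longrightarrow> \<exists>c K0. wfc (K0 + 2) c \<and> r0 < K0 \<and>
     (\<forall>K\<ge>K0. \<forall>x w s. (\<forall>r\<ge>r0. s r = 0) \<longrightarrow>
       exe K x c 0 w s (Tg x (\<lambda>i. s (a i))) 0 w (s(r0 := g x (\<lambda>i. s (a i)))))"
    by (rule compilableE[OF assms(3)]) (rule that, assumption, blast)
  obtain H where H: "pb H" "\<And>x e i v. i \<le> n x e \<Longrightarrow> v \<le> h x e \<Longrightarrow> Tg x (i ## v ## e) \<le> H x e"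
    using pb_binder[OF Tg assms(4,5)] by blast
  let ?T = "\<lambda>x e. Tf x e + Tn x e + n x e * (H x e + 6 * h x e + 10) + 2 * n x e + 10"
  show ?thesis
  proof (rule compilableI)
    show "pb ?T" by (intro pb_intros Tf Tn H(1) assms(4,5))
    fix a :: "nat \<Rightarrow> nat" and r0 assume a: "\<And>i. a i < r0"
    let ?a = "(r0 + 2) ## r0 ## a"
    have a1: "\<And>i. a i < r0 + 1" using a by (simp add: less_SucI)
    have "a j < r0 + 3" for j using a[of j] by simp
    then have a3: "?a i < r0 + 3" for i by (auto split: nat.split)
    obtain cf Kf where cf: "wfc (Kf + 2) cf" "r0 < Kf" "\<And>K x w s. K \<ge> Kf \<Longrightarrow> (\<forall>r\<ge>r0. s r = 0) \<Longrightarrow>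
       exe K x cf 0 w s (Tf x (\<lambda>i. s (a i))) 0 w (s(r0 := f x (\<lambda>i. s (a i))))"
      using f[of a, OF a] by blast
    obtain cn Kn where cn: "wfc (Kn + 2) cn" "r0 + 1 < Kn" "\<And>K x w s. K \<ge> Kn \<Longrightarrow> (\<forall>r\<ge>r0 + 1. s r = 0) \<Longrightarrow>
       exe K x cn 0 w s (Tn x (\<lambda>i. s (a i))) 0 w (s(r0 + 1 := n x (\<lambda>i. s (a i))))"
      using n[of a, OF a1] by blast
    obtain cg Kg where cg: "wfc (Kg + 2) cg" "r0 + 3 < Kg" "\<And>K x w s. K \<ge> Kg \<Longrightarrow> (\<forall>r\<ge>r0 + 3. s r = 0) \<Longrightarrow>
       exe K x cg 0 w s (Tg x (\<lambda>i. s (?a i))) 0 w (s(r0 + 3 := g x (\<lambda>i. s (?a i))))"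
      using g[of ?a, OF a3] by blast
    let ?b = "Seq (Dec (r0 + 1)) (Seq cg (Seq (clr r0) (Seq (mv (r0 + 3) r0) (Inc (r0 + 2)))))"
    let ?c = "Seq cf (Seq cn (Seq (While (r0 + 1) ?b) (clr (r0 + 2))))"
    have "exe K x ?c 0 w s (?T x (\<lambda>i. s (a i))) 0 w
        (s(r0 := rec_nat (f x (\<lambda>i. s (a i))) (\<lambda>j v. g x (j ## v ## (\<lambda>i. s (a i)))) (n x (\<lambda>i. s (a i)))))"
      if K: "K \<ge> Kf + Kn + Kg" and s: "\<forall>r\<ge>r0. s r = 0" for K x w s
    proof -
      define e where "e = (\<lambda>i. s (a i))"
      define V where "V = rec_nat (f x e) (\<lambda>i v. g x (i ## v ## e))"
      define N where "N = n x e"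
      define S where "S k = s(r0 := V k, r0 + 1 := N - k, r0 + 2 := k)" for k
      have K': "Kf \<le> K" "Kn \<le> K" "Kg \<le> K" "r0 + 3 < K" using K cg(2) by auto
      have V: "V k \<le> h x e" if "k \<le> N" for k
        using bound that unfolding V_def N_def by blast
      have 1: "exe K x cf 0 w s (Tf x e) 0 w (s(r0 := V 0))"
        using cf(3)[OF K'(1) s] by (simp add: e_def V_def)
      have "(\<lambda>i. (s(r0 := V 0)) (a i)) = e" using a by (auto simp: e_def fun_eq_iff dest: less_imp_neq)
      then have 2: "exe K x cn 0 w (s(r0 := V 0)) (Tn x e) 0 w (s(r0 := V 0, r0 + 1 := N))"
        using cn(3)[OF K'(2), of "s(r0 := V 0)"] s by (simp add: N_def)
      have 3: "exe K x (While (r0 + 1) ?b) 0 w (s(r0 := V 0, r0 + 1 := N)) (N * (H x e + 6 * h x e + 10) + 1) 0 w (S N)"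
      proof (rule exe_While[where N = N and T = "H x e + 6 * h x e + 9" and H = "\<lambda>k. 0" and W = "\<lambda>_. w"
          and S = S])
        fix k assume k: "k < N"
        let ?s1 = "s(r0 := V k, r0 + 1 := N - Suc k, r0 + 2 := k)"
        have b1: "exe K x (Dec (r0 + 1)) 0 w (S k) 1 0 w ?s1"
          by (rule exe_DecI) (use K' k in \<open>auto simp: S_def fun_eq_iff\<close>)
        have e1: "(\<lambda>i. ?s1 (?a i)) = k ## V k ## e"
        proof
          fix i
          have "a j \<noteq> r0 \<and> a j \<noteq> r0 + 1 \<and> a j \<noteq> r0 + 2" for j using a[of j] by simp
          then show "?s1 (?a i) = (k ## V k ## e) i" by (auto simp: e_def split: nat.split)
        qed
        have b2: "exe K x cg 0 w ?s1 (H x e) 0 w (?s1(r0 + 3 := V (Suc k)))"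
        proof -
          have "V (Suc k) = g x (k ## V k ## e)" by (simp add: V_def)
          moreover have "\<forall>r\<ge>r0 + 3. ?s1 r = 0" using s by auto
          ultimately have "exe K x cg 0 w ?s1 (Tg x (k ## V k ## e)) 0 w (?s1(r0 + 3 := V (Suc k)))"
            using cg(3)[OF K'(3), of ?s1] unfolding e1 by simp
          then show ?thesis using H(2)[of k x e "V k"] V[of k] k exe_mono unfolding N_def by (meson less_imp_le)
        qed
        have b3: "exe K x (clr r0) 0 w (?s1(r0 + 3 := V (Suc k))) (2 * h x e + 1) 0 w (?s1(r0 := 0, r0 + 3 := V (Suc k)))"
          by (rule exe_clr) (use K' V[of k] k in \<open>auto simp: fun_eq_iff\<close>)
        have b4: "exe K x (mv (r0 + 3) r0) 0 w (?s1(r0 := 0, r0 + 3 := V (Suc k))) (4 * h x e + 1) 0 w (?s1(r0 := V (Suc k)))"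
          by (rule exe_mv) (use K' V[of "Suc k"] k s in \<open>auto simp: fun_eq_iff\<close>)
        have b5: "exe K x (Inc (r0 + 2)) 0 w (?s1(r0 := V (Suc k))) 1 0 w (S (Suc k))"
          by (rule exe_IncI) (use K' in \<open>auto simp: S_def fun_eq_iff\<close>)
        show "exe K x ?b 0 w (S k) (H x e + 6 * h x e + 9) 0 w (S (Suc k))"
          by (rule exe_mono[OF exe_Seq[OF b1 exe_Seq[OF b2 exe_Seq[OF b3 exe_Seq[OF b4 b5 le_refl] le_refl] le_refl] le_refl]]) simp
      qed (use K' s in \<open>auto simp: S_def fun_eq_iff\<close>)
      have 4: "exe K x (clr (r0 + 2)) 0 w (S N) (2 * N + 1) 0 w (s(r0 := V N))"
        by (rule exe_clr) (use K' s in \<open>auto simp: S_def fun_eq_iff\<close>)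
      have "exe K x ?c 0 w s (?T x e) 0 w (s(r0 := V N))"
        by (rule exe_mono[OF exe_Seq[OF 1 exe_Seq[OF 2 exe_Seq[OF 3 4 le_refl] le_refl] le_refl]]) (simp add: N_def)
      then show ?thesis by (simp add: e_def V_def N_def)
    qed
    then show "\<exists>c K0. wfc (K0 + 2) c \<and> r0 < K0 \<and>
     (\<forall>K\<ge>K0. \<forall>x w s. (\<forall>r\<ge>r0. s r = 0) \<longrightarrow>
       exe K x c 0 w s (?T x (\<lambda>i. s (a i))) 0 w
        (s(r0 := rec_nat (f x (\<lambda>i. s (a i))) (\<lambda>j v. g x (j ## v ## (\<lambda>i. s (a i)))) (n x (\<lambda>i. s (a i))))))"
      using cg(2) wfc_mono[OF cf(1), of "Kf + Kn + Kg + 2"] wfc_mono[OF cn(1), of "Kf + Kn + Kg + 2"]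
        wfc_mono[OF cg(1), of "Kf + Kn + Kg + 2"]
      by (intro exI[of _ ?c] exI[of _ "Kf + Kn + Kg"]) auto
  qed
qed

lemma pt_compilable: "pt f \<Longrightarrow> compilable f"
proof (induction rule: pt.induct)
  case zero
  show ?case
  proof (rule compilableI)
    show "pb (\<lambda>x e. 1)" by (intro pb_intros)
    fix a :: "nat \<Rightarrow> nat" and r0
    have "exe K x Noop 0 w s 1 0 w (s(r0 := 0))" if "\<forall>r\<ge>r0. s r = 0" for K x w s
      using that exe_Noop[of K x 0 w s] fun_upd_idem[of s r0 0] by simp
    then show "\<exists>c K0. wfc (K0 + 2) c \<and> r0 < K0 \<and>
     (\<forall>K\<ge>K0. \<forall>x w s. (\<forall>r\<ge>r0. s r = 0) \<longrightarrow> exe K x c 0 w s 1 0 w (s(r0 := 0)))"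
      by (intro exI[of _ Noop] exI[of _ "r0 + 1"]) auto
  qed
qed (auto intro: compilable_suc compilable_var compilable_len compilable_bit compilable_loop pt_pb)

text \<open>Once the length is known, the output is written bit by bit and each position is handed
  to \<open>B\<close> afresh; nothing that has been written is ever read again.\<close>

theorem pt_list_poly_time:
  assumes "pt L" "pt B"
  shows "poly_time_computable (\<lambda>x. map (\<lambda>i. B x (i ## (\<lambda>_. 0)) \<noteq> 0) [0..<L x (\<lambda>_. 0)])"
proof -
  obtain TL where TL: "pb TL" and L: "\<And>a r0. (\<And>i. a i < r0) \<Longrightarrow> \<exists>c K0. wfc (K0 + 2) c \<and> r0 < K0 \<and>
     (\<forall>K\<ge>K0. \<forall>x w s. (\<forall>r\<ge>r0. s r = 0) \<longrightarrow>
       exe K x c 0 w s (TL x (\<lambda>i. s (a i))) 0 w (s(r0 := L x (\<lambda>i. s (a i)))))"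
    by (rule compilableE[OF pt_compilable[OF assms(1)]]) (rule that, assumption, blast)
  obtain TB where TB: "pb TB" and B: "\<And>a r0. (\<And>i. a i < r0) \<Longrightarrow> \<exists>c K0. wfc (K0 + 2) c \<and> r0 < K0 \<and>
     (\<forall>K\<ge>K0. \<forall>x w s. (\<forall>r\<ge>r0. s r = 0) \<longrightarrow>
       exe K x c 0 w s (TB x (\<lambda>i. s (a i))) 0 w (s(r0 := B x (\<lambda>i. s (a i)))))"
    by (rule compilableE[OF pt_compilable[OF assms(2)]]) (rule that, assumption, blast)
  \<comment> \<open>Variable 0, the position of the bit, is the loop index in register 2; all other
    variables share register 0, which stays 0.\<close>
  let ?a = "2 ## (\<lambda>_. 0)"
  have a3: "?a i < 3" for i by (auto split: nat.split)
  obtain cL KL where cL: "wfc (KL + 2) cL" "1 < KL" "\<And>K x w s. K \<ge> KL \<Longrightarrow> (\<forall>r\<ge>1. s r = 0) \<Longrightarrow>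
       exe K x cL 0 w s (TL x (\<lambda>i. s 0)) 0 w (s(1 := L x (\<lambda>i. s 0)))"
    using L[of "\<lambda>_. 0" 1] by auto
  obtain cB KB where cB: "wfc (KB + 2) cB" "3 < KB" "\<And>K x w s. K \<ge> KB \<Longrightarrow> (\<forall>r\<ge>3. s r = 0) \<Longrightarrow>
       exe K x cB 0 w s (TB x (\<lambda>i. s (?a i))) 0 w (s(3 := B x (\<lambda>i. s (?a i))))"
    using B[of ?a, OF a3] by blast
  obtain H where H: "pb H"
    "\<And>x e i v. i \<le> L x e \<Longrightarrow> v \<le> 0 \<Longrightarrow> TB x (i ## v ## e) + 2 * B x (i ## v ## e) \<le> H x e"
    using pb_binder[OF pb_add[OF TB pb_mult[OF pb_const[of 2] pt_pb[OF assms(2)]]] pt_pb[OF assms(1)] pb_const[of 0]] by blast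
  have zero: "0 ## (\<lambda>_. 0) = (\<lambda>_. 0)" by (auto split: nat.split)
  let ?K = "KL + KB"
  let ?b = "Seq (Dec 1) (Seq cB (Seq (Cond (3 + 2) (Suc 0) (Emit False) (Seq (Emit True) (clr 3))) (Inc 2)))"
  let ?c = "Seq cL (While 1 ?b)"
  let ?T = "\<lambda>x e. TL x e + L x e * (H x e + 12) + 2"
  have main: "\<exists>s. exe ?K x ?c 0 [] (\<lambda>_. 0) (?T x (\<lambda>_. 0)) 0 (map (\<lambda>i. B x (i ## (\<lambda>_. 0)) \<noteq> 0) [0..<L x (\<lambda>_. 0)]) s" for x
  proof -
    define N where "N = L x (\<lambda>_. 0)"
    define S :: "nat \<Rightarrow> nat \<Rightarrow> nat" where "S k = (\<lambda>_. 0)(1 := N - k, 2 := k)" for k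
    define W where "W k = map (\<lambda>i. B x (i ## (\<lambda>_. 0)) \<noteq> 0) [0..<k]" for k
    define h where "h = H x (\<lambda>_. 0)"
    have 1: "exe ?K x cL 0 [] (\<lambda>_. 0) (TL x (\<lambda>_. 0)) 0 [] (S 0)"
      using cL(3)[of ?K "\<lambda>_. 0" x "[]"] by (simp add: S_def N_def fun_upd_idem)
    have 2: "exe ?K x (While 1 ?b) 0 [] (S 0) (N * (h + 12) + 1) 0 (W N) (S N)"
    proof (rule exe_While[where N = N and T = "h + 11" and H = "\<lambda>k. 0" and W = W and S = S])
      fix k assume k: "k < N"
      let ?s1 = "(\<lambda>_. 0)(1 := N - Suc k, 2 := k) :: nat \<Rightarrow> nat"
      define v where "v = B x (k ## (\<lambda>_. 0))"
      have Hk: "TB x (k ## (\<lambda>_. 0)) + 2 * v \<le> h"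
        using H(2)[of k x "\<lambda>_. 0" 0] k by (simp add: h_def N_def zero v_def)
      have b1: "exe ?K x (Dec 1) 0 (W k) (S k) 1 0 (W k) ?s1"
        by (rule exe_DecI) (use cL cB k in \<open>auto simp: S_def fun_eq_iff\<close>)
      have e1: "(\<lambda>i. ?s1 (?a i)) = k ## (\<lambda>_. 0)" by (auto simp: fun_eq_iff split: nat.split)
      have b2: "exe ?K x cB 0 (W k) ?s1 (TB x (k ## (\<lambda>_. 0))) 0 (W k) (?s1(3 := v))"
        using cB(3)[of ?K ?s1 x "W k"] unfolding e1 by (simp add: v_def)
      have W: "W (Suc k) = W k @ [v \<noteq> 0]" by (simp add: W_def v_def)
      have b3: "exe ?K x (Cond (3 + 2) (Suc 0) (Emit False) (Seq (Emit True) (clr 3))) 0 (W k) (?s1(3 := v)) (Suc (2 * v + 5)) 0 (W (Suc k)) ?s1"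
      proof (rule exe_IfZero)
        show "3 < ?K" using cB by simp
        show "exe ?K x (if (?s1(3 := v)) 3 = 0 then Emit False else Seq (Emit True) (clr 3)) 0 (W k) (?s1(3 := v)) (2 * v + 5) 0 (W (Suc k)) ?s1"
        proof (cases "v = 0")
          case True
          have "?s1(3 := v) = ?s1" using True by (auto simp: fun_eq_iff)
          then show ?thesis using exe_Emit[of ?K x False 0 "W k" ?s1] True exe_mono[of _ _ _ _ _ _ 3 _ _ _ "2 * v + 5"] W by simp
        next
          case False
          have "exe ?K x (clr 3) 0 (W (Suc k)) (?s1(3 := v)) (2 * v + 1) 0 (W (Suc k)) ?s1"
            by (rule exe_clr) (use cB in \<open>auto simp: fun_eq_iff\<close>)
          then have "exe ?K x (Seq (Emit True) (clr 3)) 0 (W k) (?s1(3 := v)) (2 * v + 5) 0 (W (Suc k)) ?s1"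
            using exe_Seq[OF exe_Emit[of ?K x True 0 "W k" "?s1(3 := v)"]] W False by simp
          then show ?thesis using False by simp
        qed
      qed
      have b4: "exe ?K x (Inc 2) 0 (W (Suc k)) ?s1 1 0 (W (Suc k)) (S (Suc k))"
        by (rule exe_IncI) (use cB in \<open>auto simp: S_def fun_eq_iff\<close>)
      show "exe ?K x ?b 0 (W k) (S k) (h + 11) 0 (W (Suc k)) (S (Suc k))"
        by (rule exe_mono[OF exe_Seq[OF b1 exe_Seq[OF b2 exe_Seq[OF b3 b4 le_refl] le_refl] le_refl]]) (use Hk in simp)
    qed (use cB in \<open>auto simp: S_def W_def\<close>)
    have "exe ?K x ?c 0 [] (\<lambda>_. 0) (?T x (\<lambda>_. 0)) 0 (W N) (S N)"
      by (rule exe_mono[OF exe_Seq[OF 1 2 le_refl]]) (simp add: N_def h_def)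
    then show ?thesis unfolding W_def N_def by blast
  qed
  have "pb ?T" by (intro pb_intros TL H pt_pb assms)
  then obtain m d where md: "\<And>x e. ?T x e \<le> sz m x e ^ d" unfolding pb_def by blast
  show ?thesis
  proof (rule poly_time_computableI)
    show "wfc (?K + 2) ?c"
      using wfc_mono[OF cL(1), of "?K + 2"] wfc_mono[OF cB(1), of "?K + 2"] cB(2) by simp
    fix x
    have "?T x (\<lambda>_. 0) \<le> poly ([:2, 1:] ^ d) (length x)"
      using md[of x "\<lambda>_. 0"] by (simp add: sz_def)
    then show "\<exists>h s. exe ?K x ?c 0 [] (\<lambda>_. 0) (poly ([:2, 1:] ^ d) (length x)) h
        (map (\<lambda>i. B x (i ## (\<lambda>_. 0)) \<noteq> 0) [0..<L x (\<lambda>_. 0)]) s"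
      using main[of x] exe_mono by blast
  qed
qed


section \<open>Closure properties\<close>

lemma pb_comp:
  assumes "pb h" "\<And>i. pb (\<lambda>x e. s i x e)"
  shows "pb (\<lambda>x e. h x (\<lambda>i. s i x e))"
proof -
  obtain m d where "\<And>x e. h x e \<le> sz m x e ^ d" using assms(1) unfolding pb_def by blast
  then show ?thesis by (intro pb_mono[OF pb_power[OF pb_sz_comp[OF assms(2)]]])
qed

lemma pt_ren: "pt f \<Longrightarrow> pt (\<lambda>x e. f x (\<lambda>i. e (\<rho> i)))"
proof (induction arbitrary: \<rho> rule: pt.induct)
  case (loop n f g h)
  have eq: "(\<lambda>j. (i ## v ## e) ((0 ## 1 ## (\<lambda>j. Suc (Suc (\<rho> j)))) j)) = i ## v ## (\<lambda>j. e (\<rho> j))"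
    for i v :: nat and e :: "nat \<Rightarrow> nat"
    by (auto simp: fun_eq_iff split: nat.split)
  have "pt (\<lambda>x e. rec_nat (f x (\<lambda>i. e (\<rho> i)))
      (\<lambda>i v. g x (\<lambda>j. (i ## v ## e) ((0 ## 1 ## (\<lambda>j. Suc (Suc (\<rho> j)))) j))) (n x (\<lambda>i. e (\<rho> i))))"
    by (rule pt.loop[where h = "\<lambda>x e. h x (\<lambda>i. e (\<rho> i))"])
      (use loop.IH loop.hyps(4,5) in \<open>auto simp: eq intro: pb_comp pb_intros\<close>)
  then show ?case by (simp only: eq)
qed (auto intro: pt.intros)

text \<open>Under the binder of a loop the first two variables stand for themselves, and the terms
  substituted for the others are shifted by two.\<close>

lemma pt_subst: "pt f \<Longrightarrow> (\<And>i. pt (\<sigma> i)) \<Longrightarrow> pt (\<lambda>x e. f x (\<lambda>i. \<sigma> i x e))"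
proof (induction arbitrary: \<sigma> rule: pt.induct)
  case (loop n f g h)
  define \<tau> :: "nat \<Rightarrow> bool list \<Rightarrow> (nat \<Rightarrow> nat) \<Rightarrow> nat" where
    "\<tau> = case_nat (\<lambda>x e. e 0) (case_nat (\<lambda>x e. e 1) (\<lambda>j x e. \<sigma> j x (\<lambda>i. e (Suc (Suc i)))))"
  have \<tau>: "pt (\<tau> i)" for i
    using pt_ren[OF loop.prems] unfolding \<tau>_def by (auto intro: pt.intros split: nat.split)
  have eq: "(\<lambda>j. \<tau> j x (i ## v ## e)) = i ## v ## (\<lambda>j. \<sigma> j x e)" for x i v and e :: "nat \<Rightarrow> nat"
    by (auto simp: fun_eq_iff \<tau>_def split: nat.split)
  have "pt (\<lambda>x e. rec_nat (f x (\<lambda>i. \<sigma> i x e))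
      (\<lambda>i v. g x (\<lambda>j. \<tau> j x (i ## v ## e))) (n x (\<lambda>i. \<sigma> i x e)))"
    by (rule pt.loop[where h = "\<lambda>x e. h x (\<lambda>i. \<sigma> i x e)"])
      (use loop.IH(1,2)[OF loop.prems] loop.IH(3)[OF \<tau>] loop.hyps(4,5) pt_pb[OF loop.prems]
        in \<open>auto simp: eq intro: pb_comp pb_intros\<close>)
  then show ?case by (simp only: eq)
qed (auto intro: pt.intros)

text \<open>The rule in usable form: the body is an ordinary function of index and accumulator, and
  only its premise turns these into the variables 0 and 1. The rules for sums, quantifiers and
  searches below follow the same pattern.\<close>

lemma pt_rec:
  assumes n: "pt n" and f: "pt f" and g: "pt (\<lambda>x e. g (e 0) (e (Suc 0)) x (\<lambda>i. e (Suc (Suc i))))"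
    and "pb h" "\<And>x e k. k \<le> n x e \<Longrightarrow> rec_nat (f x e) (\<lambda>i v. g i v x e) k \<le> h x e"
  shows "pt (\<lambda>x e. rec_nat (f x e) (\<lambda>i v. g i v x e) (n x e))"
  using pt.loop[OF n f g assms(4)] assms(5) by simp

lemma pt_tl: "pt f \<Longrightarrow> pt (\<lambda>x e. f x (\<lambda>i. e (Suc i)))"
  by (rule pt_ren)

lemma pt_const: "pt (\<lambda>x e. c)"
  by (induction c) (auto intro: pt.intros)

text \<open>The loop discards its accumulator and returns the last index.\<close>

lemma pt_pred: "pt f \<Longrightarrow> pt (\<lambda>x e. f x e - Suc 0)"
proof -
  assume f: "pt f"
  have eq: "rec_nat 0 (\<lambda>i v. i) k = k - Suc 0" for k by (cases k) auto
  have "pt (\<lambda>x e. rec_nat 0 (\<lambda>i v. i) (f x e))"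
    by (rule pt_rec[OF f]) (use eq pt_pb[OF f] in \<open>auto intro: pt.intros\<close>)
  then show ?thesis by (simp only: eq)
qed

lemma pt_add: "pt f \<Longrightarrow> pt g \<Longrightarrow> pt (\<lambda>x e. f x e + g x e)"
proof -
  assume f: "pt f" "pt g"
  have eq: "rec_nat b (\<lambda>i v. Suc v) k = k + b" for k b :: nat by (induction k) auto
  have "pt (\<lambda>x e. rec_nat (g x e) (\<lambda>i v. Suc v) (f x e))"
    by (rule pt_rec[OF f, where h = "\<lambda>x e. f x e + g x e"])
      (use eq pt_pb f in \<open>auto intro: pt.intros pb_intros\<close>)
  then show ?thesis by (simp only: eq)
qed

lemma pt_mult: "pt f \<Longrightarrow> pt g \<Longrightarrow> pt (\<lambda>x e. f x e * g x e)"
proof -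
  assume f: "pt f" "pt g"
  have eq: "rec_nat 0 (\<lambda>i v. v + b) k = k * b" for k b :: nat by (induction k) auto
  have "pt (\<lambda>x e. rec_nat 0 (\<lambda>i v. v + g x e) (f x e))"
    by (rule pt_rec[OF f(1), where h = "\<lambda>x e. f x e * g x e"])
      (use eq pt_pb f in \<open>auto intro: pt.intros pb_intros pt_add pt_ren\<close>)
  then show ?thesis by (simp only: eq)
qed

lemma pt_diff: "pt f \<Longrightarrow> pt g \<Longrightarrow> pt (\<lambda>x e. f x e - g x e)"
proof -
  assume f: "pt f" "pt g"
  have eq: "rec_nat b (\<lambda>i v. v - Suc 0) k = b - k" for k b :: nat by (induction k) auto
  have "pt (\<lambda>x e. rec_nat (f x e) (\<lambda>i v. v - Suc 0) (g x e))"
    by (rule pt_rec[OF f(2,1), where h = "f"])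
      (use eq pt_pb f in \<open>auto intro: pt.intros pt_pred\<close>)
  then show ?thesis by (simp only: eq)
qed

lemma pb_binder1:
  assumes "pb G" "pb a"
  obtains H where "pb H" "\<And>x e i. i \<le> a x e \<Longrightarrow> G x (i ## e) \<le> H x e"
proof -
  have "pb (\<lambda>x e. G x (\<lambda>i. e (if i = 0 then 0 else Suc i)))"
    by (rule pb_comp[OF assms(1)]) (auto intro: pb_intros)
  then obtain H where "pb H" and H: "\<And>x e i v. i \<le> a x e \<Longrightarrow> v \<le> 0 \<Longrightarrow>
      G x (\<lambda>j. (i ## v ## e) (if j = 0 then 0 else Suc j)) \<le> H x e"
    using pb_binder[OF _ assms(2) pb_const[of 0]] by blast
  moreover have "(\<lambda>j. (i ## v ## e) (if j = 0 then 0 else Suc j)) = i ## e" for i v :: nat and e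
    by (auto simp: fun_eq_iff split: nat.split)
  ultimately show thesis using that by (metis le_refl)
qed

text \<open>Bounded sums are the source of quantifiers, division and search below. Partial sums stay
  below the number of rounds times a bound for the summands, which is the value bound that a loop
  requires.\<close>

lemma pt_sum:
  assumes n: "pt n" and f: "pt (\<lambda>x e. f (e 0) x (\<lambda>i. e (Suc i)))"
  shows "pt (\<lambda>x e. \<Sum>i<n x e. f i x e)"
proof -
  have eq: "rec_nat 0 (\<lambda>i v. v + g i) k = (\<Sum>i<k. g i)" for k and g :: "nat \<Rightarrow> nat"
    by (induction k) auto
  obtain H where H: "pb H" "\<And>x e i. i \<le> n x e \<Longrightarrow> f i x e \<le> H x e"
    using pb_binder1[OF pt_pb[OF f] pt_pb[OF n]] by auto
  have b: "(\<Sum>i<k. f i x e) \<le> n x e * H x e" if "k \<le> n x e" for k x e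
  proof -
    have "(\<Sum>i<k. f i x e) \<le> (\<Sum>i<k. H x e)" using H(2) that by (intro sum_mono) auto
    also have "\<dots> \<le> n x e * H x e" using that by simp
    finally show ?thesis .
  qed
  have "pt (\<lambda>x e. rec_nat 0 (\<lambda>i v. v + f i x e) (n x e))"
  proof (rule pt_rec[OF n pt.zero, where h = "\<lambda>x e. n x e * H x e"])
    have "pt (\<lambda>x e. f (e 0) x (\<lambda>i. e (Suc (Suc i))))"
      using pt_ren[OF f, of "\<lambda>i. if i = 0 then 0 else Suc i"] by simp
    then show "pt (\<lambda>x e. e (Suc 0) + f (e 0) x (\<lambda>i. e (Suc (Suc i))))"
      by (intro pt_add pt.var)
  qed (use H n pt_pb b eq in \<open>auto intro: pb_intros\<close>)
  then show ?thesis by (simp only: eq)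
qed

section \<open>Connectives, bounded quantifiers and arithmetic\<close>

named_theorems pt_intros

declare pt_const [pt_intros] pt.var [pt_intros] pt.suc [pt_intros] pt.len [pt_intros]
  pt_add [pt_intros] pt_mult [pt_intros] pt_diff [pt_intros] pt_sum [pt_intros]

definition bitat :: "bool list \<Rightarrow> nat \<Rightarrow> bool" where
  "bitat w i \<longleftrightarrow> i < length w \<and> w ! i"

lemma pt_bitat [pt_intros]: "pt f \<Longrightarrow> pt (\<lambda>x e. of_bool (bitat x (f x e)))"
  unfolding bitat_def by (rule pt.bit)

lemma pt_not [pt_intros]: "pt (\<lambda>x e. of_bool (P x e)) \<Longrightarrow> pt (\<lambda>x e. of_bool (\<not> P x e))"
proof -
  assume P: "pt (\<lambda>x e. of_bool (P x e))"
  have eq: "of_bool (\<not> b) = (1 :: nat) - of_bool b" for b by simp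
  show ?thesis unfolding eq by (intro pt_intros P)
qed

lemma pt_conj [pt_intros]: "pt (\<lambda>x e. of_bool (P x e)) \<Longrightarrow> pt (\<lambda>x e. of_bool (Q x e)) \<Longrightarrow>
    pt (\<lambda>x e. of_bool (P x e \<and> Q x e))"
  by (simp only: of_bool_conj) (intro pt_intros)

lemma pt_disj [pt_intros]: "pt (\<lambda>x e. of_bool (P x e)) \<Longrightarrow> pt (\<lambda>x e. of_bool (Q x e)) \<Longrightarrow>
    pt (\<lambda>x e. of_bool (P x e \<or> Q x e))"
  using pt_not[OF pt_conj[OF pt_not pt_not]] by simp

lemma pt_imp [pt_intros]: "pt (\<lambda>x e. of_bool (P x e)) \<Longrightarrow> pt (\<lambda>x e. of_bool (Q x e)) \<Longrightarrow>
    pt (\<lambda>x e. of_bool (P x e \<longrightarrow> Q x e))"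
  unfolding imp_conv_disj by (intro pt_intros)

lemma pt_less [pt_intros]: "pt f \<Longrightarrow> pt g \<Longrightarrow> pt (\<lambda>x e. of_bool (f x e < g x e))"
proof -
  assume f: "pt f" "pt g"
  have eq: "of_bool (a < b) = 1 - (1 - (b - a))" for a b :: nat by auto
  show ?thesis unfolding eq by (intro pt_intros f)
qed

lemma pt_le [pt_intros]: "pt f \<Longrightarrow> pt g \<Longrightarrow> pt (\<lambda>x e. of_bool (f x e \<le> g x e))"
  unfolding not_less[symmetric] by (intro pt_intros)

lemma pt_eq [pt_intros]: "pt f \<Longrightarrow> pt g \<Longrightarrow> pt (\<lambda>x e. of_bool (f x e = g x e))"
  unfolding order_eq_iff[where 'a = nat] by (intro pt_intros)

lemma pt_iff [pt_intros]: "pt (\<lambda>x e. of_bool (P x e)) \<Longrightarrow> pt (\<lambda>x e. of_bool (Q x e)) \<Longrightarrow>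
    pt (\<lambda>x e. of_bool (P x e \<longleftrightarrow> Q x e))"
  unfolding iff_conv_conj_imp by (intro pt_intros)

lemma pt_if [pt_intros]: "pt (\<lambda>x e. of_bool (P x e)) \<Longrightarrow> pt f \<Longrightarrow> pt g \<Longrightarrow>
    pt (\<lambda>x e. if P x e then f x e else g x e)"
proof -
  assume f: "pt (\<lambda>x e. of_bool (P x e))" "pt f" "pt g"
  have eq: "(if b then m else n) = of_bool b * m + of_bool (\<not> b) * n" for b and m n :: nat by auto
  show ?thesis unfolding eq by (intro pt_intros f)
qed

lemma pt_if_bool [pt_intros]: "pt (\<lambda>x e. of_bool (P x e)) \<Longrightarrow> pt (\<lambda>x e. of_bool (Q x e)) \<Longrightarrow>
    pt (\<lambda>x e. of_bool (R x e)) \<Longrightarrow> pt (\<lambda>x e. of_bool (if P x e then Q x e else R x e))"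
  unfolding if_bool_eq_conj by (intro pt_intros)

lemma pt_ex [pt_intros]:
  assumes "pt n" "pt (\<lambda>x e. of_bool (P (e 0) x (\<lambda>i. e (Suc i))))"
  shows "pt (\<lambda>x e. of_bool (\<exists>i<n x e. P i x e))"
proof -
  have eq: "(\<exists>i<k. Q i) \<longleftrightarrow> (\<Sum>i<k. of_bool (Q i) :: nat) \<noteq> 0" for k :: nat and Q by auto
  show ?thesis unfolding eq by (intro pt_intros assms)
qed

lemma pt_all [pt_intros]:
  assumes "pt n" "pt (\<lambda>x e. of_bool (P (e 0) x (\<lambda>i. e (Suc i))))"
  shows "pt (\<lambda>x e. of_bool (\<forall>i<n x e. P i x e))"
proof -
  have eq: "(\<forall>i<k. Q i) \<longleftrightarrow> (\<Sum>i<k. of_bool (\<not> Q i) :: nat) = 0" for k :: nat and Q by auto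
  show ?thesis unfolding eq by (intro pt_intros assms)
qed

text \<open>The sum counts the positive multiples of \<open>b\<close> up to \<open>a\<close>; the
  guard \<open>0 < b\<close> makes it agree with the convention that division by 0 gives 0.\<close>

lemma div_eq_sum: "a div b = (\<Sum>k<a. of_bool (0 < b \<and> Suc k * b \<le> a))" for a b :: nat
proof (cases "b = 0")
  case False
  have "{k. k < a \<and> 0 < b \<and> Suc k * b \<le> a} = {..<a div b}"
  proof (intro set_eqI)
    fix k
    have "Suc k * b \<le> a \<longleftrightarrow> Suc k \<le> a div b"
      using False less_eq_div_iff_mult_less_eq[of b "Suc k" a] by simp
    moreover have "a div b \<le> a" by simp
    ultimately show "k \<in> {k. k < a \<and> 0 < b \<and> Suc k * b \<le> a} \<longleftrightarrow> k \<in> {..<a div b}"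
      using False by (auto simp del: div_le_dividend)
  qed
  moreover have "(\<Sum>k<a. of_bool (0 < b \<and> Suc k * b \<le> a)) = card {k. k < a \<and> 0 < b \<and> Suc k * b \<le> a}"
    by (simp add: sum.If_cases Int_def of_bool_def lessThan_def del: mult_Suc)
  ultimately show ?thesis by simp
qed simp

lemma pt_div [pt_intros]: "pt f \<Longrightarrow> pt g \<Longrightarrow> pt (\<lambda>x e. f x e div g x e)"
  unfolding div_eq_sum by (intro pt_intros pt_tl[of f] pt_tl[of g])

lemma pt_mod [pt_intros]: "pt f \<Longrightarrow> pt g \<Longrightarrow> pt (\<lambda>x e. f x e mod g x e)"
  unfolding minus_div_mult_eq_mod[symmetric] by (intro pt_intros)

lemma pt_power [pt_intros]: "pt f \<Longrightarrow> pt (\<lambda>x e. f x e ^ c)"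
  by (induction c) (auto intro: pt_intros)

section \<open>Bounded search, with the bound itself reporting failure\<close>

definition bmin :: "nat \<Rightarrow> (nat \<Rightarrow> bool) \<Rightarrow> nat" where
  "bmin n P = (LEAST i. n \<le> i \<or> P i)"

lemma bmin_le: "bmin n P \<le> n"
  unfolding bmin_def by (rule Least_le) simp

lemma bmin_holds: "bmin n P < n \<Longrightarrow> P (bmin n P)"
  using LeastI[of "\<lambda>i. n \<le> i \<or> P i" n] unfolding bmin_def by auto

lemma bmin_least: "i < bmin n P \<Longrightarrow> \<not> P i"
  unfolding bmin_def using not_less_Least by blast

lemma bmin_eqI: "k \<le> n \<Longrightarrow> (\<And>i. i < k \<Longrightarrow> \<not> P i) \<Longrightarrow> k = n \<or> P k \<Longrightarrow> bmin n P = k"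
  unfolding bmin_def by (rule Least_equality) (auto simp: not_less[symmetric])

text \<open>The numbers below \<open>n\<close> with no witness at or below them form an initial
  segment, and its length is the least witness, or \<open>n\<close> if there is none.\<close>

lemma bmin_eq_sum: "bmin n P = (\<Sum>k<n. of_bool (\<forall>i<Suc k. \<not> P i))"
proof -
  have "{k. k < n \<and> (\<forall>i<Suc k. \<not> P i)} = {..<bmin n P}"
    using bmin_holds[of n P] bmin_least[of _ n P] bmin_le[of n P]
    by (auto simp: less_Suc_eq_le) (metis linorder_not_le nless_le order_less_le_trans)+
  moreover have "(\<Sum>k<n. of_bool (\<forall>i<Suc k. \<not> P i)) = card {k. k < n \<and> (\<forall>i<Suc k. \<not> P i)}"
    by (simp add: sum.If_cases Int_def of_bool_def lessThan_def)
  ultimately show ?thesis by simp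
qed

lemma pt_bmin [pt_intros]:
  assumes "pt n" and P: "pt (\<lambda>x e. of_bool (P (e 0) x (\<lambda>i. e (Suc i))))"
  shows "pt (\<lambda>x e. bmin (n x e) (\<lambda>i. P i x e))"
  unfolding bmin_eq_sum
  using pt_ren[OF P, of "\<lambda>i. if i = 0 then 0 else Suc i"] by (intro pt_intros assms) simp

section \<open>Iteration and finite tables\<close>

lemma pt_funpow:
  assumes n: "pt n" and s: "pt s" and F: "pt (\<lambda>x e. F (e 0) x (\<lambda>i. e (Suc i)))"
    and "pb h" "\<And>x e k. k \<le> n x e \<Longrightarrow> ((\<lambda>v. F v x e) ^^ k) (s x e) \<le> h x e"
  shows "pt (\<lambda>x e. ((\<lambda>v. F v x e) ^^ n x e) (s x e))"
proof -
  have eq: "rec_nat v (\<lambda>i. f) k = (f ^^ k) v" for v :: nat and f k by (induction k) auto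
  have "pt (\<lambda>x e. rec_nat (s x e) (\<lambda>i v. F v x e) (n x e))"
    by (rule pt_rec[OF n s _ assms(4)]) (use pt_ren[OF F, of Suc] assms(5) in \<open>auto simp: eq\<close>)
  then show ?thesis by (simp only: eq)
qed

lemma pt_app1: "pt (\<lambda>x e. F x (e 0)) \<Longrightarrow> pt f \<Longrightarrow> pt (\<lambda>x e. F x (f x e))"
  using pt_subst[of "\<lambda>x e. F x (e 0)" "\<lambda>_. f"] by simp

lemma pt_app2:
  assumes "pt (\<lambda>x e. F x (e 0) (e 1))" "pt f" "pt g"
  shows "pt (\<lambda>x e. F x (f x e) (g x e))"
  using pt_subst[OF assms(1), of "\<lambda>i. if i = 0 then f else g"] assms(2,3) by simp

lemma pt_const_sum: "(\<And>i. i < (C::nat) \<Longrightarrow> pt (f i)) \<Longrightarrow> pt (\<lambda>x e. \<Sum>i<C. f i x e)"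
  by (induction C) (auto intro: pt_intros)

text \<open>A function of finite support is a sum with constantly many terms. In this way the
  transition table of a fixed machine becomes computable.\<close>

lemma pt_table:
  assumes "pt f" and "\<And>i. i \<ge> (C::nat) \<Longrightarrow> t i = 0"
  shows "pt (\<lambda>x e. t (f x e))"
proof -
  have "t k = (\<Sum>i<C. of_bool (k = i) * t i)" for k
    using assms(2)[of k] by (cases "k < C") (auto simp: of_bool_def if_distrib[of "\<lambda>u. u * _"] cong: if_cong)
  then have "(\<lambda>x e. t (f x e)) = (\<lambda>x e. \<Sum>i<C. of_bool (f x e = i) * t i)" by (intro ext)
  moreover have "pt (\<lambda>x e. \<Sum>i<C. of_bool (f x e = i) * t i)"
    by (intro pt_const_sum pt_intros assms(1))
  ultimately show ?thesis by simp
qed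

lemma pt_table2:
  assumes "pt f" "pt g" and "\<And>i j. i \<ge> (C::nat) \<or> j \<ge> (D::nat) \<Longrightarrow> t i j = 0"
  shows "pt (\<lambda>x e. t (f x e) (g x e))"
proof -
  have "t k l = (\<Sum>i<C. of_bool (k = i) * t i l)" for k l
    using assms(3)[of k l] by (cases "k < C") (auto simp: of_bool_def if_distrib[of "\<lambda>u. u * _"] cong: if_cong)
  then have "(\<lambda>x e. t (f x e) (g x e)) = (\<lambda>x e. \<Sum>i<C. of_bool (f x e = i) * t i (g x e))" by (intro ext)
  moreover have "pt (\<lambda>x e. \<Sum>i<C. of_bool (f x e = i) * t i (g x e))"
    by (intro pt_const_sum pt_intros assms(1) pt_table[OF assms(2), of D]) (use assms(3) in auto)
  ultimately show ?thesis by simp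
qed


section \<open>Bit strings computed bit by bit\<close>

text \<open>In the second part variable 0 is the position of the queried bit, and the variables of
  \<open>F\<close> are shifted by one. The string itself is never stored.\<close>

definition ptl :: "(bool list \<Rightarrow> (nat \<Rightarrow> nat) \<Rightarrow> bool list) \<Rightarrow> bool" where
  "ptl F \<longleftrightarrow> pt (\<lambda>x e. length (F x e)) \<and> pt (\<lambda>x e. of_bool (bitat (F x (\<lambda>i. e (Suc i))) (e 0)))"

lemma ptl_bitat:
  assumes "ptl F" "pt f"
  shows "pt (\<lambda>x e. of_bool (bitat (F x e) (f x e)))"
proof -
  have "pt (\<lambda>x e. of_bool (bitat (F x (\<lambda>i. e (Suc i))) (e 0)))" using assms(1) by (simp add: ptl_def)
  moreover have "pt ((case_nat f (\<lambda>i x e. e i)) i)" for i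
    by (cases i) (auto intro: assms(2) pt.var)
  ultimately show ?thesis using pt_subst[of _ "case_nat f (\<lambda>i x e. e i)"] by fastforce
qed

lemma ptl_length: "ptl F \<Longrightarrow> pt (\<lambda>x e. length (F x e))"
  by (simp add: ptl_def)

lemma ptl_ren: "ptl F \<Longrightarrow> ptl (\<lambda>x e. F x (\<lambda>i. e (\<rho> i)))"
proof -
  assume F: "ptl F"
  then have "pt (\<lambda>x e. of_bool (bitat (F x (\<lambda>i. e (Suc i))) (e 0)))" by (simp add: ptl_def)
  from pt_ren[OF this, of "case_nat 0 (\<lambda>i. Suc (\<rho> i))"]
  have "pt (\<lambda>x e. of_bool (bitat (F x (\<lambda>i. e (Suc (\<rho> i)))) (e 0)))" by simp
  with F show ?thesis using pt_ren[of "\<lambda>x e. length (F x e)" \<rho>] by (simp add: ptl_def)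
qed

lemma ptlI: "pt (\<lambda>x e. length (F x e)) \<Longrightarrow> pt (\<lambda>x e. of_bool (bitat (F x (\<lambda>i. e (Suc i))) (e 0))) \<Longrightarrow> ptl F"
  by (simp add: ptl_def)

text \<open>Composition at the input: \<open>f\<close> consults its input only through the length
  and single bits, and for \<open>G x\<close> both can be recomputed whenever they are asked
  for.\<close>

lemma pt_input:
  assumes "pt f" and G: "ptl (\<lambda>x e. G x)"
  shows "pt (\<lambda>x e. f (G x) e)"
  using assms(1)
proof (induction rule: pt.induct)
  case len
  then show ?case using G by (simp add: ptl_def)
next
  case (bit f)
  then show ?case using ptl_bitat[OF G, of "\<lambda>x e. f (G x) e"] by (simp add: bitat_def)
next
  case (loop n f g h)
  have "pb (\<lambda>x e. length (G x))" using G by (auto simp: ptl_def intro: pt_pb)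
  obtain m d where md: "\<And>x e. h x e \<le> sz m x e ^ d" using loop.hyps(4) unfolding pb_def by blast
  have "pb (\<lambda>x e. sz m (G x) e)"
    unfolding sz_def by (intro pb_intros pb_sum \<open>pb (\<lambda>x e. length (G x))\<close>)
  then have "pb (\<lambda>x e. h (G x) e)" by (rule pb_mono[OF pb_power]) (rule md)
  then show ?case
    by (rule pt.loop[OF loop.IH]) (use loop.hyps(5) in auto)
qed (auto intro: pt.intros)

lemma ptl_Nil: "ptl (\<lambda>x e. [])"
  by (rule ptlI) (simp_all add: bitat_def pt_const)

lemma ptl_single: "pt (\<lambda>x e. of_bool (P x e)) \<Longrightarrow> ptl (\<lambda>x e. [P x e])"
proof (rule ptlI)
  assume P: "pt (\<lambda>x e. of_bool (P x e))"
  have "pt (\<lambda>x e. of_bool (e 0 = 0 \<and> P x (\<lambda>i. e (Suc i))))" by (intro pt_intros pt_tl[OF P])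
  then show "pt (\<lambda>x e. of_bool (bitat [P x (\<lambda>i. e (Suc i))] (e 0)))"
    by (rule back_subst[of pt]) (auto simp: fun_eq_iff bitat_def nth_Cons')
qed (auto intro: pt_intros)

lemma bitat_append: "bitat (u @ v) i \<longleftrightarrow> bitat u i \<or> length u \<le> i \<and> bitat v (i - length u)"
  by (auto simp: bitat_def nth_append)

lemma ptl_append:
  assumes "ptl F" "ptl G"
  shows "ptl (\<lambda>x e. F x e @ G x e)"
  unfolding ptl_def bitat_append length_append
  by (intro conjI pt_intros ptl_bitat ptl_length assms ptl_ren[OF assms(1)] ptl_ren[OF assms(2)])

text \<open>Block \<open>i\<close> starts at the sum of the lengths before it. Beyond the end of a
  block \<open>bitat\<close> is false, so only the block that contains \<open>j\<close> can
  answer.\<close>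

lemma bitat_concat: "bitat (concat (map F [0..<n])) j \<longleftrightarrow>
   (\<exists>i<n. (\<Sum>k<i. length (F k)) \<le> j \<and> bitat (F i) (j - (\<Sum>k<i. length (F k))))"
proof (induction n)
  case 0
  then show ?case by (simp add: bitat_def)
next
  case (Suc n)
  have "length (concat (map F [0..<n])) = (\<Sum>k<n. length (F k))"
    by (simp add: length_concat o_def interv_sum_list_conv_sum_set_nat atLeast0LessThan)
  then show ?case using Suc by (auto simp: bitat_append less_Suc_eq)
qed

lemma ptl_concat:
  assumes n: "pt n" and F: "ptl (\<lambda>x e. F (e 0) x (\<lambda>i. e (Suc i)))"
  shows "ptl (\<lambda>x e. concat (map (\<lambda>i. F i x e) [0..<n x e]))"
proof (rule ptlI)
  have "pt (\<lambda>x e. \<Sum>i<n x e. length (F i x e))" using F by (intro pt_intros n) (simp add: ptl_def)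
  then show "pt (\<lambda>x e. length (concat (map (\<lambda>i. F i x e) [0..<n x e])))"
    by (simp add: length_concat o_def interv_sum_list_conv_sum_set_nat atLeast0LessThan)
  have 1: "ptl (\<lambda>x e. F (e 0) x (\<lambda>i. e (Suc (Suc i))))"
    using ptl_ren[OF F, of "case_nat 0 (\<lambda>i. Suc (Suc i))"] by simp
  have 2: "ptl (\<lambda>x e. F (e 0) x (\<lambda>i. e (Suc (Suc (Suc i)))))"
    using ptl_ren[OF F, of "case_nat 0 (\<lambda>i. Suc (Suc (Suc i)))"] by simp
  show "pt (\<lambda>x e. of_bool (bitat (concat (map (\<lambda>i. F i x (\<lambda>i. e (Suc i))) [0..<n x (\<lambda>i. e (Suc i))])) (e 0)))"
    unfolding bitat_concat
    by (intro pt_intros pt_tl[OF n] ptl_bitat ptl_length 1 2)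
qed

lemma ptl_map:
  assumes n: "pt n" and P: "pt (\<lambda>x e. of_bool (P (e 0) x (\<lambda>i. e (Suc i))))"
  shows "ptl (\<lambda>x e. map (\<lambda>i. P i x e) [0..<n x e])"
  using ptl_concat[OF n, of "\<lambda>i x e. [P i x e]", OF ptl_single[OF P]]
  by (simp add: concat_map_singleton)

theorem ptl_poly_time:
  assumes "ptl F"
  shows "poly_time_computable (\<lambda>x. F x (\<lambda>_. 0))"
proof -
  have "poly_time_computable (\<lambda>x. map (\<lambda>i. (of_bool (bitat (F x (\<lambda>k. (i ## (\<lambda>_. 0)) (Suc k)))
      ((i ## (\<lambda>_. 0)) 0)) :: nat) \<noteq> 0) [0..<length (F x (\<lambda>_. 0))])"
    using assms unfolding ptl_def by (intro pt_list_poly_time) auto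
  moreover have "map (\<lambda>i. (of_bool (bitat (F x (\<lambda>k. (i ## (\<lambda>_. 0)) (Suc k))) ((i ## (\<lambda>_. 0)) 0)) :: nat) \<noteq> 0)
      [0..<length (F x (\<lambda>_. 0))] = F x (\<lambda>_. 0)" for x
    by (rule nth_equalityI) (auto simp: bitat_def)
  ultimately show ?thesis by simp
qed

theorem pt_class_P:
  assumes "pt (\<lambda>x e. of_bool (x \<in> L))"
  shows "L \<in> class_P"
  using ptl_poly_time[OF ptl_single[OF assms]] unfolding class_P_def by simp


section \<open>Computing encodings\<close>

definition half :: "nat \<Rightarrow> nat \<Rightarrow> nat" where "half k n = ((\<lambda>v. v div 2) ^^ k) n"

lemma half_le: "half k n \<le> n"
proof (induction k)
  case (Suc k)
  have "half (Suc k) n = half k n div 2" by (simp add: half_def)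
  then show ?case using Suc by linarith
qed (simp add: half_def)

lemma pt_half: "pt f \<Longrightarrow> pt g \<Longrightarrow> pt (\<lambda>x e. half (f x e) (g x e))"
proof -
  have "pt (\<lambda>x e. half (e 0) (e 1))"
    unfolding half_def
    by (rule pt_funpow[where h = "\<lambda>x e. e 1"]; (intro pt_intros pb_intros)?)
      (use half_le in \<open>auto simp: half_def\<close>)
  then show "pt f \<Longrightarrow> pt g \<Longrightarrow> pt (\<lambda>x e. half (f x e) (g x e))" by (rule pt_app2)
qed

lemma drop_binary: "drop k (binary n) = binary (half k n)"
proof (induction k arbitrary: n)
  case 0
  then show ?case by (simp add: half_def)
next
  case (Suc k)
  have "half (Suc k) n = half k (n div 2)" by (simp add: half_def funpow_Suc_right del: funpow.simps)
  moreover have "half (Suc k) 0 = 0" using half_le[of "Suc k" 0] by simp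
  ultimately show ?case using Suc.IH[of "n div 2"] by (cases "n = 0") (auto simp: binary.simps[of n] binary.simps[of 0])
qed

lemma binary_eq_Nil: "binary n = [] \<longleftrightarrow> n = 0"
  by (simp add: binary.simps[of n])

lemma length_binary_le: "length (binary n) \<le> n"
proof (induction n rule: less_induct)
  case (less n)
  show ?case
  proof (cases "n = 0")
    case False
    then have "length (binary (n div 2)) \<le> n div 2" by (intro less) auto
    then show ?thesis using False by (simp add: binary.simps[of n])
  qed (simp add: binary.simps[of 0])
qed

text \<open>Recursion on \<open>n\<close> is replaced by direct access to the bits: bit
  \<open>k\<close> is the parity after \<open>k\<close> halvings, and the bits end where halving has
  reached 0. This is the shape required by \<open>ptl\<close>.\<close>

lemma binary_eq: "binary n = map (\<lambda>k. odd (half k n)) [0..<bmin n (\<lambda>k. half k n = 0)]"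
proof -
  have *: "k < length (binary n) \<longleftrightarrow> half k n \<noteq> 0" for k
    using drop_binary[of k n] binary_eq_Nil[of "half k n"] by (metis drop_eq_Nil not_le)
  have "bmin n (\<lambda>k. half k n = 0) = length (binary n)"
    by (rule bmin_eqI) (use * length_binary_le[of n] in auto)
  moreover have "binary n ! k = odd (half k n)" if "k < length (binary n)" for k
    using drop_binary[of k n] that *[of k] by (auto simp: binary.simps[of "half k n"] Cons_nth_drop_Suc[symmetric])
  ultimately show ?thesis by (auto intro!: nth_equalityI)
qed

lemma ptl_enc_nat:
  assumes "pt f"
  shows "ptl (\<lambda>x e. enc_nat (f x e))"
proof -
  have eq: "enc_nat n = concat (map (\<lambda>k. [True] @ [odd (half k n)]) [0..<bmin n (\<lambda>k. half k n = 0)]) @ [False]" for n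
    unfolding enc_nat_def enc_list_def by (subst binary_eq) (simp add: o_def)
  have odd: "odd m \<longleftrightarrow> m mod 2 = 1" for m :: nat by presburger
  show ?thesis unfolding eq odd
    by (intro ptl_append ptl_concat ptl_single pt_intros pt_half assms pt_tl[OF assms])
qed

lemma ptl_enc_list:
  assumes n: "pt n" and F: "ptl (\<lambda>x e. f (g (e 0) x (\<lambda>i. e (Suc i))))"
  shows "ptl (\<lambda>x e. enc_list f (map (\<lambda>i. g i x e) [0..<n x e]))"
proof -
  have "ptl (\<lambda>x e. concat (map (\<lambda>i. [True] @ f (g i x e)) [0..<n x e]) @ [False])"
    by (intro ptl_append ptl_concat ptl_single pt_intros F n)
  then show ?thesis by (simp add: enc_list_def o_def)
qed


section \<open>Borda scores\<close>

definition points :: "'a set \<Rightarrow> 'a list \<Rightarrow> 'a \<Rightarrow> nat" where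
  "points C v c = card C - vote_rank v c"

lemma borda_score_points: "borda_score C V c = (\<Sum>v\<leftarrow>V. points C v c)"
  by (simp add: borda_score_def points_def)

lemma vote_rank_nth: "distinct v \<Longrightarrow> j < length v \<Longrightarrow> vote_rank v (v ! j) = Suc j"
proof -
  assume v: "distinct v" "j < length v"
  then have "takeWhile (\<lambda>d. d \<noteq> v ! j) v = take j v"
    by (intro takeWhile_eq_take_P_nth) (auto simp: nth_eq_iff_index_eq)
  then show ?thesis using v by (simp add: vote_rank_def)
qed

lemma perm_facts:
  assumes "v \<in> permutations_of_set C"
  shows "set v = C" "distinct v" "length v = card C" "finite C"
  using assms by (auto simp: permutations_of_set_def distinct_card)

lemma vote_rank_bounds:
  assumes "v \<in> permutations_of_set C" "c \<in> C"
  obtains j where "j < card C" "vote_rank v c = Suc j" "c = v ! j"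
  using perm_facts[OF assms(1)] assms(2) vote_rank_nth by (metis in_set_conv_nth)

lemma vote_rank_inject:
  assumes "v \<in> permutations_of_set C" "c \<in> C" "d \<in> C" "vote_rank v c = vote_rank v d"
  shows "c = d"
  using assms by (metis Suc_inject vote_rank_bounds)

lemma points_less: "v \<in> permutations_of_set C \<Longrightarrow> c \<in> C \<Longrightarrow> points C v c < card C"
  by (erule (1) vote_rank_bounds) (auto simp: points_def)

lemma points_inj: "v \<in> permutations_of_set C \<Longrightarrow> inj_on (points C v) C"
proof (rule inj_onI)
  fix c d assume v: "v \<in> permutations_of_set C" and cd: "c \<in> C" "d \<in> C" "points C v c = points C v d"
  obtain i j where "i < card C" "vote_rank v c = Suc i" "j < card C" "vote_rank v d = Suc j"
    using v cd by (metis vote_rank_bounds)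
  then show "c = d" using cd vote_rank_inject[OF v] by (simp add: points_def)
qed

lemma points_bij: "v \<in> permutations_of_set C \<Longrightarrow> bij_betw (points C v) C {..<card C}"
proof -
  assume v: "v \<in> permutations_of_set C"
  then have "points C v ` C \<subseteq> {..<card C}" using points_less by auto
  moreover have "card (points C v ` C) = card {..<card C}" using points_inj[OF v] by (simp add: card_image)
  ultimately have "points C v ` C = {..<card C}" by (intro card_subset_eq) auto
  with points_inj[OF v] show ?thesis by (simp add: bij_betw_def)
qed

lemma sum_points: "v \<in> permutations_of_set C \<Longrightarrow> (\<Sum>c\<in>C. points C v c) = (\<Sum>i<card C. i)"
  using sum.reindex_bij_betw[OF points_bij, of v C "\<lambda>i. i"] by simp

lemma double_sum_lessThan: "2 * (\<Sum>i<n. i) = n * (n - 1)" for n :: nat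
proof (induction n)
  case (Suc n)
  then show ?case by (cases n) auto
qed simp

text \<open>The total does not depend on the votes, so every bribe leaves the average score
  fixed.\<close>

lemma sum_borda_score:
  assumes "set V \<subseteq> permutations_of_set C"
  shows "2 * (\<Sum>c\<in>C. borda_score C V c) = length V * (card C * (card C - 1))"
  using assms
proof (induction V)
  case (Cons v V)
  have "(\<Sum>c\<in>C. borda_score C (v # V) c) = (\<Sum>i<card C. i) + (\<Sum>c\<in>C. borda_score C V c)"
    using Cons.prems sum_points[of v C] by (simp add: borda_score_points sum.distrib)
  then show ?case using Cons double_sum_lessThan[of "card C"] by (simp add: algebra_simps)
qed (simp add: borda_score_points)

lemma borda_score_update:
  "a < length V \<Longrightarrow> borda_score C (V[a := w]) c + points C (V ! a) c = borda_score C V c + points C w c"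
  unfolding borda_score_points
  by (subst (2) id_take_nth_drop[of a V], simp) (simp add: upd_conv_take_nth_drop)

lemma vote_of_ranks:
  assumes "bij_betw f C {..<card C}" "finite C"
  obtains w where "w \<in> permutations_of_set C" "\<And>c. c \<in> C \<Longrightarrow> vote_rank w c = Suc (f c)"
proof -
  define g where "g = inv_into C f"
  have g: "bij_betw g {..<card C} C" unfolding g_def by (rule bij_betw_inv_into[OF assms(1)])
  let ?w = "map g [0..<card C]"
  have "set ?w = C" using g by (simp add: bij_betw_def atLeast0LessThan)
  moreover have d: "distinct ?w" using g by (auto simp: bij_betw_def distinct_map atLeast0LessThan)
  ultimately have w: "?w \<in> permutations_of_set C" by (simp add: permutations_of_set_def)
  have "vote_rank ?w c = Suc (f c)" if c: "c \<in> C" for c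
  proof -
    have fc: "f c < card C" using assms(1) c by (auto simp: bij_betw_def)
    have "?w ! f c = c" using fc c assms(1) by (simp add: g_def bij_betw_inv_into_left)
    then show ?thesis using vote_rank_nth[OF d, of "f c"] fc by simp
  qed
  with w show thesis by (rule that)
qed

text \<open>Since \<open>A\<close> contains all old votes, an unbribed voter can pass as bribed with
  the old vote. So at most two bribes amount to two positions, possibly equal, which exist because
  there is a voter.\<close>

lemma bribed_two:
  assumes "V \<noteq> []" "set V \<subseteq> A"
  shows "W \<in> bribed A 2 V \<longleftrightarrow>
    (\<exists>a<length V. \<exists>b<length V. \<exists>w1\<in>A. \<exists>w2\<in>A. W = V[a := w1, b := w2])"
proof
  assume "W \<in> bribed A 2 V"
  then obtain S where W: "length W = length V" and S: "S \<subseteq> {..<length V}" "card S \<le> 2"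
    and *: "\<And>i. i < length V \<Longrightarrow> if i \<in> S then W ! i \<in> A else W ! i = V ! i"
    unfolding bribed_def by blast
  have fin: "finite S" using S(1) finite_subset by blast
  have "\<exists>a b. a < length V \<and> b < length V \<and> S \<subseteq> {a, b}"
  proof -
    consider "card S = 0" | "card S = 1" | "card S = 2" using S(2) by linarith
    then show ?thesis
    proof cases
      case 1
      then show ?thesis using fin assms(1) by (intro exI[of _ 0]) auto
    next
      case 2
      then obtain a where "S = {a}" by (rule card_1_singletonE)
      then show ?thesis using S(1) by auto
    next
      case 3
      then obtain a b where "S = {a, b}" by (auto simp: card_2_iff)
      then show ?thesis using S(1) by auto
    qed
  qed
  then obtain a b where ab: "a < length V" "b < length V" "S \<subseteq> {a, b}" by blast
  have "W ! i \<in> A" if "i < length V" for i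
    using *[OF that] assms(2) that by (auto split: if_splits)
  moreover have "W = V[a := W ! a, b := W ! b]"
  proof (rule nth_equalityI)
    fix i assume i: "i < length W"
    have "W ! i = V ! i" if "i \<noteq> a" "i \<noteq> b"
      using *[of i] i W ab(3) that by (auto split: if_splits)
    then show "W ! i = V[a := W ! a, b := W ! b] ! i"
      using ab W i by (cases "i = a"; cases "i = b") (auto simp: nth_list_update)
  qed (simp add: W)
  ultimately show "\<exists>a<length V. \<exists>b<length V. \<exists>w1\<in>A. \<exists>w2\<in>A. W = V[a := w1, b := w2]"
    using ab by blast
next
  assume "\<exists>a<length V. \<exists>b<length V. \<exists>w1\<in>A. \<exists>w2\<in>A. W = V[a := w1, b := w2]"
  then obtain a b w1 w2 where *: "a < length V" "b < length V" "w1 \<in> A" "w2 \<in> A" "W = V[a := w1, b := w2]"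
    by blast
  have "card {a, b} \<le> 2" by (simp add: card_insert_if)
  then show "W \<in> bribed A 2 V"
    unfolding bribed_def using * by (intro CollectI conjI exI[of _ "{a, b}"]) (auto simp: nth_list_update)
qed

text \<open>A right inverse makes \<open>g\<close> surjective on the range, hence injective by
  counting. Votes can thus be given by one formula for candidates and one for positions.\<close>

lemma permutations_of_upto:
  assumes "\<And>c. c < n \<Longrightarrow> pos c < n \<and> g (pos c) = c"
  shows "map g [0..<n] \<in> permutations_of_set {..<n}"
    and "c < n \<Longrightarrow> vote_rank (map g [0..<n]) c = Suc (pos c)"
proof -
  have sub: "{..<n} \<subseteq> g ` {..<n}"
  proof
    fix c assume "c \<in> {..<n}"
    then show "c \<in> g ` {..<n}" using assms[of c] by (intro image_eqI[of _ _ "pos c"]) auto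
  qed
  then have "card (g ` {..<n}) = n"
    using card_mono[OF _ sub] card_image_le[of "{..<n}" g] by simp
  then have eq: "g ` {..<n} = {..<n}" and inj: "inj_on g {..<n}"
    using card_subset_eq[OF _ sub] eq_card_imp_inj_on[of "{..<n}" g] by auto
  then have d: "distinct (map g [0..<n])" by (simp add: distinct_map atLeast0LessThan)
  then show "map g [0..<n] \<in> permutations_of_set {..<n}"
    using eq by (simp add: permutations_of_set_def atLeast0LessThan)
  show "vote_rank (map g [0..<n]) c = Suc (pos c)" if "c < n"
    using vote_rank_nth[OF d, of "pos c"] assms[OF that] by simp
qed


section \<open>From displacements of permutations to Borda bribery\<close>

definition swap12 :: "bool \<Rightarrow> nat \<Rightarrow> nat" where
  "swap12 f r = (if f \<and> r = 1 then 2 else if f \<and> r = 2 then 1 else r)"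

text \<open>Candidate \<open>m\<close> is the preferred one. Position 1 of the unswapped base vote holds candidate \<open>i\<close>
  and position 2 holds \<open>m\<close>. The second vote of a pair runs through the base vote backwards, so that a
  pair gives \<open>m\<close> points to everybody, up to one point exchanged between \<open>i\<close> and \<open>m\<close>.\<close>

definition base_vote :: "nat \<Rightarrow> nat \<Rightarrow> nat \<Rightarrow> nat" where
  "base_vote m i r = (if r = 0 then (i + 1) mod m else if r = 1 then i else if r = 2 then m
     else (i + r - 1) mod m)"

text \<open>The inverse of \<open>base_vote m i\<close>. Here \<open>k\<close> is the cyclic
  distance from \<open>i\<close> to \<open>c\<close>; distance 1 occupies position 0, and the larger
  distances follow after the positions 1 and 2 of \<open>i\<close> and \<open>m\<close>.\<close>

definition base_pos :: "nat \<Rightarrow> nat \<Rightarrow> nat \<Rightarrow> nat" where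
  "base_pos m i c = (if c = m then 2 else if c = i then 1 else
     let k = (c + m - i) mod m in if k = 1 then 0 else k + 1)"

definition vote1 :: "nat \<Rightarrow> nat \<Rightarrow> bool \<Rightarrow> nat list" where
  "vote1 m i f = map (\<lambda>r. base_vote m i (swap12 f r)) [0..<Suc m]"

definition vote2 :: "nat \<Rightarrow> nat \<Rightarrow> bool \<Rightarrow> nat list" where
  "vote2 m i f = map (\<lambda>r. base_vote m i (swap12 f (m - r))) [0..<Suc m]"

lemma swap12_swap12 [simp]: "swap12 f (swap12 f r) = r"
  by (simp add: swap12_def)

lemma base_vote_pos:
  assumes "m \<ge> 3" "i < m" "c \<le> m"
  shows "base_pos m i c \<le> m" "base_vote m i (base_pos m i c) = c"
proof -
  have *: "base_pos m i c \<le> m \<and> base_vote m i (base_pos m i c) = c" if c: "c \<noteq> m" "c \<noteq> i"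
  proof -
    define k where "k = (c + m - i) mod m"
    have km: "k < m" using assms by (simp add: k_def)
    have ik: "(i + k) mod m = c"
    proof -
      have "(i + k) mod m = (i + (c + m - i)) mod m" unfolding k_def by (rule mod_add_right_eq)
      also have "i + (c + m - i) = c + m" using assms by simp
      finally show ?thesis using assms c by simp
    qed
    have k0: "k \<noteq> 0" using ik c assms(2) by (intro notI) simp
    have pos: "base_pos m i c = (if k = 1 then 0 else k + 1)"
      using c by (simp add: base_pos_def k_def)
    show ?thesis
    proof (cases "k = 1")
      case True
      then show ?thesis using ik pos by (simp add: base_vote_def)
    next
      case False
      then show ?thesis using ik pos k0 km by (simp add: base_vote_def)
    qed
  qed
  show "base_pos m i c \<le> m"
    using * assms by (cases "c = m"; cases "c = i") (auto simp: base_pos_def)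
  show "base_vote m i (base_pos m i c) = c"
    using * assms by (cases "c = m"; cases "c = i") (auto simp: base_pos_def base_vote_def)
qed

lemma swap12_le: "m \<ge> 2 \<Longrightarrow> r \<le> m \<Longrightarrow> swap12 f r \<le> m"
  by (simp add: swap12_def)

lemma vote1_perm:
  assumes "m \<ge> 3" "i < m"
  shows "vote1 m i f \<in> permutations_of_set {..<Suc m}"
    and "c \<le> m \<Longrightarrow> vote_rank (vote1 m i f) c = Suc (swap12 f (base_pos m i c))"
proof -
  have *: "swap12 f (base_pos m i c) < Suc m \<and> base_vote m i (swap12 f (swap12 f (base_pos m i c))) = c"
    if "c < Suc m" for c
    using base_vote_pos[of m i c] assms that swap12_le[of m "base_pos m i c" f] by simp
  show "vote1 m i f \<in> permutations_of_set {..<Suc m}"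
    unfolding vote1_def by (rule permutations_of_upto(1)[OF *])
  show "vote_rank (vote1 m i f) c = Suc (swap12 f (base_pos m i c))" if "c \<le> m"
    unfolding vote1_def by (rule permutations_of_upto(2)[OF *]) (use that in auto)
qed

lemma vote2_perm:
  assumes "m \<ge> 3" "i < m"
  shows "vote2 m i f \<in> permutations_of_set {..<Suc m}"
    and "c \<le> m \<Longrightarrow> vote_rank (vote2 m i f) c = Suc (m - swap12 f (base_pos m i c))"
proof -
  have *: "m - swap12 f (base_pos m i c) < Suc m \<and>
      base_vote m i (swap12 f (m - (m - swap12 f (base_pos m i c)))) = c"
    if "c < Suc m" for c
    using base_vote_pos[of m i c] assms that swap12_le[of m "base_pos m i c" f] by simp
  show "vote2 m i f \<in> permutations_of_set {..<Suc m}"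
    unfolding vote2_def by (rule permutations_of_upto(1)[OF *])
  show "vote_rank (vote2 m i f) c = Suc (m - swap12 f (base_pos m i c))" if "c \<le> m"
    unfolding vote2_def by (rule permutations_of_upto(2)[OF *]) (use that in auto)
qed

lemma pair_points:
  assumes "m \<ge> 3" "i < m" "c \<le> m" "\<not> (f1 \<and> f2)"
  shows "int (points {..<Suc m} (vote1 m i f1) c) + int (points {..<Suc m} (vote2 m i f2) c) =
    int m + (if c = i then of_bool f2 - of_bool f1 else if c = m then of_bool f1 - of_bool f2 else 0)"
proof -
  have b: "base_pos m i c \<le> m" by (rule base_vote_pos) (use assms in auto)
  have "swap12 f1 (base_pos m i c) \<le> m" "swap12 f2 (base_pos m i c) \<le> m"
    using b assms(1) by (auto intro: swap12_le)
  then have "int (points {..<Suc m} (vote1 m i f1) c) + int (points {..<Suc m} (vote2 m i f2) c) =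
      int m - int (swap12 f1 (base_pos m i c)) + int (swap12 f2 (base_pos m i c))"
    using assms by (simp add: points_def vote1_perm vote2_perm of_nat_diff)
  moreover have "base_pos m i c \<noteq> 1 \<and> base_pos m i c \<noteq> 2" if "c \<noteq> i" "c \<noteq> m"
  proof
    have "c = base_vote m i (base_pos m i c)" using base_vote_pos assms by simp
    then show "base_pos m i c \<noteq> 1" "base_pos m i c \<noteq> 2" using that by (auto simp: base_vote_def)
  qed
  ultimately show ?thesis using assms by (auto simp: swap12_def base_pos_def)
qed

text \<open>The preferred candidate holds position 1 or 2 of a base vote of length at least 4, so it
  is last neither forwards nor backwards. This is what singles out the two special voters
  later.\<close>

lemma points_preferred_pos:
  assumes "m \<ge> 3" "i < m"
  shows "points {..<Suc m} (vote1 m i f) m > 0" "points {..<Suc m} (vote2 m i f) m > 0"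
  using assms by (auto simp: points_def vote1_perm vote2_perm base_pos_def swap12_def)

text \<open>Among the \<open>U\<close> pairs of rival \<open>i\<close>, the first
  \<open>dn i\<close> move a point from \<open>i\<close> to \<open>m\<close> and the first
  \<open>up i\<close> move one from \<open>m\<close> to \<open>i\<close>. All rivals have the same
  number of pairs, so only these swaps make scores differ.\<close>

definition fixed_votes :: "nat \<Rightarrow> nat \<Rightarrow> (nat \<Rightarrow> nat) \<Rightarrow> (nat \<Rightarrow> nat) \<Rightarrow> nat list list" where
  "fixed_votes m U up dn = concat (map (\<lambda>i. concat (map (\<lambda>u.
     [vote1 m i (u < dn i), vote2 m i (u < up i)]) [0..<U])) [0..<m])"

definition all_votes :: "nat \<Rightarrow> nat \<Rightarrow> (nat \<Rightarrow> nat) \<Rightarrow> (nat \<Rightarrow> nat) \<Rightarrow> nat list list" where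
  "all_votes m U up dn = fixed_votes m U up dn @ [[0..<Suc m], [0..<Suc m]]"

lemma fixed_votes_perm: "m \<ge> 3 \<Longrightarrow> set (fixed_votes m U up dn) \<subseteq> permutations_of_set {..<Suc m}"
  unfolding fixed_votes_def using vote1_perm(1) vote2_perm(1) by (auto simp del: permutations_of_set_infinite)

lemma length_fixed_votes: "length (fixed_votes m U up dn) = 2 * m * U"
  by (simp add: fixed_votes_def length_concat o_def sum_list_triv)

lemma all_votes_perm: "m \<ge> 3 \<Longrightarrow> set (all_votes m U up dn) \<subseteq> permutations_of_set {..<Suc m}"
  using fixed_votes_perm[of m U up dn] by (auto simp: all_votes_def permutations_of_set_def)

lemma sum_list_concat_upt: "(\<Sum>v\<leftarrow>concat (map F [0..<n]). g v) = (\<Sum>i<n. \<Sum>v\<leftarrow>F i. g v)"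
  for g :: "'b \<Rightarrow> 'a::comm_monoid_add"
  by (induction n) auto

lemma card_lessThan_Int: "b \<le> U \<Longrightarrow> card ({..<U} \<inter> {u. u < b}) = b" for U :: nat
proof -
  assume "b \<le> U"
  then have "{..<U} \<inter> {u. u < b} = {..<b}" by auto
  then show ?thesis by simp
qed

text \<open>Each of the \<open>m * U\<close> pairs gives everybody \<open>m\<close> points up to the
  swaps. Rival \<open>i\<close> gains \<open>1 - d i\<close> by them at the expense of
  \<open>m\<close>; as the \<open>d i\<close> sum to 0, the preferred candidate loses
  \<open>m\<close> in total.\<close>

lemma score_fixed_votes:
  assumes m: "m \<ge> 3" and U: "\<And>i. i < m \<Longrightarrow> up i \<le> U \<and> dn i \<le> U \<and> (up i = 0 \<or> dn i = 0)"
    and d: "\<And>i. i < m \<Longrightarrow> int (up i) - int (dn i) = 1 - d i" "(\<Sum>i<m. d i) = 0"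
  shows "c < m \<Longrightarrow> int (borda_score {..<Suc m} (fixed_votes m U up dn) c) = int (m * (m * U)) + 1 - d c"
    and "int (borda_score {..<Suc m} (fixed_votes m U up dn) m) = int (m * (m * U)) - int m"
proof -
  have pair: "int (points {..<Suc m} (vote1 m i (u < dn i)) c) + int (points {..<Suc m} (vote2 m i (u < up i)) c) =
      int m + (if c = i then of_bool (u < up i) - of_bool (u < dn i)
        else if c = m then of_bool (u < dn i) - of_bool (u < up i) else 0)"
    if "i < m" "c \<le> m" for i c u
    by (rule pair_points) (use m that U[OF that(1)] in auto)
  have inner: "(\<Sum>u<U. int m + (if c = i then of_bool (u < up i) - of_bool (u < dn i)
        else if c = m then of_bool (u < dn i) - of_bool (u < up i) else 0)) =
      int (m * U) + (if c = i then 1 - d i else if c = m then d i - 1 else 0)"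
    if "i < m" for i c
    using U[OF that] d(1)[OF that] by (simp add: sum.distrib sum_subtractf card_lessThan_Int)
  have score: "int (borda_score {..<Suc m} (fixed_votes m U up dn) c) =
      (\<Sum>i<m. int (m * U) + (if c = i then 1 - d i else if c = m then d i - 1 else 0))" if "c \<le> m" for c
  proof -
    have "int (borda_score {..<Suc m} (fixed_votes m U up dn) c) =
      (\<Sum>i<m. \<Sum>u<U. int (points {..<Suc m} (vote1 m i (u < dn i)) c) + int (points {..<Suc m} (vote2 m i (u < up i)) c))"
      by (simp add: borda_score_points fixed_votes_def sum_list_concat_upt)
    also have "\<dots> = (\<Sum>i<m. int (m * U) + (if c = i then 1 - d i else if c = m then d i - 1 else 0))"
      using pair[OF _ that] inner by (intro sum.cong) (auto simp del: of_nat_mult)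
    finally show ?thesis .
  qed
  show "int (borda_score {..<Suc m} (fixed_votes m U up dn) c) = int (m * (m * U)) + 1 - d c" if "c < m"
  proof -
    have "(\<Sum>i<m. int (m * U) + (if c = i then 1 - d i else if c = m then d i - 1 else 0)) =
        (\<Sum>i<m. int (m * U) + (if c = i then 1 - d i else 0))"
      using that by (intro sum.cong) auto
    then show ?thesis using score[of c] that by (simp add: sum.distrib)
  qed
  have "(\<Sum>i<m. int (m * U) + (if m = i then 1 - d i else if m = m then d i - 1 else 0)) =
      (\<Sum>i<m. int (m * U) + (d i - 1))"
    by (intro sum.cong) auto
  also have "\<dots> = int (m * (m * U)) - int m" using d(2) by (simp add: sum.distrib sum_subtractf)
  finally show "int (borda_score {..<Suc m} (fixed_votes m U up dn) m) = int (m * (m * U)) - int m"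
    using score[of m] by simp
qed

lemma borda_score_append: "borda_score C (V @ W) c = borda_score C V c + borda_score C W c"
  by (simp add: borda_score_def)

text \<open>The average score is \<open>(m * U + 1) * m\<close>, and the preferred candidate is
  \<open>2 * m\<close> below it. Both bribes must raise it from 0 to \<open>m\<close> points, which
  leaves it exactly at the average, so everybody ties. The two new votes then give rival
  \<open>c\<close> exactly \<open>m - 1 + d c\<close> points together.\<close>

theorem borda_bribable_iff_displacements:
  assumes m: "m \<ge> 3" and U: "\<And>i. i < m \<Longrightarrow> up i \<le> U \<and> dn i \<le> U \<and> (up i = 0 \<or> dn i = 0)"
    and d: "\<And>i. i < m \<Longrightarrow> int (up i) - int (dn i) = 1 - d i" "(\<Sum>i<m. d i) = 0"
  shows "borda_bribable {..<Suc m} (all_votes m U up dn) 2 m \<longleftrightarrow>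
    (\<exists>p q. bij_betw p {..<m} {..<m} \<and> bij_betw q {..<m} {..<m} \<and> (\<forall>i<m. int (q i) = int (p i) + d i))"
    (is "?L \<longleftrightarrow> ?R")
proof -
  let ?C = "{..<Suc m}"
  let ?P = "permutations_of_set ?C"
  let ?F = "fixed_votes m U up dn"
  let ?V = "all_votes m U up dn"
  have V: "?V \<noteq> []" "set ?V \<subseteq> ?P" using all_votes_perm[OF m] by (auto simp: all_votes_def)
  have lenV: "length ?V = 2 * m * U + 2" by (simp add: all_votes_def length_fixed_votes)
  have perm_last: "[0..<Suc m] \<in> ?P" using V(2) by (auto simp: all_votes_def)
  have last: "points ?C [0..<Suc m] m = 0"
    using vote_rank_nth[of "[0..<Suc m]" m] nth_upt[of 0 m "Suc m"] by (simp add: points_def del: upt_Suc)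
  have bs_last: "borda_score ?C [[0..<Suc m], [0..<Suc m]] m = 0" by (simp add: borda_score_points last del: upt_Suc)
  have score_c: "int (borda_score ?C ?F c) = int (m * (m * U)) + 1 - d c" if "c < m" for c
    by (rule score_fixed_votes(1)[where d = d]) (fact m, erule U, erule d(1), fact d(2), fact that)
  have score_p: "int (borda_score ?C ?F m) = int (m * (m * U)) - int m"
    by (rule score_fixed_votes(2)[where d = d]) (fact m, erule U, erule d(1), fact d(2))
  have ptsm: "points ?C w c \<le> m" if "w \<in> ?P" "c \<in> ?C" for w c using points_less[OF that] by simp
  show ?thesis
  proof
    assume ?L
    then obtain W where W: "W \<in> bribed ?P 2 ?V" "m \<in> borda_winners ?C W"
      unfolding borda_bribable_def by blast
    obtain a b w1 w2 where ab: "a < length ?V" "b < length ?V" "w1 \<in> ?P" "w2 \<in> ?P"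
      "W = ?V[a := w1, b := w2]" using W(1) unfolding bribed_two[OF V] by blast
    have setW: "set W \<subseteq> ?P" unfolding ab(5) by (intro set_update_subsetI V ab)
    have lenW: "length W = 2 * m * U + 2" using ab lenV by simp
    have win: "borda_score ?C W c \<le> borda_score ?C W m" if "c \<in> ?C" for c
      using W(2) that by (simp add: borda_winners_def)
    have total: "2 * (\<Sum>c\<in>?C. borda_score ?C W c) = (2 * m * U + 2) * (Suc m * m)"
      using sum_borda_score[OF setW] lenW by simp
    have "(\<Sum>c\<in>?C. borda_score ?C W c) \<le> (\<Sum>c\<in>?C. borda_score ?C W m)"
      by (intro sum_mono win)
    then have "2 * Suc m * ((m * U + 1) * m) \<le> 2 * Suc m * borda_score ?C W m"
      using total by (simp add: algebra_simps)
    then have low: "(m * U + 1) * m \<le> borda_score ?C W m" by (subst (asm) mult_le_cancel1) simp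
    have scoreV: "int (borda_score ?C ?V m) = int (m * (m * U)) - int m"
      using score_p bs_last by (simp add: all_votes_def borda_score_append)
    let ?V1 = "?V[a := w1]"
    have up1: "int (borda_score ?C ?V1 m) = int (borda_score ?C ?V m) + int (points ?C w1 m) - int (points ?C (?V ! a) m)"
      using borda_score_update[of a ?V ?C w1 m] ab(1) by simp
    have up2: "int (borda_score ?C W m) = int (borda_score ?C ?V1 m) + int (points ?C w2 m) - int (points ?C (?V1 ! b) m)"
      using borda_score_update[of b ?V1 ?C w2 m] ab by simp
    have p12: "points ?C w1 m \<le> m" "points ?C w2 m \<le> m" using ptsm ab by auto
    have low': "int (m * (m * U)) + int m \<le> int (borda_score ?C W m)"
      using low by (simp add: algebra_simps flip: of_nat_mult of_nat_add)
    \<comment> \<open>A single voter gains at most \<open>m\<close> points for the preferred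
      candidate, but \<open>2 * m\<close> are missing.\<close>
    have "a \<noteq> b"
    proof
      assume "a = b"
      then have "points ?C (?V1 ! b) m = points ?C w1 m" using ab by simp
      then show False using up1 up2 scoreV low' p12 m by linarith
    qed
    then have Vb: "?V1 ! b = ?V ! b" by simp
    \<comment> \<open>The gap is closed only if both bribes gain the full \<open>m\<close> points,
      so both bribed votes gave none before.\<close>
    have z: "points ?C (?V ! a) m = 0" "points ?C (?V ! b) m = 0"
      using up1 up2 scoreV low' p12 Vb by auto
    have nonfixed: "length ?F \<le> j" if j: "j < length ?V" "points ?C (?V ! j) m = 0" for j
    proof (rule ccontr)
      assume "\<not> length ?F \<le> j"
      then have "?V ! j \<in> set ?F" by (simp add: all_votes_def nth_append)
      then have "0 < points ?C (?V ! j) m"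
        unfolding fixed_votes_def by (auto intro: points_preferred_pos[OF m])
      then show False using j(2) by simp
    qed
    have "length ?F \<le> a" "length ?F \<le> b" using nonfixed ab z by auto
    then have "(a = length ?F \<and> b = Suc (length ?F)) \<or> (b = length ?F \<and> a = Suc (length ?F))"
      using \<open>a \<noteq> b\<close> ab(1,2) by (auto simp: all_votes_def)
    then have "\<exists>w w'. w \<in> ?P \<and> w' \<in> ?P \<and> W = ?F @ [w, w']"
      using ab by (auto simp: all_votes_def list_update_append)
    then obtain w w' where w: "w \<in> ?P" "w' \<in> ?P" "W = ?F @ [w, w']" by blast
    have scoreW: "borda_score ?C W c = borda_score ?C ?F c + points ?C w c + points ?C w' c" for c
      by (simp add: w(3) borda_score_append borda_score_points)
    have wm: "points ?C w m = m" "points ?C w' m = m"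
      using scoreW[of m] score_p low' ptsm[OF w(1), of m] ptsm[OF w(2), of m] by auto
    have scoreWm: "borda_score ?C W m = (m * U + 1) * m"
    proof -
      have "int (borda_score ?C W m) = int ((m * U + 1) * m)"
        using scoreW[of m] score_p wm by (simp add: algebra_simps)
      then show ?thesis by linarith
    qed
    \<comment> \<open>The winner has exactly the average score, and nonnegative deficits with sum 0
      all vanish.\<close>
    have sumeq: "(\<Sum>c\<in>?C. borda_score ?C W m - borda_score ?C W c) = 0"
    proof -
      have "(\<Sum>c\<in>?C. borda_score ?C W m - borda_score ?C W c) =
          (\<Sum>c\<in>?C. borda_score ?C W m) - (\<Sum>c\<in>?C. borda_score ?C W c)"
        by (rule sum_subtractf_nat) (use win in auto)
      also have "(\<Sum>c\<in>?C. borda_score ?C W m) = (\<Sum>c\<in>?C. borda_score ?C W c)"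
        using total scoreWm by (simp add: algebra_simps)
      finally show ?thesis by simp
    qed
    then have "\<forall>c\<in>?C. borda_score ?C W m - borda_score ?C W c = 0"
      by (simp only: sum_eq_0_iff finite_lessThan)
    then have alleq: "borda_score ?C W c = borda_score ?C W m" if "c \<in> ?C" for c
      using that win[OF that] by (metis diff_is_0_eq le_antisym)
    have eq: "int (points ?C w c) + int (points ?C w' c) = int m - 1 + d c" if "c < m" for c
    proof -
      have "int (borda_score ?C ?F c) + int (points ?C w c) + int (points ?C w' c) = int ((m * U + 1) * m)"
        using alleq[of c] scoreWm scoreW[of c] that by (simp flip: of_nat_add of_nat_mult)
      then show ?thesis using score_c[OF that] by (simp add: algebra_simps)
    qed
    have bij: "bij_betw (points ?C v) {..<m} {..<m}" if "v \<in> ?P" "points ?C v m = m" for v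
    proof -
      have "bij_betw (points ?C v) (?C - {m}) ({..<card ?C} - {m})"
        using bij_betw_DiffI[OF points_bij[OF that(1)], of "{m}" "{m}"] that(2) by (simp add: bij_betw_def)
      moreover have "?C - {m} = {..<m}" by auto
      ultimately show ?thesis by simp
    qed
    \<comment> \<open>Reversing the first new vote on the rivals turns the prescribed sum
      \<open>m - 1 + d c\<close> into the prescribed difference \<open>d c\<close>.\<close>
    have rev: "bij_betw (\<lambda>i. m - 1 - i) {..<m} {..<m}"
      by (rule bij_betw_byWitness[where f' = "\<lambda>i. m - 1 - i"]) auto
    have "bij_betw (\<lambda>c. m - 1 - points ?C w c) {..<m} {..<m}"
      using bij_betw_trans[OF bij[OF w(1) wm(1)] rev] by (simp add: o_def)
    moreover have "int (points ?C w' c) = int (m - 1 - points ?C w c) + d c" if "c < m" for c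
    proof -
      have "points ?C w c < m" using bij[OF w(1) wm(1)] that by (auto simp: bij_betw_def)
      then show ?thesis using eq[OF that] by (simp add: of_nat_diff)
    qed
    ultimately show ?R using bij[OF w(2) wm(2)] by (intro exI[of _ "\<lambda>c. m - 1 - points ?C w c"] exI[of _ "points ?C w'"]) auto
  next
    assume ?R
    then obtain p q where p: "bij_betw p {..<m} {..<m}" and q: "bij_betw q {..<m} {..<m}"
      and pq: "\<And>i. i < m \<Longrightarrow> int (q i) = int (p i) + d i" by blast
    \<comment> \<open>The preferred candidate takes the top position, which leaves exactly the point
      values below \<open>m\<close> for the rivals.\<close>
    have ex: "\<exists>w\<in>?P. points ?C w m = m \<and> (\<forall>c<m. points ?C w c = f c)"
      if f: "bij_betw f {..<m} {..<m}" for f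
    proof -
      have C: "?C = insert m {..<m}" by auto
      have "bij_betw (f(m := m)) ?C ?C"
        unfolding C using f by (intro bij_betw_combine[of _ "{..<m}" "{..<m}" "{m}" "{m}", simplified])
          (auto simp: bij_betw_def inj_on_def)
      moreover have "bij_betw (\<lambda>i. m - i) ?C ?C"
        by (rule bij_betw_byWitness[where f' = "\<lambda>i. m - i"]) auto
      ultimately have b: "bij_betw (\<lambda>c. m - (f(m := m)) c) ?C {..<card ?C}"
        using bij_betw_trans[of "f(m := m)" ?C ?C "\<lambda>i. m - i" ?C] by (simp add: o_def)
      obtain w where w: "w \<in> ?P" "\<And>c. c \<in> ?C \<Longrightarrow> vote_rank w c = Suc (m - (f(m := m)) c)"
        using vote_of_ranks[OF b] by blast
      have "f c < m" if "c < m" for c using f that by (auto simp: bij_betw_def)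
      then have "points ?C w c = f c" if "c < m" for c
        using w(2)[of c] that by (simp add: points_def less_imp_le)
      moreover have "points ?C w m = m" using w(2)[of m] by (simp add: points_def)
      ultimately show ?thesis using w(1) by blast
    qed
    have rev: "bij_betw (\<lambda>i. m - 1 - i) {..<m} {..<m}"
      by (rule bij_betw_byWitness[where f' = "\<lambda>i. m - 1 - i"]) auto
    have p': "bij_betw (\<lambda>c. m - 1 - p c) {..<m} {..<m}"
      using bij_betw_trans[OF p rev] by (simp add: o_def)
    obtain w where w: "w \<in> ?P" "points ?C w m = m" "\<And>c. c < m \<Longrightarrow> points ?C w c = m - 1 - p c"
      using ex[OF p'] by blast
    obtain w' where w': "w' \<in> ?P" "points ?C w' m = m" "\<And>c. c < m \<Longrightarrow> points ?C w' c = q c"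
      using ex[OF q] by blast
    let ?W = "?F @ [w, w']"
    have "?W = ?V[length ?F := w, Suc (length ?F) := w']" by (simp add: all_votes_def list_update_append)
    then have "?W \<in> bribed ?P 2 ?V"
      unfolding bribed_two[OF V] using w(1) w'(1)
      by (intro exI[of _ "length ?F"] exI[of _ "Suc (length ?F)"] conjI bexI[of _ w] bexI[of _ w'])
        (auto simp: all_votes_def)
    moreover have "m \<in> borda_winners ?C ?W"
    proof -
    have sc: "int (borda_score ?C ?W c) = int (m * (m * U)) + int m" if "c \<le> m" for c
    proof (cases "c = m")
      case True
      then show ?thesis using score_p w(2) w'(2) by (simp add: borda_score_append borda_score_points)
    next
      case False
      then have c: "c < m" using that by simp
      have "p c < m" using p c by (auto simp: bij_betw_def)
      then show ?thesis
        using score_c[OF c] w(3)[OF c] w'(3)[OF c] pq[OF c]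
        by (simp add: borda_score_append borda_score_points of_nat_diff)
    qed
    have "borda_score ?C ?W c \<le> borda_score ?C ?W m" if "c \<le> m" for c
      using sc[OF that] sc[of m] by linarith
    then show ?thesis unfolding borda_winners_def by (simp add: less_Suc_eq_le)
    qed
    ultimately show ?L unfolding borda_bribable_def by blast
  qed
qed


section \<open>From exact packing to displacements\<close>

definition packable :: "nat \<Rightarrow> nat \<Rightarrow> nat \<Rightarrow> (nat \<Rightarrow> nat) \<Rightarrow> bool" where
  "packable N n B w \<longleftrightarrow> (\<exists>f. (\<forall>i<N. f i < n) \<and> (\<forall>b<n. (\<Sum>i\<in>{i. i < N \<and> f i = b}. w i) = B))"

text \<open>Indices below \<open>N\<close> are the items and the next \<open>n\<close> are the jumps
  back, one for each bin. All further indices keep their place and fill what is left of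
  \<open>n\<close> residue classes with \<open>B + 1\<close> levels each.\<close>

definition displ :: "nat \<Rightarrow> nat \<Rightarrow> nat \<Rightarrow> (nat \<Rightarrow> nat) \<Rightarrow> nat \<Rightarrow> int" where
  "displ N n B w i = (if i < N then int (n * w i) else if i < N + n then - int (n * B) else 0)"

lemma bij_betw_fibre: "bij_betw p A B \<Longrightarrow> bij_betw p {i \<in> A. P (p i)} {x \<in> B. P x}"
  by (auto simp: bij_betw_def inj_on_def image_def)

lemma mult_add_eq_iff: "b < n \<Longrightarrow> b' < n \<Longrightarrow> n * a + b = n * a' + b' \<longleftrightarrow> a = a' \<and> b = b'" for n :: nat
  by (metis add.commute div_mult_self2 div_less add_0 mod_less mod_mult_self2 less_nat_zero_code)

lemma packing_size:
  fixes w :: "nat \<Rightarrow> nat"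
  assumes "\<And>i. i < N \<Longrightarrow> 0 < w i" "(\<Sum>i<N. w i) = n * B"
  shows "N + n \<le> n * (B + 1)"
proof -
  have "(\<Sum>i<N. 1 :: nat) \<le> (\<Sum>i<N. w i)" using assms(1) by (intro sum_mono) (simp add: Suc_leI)
  then show ?thesis using assms(2) by simp
qed

text \<open>All displacements are multiples of \<open>n\<close>, so the positions of each residue class modulo \<open>n\<close> are
  permuted and the displacements starting there cancel. The jumps back by \<open>n * B\<close> start at the last
  \<open>n\<close> positions, one in each residue class.\<close>

lemma packable_if_displacements:
  assumes n: "n > 0" and w: "\<And>i. i < N \<Longrightarrow> 0 < w i" "(\<Sum>i<N. w i) = n * B"
    and p: "bij_betw p {..<n * (B + 1)} {..<n * (B + 1)}"
    and q: "bij_betw q {..<n * (B + 1)} {..<n * (B + 1)}"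
    and pq: "\<And>i. i < n * (B + 1) \<Longrightarrow> int (q i) = int (p i) + displ N n B w i"
  shows "packable N n B w"
proof -
  let ?M = "n * (B + 1)"
  have NM: "N + n \<le> ?M" by (rule packing_size[OF w])
  define R where "R \<rho> = {i \<in> {..<?M}. p i mod n = \<rho>}" for \<rho>
  have qp: "q i = p i + n * w i" if "i < N" for i
    using pq[of i] that NM by (simp add: displ_def flip: of_nat_mult of_nat_add)
  have pb: "p i = q i + n * B" if "N \<le> i" "i < N + n" for i
  proof -
    have "int (p i) = int (q i + n * B)" using pq[of i] that NM by (simp add: displ_def)
    then show ?thesis by linarith
  qed
  have p0: "q i = p i" if "N + n \<le> i" "i < ?M" for i
    using pq[of i] that by (simp add: displ_def)
  have mods: "q i mod n = p i mod n" if i: "i < ?M" for i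
  proof -
    consider "q i = p i + n * w i" | "p i = q i + n * B" | "q i = p i"
      using qp[of i] pb[of i] p0[of i] i by (meson leI)
    then show ?thesis
    proof cases
      case 1
      show ?thesis unfolding 1 by simp
    next
      case 2
      show ?thesis unfolding 2 by simp
    qed simp
  qed
  have R_q: "R \<rho> = {i \<in> {..<?M}. q i mod n = \<rho>}" for \<rho>
    unfolding R_def using mods by auto
  \<comment> \<open>Both \<open>p\<close> and \<open>q\<close> map \<open>R \<rho>\<close> onto all
    positions of this residue class, so the sums of their values agree.\<close>
  have zero: "(\<Sum>i\<in>R \<rho>. displ N n B w i) = 0" for \<rho>
  proof -
    have "(\<Sum>i\<in>R \<rho>. int (p i)) = (\<Sum>x\<in>{x \<in> {..<?M}. x mod n = \<rho>}. int x)"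
      unfolding R_def by (rule sum.reindex_bij_betw[OF bij_betw_fibre[OF p, of "\<lambda>x. x mod n = \<rho>"]])
    moreover have "(\<Sum>i\<in>R \<rho>. int (q i)) = (\<Sum>x\<in>{x \<in> {..<?M}. x mod n = \<rho>}. int x)"
      unfolding R_q by (rule sum.reindex_bij_betw[OF bij_betw_fibre[OF q, of "\<lambda>x. x mod n = \<rho>"]])
    moreover have "(\<Sum>i\<in>R \<rho>. int (q i)) = (\<Sum>i\<in>R \<rho>. int (p i)) + (\<Sum>i\<in>R \<rho>. displ N n B w i)"
      unfolding sum.distrib[symmetric] by (rule sum.cong) (auto simp: R_def pq)
    ultimately show ?thesis by simp
  qed
  \<comment> \<open>Positions lie below \<open>n * (B + 1)\<close>, so a jump back by
    \<open>n * B\<close> ends among the first \<open>n\<close> positions. There are \<open>n\<close>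
    such jumps, so they fill these positions, and every residue class has exactly one of
    them.\<close>
  have qn: "q i < n" if "N \<le> i" "i < N + n" for i
  proof -
    have "p i < ?M" using p that NM by (auto simp: bij_betw_def)
    then show ?thesis using pb[OF that] by simp
  qed
  have "inj_on q {N..<N + n}"
    using q NM by (auto simp: bij_betw_def intro: inj_on_subset)
  moreover have "q ` {N..<N + n} \<subseteq> {..<n}" using qn by auto
  ultimately have qbij: "q ` {N..<N + n} = {..<n}" "inj_on q {N..<N + n}"
    using card_subset_eq[of "{..<n}" "q ` {N..<N + n}"] by (simp_all add: card_image)
  have main: "(\<Sum>i\<in>{i. i < N \<and> p i mod n = b}. w i) = B" if b: "b < n" for b
  proof -
    obtain i0 where i0: "N \<le> i0" "i0 < N + n" "q i0 = b"
    proof -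
      have "b \<in> q ` {N..<N + n}" using qbij(1) b by simp
      then show thesis using that by auto
    qed
    have "{i \<in> R b. N \<le> i \<and> i < N + n} = {i0}"
    proof -
      have "i = i0" if "N \<le> i" "i < N + n" "i \<in> R b" for i
      proof -
        have "q i mod n = b" using that(3) unfolding R_q by simp
        then have "q i = q i0" using i0(3) qn[OF that(1,2)] by simp
        then show ?thesis using qbij(2) that(1,2) i0(1,2) by (simp add: inj_on_def)
      qed
      moreover have "i0 \<in> R b" using i0 NM b by (simp add: R_q)
      ultimately show ?thesis using i0(1,2) by blast
    qed
    then have R_eq: "R b = {i. i < N \<and> p i mod n = b} \<union> ({i0} \<union> {i \<in> R b. N + n \<le> i})" (is "_ = ?A \<union> (_ \<union> ?C)")
    proof -
      have "i \<in> R b \<longleftrightarrow> i < N \<and> p i mod n = b \<or> (i \<in> R b \<and> N \<le> i \<and> i < N + n) \<or> (i \<in> R b \<and> N + n \<le> i)" for i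
        using NM unfolding R_def by (cases "i < N"; cases "i < N + n"; simp)
      with \<open>{i \<in> R b. N \<le> i \<and> i < N + n} = {i0}\<close> show ?thesis by blast
    qed
    have fin: "finite ?A" "finite ?C" by (auto simp: R_def)
    have "(\<Sum>i\<in>R b. displ N n B w i) = (\<Sum>i\<in>?A. displ N n B w i) + (displ N n B w i0 + (\<Sum>i\<in>?C. displ N n B w i))"
      using i0 fin by (subst R_eq, subst sum.union_disjoint) (auto simp: sum.union_disjoint)
    also have "(\<Sum>i\<in>?A. displ N n B w i) = (\<Sum>i\<in>?A. int n * int (w i))"
      by (intro sum.cong) (auto simp: displ_def)
    also have "\<dots> = int n * int (\<Sum>i\<in>?A. w i)" by (simp add: sum_distrib_left)
    also have "(\<Sum>i\<in>?C. displ N n B w i) = 0" by (intro sum.neutral) (auto simp: displ_def)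
    finally have "int n * int (\<Sum>i\<in>?A. w i) = int n * int B"
      using zero[of b] i0 by (simp add: displ_def)
    then have "int (\<Sum>i\<in>?A. w i) = int B" using n by (simp del: of_nat_sum)
    then show ?thesis by (simp only: of_nat_eq_iff)
  qed
  show ?thesis unfolding packable_def
    by (intro exI[of _ "\<lambda>i. p i mod n"]) (use n main in auto)
qed

text \<open>A position is \<open>n\<close> times a level plus a residue. The items of bin
  \<open>b\<close> are stacked in residue class \<open>b\<close> in the order of their indices: item
  \<open>i\<close> leads from level \<open>pre i\<close> to \<open>pre i + w i\<close>, and the jump
  back leads from \<open>B\<close> to 0. These tours are closed, so starts and ends form the same
  set of positions, and the other indices can be placed arbitrarily with displacement 0.\<close>

lemma displacements_if_packable:
  assumes n: "n > 0" and w: "\<And>i. i < N \<Longrightarrow> 0 < w i" "(\<Sum>i<N. w i) = n * B"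
    and pack: "packable N n B w"
  shows "\<exists>p q. bij_betw p {..<n * (B + 1)} {..<n * (B + 1)} \<and> bij_betw q {..<n * (B + 1)} {..<n * (B + 1)} \<and>
    (\<forall>i<n * (B + 1). int (q i) = int (p i) + displ N n B w i)"
proof -
  let ?M = "n * (B + 1)"
  have NM: "N + n \<le> ?M" by (rule packing_size[OF w])
  obtain f where f: "\<And>i. i < N \<Longrightarrow> f i < n" "\<And>b. b < n \<Longrightarrow> (\<Sum>i\<in>{i. i < N \<and> f i = b}. w i) = B"
    using pack unfolding packable_def by blast
  define pre where "pre i = (\<Sum>j\<in>{j. j < i \<and> f j = f i}. w j)" for i
  have pre_Suc: "pre i + w i = (\<Sum>j\<in>{j. j \<le> i \<and> f j = f i}. w j)" for i
  proof -
    have "{j. j \<le> i \<and> f j = f i} = insert i {j. j < i \<and> f j = f i}" by auto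
    then show ?thesis by (simp add: pre_def)
  qed
  have pre_next: "pre i + w i \<le> pre i'" if "i < i'" "f i = f i'" for i i'
    unfolding pre_Suc unfolding pre_def using that by (intro sum_mono2) auto
  have pre_B: "pre i + w i \<le> B" if "i < N" for i
  proof -
    have "pre i + w i \<le> (\<Sum>j\<in>{j. j < N \<and> f j = f i}. w j)"
      unfolding pre_Suc using that by (intro sum_mono2) auto
    then show ?thesis using f that by simp
  qed
  define lp where "lp i = (if i < N then pre i else B)" for i
  define lq where "lq i = (if i < N then pre i + w i else 0)" for i
  define rs where "rs i = (if i < N then f i else i - N)" for i
  have rs: "rs i < n" if "i < N + n" for i using f(1)[of i] that by (auto simp: rs_def)
  let ?p = "\<lambda>i. n * lp i + rs i" and ?q = "\<lambda>i. n * lq i + rs i"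
  have lp_B: "lp i \<le> B" "lq i \<le> B" for i using pre_B[of i] by (auto simp: lp_def lq_def)
  have key: "i = i'" if "i < N + n" "i' < N + n" "rs i = rs i'" "lp i = lp i' \<or> lq i = lq i'" "i \<le> i'" for i i'
  proof (cases "i' < N")
    case True
    then show ?thesis
      using that pre_next[of i i'] w(1)[of i] w(1)[of i'] by (cases "i = i'") (auto simp: lp_def lq_def rs_def)
  next
    case False
    then show ?thesis
      using that pre_B[of i] w(1)[of i] by (cases "i < N") (auto simp: lp_def lq_def rs_def)
  qed
  have inj: "inj_on ?p {..<N + n}" "inj_on ?q {..<N + n}"
    by (rule inj_onI, metis lessThan_iff mult_add_eq_iff[OF rs rs] key nle_le)+
  have lt: "n * l + r < ?M" if "l \<le> B" "r < n" for l r
  proof -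
    have "n * l + r < n * l + n" using that by simp
    also have "\<dots> = n * (l + 1)" by simp
    also have "\<dots> \<le> ?M" using that(1) by (intro mult_le_mono2) simp
    finally show ?thesis .
  qed
  \<comment> \<open>An item ends where the next item of its bin starts, and the last one ends at
    level \<open>B\<close>, where the jump back starts; that jump ends where the first item
    starts.\<close>
  have sub: "\<exists>i'<N + n. rs i' = rs i \<and> lp i' = lq i" if i: "i < N + n" for i
  proof (cases "i < N")
    case True
    let ?F = "{j. j < N \<and> f j = f i \<and> i < j}"
    show ?thesis
    proof (cases "?F = {}")
      case True
      then have "{j. j \<le> i \<and> f j = f i} = {j. j < N \<and> f j = f i}" using \<open>i < N\<close> by (auto simp: not_less)
      then have "pre i + w i = B" unfolding pre_Suc using f \<open>i < N\<close> by simp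
      then show ?thesis using \<open>i < N\<close> f(1)[of i] by (intro exI[of _ "N + f i"]) (auto simp: rs_def lp_def lq_def)
    next
      case False
      define i' where "i' = Min ?F"
      have i': "i' < N" "f i' = f i" "i < i'" using Min_in[of ?F] False by (auto simp: i'_def)
      have "{j. j < i' \<and> f j = f i'} = {j. j \<le> i \<and> f j = f i}"
      proof -
        have "j \<le> i" if "j < i'" "f j = f i" for j
        proof (rule ccontr)
          assume "\<not> j \<le> i"
          then have "j \<in> ?F" using that i' by auto
          then have "i' \<le> j" unfolding i'_def by (intro Min_le) auto
          then show False using that by simp
        qed
        then show ?thesis using i' by auto
      qed
      then have "pre i' = pre i + w i" unfolding pre_Suc by (simp add: pre_def)
      then show ?thesis using i' \<open>i < N\<close> by (intro exI[of _ i']) (auto simp: rs_def lp_def lq_def)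
    qed
  next
    case False
    let ?F = "{j. j < N \<and> f j = i - N}"
    have b: "i - N < n" using i False by auto
    show ?thesis
    proof (cases "?F = {}")
      case True
      \<comment> \<open>An empty bin forces \<open>B = 0\<close>, and then the jump back starts and
        ends at level 0.\<close>
      have "B = 0" using f(2)[OF b] unfolding True by simp
      then show ?thesis using i False by (intro exI[of _ i]) (auto simp: lp_def lq_def)
    next
      case F: False
      define i' where "i' = Min ?F"
      have i': "i' < N" "f i' = i - N" using Min_in[of ?F] F by (auto simp: i'_def)
      have "{j. j < i' \<and> f j = f i'} = {}"
      proof -
        have False if "j < i'" "f j = f i'" for j
        proof -
          have "i' \<le> j" unfolding i'_def using that i' by (intro Min_le) auto
          then show False using that by simp
        qed
        then show ?thesis by auto
      qed
      then have "pre i' = 0" by (simp only: pre_def sum.empty)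
      then show ?thesis using i' False by (intro exI[of _ i']) (auto simp: rs_def lp_def lq_def)
    qed
  qed
  have "?q ` {..<N + n} \<subseteq> ?p ` {..<N + n}"
  proof
    fix y assume "y \<in> ?q ` {..<N + n}"
    then obtain i where "i < N + n" "y = ?q i" by auto
    then show "y \<in> ?p ` {..<N + n}" using sub[of i] by (metis (no_types, lifting) image_eqI lessThan_iff)
  qed
  then have img: "?q ` {..<N + n} = ?p ` {..<N + n}"
    by (intro card_subset_eq) (auto simp: card_image inj)
  let ?I = "?p ` {..<N + n}"
  have I: "?I \<subseteq> {..<?M}" using lt lp_B rs by auto
  \<comment> \<open>The remaining indices are sent to the remaining positions by the same bijection
    \<open>g\<close> in both permutations.\<close>
  have "card ({..<?M} - ?I) = card ({..<?M} - {..<N + n})"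
    using I NM by (subst (1 2) card_Diff_subset) (auto simp: card_image inj)
  then obtain g where g: "bij_betw g ({..<?M} - {..<N + n}) ({..<?M} - ?I)"
    by (metis finite_Diff finite_lessThan finite_same_card_bij)
  have ext: "bij_betw (\<lambda>i. if i \<in> {..<N + n} then h i else g i) {..<?M} {..<?M}"
    if "inj_on h {..<N + n}" "h ` {..<N + n} = ?I" for h
  proof -
    have "bij_betw (\<lambda>i. if i \<in> {..<N + n} then h i else g i) ({..<N + n} \<union> ({..<?M} - {..<N + n})) (?I \<union> ({..<?M} - ?I))"
      by (rule bij_betw_disjoint_Un) (use that g in \<open>auto simp: bij_betw_def\<close>)
    moreover have "{..<N + n} \<union> ({..<?M} - {..<N + n}) = {..<?M}" "?I \<union> ({..<?M} - ?I) = {..<?M}"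
      using NM I by auto
    ultimately show ?thesis by simp
  qed
  have "int (if i \<in> {..<N + n} then ?q i else g i) =
      int (if i \<in> {..<N + n} then ?p i else g i) + displ N n B w i" if "i < ?M" for i
    using that by (auto simp: displ_def lp_def lq_def rs_def algebra_simps)
  with ext[OF inj(1) refl] ext[OF inj(2) img] show ?thesis by blast
qed

lemma sum_displ:
  assumes "\<And>i. i < N \<Longrightarrow> 0 < w i" "(\<Sum>i<N. w i) = n * B"
  shows "(\<Sum>i<n * (B + 1). displ N n B w i) = 0"
proof -
  have NM: "N + n \<le> n * (B + 1)" by (rule packing_size[OF assms])
  have split: "(\<Sum>i<N + k. g i) = (\<Sum>i<N. g i) + (\<Sum>i<k. g (N + i))" for k and g :: "nat \<Rightarrow> int"
    by (induction k) auto
  have "(\<Sum>i<n * (B + 1). displ N n B w i) = (\<Sum>i<N + n. displ N n B w i)"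
    by (rule sum.mono_neutral_right) (use NM in \<open>auto simp: displ_def\<close>)
  also have "\<dots> = (\<Sum>i<N. displ N n B w i) + (\<Sum>i<n. displ N n B w (N + i))"
    by (rule split)
  also have "(\<Sum>i<N. displ N n B w i) = int n * int (\<Sum>i<N. w i)"
    by (simp add: displ_def sum_distrib_left)
  also have "(\<Sum>i<n. displ N n B w (N + i)) = - int n * int (n * B)"
    by (simp add: displ_def)
  finally show ?thesis using assms(2) by (simp add: algebra_simps)
qed


section \<open>From prescribed class counts to exact packing\<close>

text \<open>\<open>e d t\<close> is the class of the index \<open>t\<close> in partition \<open>d\<close>.\<close>

definition feasible :: "nat \<Rightarrow> nat \<Rightarrow> (nat \<Rightarrow> nat \<Rightarrow> nat) \<Rightarrow> (nat \<Rightarrow> nat \<Rightarrow> nat) \<Rightarrow> bool" where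
  "feasible \<tau> E e r \<longleftrightarrow> (\<exists>S\<subseteq>{..<\<tau>}. \<forall>d\<in>{1, 2, 3}. \<forall>c<E. card {t \<in> S. e d t = c} = r d c)"

text \<open>In every class of partition \<open>d\<close>, the first \<open>r d\<close> members get an item marked as chosen, the others
  an item marked as not chosen. Bin \<open>t\<close> is labelled by item \<open>4 * t\<close> and has to receive
  one item of the class of \<open>t\<close> for each partition, all with the same mark. The digits of a weight in
  base \<open>radix E\<close> express this; the leading digit limits a bin to four items, so that nothing is carried.\<close>

definition mark :: "(nat \<Rightarrow> nat \<Rightarrow> nat) \<Rightarrow> (nat \<Rightarrow> nat \<Rightarrow> nat) \<Rightarrow> nat \<Rightarrow> nat \<Rightarrow> bool" where
  "mark e r d t \<longleftrightarrow> card {t'. t' < t \<and> e d t' = e d t} < r d (e d t)"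

text \<open>Four items belong to each index: \<open>i mod 4\<close> is 0 for the label of a bin and
  \<open>d\<close> for partition \<open>d\<close>. For truth values,
  \<open>a 1 + a 2 + (2 - 2 * a 3)\<close> equals 2 only if all three agree.\<close>

definition digit_mark :: "(nat \<Rightarrow> nat \<Rightarrow> bool) \<Rightarrow> nat \<Rightarrow> nat" where
  "digit_mark a i = (if i mod 4 = 1 then of_bool (a 1 (i div 4)) else
     if i mod 4 = 2 then of_bool (a 2 (i div 4)) else
     if i mod 4 = 3 then 2 - 2 * of_bool (a 3 (i div 4)) else 0)"

text \<open>The label carries the complement \<open>E - e\<close>, so a digit sum of
  \<open>E\<close> says that label and item have the same class.\<close>

definition digit_id :: "nat \<Rightarrow> (nat \<Rightarrow> nat \<Rightarrow> nat) \<Rightarrow> nat \<Rightarrow> nat \<Rightarrow> nat" where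
  "digit_id E e d i = (if i mod 4 = 0 then E - e d (i div 4) else if i mod 4 = d then e d (i div 4) else 0)"

text \<open>The digits of four items sum to at most \<open>4 * 2\<close>, \<open>4 * E\<close> or
  \<open>4 * 1\<close>, all of which are smaller than this base.\<close>

definition radix :: "nat \<Rightarrow> nat" where "radix E = 4 * E + 9"

definition weight :: "nat \<Rightarrow> (nat \<Rightarrow> nat \<Rightarrow> nat) \<Rightarrow> (nat \<Rightarrow> nat \<Rightarrow> bool) \<Rightarrow> nat \<Rightarrow> nat" where
  "weight E e a i = digit_mark a i + radix E * (digit_id E e 1 i + radix E * (digit_id E e 2 i +
     radix E * (digit_id E e 3 i + radix E * (of_bool (i mod 4 = 1) + radix E * (of_bool (i mod 4 = 2) +
     radix E * (of_bool (i mod 4 = 3) + radix E))))))"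

text \<open>The digits, lowest first, demand equal marks, equal classes in the three partitions, one
  item of each partition, and four items altogether.\<close>

definition capacity :: "nat \<Rightarrow> nat" where
  "capacity E = 2 + radix E * (E + radix E * (E + radix E * (E + radix E * (1 + radix E * (1 +
     radix E * (1 + radix E * 4))))))"

section \<open>Digit sums without carries\<close>

lemma digit_cong:
  assumes "a + D * b = a' + D * b'" "a < D" "a' < (D::nat)"
  shows "a = a'" "b = b'"
  using mult_add_eq_iff[OF assms(2,3), of b b'] assms(1) by (auto simp: add.commute)

lemma sum_weight: "(\<Sum>i\<in>I. weight E e a i) = (\<Sum>i\<in>I. digit_mark a i) + radix E * ((\<Sum>i\<in>I. digit_id E e 1 i) +
    radix E * ((\<Sum>i\<in>I. digit_id E e 2 i) + radix E * ((\<Sum>i\<in>I. digit_id E e 3 i) +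
    radix E * ((\<Sum>i\<in>I. of_bool (i mod 4 = 1)) + radix E * ((\<Sum>i\<in>I. of_bool (i mod 4 = 2)) +
    radix E * ((\<Sum>i\<in>I. of_bool (i mod 4 = 3)) + radix E * card I))))))"
  by (simp only: weight_def sum.distrib sum_distrib_left[symmetric] sum_constant mult.commute[of _ "radix E"] of_nat_id)

lemma card_bound_of_sum:
  fixes g :: "nat \<Rightarrow> nat"
  assumes "finite I" "\<And>i. i \<in> I \<Longrightarrow> L \<le> g i" "(\<Sum>i\<in>I. g i) < (k + 1) * L"
  shows "card I \<le> k"
proof (rule ccontr)
  assume "\<not> card I \<le> k"
  then have "(k + 1) * L \<le> card I * L" by (intro mult_le_mono1) simp
  also have "\<dots> = (\<Sum>i\<in>I. L)" by simp
  also have "\<dots> \<le> (\<Sum>i\<in>I. g i)" by (intro sum_mono assms(2))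
  finally show False using assms(3) by simp
qed

text \<open>Every weight has leading digit 1 and the capacity has leading digit 4, so a full bin
  holds at most four items. This has to be known before any digits are compared, as it is what
  excludes carries.\<close>

lemma radix_pow_bounds:
  fixes E :: nat
  defines "D \<equiv> radix E"
  shows "D ^ 7 \<le> weight E e a i" "capacity E < 5 * D ^ 7"
proof -
  have pow: "D ^ 7 = D * (D * (D * (D * (D * (D * D)))))"
    by (simp add: eval_nat_numeral)
  have step: "D * x \<le> a + D * y" if "x \<le> y" for a x y using that by (simp add: trans_le_add2)
  show "D ^ 7 \<le> weight E e a i"
    unfolding weight_def pow D_def[symmetric] by (intro step le_add2)
  have bound: "x + D * y < D * Y" if "x < D" "y < Y" for x y Y
  proof -
    have "x + D * y < D * (y + 1)" using that by simp
    also have "\<dots> \<le> D * Y" using that by (intro mult_le_mono2) simp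
    finally show ?thesis .
  qed
  have D: "2 < D" "E < D" "1 < D" by (auto simp: D_def radix_def)
  have "capacity E < D * (D * (D * (D * (D * (D * (D * 5))))))"
    unfolding capacity_def D_def[symmetric] using D by (intro bound) auto
  then show "capacity E < 5 * D ^ 7" unfolding pow by (simp only: ac_simps)
qed

lemma weight_pos: "0 < weight E e a i"
  using radix_pow_bounds(1)[of E e a i] by (rule less_le_trans[rotated]) (simp add: radix_def)

lemma sum_le_4:
  fixes g :: "nat \<Rightarrow> nat"
  assumes "card I \<le> 4" "\<And>i. i \<in> I \<Longrightarrow> g i \<le> L"
  shows "(\<Sum>i\<in>I. g i) \<le> 4 * L"
proof -
  have "(\<Sum>i\<in>I. g i) \<le> (\<Sum>i\<in>I. L)" by (intro sum_mono assms(2))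
  also have "\<dots> \<le> 4 * L" using assms(1) by simp
  finally show ?thesis .
qed

lemma sum_of_bool_card: "finite I \<Longrightarrow> (\<Sum>i\<in>I. of_bool (P i) :: nat) = card {i \<in> I. P i}"
  by (simp add: sum.If_cases of_bool_def Int_def)

text \<open>With at most four items nothing is carried, and the capacity splits into one equation
  per digit. There are four items and one of each partition, so the fourth one is a label; the other
  digits then yield equal classes and equal marks.\<close>

lemma bin_structure:
  assumes I: "finite I" and e: "\<And>i d. i \<in> I \<Longrightarrow> d \<in> {1, 2, 3} \<Longrightarrow> e d (i div 4) < E"
    and sum: "(\<Sum>i\<in>I. weight E e a i) = capacity E"
  obtains t0 t1 t2 t3 where "I = {4 * t0, 4 * t1 + 1, 4 * t2 + 2, 4 * t3 + 3}"
    "e 1 t1 = e 1 t0" "e 2 t2 = e 2 t0" "e 3 t3 = e 3 t0" "a 1 t1 = a 3 t3" "a 2 t2 = a 3 t3"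
proof -
  let ?D = "radix E"
  have card4: "card I \<le> 4"
    by (rule card_bound_of_sum[OF I, where g = "weight E e a" and L = "?D ^ 7"])
      (use sum radix_pow_bounds in auto)
  have D: "4 * 2 < ?D" "4 * E < ?D" "4 * 1 < ?D" by (auto simp: radix_def)
  have b0: "(\<Sum>i\<in>I. digit_mark a i) < ?D"
    by (rule le_less_trans[OF sum_le_4[OF card4] D(1)]) (auto simp: digit_mark_def)
  have b1: "(\<Sum>i\<in>I. digit_id E e d i) < ?D" if "d \<in> {1, 2, 3}" for d
    by (rule le_less_trans[OF sum_le_4[OF card4] D(2)]) (use e that in \<open>force simp: digit_id_def less_imp_le\<close>)
  have b2: "(\<Sum>i\<in>I. of_bool (P i)) < ?D" for P
    by (rule le_less_trans[OF sum_le_4[OF card4] D(3)]) auto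
  have b11: "(\<Sum>i\<in>I. digit_id E e 1 i) < ?D" and b12: "(\<Sum>i\<in>I. digit_id E e 2 i) < ?D"
    and b13: "(\<Sum>i\<in>I. digit_id E e 3 i) < ?D" using b1[of 1] b1[of 2] b1[of 3] by auto
  \<comment> \<open>The digits are split off one by one, starting with the least significant; what
    finally remains is the equation for \<open>card I\<close>.\<close>
  note eq = sum[unfolded sum_weight capacity_def]
  have s0: "(\<Sum>i\<in>I. digit_mark a i) = 2" by (rule digit_cong(1)[OF eq]) (use b0 D in auto)
  note eq = digit_cong(2)[OF eq b0]
  have lt: "2 < ?D" "E < ?D" "1 < ?D" using D by auto
  note eq = eq[OF lt(1)]
  have s1: "(\<Sum>i\<in>I. digit_id E e 1 i) = E" by (rule digit_cong(1)[OF eq b11 lt(2)])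
  note eq = digit_cong(2)[OF eq b11 lt(2)]
  have s2: "(\<Sum>i\<in>I. digit_id E e 2 i) = E" by (rule digit_cong(1)[OF eq b12 lt(2)])
  note eq = digit_cong(2)[OF eq b12 lt(2)]
  have s3: "(\<Sum>i\<in>I. digit_id E e 3 i) = E" by (rule digit_cong(1)[OF eq b13 lt(2)])
  note eq = digit_cong(2)[OF eq b13 lt(2)]
  have c: "card {i \<in> I. i mod 4 = 1} = 1 \<and> card {i \<in> I. i mod 4 = 2} = 1 \<and> card {i \<in> I. i mod 4 = 3} = 1 \<and> card I = 4"
  proof -
    have k1: "(\<Sum>i\<in>I. of_bool (i mod 4 = 1)) = (1 :: nat)" by (rule digit_cong(1)[OF eq b2 lt(3)])
    note eq = digit_cong(2)[OF eq b2 lt(3)]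
    have k2: "(\<Sum>i\<in>I. of_bool (i mod 4 = 2)) = (1 :: nat)" by (rule digit_cong(1)[OF eq b2 lt(3)])
    note eq = digit_cong(2)[OF eq b2 lt(3)]
    have k3: "(\<Sum>i\<in>I. of_bool (i mod 4 = 3)) = (1 :: nat)" by (rule digit_cong(1)[OF eq b2 lt(3)])
    note eq = digit_cong(2)[OF eq b2 lt(3)]
    then have "card I = 4" using lt(1) by simp
    with k1 k2 k3 show ?thesis unfolding sum_of_bool_card[OF I] by blast
  qed
  have "I = {i \<in> I. i mod 4 = 0} \<union> ({i \<in> I. i mod 4 = 1} \<union> ({i \<in> I. i mod 4 = 2} \<union> {i \<in> I. i mod 4 = 3}))"
    (is "_ = ?I0 \<union> (?I1 \<union> (?I2 \<union> ?I3))")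
  proof -
    have "i mod 4 = 0 \<or> i mod 4 = 1 \<or> i mod 4 = 2 \<or> i mod 4 = 3" for i :: nat by presburger
    then show ?thesis by auto
  qed
  then have Ieq: "I = ?I0 \<union> (?I1 \<union> (?I2 \<union> ?I3))" .
  have "card I = card ?I0 + (card ?I1 + (card ?I2 + card ?I3))"
    by (subst Ieq, (subst card_Un_disjoint; (use I in auto)?)+)
  then have c0: "card ?I0 = 1" using c by simp
  obtain i0 where i0: "?I0 = {i0}" using c0 by (rule card_1_singletonE)
  obtain i1 where i1: "?I1 = {i1}" using c by (metis card_1_singletonE)
  obtain i2 where i2: "?I2 = {i2}" using c by (metis card_1_singletonE)
  obtain i3 where i3: "?I3 = {i3}" using c by (metis card_1_singletonE)
  have m: "i0 mod 4 = 0" "i1 mod 4 = 1" "i2 mod 4 = 2" "i3 mod 4 = 3"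
    using i0 i1 i2 i3 by (auto simp: set_eq_iff)
  have I4: "I = {i0, i1, i2, i3}" using Ieq i0 i1 i2 i3 by auto
  define t0 t1 t2 t3 where t: "t0 = i0 div 4" "t1 = i1 div 4" "t2 = i2 div 4" "t3 = i3 div 4"
  have i: "i0 = 4 * t0" "i1 = 4 * t1 + 1" "i2 = 4 * t2 + 2" "i3 = 4 * t3 + 3"
    using m unfolding t by presburger+
  have sum4: "(\<Sum>i\<in>I. g i) = g i0 + (g i1 + (g i2 + g i3))" for g :: "nat \<Rightarrow> nat"
    unfolding I4 using m by (subst sum.insert; auto)+
  have et: "e d t0 < E" if "d \<in> {1, 2, 3}" for d using e[of i0 d] that I4 t by auto
  have "e 1 t1 = e 1 t0" using s1 et[of 1] m unfolding sum4 by (auto simp: digit_id_def t)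
  moreover have "e 2 t2 = e 2 t0" using s2 et[of 2] m unfolding sum4 by (auto simp: digit_id_def t)
  moreover have "e 3 t3 = e 3 t0" using s3 et[of 3] m unfolding sum4 by (auto simp: digit_id_def t)
  moreover have "a 1 t1 = a 3 t3 \<and> a 2 t2 = a 3 t3"
  proof -
    have "digit_mark a i0 = 0" "digit_mark a i1 = of_bool (a 1 t1)" "digit_mark a i2 = of_bool (a 2 t2)"
      "digit_mark a i3 = 2 - 2 * of_bool (a 3 t3)"
      unfolding digit_mark_def m t by simp_all
    then have "of_bool (a 1 t1) + (of_bool (a 2 t2) + (2 - 2 * of_bool (a 3 t3))) = (2 :: nat)"
      using s0 unfolding sum4 by simp
    then show ?thesis by (cases "a 1 t1"; cases "a 2 t2"; cases "a 3 t3") simp_all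
  qed
  ultimately show thesis using that I4 i by blast
qed

lemma bin_weight:
  assumes "e 1 t1 = e 1 t0" "e 2 t2 = e 2 t0" "e 3 t3 = e 3 t0" "a 1 t1 = a 3 t3" "a 2 t2 = a 3 t3"
    and e: "\<And>d. d \<in> {1, 2, 3} \<Longrightarrow> e d t0 < E"
  shows "(\<Sum>i\<in>{4 * t0, 4 * t1 + 1, 4 * t2 + 2, 4 * t3 + 3}. weight E e a i) = capacity E"
proof -
  have mods: "4 * t0 mod 4 = 0" "(4 * t1 + 1) mod 4 = 1" "(4 * t2 + 2) mod 4 = 2" "(4 * t3 + 3) mod 4 = 3"
    by presburger+
  then have ne: "4 * t0 \<noteq> 4 * t1 + 1" "4 * t0 \<noteq> 4 * t2 + 2" "4 * t0 \<noteq> 4 * t3 + 3"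
    "4 * t1 + 1 \<noteq> 4 * t2 + 2" "4 * t1 + 1 \<noteq> 4 * t3 + 3" "4 * t2 + 2 \<noteq> 4 * t3 + 3"
    by presburger+
  have divs: "(4 * t0) div 4 = t0" "(4 * t1 + 1) div 4 = t1" "(4 * t2 + 2) div 4 = t2" "(4 * t3 + 3) div 4 = t3"
    by presburger+
  have sum4: "(\<Sum>i\<in>{4 * t0, 4 * t1 + 1, 4 * t2 + 2, 4 * t3 + 3}. g i) =
      g (4 * t0) + (g (4 * t1 + 1) + (g (4 * t2 + 2) + g (4 * t3 + 3)))" for g :: "nat \<Rightarrow> nat"
    using ne by (subst sum.insert; auto)+
  have card: "card {4 * t0, 4 * t1 + 1, 4 * t2 + 2, 4 * t3 + 3} = 4"
    using sum4[of "\<lambda>_. 1"] by simp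
  have "e 1 t0 < E" "e 2 t0 < E" "e 3 t0 < E" using e by auto
  then show ?thesis
    unfolding sum_weight card capacity_def
    unfolding sum4 digit_mark_def digit_id_def mods divs using assms(1-5) by (simp add: of_bool_def)
qed

section \<open>Marks and equally distributed classes\<close>

lemma fibre_bij:
  assumes "finite A" "finite B" "\<And>\<kappa>. card {x \<in> A. k1 x = \<kappa>} = card {y \<in> B. k2 y = \<kappa>}"
  obtains \<pi> where "bij_betw \<pi> A B" "\<And>x. x \<in> A \<Longrightarrow> k2 (\<pi> x) = k1 x"
proof -
  have "\<exists>h. bij_betw h {x \<in> A. k1 x = \<kappa>} {y \<in> B. k2 y = \<kappa>}" for \<kappa>
    using assms by (intro finite_same_card_bij) auto
  then obtain h where h: "\<And>\<kappa>. bij_betw (h \<kappa>) {x \<in> A. k1 x = \<kappa>} {y \<in> B. k2 y = \<kappa>}" by metis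
  let ?\<pi> = "\<lambda>x. h (k1 x) x"
  have mem: "?\<pi> x \<in> B \<and> k2 (?\<pi> x) = k1 x" if "x \<in> A" for x
    using h[of "k1 x"] that by (auto simp: bij_betw_def)
  have "inj_on ?\<pi> A"
  proof (rule inj_onI)
    fix x y assume xy: "x \<in> A" "y \<in> A" "?\<pi> x = ?\<pi> y"
    then have "k1 x = k1 y" using mem by metis
    then show "x = y" using xy h[of "k1 x"] by (auto simp: bij_betw_def inj_on_def)
  qed
  moreover have "?\<pi> ` A = B"
  proof (intro equalityI subsetI)
    fix y assume "y \<in> B"
    then have "y \<in> h (k2 y) ` {x \<in> A. k1 x = k2 y}" using h[of "k2 y"] by (auto simp: bij_betw_def)
    then obtain x where "x \<in> A" "k1 x = k2 y" "y = h (k2 y) x" by blast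
    then show "y \<in> ?\<pi> ` A" by (intro image_eqI[of _ _ x]) simp_all
  qed (use mem in auto)
  ultimately show thesis using that[of ?\<pi>] mem by (auto simp: bij_betw_def)
qed

text \<open>The number of smaller members maps \<open>A\<close> bijectively onto
  \<open>{..<card A}\<close>.\<close>

lemma card_first:
  fixes A :: "nat set"
  assumes "finite A" "r \<le> card A"
  shows "card {t \<in> A. card {t' \<in> A. t' < t} < r} = r"
proof -
  let ?k = "\<lambda>t. card {t' \<in> A. t' < t}"
  have mono: "?k t < ?k u" if "t < u" "t \<in> A" for t u
    using assms(1) that by (intro psubset_card_mono) auto
  have inj: "inj_on ?k A"
  proof (rule inj_onI, rule ccontr)
    fix t u assume "t \<in> A" "u \<in> A" "?k t = ?k u" "t \<noteq> u"
    then show False using mono[of t u] mono[of u t] by (cases "t < u") auto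
  qed
  have "?k t < card A" if "t \<in> A" for t
    using assms(1) that by (intro psubset_card_mono) auto
  then have "?k ` A \<subseteq> {..<card A}" by blast
  then have img: "?k ` A = {..<card A}" using inj by (intro card_subset_eq) (auto simp: card_image)
  have "bij_betw ?k {t \<in> A. ?k t < r} {x \<in> {..<card A}. x < r}"
    by (rule bij_betw_fibre) (use inj img in \<open>auto simp: bij_betw_def\<close>)
  then have "card {t \<in> A. ?k t < r} = card {x \<in> {..<card A}. x < r}" by (rule bij_betw_same_card)
  also have "{x \<in> {..<card A}. x < r} = {..<r}" using assms(2) by auto
  finally show ?thesis by simp
qed

lemma card_mark:
  assumes "r d c \<le> card {t. t < \<tau> \<and> e d t = c}"
  shows "card {t. t < \<tau> \<and> e d t = c \<and> mark e r d t} = r d c"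
proof -
  let ?A = "{t. t < \<tau> \<and> e d t = c}"
  have "{t. t < \<tau> \<and> e d t = c \<and> mark e r d t} = {t \<in> ?A. card {t' \<in> ?A. t' < t} < r d c}"
  proof -
    have "{t'. t' < t \<and> e d t' = e d t} = {t' \<in> ?A. t' < t}" if "t \<in> ?A" for t using that by auto
    then show ?thesis by (auto simp: mark_def)
  qed
  then show ?thesis using card_first[of ?A "r d c"] assms by simp
qed

text \<open>Given a packing, the labels and the items of each partition are permutations of the
  indices along the bins, and the chosen set consists of the labels of bins with marked items.
  Conversely, for each \<open>d\<close> a permutation \<open>\<pi> d\<close> that preserves the
  classes of partition \<open>d\<close> turns membership in \<open>S\<close> into the mark, and bin
  \<open>t\<close> receives label \<open>t\<close> together with the items of
  \<open>\<pi> d t\<close>.\<close>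

lemma packable_iff_feasible:
  assumes e: "\<And>d t. d \<in> {1, 2, 3} \<Longrightarrow> t < \<tau> \<Longrightarrow> e d t < E"
    and r: "\<And>d c. d \<in> {1, 2, 3} \<Longrightarrow> c < E \<Longrightarrow> r d c \<le> card {t. t < \<tau> \<and> e d t = c}"
  shows "packable (4 * \<tau>) \<tau> (capacity E) (weight E e (mark e r)) \<longleftrightarrow> feasible \<tau> E e r"
proof
  assume "packable (4 * \<tau>) \<tau> (capacity E) (weight E e (mark e r))"
  then obtain f where f: "\<And>i. i < 4 * \<tau> \<Longrightarrow> f i < \<tau>"
    "\<And>b. b < \<tau> \<Longrightarrow> (\<Sum>i\<in>{i. i < 4 * \<tau> \<and> f i = b}. weight E e (mark e r) i) = capacity E"
    unfolding packable_def by blast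
  let ?a = "mark e r"
  define Q where "Q b u = (case u of (t0, t1, t2, t3) \<Rightarrow>
      {i. i < 4 * \<tau> \<and> f i = b} = {4 * t0, 4 * t1 + 1, 4 * t2 + 2, 4 * t3 + 3} \<and>
      e 1 t1 = e 1 t0 \<and> e 2 t2 = e 2 t0 \<and> e 3 t3 = e 3 t0 \<and> ?a 1 t1 = ?a 3 t3 \<and> ?a 2 t2 = ?a 3 t3)" for b u
  have "\<exists>u. b < \<tau> \<longrightarrow> Q b u" for b
  proof (cases "b < \<tau>")
    case True
    have "e d (i div 4) < E" if "i \<in> {i. i < 4 * \<tau> \<and> f i = b}" "d \<in> {1, 2, 3}" for i d
      by (rule e[OF that(2)]) (use that(1) in auto)
    then obtain t0 t1 t2 t3 where "Q b (t0, t1, t2, t3)"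
      unfolding Q_def prod.case by (rule bin_structure[OF _ _ f(2)[OF True], rotated]) auto
    then show ?thesis by blast
  qed blast
  then obtain T where T: "\<And>b. b < \<tau> \<Longrightarrow> Q b (T b)" by metis
  define t0 t1 t2 t3 where tdef: "t0 b = fst (T b)" "t1 b = fst (snd (T b))" "t2 b = fst (snd (snd (T b)))"
    "t3 b = snd (snd (snd (T b)))" for b
  have TQ: "Q b (t0 b, t1 b, t2 b, t3 b)" if "b < \<tau>" for b using T[OF that] by (simp add: tdef)
  have t: "{i. i < 4 * \<tau> \<and> f i = b} = {4 * t0 b, 4 * t1 b + 1, 4 * t2 b + 2, 4 * t3 b + 3}"
    and te: "e 1 (t1 b) = e 1 (t0 b)" "e 2 (t2 b) = e 2 (t0 b)" "e 3 (t3 b) = e 3 (t0 b)"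
    and ta: "?a 1 (t1 b) = ?a 3 (t3 b)" "?a 2 (t2 b) = ?a 3 (t3 b)" if "b < \<tau>" for b
    using TQ[OF that] unfolding Q_def prod.case by blast+
  have in_bin: "4 * t0 b < 4 * \<tau> \<and> f (4 * t0 b) = b" "4 * t1 b + 1 < 4 * \<tau> \<and> f (4 * t1 b + 1) = b"
    "4 * t2 b + 2 < 4 * \<tau> \<and> f (4 * t2 b + 2) = b" "4 * t3 b + 3 < 4 * \<tau> \<and> f (4 * t3 b + 3) = b" if "b < \<tau>" for b
  proof -
    have "{4 * t0 b, 4 * t1 b + 1, 4 * t2 b + 2, 4 * t3 b + 3} \<subseteq> {i. i < 4 * \<tau> \<and> f i = b}"
      unfolding t[OF that] by (rule order_refl)
    then show "4 * t0 b < 4 * \<tau> \<and> f (4 * t0 b) = b" "4 * t1 b + 1 < 4 * \<tau> \<and> f (4 * t1 b + 1) = b"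
      "4 * t2 b + 2 < 4 * \<tau> \<and> f (4 * t2 b + 2) = b" "4 * t3 b + 3 < 4 * \<tau> \<and> f (4 * t3 b + 3) = b"
      unfolding insert_subset mem_Collect_eq by blast+
  qed
  \<comment> \<open>Distinct bins contain distinct items, so the map is injective on a finite set
    into itself.\<close>
  have bij: "bij_betw s {..<\<tau>} {..<\<tau>}" if "\<And>b. b < \<tau> \<Longrightarrow> 4 * s b + k < 4 * \<tau> \<and> f (4 * s b + k) = b" for s k
  proof -
    have "inj_on s {..<\<tau>}" using that by (intro inj_onI) (metis lessThan_iff)
    moreover have "s b < \<tau>" if "b < \<tau>" for b using \<open>\<And>b. b < \<tau> \<Longrightarrow> 4 * s b + k < 4 * \<tau> \<and> f (4 * s b + k) = b\<close>[OF that] by simp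
    then have "s ` {..<\<tau>} \<subseteq> {..<\<tau>}" by auto
    ultimately show ?thesis using endo_inj_surj[of "{..<\<tau>}" s] by (simp add: bij_betw_def)
  qed
  have b0: "bij_betw t0 {..<\<tau>} {..<\<tau>}" by (rule bij[of _ 0]) (use in_bin(1) in simp)
  have b1: "bij_betw t1 {..<\<tau>} {..<\<tau>}" by (rule bij[of _ 1]) (use in_bin(2) in simp)
  have b2: "bij_betw t2 {..<\<tau>} {..<\<tau>}" by (rule bij[of _ 2]) (use in_bin(3) in simp)
  have b3: "bij_betw t3 {..<\<tau>} {..<\<tau>}" by (rule bij[of _ 3]) (use in_bin(4) in simp)
  \<comment> \<open>All marks in a bin agree, so the item of partition 3 can speak for the
    bin.\<close>
  let ?S = "t0 ` {b. b < \<tau> \<and> ?a 3 (t3 b)}"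
  have count: "card {t \<in> ?S. e d t = c} = r d c"
    if d: "d \<in> {1, 2, 3}" and c: "c < E" and s: "bij_betw s {..<\<tau>} {..<\<tau>}"
      "\<And>b. b < \<tau> \<Longrightarrow> e d (s b) = e d (t0 b) \<and> ?a d (s b) = ?a 3 (t3 b)" for d c s
  proof -
    have 1: "{t \<in> ?S. e d t = c} = t0 ` {b. b < \<tau> \<and> e d (t0 b) = c \<and> ?a 3 (t3 b)}" by auto
    have 2: "card (t0 ` {b. b < \<tau> \<and> e d (t0 b) = c \<and> ?a 3 (t3 b)}) =
        card {b. b < \<tau> \<and> e d (t0 b) = c \<and> ?a 3 (t3 b)}"
      by (intro card_image inj_on_subset[OF bij_betw_imp_inj_on[OF b0]]) auto
    have 3: "{b. b < \<tau> \<and> e d (t0 b) = c \<and> ?a 3 (t3 b)} = {b \<in> {..<\<tau>}. e d (s b) = c \<and> ?a d (s b)}"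
    proof (intro Collect_cong)
      fix b show "(b < \<tau> \<and> e d (t0 b) = c \<and> ?a 3 (t3 b)) = (b \<in> {..<\<tau>} \<and> e d (s b) = c \<and> ?a d (s b))"
        using s(2)[of b] by (cases "b < \<tau>") simp_all
    qed
    have 4: "card {b \<in> {..<\<tau>}. e d (s b) = c \<and> ?a d (s b)} = card {t \<in> {..<\<tau>}. e d t = c \<and> ?a d t}"
      by (rule bij_betw_same_card[OF bij_betw_fibre[OF s(1), of "\<lambda>t. e d t = c \<and> ?a d t"]])
    have 5: "card {t \<in> {..<\<tau>}. e d t = c \<and> ?a d t} = r d c"
      using card_mark[where e = e and r = r, OF r[OF d c]] by simp
    show ?thesis unfolding 1 2 unfolding 3 4 5 ..
  qed
  have "?S \<subseteq> {..<\<tau>}" using b0 by (auto simp: bij_betw_def)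
  moreover have "\<forall>d\<in>{1, 2, 3}. \<forall>c<E. card {t \<in> ?S. e d t = c} = r d c"
  proof (intro ballI allI impI)
    fix d c :: nat assume d: "d \<in> {1, 2, 3}" and c: "c < E"
    have s: "bij_betw (if d = 1 then t1 else if d = 2 then t2 else t3) {..<\<tau>} {..<\<tau>}"
      using b1 b2 b3 by simp
    show "card {t \<in> ?S. e d t = c} = r d c"
      by (rule count[OF d c s]) (use d te ta in auto)
  qed
  ultimately show "feasible \<tau> E e r" unfolding feasible_def by blast
next
  assume "feasible \<tau> E e r"
  then obtain S where S: "S \<subseteq> {..<\<tau>}" "\<And>d c. d \<in> {1, 2, 3} \<Longrightarrow> c < E \<Longrightarrow> card {t \<in> S. e d t = c} = r d c"
    unfolding feasible_def by blast
  let ?a = "mark e r"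
  \<comment> \<open>In a class \<open>c\<close> both the members of \<open>S\<close> and the marked
    indices number \<open>r d c\<close>; hence their complements are equally large too, and the
    pairs of class and truth value are equally distributed.\<close>
  have "\<exists>\<pi>. bij_betw \<pi> {..<\<tau>} {..<\<tau>} \<and> (\<forall>t<\<tau>. e d (\<pi> t) = e d t \<and> (?a d (\<pi> t) \<longleftrightarrow> t \<in> S))"
    if d: "d \<in> {1, 2, 3}" for d
  proof -
    have "card {x \<in> {..<\<tau>}. (e d x, x \<in> S) = \<kappa>} = card {y \<in> {..<\<tau>}. (e d y, ?a d y) = \<kappa>}" for \<kappa>
    proof -
      obtain c b where \<kappa>: "\<kappa> = (c, b)" by (cases \<kappa>)
      show ?thesis
      proof (cases "c < E")
        case False
        then have "{x \<in> {..<\<tau>}. (e d x, x \<in> S) = \<kappa>} = {}" "{y \<in> {..<\<tau>}. (e d y, ?a d y) = \<kappa>} = {}"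
          using e[OF d] \<kappa> by auto
        then show ?thesis by (simp only:)
      next
        case True
        let ?A = "{t. t < \<tau> \<and> e d t = c}"
        have 1: "card {t \<in> ?A. t \<in> S} = r d c"
        proof -
          have "{t \<in> ?A. t \<in> S} = {t \<in> S. e d t = c}" using S(1) by auto
          then show ?thesis using S(2)[OF d True] by simp
        qed
        have 2: "card {t \<in> ?A. ?a d t} = r d c"
          using card_mark[where e = e and r = r, OF r[OF d True]] by (simp add: conj_assoc)
        have comp: "card {t \<in> ?A. \<not> P t} = card ?A - card {t \<in> ?A. P t}" for P
        proof -
          have "{t \<in> ?A. \<not> P t} = ?A - {t \<in> ?A. P t}" by auto
          moreover have "card (?A - {t \<in> ?A. P t}) = card ?A - card {t \<in> ?A. P t}"
            by (rule card_Diff_subset) auto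
          ultimately show ?thesis by (simp only:)
        qed
        show ?thesis
        proof (cases b)
          case True
          then have "{x \<in> {..<\<tau>}. (e d x, x \<in> S) = \<kappa>} = {t \<in> ?A. t \<in> S}" "{y \<in> {..<\<tau>}. (e d y, ?a d y) = \<kappa>} = {t \<in> ?A. ?a d t}"
            using \<kappa> by auto
          then show ?thesis by (simp only: 1 2)
        next
          case False
          then have "{x \<in> {..<\<tau>}. (e d x, x \<in> S) = \<kappa>} = {t \<in> ?A. t \<notin> S}" "{y \<in> {..<\<tau>}. (e d y, ?a d y) = \<kappa>} = {t \<in> ?A. \<not> ?a d t}"
            using \<kappa> by auto
          then show ?thesis by (simp only: 1 2 comp)
        qed
      qed
    qed
    then obtain \<pi> where "bij_betw \<pi> {..<\<tau>} {..<\<tau>}" "\<And>x. x \<in> {..<\<tau>} \<Longrightarrow> (e d (\<pi> x), ?a d (\<pi> x)) = (e d x, x \<in> S)"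
      by (rule fibre_bij[rotated 2]) auto
    then show ?thesis by (intro exI[of _ \<pi>]) auto
  qed
  then obtain \<pi> where \<pi>: "\<And>d. d \<in> {1, 2, 3} \<Longrightarrow> bij_betw (\<pi> d) {..<\<tau>} {..<\<tau>}"
    "\<And>d t. d \<in> {1, 2, 3} \<Longrightarrow> t < \<tau> \<Longrightarrow> e d (\<pi> d t) = e d t \<and> (?a d (\<pi> d t) \<longleftrightarrow> t \<in> S)" by metis
  define f where "f i = (if i mod 4 = 0 then i div 4 else inv_into {..<\<tau>} (\<pi> (i mod 4)) (i div 4))" for i
  have dmem: "i mod 4 = 0 \<or> i mod 4 \<in> {1, 2, 3}" for i :: nat by (simp, presburger)
  have inv: "inv_into {..<\<tau>} (\<pi> d) t < \<tau>" "\<pi> d (inv_into {..<\<tau>} (\<pi> d) t) = t" if "d \<in> {1, 2, 3}" "t < \<tau>" for d t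
  proof -
    have t: "t \<in> \<pi> d ` {..<\<tau>}" using \<pi>(1)[OF that(1)] that(2) by (auto simp: bij_betw_def)
    show "inv_into {..<\<tau>} (\<pi> d) t < \<tau>" using inv_into_into[OF t] by simp
    show "\<pi> d (inv_into {..<\<tau>} (\<pi> d) t) = t" by (rule f_inv_into_f[OF t])
  qed
  have inv2: "inv_into {..<\<tau>} (\<pi> d) (\<pi> d b) = b" if "d \<in> {1, 2, 3}" "b < \<tau>" for d b
    using \<pi>(1)[OF that(1)] that(2) by (simp add: bij_betw_def)
  have fb: "f i < \<tau>" if "i < 4 * \<tau>" for i
    using dmem[of i] inv(1)[of "i mod 4" "i div 4"] that by (auto simp: f_def)
  have bins: "{i. i < 4 * \<tau> \<and> f i = b} = {4 * b, 4 * \<pi> 1 b + 1, 4 * \<pi> 2 b + 2, 4 * \<pi> 3 b + 3}" if b: "b < \<tau>" for b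
  proof (intro equalityI subsetI)
    fix i assume i: "i \<in> {i. i < 4 * \<tau> \<and> f i = b}"
    have dec: "i = 4 * (i div 4) + i mod 4" by simp
    have "i = 4 * b \<or> (\<exists>d\<in>{1, 2, 3}. i = 4 * \<pi> d b + d)"
    proof (cases "i mod 4 = 0")
      case True
      then show ?thesis using i dec by (simp add: f_def)
    next
      case False
      then have d: "i mod 4 \<in> {1, 2, 3}" using dmem[of i] by simp
      then have "i div 4 = \<pi> (i mod 4) b"
      proof -
        have "i div 4 < \<tau>" using i by auto
        then show ?thesis using i False inv(2)[OF d, of "i div 4"] by (simp add: f_def)
      qed
      then show ?thesis using d dec by (intro disjI2 bexI[OF _ d]) simp
    qed
    then show "i \<in> {4 * b, 4 * \<pi> 1 b + 1, 4 * \<pi> 2 b + 2, 4 * \<pi> 3 b + 3}"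
      by (elim disjE bexE insertE emptyE) simp_all
  next
    fix i assume "i \<in> {4 * b, 4 * \<pi> 1 b + 1, 4 * \<pi> 2 b + 2, 4 * \<pi> 3 b + 3}"
    then consider "i = 4 * b" | d where "d \<in> {1, 2, 3}" "i = 4 * \<pi> d b + d"
      by (elim insertE emptyE) (blast intro: insertI1 insertI2)+
    then show "i \<in> {i. i < 4 * \<tau> \<and> f i = b}"
    proof cases
      case 1
      then show ?thesis using b by (simp add: f_def)
    next
      case 2
      have md: "i mod 4 = d" "i div 4 = \<pi> d b" using 2 by auto
      have "\<pi> d b < \<tau>" using \<pi>(1)[OF 2(1)] b by (auto simp: bij_betw_def)
      then have "i < 4 * \<tau>" using 2 by auto
      moreover have "f i = b" unfolding f_def md using inv2[OF 2(1) b] 2(1) by auto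
      ultimately show ?thesis by simp
    qed
  qed
  have "(\<Sum>i\<in>{i. i < 4 * \<tau> \<and> f i = b}. weight E e ?a i) = capacity E" if b: "b < \<tau>" for b
    unfolding bins[OF b] by (rule bin_weight) (use \<pi>(2)[OF _ b] e b in auto)
  with fb show "packable (4 * \<tau>) \<tau> (capacity E) (weight E e (mark e r))"
    unfolding packable_def by blast
qed

text \<open>Bins are to be filled without gaps, so the total has to fit exactly. The mark digits
  balance because every partition has the same number \<open>k\<close> of marks: they sum to
  \<open>k + k + 2 * \<tau> - 2 * k\<close>.\<close>

lemma total_weight:
  assumes e: "\<And>d t. d \<in> {1, 2, 3} \<Longrightarrow> t < \<tau> \<Longrightarrow> e d t < E"
    and c: "card {t. t < \<tau> \<and> a 1 t} = k" "card {t. t < \<tau> \<and> a 2 t} = k" "card {t. t < \<tau> \<and> a 3 t} = k"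
  shows "(\<Sum>i<4 * \<tau>. weight E e a i) = \<tau> * capacity E"
proof -
  have four: "(\<Sum>i<4 * n. g i) = (\<Sum>t<n. g (4 * t) + g (4 * t + 1) + g (4 * t + 2) + g (4 * t + 3))" for n and g :: "nat \<Rightarrow> nat"
    by (induction n) (auto simp: eval_nat_numeral)
  have "(\<Sum>i<4 * \<tau>. digit_mark a i) = 2 * \<tau>"
  proof -
    have m: "(4 * t) mod 4 = 0" "(4 * t + 1) mod 4 = 1" "(4 * t + 2) mod 4 = 2" "(4 * t + 3) mod 4 = 3"
      "(4 * t + 1) div 4 = t" "(4 * t + 2) div 4 = t" "(4 * t + 3) div 4 = t" for t :: nat by presburger+
    have "(\<Sum>i<4 * \<tau>. digit_mark a i) + (\<Sum>t<\<tau>. 2 * of_bool (a 3 t)) =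
        (\<Sum>t<\<tau>. of_bool (a 1 t) + of_bool (a 2 t) + 2)"
      unfolding four sum.distrib[symmetric] digit_mark_def m
      by (rule sum.cong) (auto simp: of_bool_def)
    also have "\<dots> = (\<Sum>t<\<tau>. of_bool (a 1 t)) + (\<Sum>t<\<tau>. of_bool (a 2 t)) + 2 * \<tau>"
      by (simp only: sum.distrib sum_constant card_lessThan of_nat_id mult.commute[of \<tau>])
    finally have "(\<Sum>i<4 * \<tau>. digit_mark a i) + (\<Sum>t<\<tau>. 2 * of_bool (a 3 t)) =
        (\<Sum>t<\<tau>. of_bool (a 1 t)) + (\<Sum>t<\<tau>. of_bool (a 2 t)) + 2 * \<tau>" .
    moreover have "(\<Sum>t<\<tau>. of_bool (P t)) = card {t. t < \<tau> \<and> P t}" for P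
      by (subst sum_of_bool_card) auto
    ultimately show ?thesis using c by (simp add: sum_distrib_left[symmetric] del: sum_of_bool_eq)
  qed
  moreover have "(\<Sum>i<4 * \<tau>. digit_id E e d i) = E * \<tau>" if "d \<in> {1, 2, 3}" for d
  proof -
    have m: "(4 * t) mod 4 = 0" "(4 * t + 1) mod 4 = 1" "(4 * t + 2) mod 4 = 2" "(4 * t + 3) mod 4 = 3"
      "(4 * t) div 4 = t" "(4 * t + 1) div 4 = t" "(4 * t + 2) div 4 = t" "(4 * t + 3) div 4 = t" for t :: nat by presburger+
    have "(\<Sum>i<4 * \<tau>. digit_id E e d i) = (\<Sum>t<\<tau>. E)"
      unfolding four digit_id_def m by (rule sum.cong) (use that e[OF that] in \<open>auto simp: less_imp_le\<close>)
    then show ?thesis by simp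
  qed
  moreover have "(\<Sum>i<4 * \<tau>. of_bool (i mod 4 = d) :: nat) = \<tau>" if "d \<in> {1, 2, 3}" for d
  proof -
    have m: "(4 * t) mod 4 = 0" "(4 * t + 1) mod 4 = 1" "(4 * t + 2) mod 4 = 2" "(4 * t + 3) mod 4 = 3" for t :: nat by presburger+
    have "(\<Sum>i<4 * \<tau>. of_bool (i mod 4 = d) :: nat) = (\<Sum>t<\<tau>. 1)"
      unfolding four m by (rule sum.cong) (use that in auto)
    then show ?thesis by simp
  qed
  ultimately show ?thesis unfolding sum_weight capacity_def by (simp add: algebra_simps)
qed


section \<open>From satisfiability to class counts\<close>

text \<open>\<open>lit j v s\<close> says that clause \<open>j < m\<close> contains the variable \<open>v < n\<close>, positively if \<open>s = 1\<close>
  and negatively if \<open>s = 0\<close>.\<close>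

definition satisfiable :: "nat \<Rightarrow> nat \<Rightarrow> (nat \<Rightarrow> nat \<Rightarrow> nat \<Rightarrow> bool) \<Rightarrow> bool" where
  "satisfiable n m lit \<longleftrightarrow> (\<exists>\<alpha> :: nat \<Rightarrow> bool. \<forall>j<m. \<exists>v<n. lit j v (of_bool (\<alpha> v)))"

text \<open>An index is \<open>6 * P + 3 * s + k\<close>, where \<open>P = j * n + v\<close> is a pair of a clause and a variable.
  For each variable, the indices with \<open>k = 0\<close> form a cyclic chain that has to be chosen entirely with
  \<open>s = 1\<close> or entirely with \<open>s = 0\<close>; the latter means that \<open>v\<close> is true. For each pair this leaves
  one \<open>s\<close>, which is taken by an index with \<open>k = 1\<close> if the literal is the witness for the clause, and
  by an index with \<open>k = 2\<close> otherwise.\<close>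

definition el :: "nat \<Rightarrow> nat \<Rightarrow> (nat \<Rightarrow> nat \<Rightarrow> nat \<Rightarrow> bool) \<Rightarrow> nat \<Rightarrow> nat \<Rightarrow> nat" where
  "el n m lit d t =
    (if d = 1 then
       if t mod 3 = 0 then if t div 3 mod 2 = 0 then t div 6 else (t div 6 + n) mod (m * n)
       else if t mod 3 = 1 then
         if lit (t div 6 div n) (t div 6 mod n) (t div 3 mod 2) then m * n + t div 6 div n else m * n + m
       else m * n + m + 1
     else if d = 2 then if t mod 3 = 0 then t div 6 else m * n
     else t div 3)"

text \<open>In partition 1 the classes below \<open>m * n\<close> are the links of the chains, class
  \<open>m * n + j\<close> asks for one witness of clause \<open>j\<close>, demand 0 at
  \<open>m * n + m\<close> forbids literals that do not occur, and \<open>m * n - m\<close> pairs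
  are no witness. Partition 2 picks one \<open>s\<close> per pair, partition 3 uses each
  \<open>(P, s)\<close> once.\<close>

definition dem :: "nat \<Rightarrow> nat \<Rightarrow> nat \<Rightarrow> nat \<Rightarrow> nat" where
  "dem n m d c =
    (if d = 1 then
       if c < m * n + m then 1 else if c = m * n + m then 0 else if c = m * n + m + 1 then m * n - m else 0
     else if d = 2 then if c < m * n then 1 else if c = m * n then m * n else 0
     else if c < 2 * (m * n) then 1 else 0)"

lemma decode:
  assumes "k < 3" "s < 2"
  shows "(6 * P + 3 * s + k) mod 3 = k" "(6 * P + 3 * s + k) div 3 = 2 * P + s"
    "(6 * P + 3 * s + k) div 3 mod 2 = s" "(6 * P + 3 * s + k) div 6 = (P :: nat)"
    "(2 * P + s) mod 2 = s"
proof -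
  have eq: "6 * P + 3 * s + k = k + 3 * (2 * P + s)" by simp
  show "(6 * P + 3 * s + k) mod 3 = k" unfolding eq mod_mult_self2 using assms(1) by simp
  show 3: "(6 * P + 3 * s + k) div 3 = 2 * P + s"
    unfolding eq using assms(1) by (subst div_mult_self2) auto
  show "(6 * P + 3 * s + k) div 3 mod 2 = s" unfolding 3 using assms(2) by simp
  have "(6 * P + 3 * s + k) div (3 * 2) = (6 * P + 3 * s + k) div 3 div 2" by (rule div_mult2_eq)
  then show "(6 * P + 3 * s + k) div 6 = P" unfolding 3 using assms(2) by simp
  show "(2 * P + s) mod 2 = s" using assms(2) by simp
qed

lemma encode: "t = 6 * (t div 6) + 3 * (t div 3 mod 2) + t mod 3" for t :: nat
proof -
  have "t div (3 * 2) = t div 3 div 2" by (rule div_mult2_eq)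
  then have 1: "t div 6 = t div 3 div 2" by simp
  have 2: "t = 3 * (t div 3) + t mod 3" by simp
  have 3: "t div 3 = 2 * (t div 3 div 2) + t div 3 mod 2" by simp
  show ?thesis using 1 2 3 by linarith
qed

lemma pair_less: "j < m \<Longrightarrow> v < n \<Longrightarrow> j * n + v < m * n" for n :: nat
proof -
  assume "j < m" "v < n"
  then have "j * n + v < Suc j * n" by simp
  also have "\<dots> \<le> m * n" using \<open>j < m\<close> by (intro mult_le_mono1) simp
  finally show "j * n + v < m * n" .
qed

lemma card_1_pair:
  assumes "card A = 1" "A \<subseteq> {u, v}" "u \<noteq> v"
  shows "u \<in> A \<longleftrightarrow> v \<notin> A"
proof -
  obtain a where "A = {a}" using assms(1) by (rule card_1_singletonE)
  then show ?thesis using assms(2,3) by auto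
qed

lemma shift_mod: "n \<le> N \<Longrightarrow> P < N \<Longrightarrow> (P + n) mod N = (if P + n < N then P + n else P + n - N)" for N :: nat
  by (simp add: mod_if)

lemma shift_mod_inj: "n \<le> N \<Longrightarrow> inj_on (\<lambda>P. (P + n) mod N) {..<N}" for N :: nat
  by (rule inj_onI) (auto simp: shift_mod split: if_splits)

lemma el_less:
  assumes n: "n > 0" and m: "m > 0" and t: "t < 6 * (m * n)"
  shows "el n m lit d t < 2 * (m * n) + m + 2"
proof -
  have P: "t div 6 < m * n" using t by auto
  then have "t div 6 div n < m" using n by (simp add: div_less_iff_less_mult)
  moreover have "(t div 6 + n) mod (m * n) < m * n" using n m by simp
  moreover have "t div 3 < 2 * (m * n)" using t by auto
  ultimately show ?thesis using P unfolding el_def by simp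
qed

context
  fixes n m :: nat and lit :: "nat \<Rightarrow> nat \<Rightarrow> nat \<Rightarrow> bool"
  assumes n: "n > 0" and m: "m > 0"
begin

text \<open>Partition 2 makes \<open>y 0\<close> and \<open>y 1\<close> complementary, and the chain
  makes \<open>y 1\<close> the same in all clauses, so \<open>y 0\<close> is an assignment. By
  partition 3 the witness of a clause can only sit at the other \<open>s\<close>, which is the sign
  that this assignment makes true.\<close>

lemma satisfiable_if_feasible:
  assumes "feasible (6 * (m * n)) (2 * (m * n) + m + 2) (el n m lit) (dem n m)"
  shows "satisfiable n m lit"
proof -
  let ?N = "m * n"
  let ?E = "2 * ?N + m + 2"
  obtain S where S: "S \<subseteq> {..<6 * ?N}"
    "\<And>d c. d \<in> {1, 2, 3} \<Longrightarrow> c < ?E \<Longrightarrow> card {t \<in> S. el n m lit d t = c} = dem n m d c"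
    using assms unfolding feasible_def by blast
  have nN: "n \<le> ?N" using m by simp
  define y where "y s P \<longleftrightarrow> 6 * P + 3 * s \<in> S" for s P
  have y01: "y 0 P \<longleftrightarrow> \<not> y 1 P" if P: "P < ?N" for P
  proof -
    let ?A = "{t \<in> S. el n m lit 2 t = P}"
    have c: "card ?A = 1" using S(2)[of 2 P] P by (simp add: dem_def)
    have "?A \<subseteq> {6 * P, 6 * P + 3}"
    proof
      fix t assume "t \<in> ?A"
      then have "t mod 3 = 0" "t div 6 = P" using P by (auto simp: el_def split: if_splits)
      then show "t \<in> {6 * P, 6 * P + 3}" by (simp, presburger)
    qed
    from card_1_pair[OF c this] have "6 * P \<in> ?A \<longleftrightarrow> 6 * P + 3 \<notin> ?A" by simp
    moreover have "el n m lit 2 (6 * P) = P" "el n m lit 2 (6 * P + 3) = P"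
      using decode[of 0 0 P] decode[of 0 1 P] by (auto simp: el_def)
    ultimately show ?thesis by (simp add: y_def)
  qed
  \<comment> \<open>A class of the chain has only two members, the one with \<open>s = 0\<close> at
    the pair \<open>(P + n) mod ?N\<close> and the one with \<open>s = 1\<close> at
    \<open>P\<close>. Adding \<open>n\<close> leads to the same variable in the next clause.\<close>
  have step: "y 1 P \<longleftrightarrow> y 1 ((P + n) mod ?N)" if P: "P < ?N" for P
  proof -
    let ?Q = "(P + n) mod ?N"
    have Q: "?Q < ?N" using n m by simp
    let ?A = "{t \<in> S. el n m lit 1 t = ?Q}"
    have c: "card ?A = 1" using S(2)[of 1 ?Q] Q by (simp add: dem_def)
    have "?A \<subseteq> {6 * ?Q, 6 * P + 3}"
    proof
      fix t assume t: "t \<in> ?A"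
      then have tN: "t div 6 < ?N" using S(1) by auto
      have "t mod 3 = 0" "if t div 3 mod 2 = 0 then t div 6 = ?Q else (t div 6 + n) mod ?N = ?Q"
        using t Q by (auto simp: el_def split: if_splits)
      moreover have "t div 6 = P" if "(t div 6 + n) mod ?N = ?Q"
        using shift_mod_inj[OF nN] that P tN by (simp add: inj_on_def)
      ultimately have "t div 3 mod 2 = 0 \<and> t div 6 = ?Q \<or> t div 3 mod 2 = 1 \<and> t div 6 = P" "t mod 3 = 0"
        by (auto split: if_splits)
      then show "t \<in> {6 * ?Q, 6 * P + 3}" using encode[of t] by auto
    qed
    moreover have "6 * a \<noteq> 6 * b + 3" for a b :: nat by presburger
    ultimately have "6 * ?Q \<in> ?A \<longleftrightarrow> 6 * P + 3 \<notin> ?A" using card_1_pair[OF c] by simp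
    moreover have "el n m lit 1 (6 * ?Q) = ?Q" "el n m lit 1 (6 * P + 3) = ?Q"
      using decode[of 0 0 ?Q] decode[of 0 1 P] by (auto simp: el_def)
    ultimately have "y 0 ?Q \<longleftrightarrow> \<not> y 1 P" by (simp add: y_def)
    then show ?thesis using y01[OF Q] by simp
  qed
  have const: "y 1 (j * n + v) \<longleftrightarrow> y 1 v" if "j < m" "v < n" for j v
    using that(1)
  proof (induction j)
    case (Suc j)
    then have less: "j * n + v < ?N" "Suc j * n + v < ?N" using pair_less[OF _ that(2), of j m] pair_less[OF _ that(2), of "Suc j" m] by auto
    have "(j * n + v + n) mod ?N = Suc j * n + v"
      using less(2) by (subst mod_less) (simp_all add: algebra_simps)
    then show ?case using step[OF less(1)] Suc by simp
  qed simp
  have "\<exists>v<n. lit j v (of_bool (y 0 v))" if j: "j < m" for j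
  proof -
    have "card {t \<in> S. el n m lit 1 t = ?N + j} = 1" using S(2)[of 1 "?N + j"] j by (simp add: dem_def)
    then obtain t where "{t \<in> S. el n m lit 1 t = ?N + j} = {t}" by (rule card_1_singletonE)
    then have t: "t \<in> S" "el n m lit 1 t = ?N + j" by auto
    define P where "P = t div 6"
    define s where "s = t div 3 mod 2"
    have P: "P < ?N" using t(1) S(1) by (auto simp: P_def)
    have "(P + n) mod ?N < ?N" using n m by simp
    then have k: "t mod 3 = 1" and l: "lit (P div n) (P mod n) s" "P div n = j"
      using t(2) P j unfolding el_def P_def s_def by (auto split: if_splits)
    have s2: "s < 2" by (simp add: s_def)
    have t': "t = 6 * P + 3 * s + 1" using encode[of t] k by (simp add: P_def s_def)
    have v: "P mod n < n" "P = j * n + P mod n" using n l(2) by auto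
    \<comment> \<open>Only one index may be chosen for \<open>(P, s)\<close>, and the witness
      \<open>t\<close> is one already.\<close>
    have "\<not> y s P"
    proof
      assume "y s P"
      have "card {t' \<in> S. el n m lit 3 t' = 2 * P + s} = 1" using S(2)[of 3 "2 * P + s"] P s2 by (simp add: dem_def)
      then obtain t'' where eq: "{t' \<in> S. el n m lit 3 t' = 2 * P + s} = {t''}" by (rule card_1_singletonE)
      have "6 * P + 3 * s \<in> {t' \<in> S. el n m lit 3 t' = 2 * P + s}"
        using \<open>y s P\<close> decode(2)[of 0 s P] s2 by (simp add: y_def el_def)
      moreover have "t \<in> {t' \<in> S. el n m lit 3 t' = 2 * P + s}"
        using t(1) decode(2)[of 1 s P] s2 by (simp add: t' el_def)
      ultimately show False unfolding eq t' by simp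
    qed
    moreover have "y 1 P \<longleftrightarrow> y 1 (P mod n)" using const[OF j v(1)] v(2) by simp
    moreover have "P mod n < ?N" using v(1) nN by (rule less_le_trans)
    ultimately have "s = of_bool (y 0 (P mod n))"
      using y01[OF P] y01[of "P mod n"] s2 by (auto simp: less_2_cases_iff)
    then show ?thesis using l v(1) by auto
  qed
  then show ?thesis unfolding satisfiable_def by blast
qed

text \<open>Each clause gets one true literal \<open>w j\<close> as witness. For every
  \<open>(P, s)\<close> exactly one index is chosen, the one with \<open>k = kind P s\<close>, so
  the members of a class can be counted as pairs \<open>(P, s)\<close>.\<close>

lemma feasible_if_satisfiable:
  assumes "satisfiable n m lit"
  shows "feasible (6 * (m * n)) (2 * (m * n) + m + 2) (el n m lit) (dem n m)"
proof -
  let ?N = "m * n"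
  obtain \<alpha> w where w: "\<And>j. j < m \<Longrightarrow> w j < n \<and> lit j (w j) (of_bool (\<alpha> (w j)))"
    using assms unfolding satisfiable_def by metis
  have nN: "n \<le> ?N" using m by simp
  define kind where "kind P s = (if s = (of_bool (\<not> \<alpha> (P mod n)) :: nat) then 0
      else if P mod n = w (P div n) then 1 else (2 :: nat))" for P s
  have kind3: "kind P s < 3" for P s by (simp add: kind_def)
  have kind1: "kind P s = 1 \<longleftrightarrow> s \<noteq> of_bool (\<not> \<alpha> (P mod n)) \<and> P mod n = w (P div n)" for P s
    by (simp add: kind_def)
  have flip: "s \<noteq> of_bool (\<not> b) \<longleftrightarrow> s = of_bool b" if "s < 2" for s :: nat and b
    using that by (cases b) auto
  define S where "S = {t. t < 6 * ?N \<and> t mod 3 = kind (t div 6) (t div 3 mod 2)}"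
  have mem: "6 * P + 3 * s + k \<in> S \<longleftrightarrow> P < ?N \<and> k = kind P s" if "s < 2" "k < 3" for P s k
  proof -
    have less: "6 * P + 3 * s + k < 6 * R \<longleftrightarrow> P < R" for R
    proof
      assume "P < R"
      then show "6 * P + 3 * s + k < 6 * R" using that by linarith
    qed (use that in linarith)
    show ?thesis unfolding S_def mem_Collect_eq decode[OF that(2,1)] less by blast
  qed
  have S_cases: "\<exists>P s. t = 6 * P + 3 * s + kind P s \<and> P < ?N \<and> s < 2" if "t \<in> S" for t
    using that encode[of t] by (intro exI[of _ "t div 6"] exI[of _ "t div 3 mod 2"]) (auto simp: S_def)
  have el1: "el n m lit 1 (6 * P + 3 * s + kind P s) = (if kind P s = 0 then if s = 0 then P else (P + n) mod ?N
      else if kind P s = 1 then ?N + P div n else ?N + m + 1)" if "P < ?N" "s < 2" for P s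
  proof -
    have "lit (P div n) (P mod n) s" if k: "kind P s = 1"
    proof -
      have "P div n < m" using \<open>P < ?N\<close> n by (simp add: div_less_iff_less_mult)
      moreover have "s = of_bool (\<alpha> (P mod n))" "P mod n = w (P div n)"
        using k unfolding kind1 flip[OF \<open>s < 2\<close>] by simp_all
      ultimately show ?thesis using w[of "P div n"] by simp
    qed
    then show ?thesis unfolding el_def decode[OF kind3 that(2)] by simp
  qed
  have el2: "el n m lit 2 (6 * P + 3 * s + kind P s) = (if kind P s = 0 then P else ?N)" if "s < 2" for P s
    unfolding el_def decode[OF kind3 that] by simp
  have el3: "el n m lit 3 (6 * P + 3 * s + kind P s) = 2 * P + s" if "s < 2" for P s
    unfolding el_def decode[OF kind3 that] by simp
  have fibre: "{t \<in> S. el n m lit d t = c} = (\<lambda>(P, s). 6 * P + 3 * s + kind P s) `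
      {(P, s). P < ?N \<and> s < 2 \<and> el n m lit d (6 * P + 3 * s + kind P s) = c}" for d c
  proof (intro equalityI subsetI)
    fix t assume t: "t \<in> {t \<in> S. el n m lit d t = c}"
    then obtain P s where "t = 6 * P + 3 * s + kind P s" "P < ?N" "s < 2" using S_cases by blast
    then show "t \<in> (\<lambda>(P, s). 6 * P + 3 * s + kind P s) `
      {(P, s). P < ?N \<and> s < 2 \<and> el n m lit d (6 * P + 3 * s + kind P s) = c}"
      using t by (intro image_eqI[of _ _ "(P, s)"]) auto
  next
    fix t assume "t \<in> (\<lambda>(P, s). 6 * P + 3 * s + kind P s) `
      {(P, s). P < ?N \<and> s < 2 \<and> el n m lit d (6 * P + 3 * s + kind P s) = c}"
    then obtain P s where "t = 6 * P + 3 * s + kind P s" "P < ?N" "s < 2" "el n m lit d (6 * P + 3 * s + kind P s) = c"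
      by auto
    then show "t \<in> {t \<in> S. el n m lit d t = c}" using mem[of s "kind P s" P] kind3 by simp
  qed
  have card_fibre: "card {t \<in> S. el n m lit d t = c} =
      card {(P, s). P < ?N \<and> s < 2 \<and> el n m lit d (6 * P + 3 * s + kind P s) = c}" for d c
    unfolding fibre
  proof (rule card_image, rule inj_onI)
    fix x y assume x: "x \<in> {(P, s). P < ?N \<and> s < 2 \<and> el n m lit d (6 * P + 3 * s + kind P s) = c}"
      and y: "y \<in> {(P, s). P < ?N \<and> s < 2 \<and> el n m lit d (6 * P + 3 * s + kind P s) = c}"
      and eq: "(case x of (P, s) \<Rightarrow> 6 * P + 3 * s + kind P s) = (case y of (P, s) \<Rightarrow> 6 * P + 3 * s + kind P s)"
    obtain P s P' s' where xy: "x = (P, s)" "y = (P', s')" by (cases x, cases y)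
    have "s < 2" "s' < 2" "6 * P + 3 * s + kind P s = 6 * P' + 3 * s' + kind P' s'" using x y eq xy by auto
    then show "x = y" using decode(3,4)[of "kind P s" s P] decode(3,4)[of "kind P' s'" s' P'] kind3 xy by simp
  qed
  have one: "card {(P, s). P < ?N \<and> s < 2 \<and> el n m lit d (6 * P + 3 * s + kind P s) = c} = 1"
    if "P0 < ?N" "s0 < 2" "\<And>P s. P < ?N \<Longrightarrow> s < 2 \<Longrightarrow> el n m lit d (6 * P + 3 * s + kind P s) = c \<longleftrightarrow> P = P0 \<and> s = s0"
    for d c P0 s0
  proof -
    have "{(P, s). P < ?N \<and> s < 2 \<and> el n m lit d (6 * P + 3 * s + kind P s) = c} = {(P0, s0)}"
      using that by blast
    then show ?thesis by simp
  qed
  have none: "card {(P, s). P < ?N \<and> s < 2 \<and> el n m lit d (6 * P + 3 * s + kind P s) = c} = 0"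
    if "\<And>P s. P < ?N \<Longrightarrow> s < 2 \<Longrightarrow> el n m lit d (6 * P + 3 * s + kind P s) \<noteq> c" for d c
  proof -
    have "{(P, s). P < ?N \<and> s < 2 \<and> el n m lit d (6 * P + 3 * s + kind P s) = c} = {}"
      using that by blast
    then show ?thesis by (simp only: card.empty)
  qed
  have kind0: "kind P s = 0 \<longleftrightarrow> s = of_bool (\<not> \<alpha> (P mod n))" for P s by (simp add: kind_def)
  have dP: "P div n < m" if "P < ?N" for P using that n by (simp add: div_less_iff_less_mult)
  have mP: "(P + n) mod ?N < ?N" if "P < ?N" for P using n m by simp
  have c1: "card {t \<in> S. el n m lit 1 t = c} = dem n m 1 c" for c
  proof -
    consider "c < ?N" | j where "j < m" "c = ?N + j" | "c = ?N + m + 1" | "c = ?N + m \<or> ?N + m + 1 < c"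
    proof -
      assume a: "c < ?N \<Longrightarrow> thesis" "\<And>j. j < m \<Longrightarrow> c = ?N + j \<Longrightarrow> thesis" "c = ?N + m + 1 \<Longrightarrow> thesis"
        "c = ?N + m \<or> ?N + m + 1 < c \<Longrightarrow> thesis"
      show thesis using a(1,3,4) a(2)[of "c - ?N"] by (cases "c < ?N"; cases "c < ?N + m"; force)
    qed
    then show ?thesis
    proof cases
      case 1
      \<comment> \<open>The candidates for link \<open>c\<close> are \<open>(c, 0)\<close> and
        \<open>(Q, 1)\<close>, where \<open>Q\<close> precedes \<open>c\<close> in the chain. They
        belong to the same variable, so its truth value decides between them.\<close>
      have "c \<in> (\<lambda>P. (P + n) mod ?N) ` {..<?N}"
      proof -
        have "(\<lambda>P. (P + n) mod ?N) ` {..<?N} = {..<?N}"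
          by (rule endo_inj_surj) (use mP shift_mod_inj[OF nN] in auto)
        then show ?thesis using 1 by simp
      qed
      then obtain Q where Q: "Q < ?N" "(Q + n) mod ?N = c" by auto
      have Qmod: "Q mod n = c mod n" unfolding Q(2)[symmetric] by (simp add: mod_mod_cancel)
      have Quniq: "P = Q" if "P < ?N" "(P + n) mod ?N = c" for P
        using shift_mod_inj[OF nN] that Q by (simp add: inj_on_def)
      have "card {(P, s). P < ?N \<and> s < 2 \<and> el n m lit 1 (6 * P + 3 * s + kind P s) = c} = 1"
      proof (cases "\<alpha> (c mod n)")
        case True
        show ?thesis
        proof (rule one[of c 0])
          fix P s :: nat assume Ps: "P < ?N" "s < 2"
          show "el n m lit 1 (6 * P + 3 * s + kind P s) = c \<longleftrightarrow> P = c \<and> s = 0"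
          proof
            assume h: "el n m lit 1 (6 * P + 3 * s + kind P s) = c"
            then have k: "kind P s = 0" using 1 dP[OF Ps(1)] unfolding el1[OF Ps] by (auto split: if_splits)
            have "s = 0"
            proof (rule ccontr)
              assume s: "s \<noteq> 0"
              then have "P = Q" using h k Quniq[OF Ps(1)] unfolding el1[OF Ps] by simp
              then show False using k s True Qmod by (simp add: kind0)
            qed
            then show "P = c \<and> s = 0" using h k unfolding el1[OF Ps] by simp
          next
            assume "P = c \<and> s = 0"
            then show "el n m lit 1 (6 * P + 3 * s + kind P s) = c"
              using True unfolding el1[OF Ps] kind0 by simp
          qed
        qed (use 1 in auto)
      next
        case False
        show ?thesis
        proof (rule one[of Q 1])
          fix P s :: nat assume Ps: "P < ?N" "s < 2"
          show "el n m lit 1 (6 * P + 3 * s + kind P s) = c \<longleftrightarrow> P = Q \<and> s = 1"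
          proof
            assume h: "el n m lit 1 (6 * P + 3 * s + kind P s) = c"
            then have k: "kind P s = 0" using 1 dP[OF Ps(1)] unfolding el1[OF Ps] by (auto split: if_splits)
            have "s \<noteq> 0"
            proof
              assume s: "s = 0"
              then have "P = c" using h k unfolding el1[OF Ps] by simp
              then show False using k s False by (simp add: kind0)
            qed
            then show "P = Q \<and> s = 1" using h k Quniq[OF Ps(1)] Ps(2) unfolding el1[OF Ps] by simp
          next
            assume "P = Q \<and> s = 1"
            then show "el n m lit 1 (6 * P + 3 * s + kind P s) = c"
              using False Qmod Q(2) unfolding el1[OF Ps] kind0 by simp
          qed
        qed (use Q in auto)
      qed
      then show ?thesis unfolding card_fibre using 1 by (simp add: dem_def)
    next
      case (2 j)
      let ?P = "j * n + w j"
      have wj: "w j < n" using w 2 by blast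
      have P0: "?P < ?N" "?P div n = j" "?P mod n = w j" using pair_less[of j m "w j" n] 2 wj by auto
      have "card {(P, s). P < ?N \<and> s < 2 \<and> el n m lit 1 (6 * P + 3 * s + kind P s) = c} = 1"
      proof (rule one[of ?P "of_bool (\<alpha> (w j))"])
        fix P s :: nat assume Ps: "P < ?N" "s < 2"
        show "el n m lit 1 (6 * P + 3 * s + kind P s) = c \<longleftrightarrow> P = ?P \<and> s = of_bool (\<alpha> (w j))"
        proof
          assume "el n m lit 1 (6 * P + 3 * s + kind P s) = c"
          then have k: "kind P s = 1" "P div n = j" using 2 Ps(1) mP[OF Ps(1)] unfolding el1[OF Ps] by (auto split: if_splits)
          have "P mod n = w j" "s = of_bool (\<alpha> (P mod n))" using k unfolding kind1 flip[OF Ps(2)] by simp_all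
          then show "P = ?P \<and> s = of_bool (\<alpha> (w j))"
            using k(2) div_mult_mod_eq[of P n] by simp
        next
          assume h: "P = ?P \<and> s = of_bool (\<alpha> (w j))"
          then have "kind P s = 1" using P0 by (simp add: kind_def)
          then show "el n m lit 1 (6 * P + 3 * s + kind P s) = c" using h P0 2 unfolding el1[OF Ps] by simp
        qed
      qed (use P0 in auto)
      then show ?thesis unfolding card_fibre using 2 by (simp add: dem_def)
    next
      case 3
      \<comment> \<open>For each clause this class collects the \<open>n - 1\<close> variables other
        than its witness.\<close>
      have "{(P, s). P < ?N \<and> s < 2 \<and> el n m lit 1 (6 * P + 3 * s + kind P s) = c} =
          (\<lambda>(j, v). (j * n + v, of_bool (\<alpha> v))) ` (SIGMA j:{..<m}. {..<n} - {w j})" (is "?A = ?f ` ?B")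
      proof (intro equalityI subsetI)
        fix x assume "x \<in> ?A"
        then obtain P s where x: "x = (P, s)" and Ps: "P < ?N" "s < 2" and h: "el n m lit 1 (6 * P + 3 * s + kind P s) = c" by auto
        have "kind P s \<noteq> 0" "kind P s \<noteq> 1"
          using h 3 dP[OF Ps(1)] mP[OF Ps(1)] Ps(1) unfolding el1[OF Ps] by (auto split: if_splits)
        then have "s = of_bool (\<alpha> (P mod n))" "P mod n \<noteq> w (P div n)"
          unfolding kind0 kind1 flip[OF Ps(2)] by simp_all
        then show "x \<in> ?f ` ?B"
          using x dP[OF Ps(1)] n by (intro image_eqI[of _ _ "(P div n, P mod n)"]) simp_all
      next
        fix x assume "x \<in> ?f ` ?B"
        then obtain j v where jv: "j < m" "v < n" "v \<noteq> w j" "x = (j * n + v, of_bool (\<alpha> v))" by auto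
        let ?P = "j * n + v" and ?s = "of_bool (\<alpha> v) :: nat"
        have P: "?P < ?N" "?P div n = j" "?P mod n = v" using pair_less[of j m v n] jv by auto
        have "kind ?P ?s = 2" using P jv by (simp add: kind_def)
        then show "x \<in> ?A" using P(1) jv(4) 3 el1[OF P(1), of ?s] by simp
      qed
      moreover have "inj_on ?f ?B"
      proof (rule inj_onI)
        fix x y assume xy: "x \<in> ?B" "y \<in> ?B" "?f x = ?f y"
        obtain j v j' v' where e: "x = (j, v)" "y = (j', v')" by (cases x, cases y)
        have "v < n" "v' < n" "n * j + v = n * j' + v'" using xy e by (auto simp: mult.commute)
        then show "x = y" using mult_add_eq_iff[of v n v' j j'] e by simp
      qed
      moreover have "card ?B = ?N - m"
      proof -
        have "card ?B = (\<Sum>j<m. card ({..<n} - {w j}))" by (subst card_SigmaI) auto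
        also have "\<dots> = (\<Sum>j<m. n - 1)" using w by (intro sum.cong) auto
        finally show ?thesis by (simp add: diff_mult_distrib2)
      qed
      ultimately show ?thesis unfolding card_fibre using 3 by (simp add: card_image dem_def)
    next
      case 4
      have "card {(P, s). P < ?N \<and> s < 2 \<and> el n m lit 1 (6 * P + 3 * s + kind P s) = c} = 0"
      proof (rule none)
        fix P s :: nat assume Ps: "P < ?N" "s < 2"
        show "el n m lit 1 (6 * P + 3 * s + kind P s) \<noteq> c"
          using 4 dP[OF Ps(1)] mP[OF Ps(1)] Ps(1) unfolding el1[OF Ps] by (auto split: if_splits)
      qed
      then show ?thesis unfolding card_fibre using 4 by (auto simp: dem_def)
    qed
  qed
  have c2: "card {t \<in> S. el n m lit 2 t = c} = dem n m 2 c" for c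
  proof -
    consider "c < ?N" | "c = ?N" | "c > ?N" by linarith
    then show ?thesis
    proof cases
      case 1
      have "card {(P, s). P < ?N \<and> s < 2 \<and> el n m lit 2 (6 * P + 3 * s + kind P s) = c} = 1"
      proof (rule one[of c "of_bool (\<not> \<alpha> (c mod n))"])
        fix P s :: nat assume Ps: "P < ?N" "s < 2"
        show "el n m lit 2 (6 * P + 3 * s + kind P s) = c \<longleftrightarrow> P = c \<and> s = of_bool (\<not> \<alpha> (c mod n))"
          unfolding el2[OF Ps(2)] kind0 using 1 by auto
      qed (use 1 in auto)
      then show ?thesis unfolding card_fibre using 1 by (simp add: dem_def)
    next
      case 2
      have "{(P, s). P < ?N \<and> s < 2 \<and> el n m lit 2 (6 * P + 3 * s + kind P s) = c} =
          (\<lambda>P. (P, of_bool (\<alpha> (P mod n)))) ` {..<?N}" (is "?A = ?f ` ?B")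
      proof (intro equalityI subsetI)
        fix x assume "x \<in> ?A"
        then obtain P s where x: "x = (P, s)" and Ps: "P < ?N" "s < 2" and h: "el n m lit 2 (6 * P + 3 * s + kind P s) = c" by auto
        have "kind P s \<noteq> 0" using h Ps(1) 2 unfolding el2[OF Ps(2)] by (simp split: if_splits)
        then have "s = of_bool (\<alpha> (P mod n))" unfolding kind0 flip[OF Ps(2)] .
        then show "x \<in> ?f ` ?B" using x Ps(1) by simp
      next
        fix x assume "x \<in> ?f ` ?B"
        then obtain P where P: "P < ?N" "x = (P, of_bool (\<alpha> (P mod n)))" by auto
        then show "x \<in> ?A" using 2 el2[of "of_bool (\<alpha> (P mod n))" P] by (simp add: kind0)
      qed
      moreover have "inj_on ?f ?B" by (rule inj_onI) simp
      ultimately show ?thesis unfolding card_fibre using 2 by (simp add: card_image dem_def)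
    next
      case 3
      have "card {(P, s). P < ?N \<and> s < 2 \<and> el n m lit 2 (6 * P + 3 * s + kind P s) = c} = 0"
      proof (rule none)
        fix P s :: nat assume Ps: "P < ?N" "s < 2"
        show "el n m lit 2 (6 * P + 3 * s + kind P s) \<noteq> c" unfolding el2[OF Ps(2)] using 3 Ps by simp
      qed
      then show ?thesis unfolding card_fibre using 3 by (simp add: dem_def)
    qed
  qed
  have c3: "card {t \<in> S. el n m lit 3 t = c} = dem n m 3 c" for c
  proof (cases "c < 2 * ?N")
    case True
    have "card {(P, s). P < ?N \<and> s < 2 \<and> el n m lit 3 (6 * P + 3 * s + kind P s) = c} = 1"
    proof (rule one[of "c div 2" "c mod 2"])
      fix P s :: nat assume Ps: "P < ?N" "s < 2"
      show "el n m lit 3 (6 * P + 3 * s + kind P s) = c \<longleftrightarrow> P = c div 2 \<and> s = c mod 2"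
        unfolding el3[OF Ps(2)] using Ps(2) by presburger
    qed (use True in auto)
    then show ?thesis unfolding card_fibre using True by (simp add: dem_def)
  next
    case False
    have "card {(P, s). P < ?N \<and> s < 2 \<and> el n m lit 3 (6 * P + 3 * s + kind P s) = c} = 0"
    proof (rule none)
      fix P s :: nat assume Ps: "P < ?N" "s < 2"
      show "el n m lit 3 (6 * P + 3 * s + kind P s) \<noteq> c" unfolding el3[OF Ps(2)] using False Ps by linarith
    qed
    then show ?thesis unfolding card_fibre using False by (simp add: dem_def)
  qed
  have "S \<subseteq> {..<6 * ?N}" by (auto simp: S_def)
  then show ?thesis unfolding feasible_def using c1 c2 c3 by (intro exI[of _ S]) simp
qed

section \<open>Sizes of the classes and total demand\<close>

lemma dem_le_class:
  assumes lit: "\<And>j. j < m \<Longrightarrow> \<exists>v<n. \<exists>s<2. lit j v s"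
    and d: "d \<in> {1, 2, 3}"
  shows "dem n m d c \<le> card {t. t < 6 * (m * n) \<and> el n m lit d t = c}"
proof -
  let ?N = "m * n"
  let ?A = "{t. t < 6 * ?N \<and> el n m lit d t = c}"
  have one: "1 \<le> card ?A" if "t \<in> ?A" for t
    using card_mono[of ?A "{t}"] that by simp
  have many: "?N \<le> card ?A" if "\<And>P. P < ?N \<Longrightarrow> 6 * P + k \<in> ?A" for k
  proof -
    have "card ((\<lambda>P. 6 * P + k) ` {..<?N}) \<le> card ?A" by (rule card_mono) (use that in auto)
    moreover have "card ((\<lambda>P. 6 * P + k) ` {..<?N}) = ?N" by (subst card_image) (auto simp: inj_on_def)
    ultimately show ?thesis by simp
  qed
  consider "d = 1" | "d = 2" | "d = 3" using d by auto
  then show ?thesis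
  proof cases
    case 1
    consider "c < ?N" | j where "j < m" "c = ?N + j" | "c = ?N + m + 1" | "c = ?N + m \<or> ?N + m + 1 < c"
    proof -
      assume a: "c < ?N \<Longrightarrow> thesis" "\<And>j. j < m \<Longrightarrow> c = ?N + j \<Longrightarrow> thesis" "c = ?N + m + 1 \<Longrightarrow> thesis"
        "c = ?N + m \<or> ?N + m + 1 < c \<Longrightarrow> thesis"
      show thesis using a(1,3,4) a(2)[of "c - ?N"] by (cases "c < ?N"; cases "c < ?N + m"; force)
    qed
    then show ?thesis
    proof cases
      case c: 1
      have "6 * c + 3 * 0 + 0 \<in> ?A" using c decode[of 0 0 c] 1 by (simp add: el_def)
      then have "1 \<le> card ?A" by (rule one)
      then show ?thesis using c 1 by (simp add: dem_def)
    next
      case (2 j)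
      obtain v s where l: "v < n" "s < 2" "lit j v s" using lit[OF 2(1)] by blast
      let ?P = "j * n + v"
      have one_less: "(1 :: nat) < 3" by simp
      have P: "?P < ?N" "?P div n = j" "?P mod n = v" using pair_less[of j m v n] 2 l by auto
      have "6 * ?P + 3 * s + 1 \<in> ?A"
      proof -
        have "6 * Q + 3 * s + 1 < 6 * R" if "Q < R" for Q R :: nat using that l(2) by linarith
        then have "6 * ?P + 3 * s + 1 < 6 * ?N" using P(1) .
        moreover have "el n m lit 1 (6 * ?P + 3 * s + 1) = c"
          unfolding el_def decode[OF one_less l(2)] P(2,3) using l(3) 2 by simp
        ultimately show ?thesis using 1 by simp
      qed
      then have "1 \<le> card ?A" by (rule one)
      then show ?thesis using 2 1 by (simp add: dem_def)
    next
      case 3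
      have "?N \<le> card ?A"
      proof (rule many[of 2])
        fix P assume "P < ?N"
        then show "6 * P + 2 \<in> ?A" using decode[of 2 0 P] 3 1 by (simp add: el_def)
      qed
      then show ?thesis using 3 1 by (simp add: dem_def)
    next
      case 4
      then have "dem n m d c = 0" using 1 by (auto simp: dem_def)
      then show ?thesis by simp
    qed
  next
    case 2
    consider "c < ?N" | "c = ?N" | "c > ?N" by linarith
    then show ?thesis
    proof cases
      case c: 1
      have "6 * c + 3 * 0 + 0 \<in> ?A" using c decode[of 0 0 c] 2 by (simp add: el_def)
      then have "1 \<le> card ?A" by (rule one)
      then show ?thesis using c 2 by (simp add: dem_def)
    next
      case c: 2
      have "?N \<le> card ?A"
      proof (rule many[of 1])
        fix P assume "P < ?N"
        then show "6 * P + 1 \<in> ?A" using decode[of 1 0 P] c 2 by (simp add: el_def)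
      qed
      then show ?thesis using c 2 by (simp add: dem_def)
    next
      case c: 3
      then show ?thesis using 2 by (simp add: dem_def)
    qed
  next
    case 3
    show ?thesis
    proof (cases "c < 2 * ?N")
      case True
      have "3 * c \<in> ?A" using True 3 by (simp add: el_def)
      then have "1 \<le> card ?A" by (rule one)
      then show ?thesis using True 3 by (simp add: dem_def)
    qed (use 3 in \<open>simp add: dem_def\<close>)
  qed
qed

text \<open>The total demand is the same in all three partitions, which is the common number of
  marks that \<open>total_weight\<close> asks for.\<close>

lemma sum_dem:
  assumes "d \<in> {1, 2, 3}"
  shows "(\<Sum>c<2 * (m * n) + m + 2. dem n m d c) = 2 * (m * n)"
proof -
  let ?N = "m * n"
  have mN: "m \<le> ?N" using n by simp
  have split: "(\<Sum>i<a + b. g i) = (\<Sum>i<a. g i) + (\<Sum>i<b. g (a + i))" for a b :: nat and g :: "nat \<Rightarrow> nat"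
    by (induction b) auto
  consider "d = 1" | "d = 2" | "d = 3" using assms by auto
  then show ?thesis
  proof cases
    case 1
    have "(\<Sum>c<(?N + m) + (2 + ?N). dem n m d c) = (\<Sum>c<?N + m. 1) + (\<Sum>i<2 + ?N. dem n m d (?N + m + i))"
      unfolding split[of _ "?N + m"] using 1 by (simp add: dem_def)
    also have "(\<Sum>i<2 + ?N. dem n m d (?N + m + i)) = (\<Sum>i\<in>{1}. dem n m d (?N + m + i))"
      by (rule sum.mono_neutral_right) (use 1 in \<open>auto simp: dem_def\<close>)
    also have "\<dots> = ?N - m" using 1 by (simp add: dem_def)
    finally have "(\<Sum>c<(?N + m) + (2 + ?N). dem n m d c) = 2 * ?N" using mN by simp
    moreover have "2 * ?N + m + 2 = (?N + m) + (2 + ?N)" by simp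
    ultimately show ?thesis by (simp only:)
  next
    case 2
    have "(\<Sum>c<?N + (?N + m + 2). dem n m d c) = (\<Sum>c<?N. 1) + (\<Sum>i<?N + m + 2. dem n m d (?N + i))"
      unfolding split[of _ "?N"] using 2 by (simp add: dem_def)
    also have "(\<Sum>i<?N + m + 2. dem n m d (?N + i)) = (\<Sum>i\<in>{0}. dem n m d (?N + i))"
      by (rule sum.mono_neutral_right) (use 2 in \<open>auto simp: dem_def\<close>)
    also have "\<dots> = ?N" using 2 by (simp add: dem_def)
    finally have "(\<Sum>c<?N + (?N + m + 2). dem n m d c) = 2 * ?N" by simp
    moreover have "2 * ?N + m + 2 = ?N + (?N + m + 2)" by simp
    ultimately show ?thesis by (simp only:)
  next
    case 3
    have "(\<Sum>c<2 * ?N + (m + 2). dem n m d c) = (\<Sum>c<2 * ?N. 1) + (\<Sum>i<m + 2. dem n m d (2 * ?N + i))"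
      unfolding split[of _ "2 * ?N"] using 3 by (simp add: dem_def)
    also have "(\<Sum>i<m + 2. dem n m d (2 * ?N + i)) = 0" using 3 by (simp add: dem_def)
    finally show ?thesis by (simp add: add.assoc)
  qed
qed

end


section \<open>From satisfiability to Borda bribery\<close>

definition num_indices :: "nat \<Rightarrow> nat \<Rightarrow> nat" where "num_indices n m = 6 * (m * n)"

definition num_classes :: "nat \<Rightarrow> nat \<Rightarrow> nat" where "num_classes n m = 2 * (m * n) + m + 2"

definition item :: "nat \<Rightarrow> nat \<Rightarrow> (nat \<Rightarrow> nat \<Rightarrow> nat \<Rightarrow> bool) \<Rightarrow> nat \<Rightarrow> nat" where
  "item n m lit = weight (num_classes n m) (el n m lit) (mark (el n m lit) (dem n m))"

definition jump :: "nat \<Rightarrow> nat \<Rightarrow> nat" where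
  "jump n m = num_indices n m * capacity (num_classes n m)"

definition num_rivals :: "nat \<Rightarrow> nat \<Rightarrow> nat" where
  "num_rivals n m = num_indices n m * (capacity (num_classes n m) + 1)"

text \<open>The difference of gain and loss has to be 1 minus the displacement: an item rises by
  \<open>num_indices n m * item n m lit i\<close>, a jump back falls by \<open>jump n m\<close>, and
  all other rivals stay.\<close>

definition gain :: "nat \<Rightarrow> nat \<Rightarrow> nat \<Rightarrow> nat" where
  "gain n m i = (if i < 4 * num_indices n m then 0 else if i < 5 * num_indices n m then jump n m + 1 else 1)"

definition loss :: "nat \<Rightarrow> nat \<Rightarrow> (nat \<Rightarrow> nat \<Rightarrow> nat \<Rightarrow> bool) \<Rightarrow> nat \<Rightarrow> nat" where
  "loss n m lit i = (if i < 4 * num_indices n m then num_indices n m * item n m lit i - 1 else 0)"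

theorem borda_bribable_iff_satisfiable:
  assumes n: "n > 0" and m: "m > 0" and lit: "\<And>j. j < m \<Longrightarrow> \<exists>v<n. \<exists>s<2. lit j v s"
  shows "borda_bribable {..<Suc (num_rivals n m)}
      (all_votes (num_rivals n m) (jump n m + 1) (gain n m) (loss n m lit)) 2 (num_rivals n m)
    \<longleftrightarrow> satisfiable n m lit"
proof -
  let ?t = "num_indices n m"
  let ?E = "num_classes n m"
  let ?B = "capacity ?E"
  let ?w = "item n m lit"
  let ?M = "num_rivals n m"
  have t0: "?t \<ge> 6" using n m by (simp add: num_indices_def Suc_leI)
  have e: "el n m lit d t < ?E" if "t < ?t" for d t
    using el_less[OF n m, of t lit d] that by (simp add: num_indices_def num_classes_def)
  have r: "dem n m d c \<le> card {t. t < ?t \<and> el n m lit d t = c}" if "d \<in> {1, 2, 3}" for d c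
    using dem_le_class[OF n m lit that] by (simp add: num_indices_def)
  \<comment> \<open>Each class contains exactly as many marks as it demands, so the marks of a
    partition sum to its total demand.\<close>
  have marks: "card {t. t < ?t \<and> mark (el n m lit) (dem n m) d t} = 2 * (m * n)" if d: "d \<in> {1, 2, 3}" for d
  proof -
    let ?C = "\<lambda>c. {t. t < ?t \<and> el n m lit d t = c \<and> mark (el n m lit) (dem n m) d t}"
    have 1: "{t. t < ?t \<and> mark (el n m lit) (dem n m) d t} = (\<Union>c<?E. ?C c)"
      using e by auto
    have 2: "card (\<Union>c<?E. ?C c) = (\<Sum>c<?E. card (?C c))"
      by (rule card_UN_disjoint) auto
    have "card (?C c) = dem n m d c" for c
      by (rule card_mark[of "dem n m" d c ?t "el n m lit"]) (rule r[OF d])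
    then have 3: "(\<Sum>c<?E. card (?C c)) = (\<Sum>c<?E. dem n m d c)" by (simp only:)
    have 4: "(\<Sum>c<?E. dem n m d c) = 2 * (m * n)"
      unfolding num_classes_def by (rule sum_dem[OF n m d])
    show ?thesis unfolding 1 2 3 4 ..
  qed
  have w: "0 < ?w i" for i by (simp add: item_def weight_pos)
  have total: "(\<Sum>i<4 * ?t. ?w i) = ?t * ?B"
    unfolding item_def by (rule total_weight) (use e marks in auto)
  have M: "?M = ?t * (?B + 1)" by (simp add: num_rivals_def)
  \<comment> \<open>No digit of an item exceeds that of the capacity, so no item outweighs a bin and
    the losses fit into the \<open>jump n m + 1\<close> pairs of each rival.\<close>
  have B: "?w i \<le> ?B" if "i < 4 * ?t" for i
  proof -
    have "el n m lit d (i div 4) < ?E" for d using e[of "i div 4"] that by simp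
    then have "digit_id ?E (el n m lit) d i \<le> ?E" for d by (simp add: digit_id_def less_imp_le)
    moreover have "digit_mark a i \<le> 2" for a by (simp add: digit_mark_def)
    ultimately show ?thesis unfolding item_def weight_def capacity_def
      by (intro add_mono mult_le_mono2) auto
  qed
  have tw: "?t * ?w i > 0" for i using w t0 by simp
  have step1: "borda_bribable {..<Suc ?M} (all_votes ?M (jump n m + 1) (gain n m) (loss n m lit)) 2 ?M \<longleftrightarrow>
    (\<exists>p q. bij_betw p {..<?M} {..<?M} \<and> bij_betw q {..<?M} {..<?M} \<and>
      (\<forall>i<?M. int (q i) = int (p i) + displ (4 * ?t) ?t ?B ?w i))"
  proof (rule borda_bribable_iff_displacements)
    have "3 \<le> ?t * 1" using t0 by simp
    also have "\<dots> \<le> ?M" unfolding M by (intro mult_le_mono2) simp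
    finally show "3 \<le> ?M" .
    fix i assume "i < ?M"
    show "gain n m i \<le> jump n m + 1 \<and> loss n m lit i \<le> jump n m + 1 \<and> (gain n m i = 0 \<or> loss n m lit i = 0)"
    proof -
      have "?t * ?w i - 1 \<le> ?t * ?B + 1" if "i < 4 * ?t"
        using mult_le_mono2[OF B[OF that], of ?t] by linarith
      then show ?thesis by (simp add: gain_def loss_def jump_def)
    qed
    show "int (gain n m i) - int (loss n m lit i) = 1 - displ (4 * ?t) ?t ?B ?w i"
      using tw[of i] by (simp add: gain_def loss_def displ_def jump_def of_nat_diff)
  next
    show "(\<Sum>i<?M. displ (4 * ?t) ?t ?B ?w i) = 0" unfolding M by (rule sum_displ[OF w total])
  qed
  have step2: "(\<exists>p q. bij_betw p {..<?M} {..<?M} \<and> bij_betw q {..<?M} {..<?M} \<and>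
      (\<forall>i<?M. int (q i) = int (p i) + displ (4 * ?t) ?t ?B ?w i)) \<longleftrightarrow> packable (4 * ?t) ?t ?B ?w"
  proof
    assume "\<exists>p q. bij_betw p {..<?M} {..<?M} \<and> bij_betw q {..<?M} {..<?M} \<and>
      (\<forall>i<?M. int (q i) = int (p i) + displ (4 * ?t) ?t ?B ?w i)"
    then obtain p q where pq: "bij_betw p {..<?M} {..<?M}" "bij_betw q {..<?M} {..<?M}"
      "\<And>i. i < ?M \<Longrightarrow> int (q i) = int (p i) + displ (4 * ?t) ?t ?B ?w i" by blast
    show "packable (4 * ?t) ?t ?B ?w"
      by (rule packable_if_displacements[OF _ w total pq[unfolded M]]) (use t0 in auto)
  next
    assume "packable (4 * ?t) ?t ?B ?w"
    then show "\<exists>p q. bij_betw p {..<?M} {..<?M} \<and> bij_betw q {..<?M} {..<?M} \<and>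
      (\<forall>i<?M. int (q i) = int (p i) + displ (4 * ?t) ?t ?B ?w i)"
      unfolding M by (intro displacements_if_packable w total) (use t0 in auto)
  qed
  have step3: "packable (4 * ?t) ?t ?B ?w \<longleftrightarrow> feasible ?t ?E (el n m lit) (dem n m)"
    unfolding item_def by (rule packable_iff_feasible) (use e r in auto)
  have step4: "feasible ?t ?E (el n m lit) (dem n m) \<longleftrightarrow> satisfiable n m lit"
    using satisfiable_if_feasible[OF n m, of lit] feasible_if_satisfiable[OF n m, of lit]
    unfolding num_indices_def num_classes_def by blast
  show ?thesis unfolding step1 step2 step3 step4 ..
qed


section \<open>Computations as satisfiability instances\<close>

lemma poly_nat_mono: "a \<le> b \<Longrightarrow> poly T a \<le> poly T b" for a b :: nat
  by (induction T) (auto intro: add_mono mult_mono)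

lemma pt_poly: "pt f \<Longrightarrow> pt (\<lambda>x e. poly T (f x e))"
  by (induction T) (auto intro: pt_intros)

text \<open>Halting is turned into stuttering, so that a run can be described up to a time fixed in
  advance.\<close>

definition full_delta :: "tm \<Rightarrow> nat \<Rightarrow> nat list \<Rightarrow> nat \<times> (nat \<times> direction) list" where
  "full_delta M q as = (if q < num_states M then delta M q as else (q, map (\<lambda>a. (a, Stay)) as))"

text \<open>Shifted by one to be a natural number; a head in cell \<open>p\<close> moves to
  \<open>p + offset d - 1\<close>.\<close>

definition offset :: "direction \<Rightarrow> nat" where
  "offset d = (case d of Left \<Rightarrow> 0 | Stay \<Rightarrow> 1 | Right \<Rightarrow> 2)"

lemma move_head_offset: "move_head d h = h + int (offset d) - 1"
  by (cases d) (auto simp: offset_def)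

lemma offset_le: "offset d \<le> 2"
  by (cases d) (auto simp: offset_def)

section \<open>Runs of a machine, cell by cell\<close>

definition trace :: "tm \<Rightarrow> bool list \<Rightarrow> nat \<Rightarrow> config" where
  "trace M z t = (tm_step M ^^ t) (init_config M z)"

definition state_at :: "tm \<Rightarrow> bool list \<Rightarrow> nat \<Rightarrow> nat" where
  "state_at M z t = fst (trace M z t)"

definition cell_at :: "tm \<Rightarrow> bool list \<Rightarrow> nat \<Rightarrow> nat \<Rightarrow> int \<Rightarrow> nat" where
  "cell_at M z t i = fst (snd (trace M z t) ! i)"

definition head_at :: "tm \<Rightarrow> bool list \<Rightarrow> nat \<Rightarrow> nat \<Rightarrow> int" where
  "head_at M z t i = snd (snd (trace M z t) ! i)"

definition read_at :: "tm \<Rightarrow> bool list \<Rightarrow> nat \<Rightarrow> nat list" where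
  "read_at M z t = map (\<lambda>i. cell_at M z t i (head_at M z t i)) [0..<num_tapes M]"

lemma full_delta_wf:
  assumes "wf_tm M" "q \<le> num_states M" "length as = num_tapes M" "set as \<subseteq> {..<num_symbols M}"
    and "full_delta M q as = (q', acts)"
  shows "q' \<le> num_states M" "length acts = num_tapes M" "fst ` set acts \<subseteq> {..<num_symbols M}"
proof -
  have "q' \<le> num_states M \<and> length acts = num_tapes M \<and> fst ` set acts \<subseteq> {..<num_symbols M}"
  proof (cases "q < num_states M")
    case True
    have "\<forall>q<num_states M. \<forall>as. length as = num_tapes M \<and> set as \<subseteq> {..<num_symbols M} \<longrightarrow>
        (case delta M q as of (q', acts) \<Rightarrow> q' \<le> num_states M \<and> length acts = num_tapes M \<and>
           fst ` set acts \<subseteq> {..<num_symbols M})" using assms(1) unfolding wf_tm_def by (elim conjE)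
    from this[rule_format, OF True conjI[OF assms(3,4)]] show ?thesis
      using assms(5) True by (simp add: full_delta_def)
  next
    case False
    then have "q' = q" "acts = map (\<lambda>a. (a, Stay)) as" using assms(5) by (simp_all add: full_delta_def)
    then show ?thesis using assms(2-4) by (simp add: image_image)
  qed
  then show "q' \<le> num_states M" "length acts = num_tapes M" "fst ` set acts \<subseteq> {..<num_symbols M}" by auto
qed

lemma trace_invariant:
  assumes "wf_tm M"
  shows "length (snd (trace M z t)) = num_tapes M" "state_at M z t \<le> num_states M"
    and "i < num_tapes M \<Longrightarrow> cell_at M z t i h < num_symbols M"
    and "state_at M z (Suc t) = fst (full_delta M (state_at M z t) (read_at M z t))"
    and "i < num_tapes M \<Longrightarrow> cell_at M z (Suc t) i = (cell_at M z t i)(head_at M z t i :=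
      fst (snd (full_delta M (state_at M z t) (read_at M z t)) ! i))"
    and "i < num_tapes M \<Longrightarrow> head_at M z (Suc t) i =
      move_head (snd (snd (full_delta M (state_at M z t) (read_at M z t)) ! i)) (head_at M z t i)"
proof -
  define ok where "ok t \<longleftrightarrow> length (snd (trace M z t)) = num_tapes M \<and> state_at M z t \<le> num_states M \<and>
    (\<forall>i<num_tapes M. \<forall>h. cell_at M z t i h < num_symbols M)" for t
  have step: "state_at M z (Suc t) = fst (full_delta M (state_at M z t) (read_at M z t)) \<and>
    (\<forall>i<num_tapes M. cell_at M z (Suc t) i = (cell_at M z t i)(head_at M z t i :=
      fst (snd (full_delta M (state_at M z t) (read_at M z t)) ! i)) \<and>
     head_at M z (Suc t) i =
      move_head (snd (snd (full_delta M (state_at M z t) (read_at M z t)) ! i)) (head_at M z t i)) \<and> ok (Suc t)"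
    if ok: "ok t" for t
  proof -
    obtain q ts where qts: "trace M z t = (q, ts)" by (cases "trace M z t")
    have len: "length ts = num_tapes M" and q: "q \<le> num_states M"
      and sym: "\<And>i h. i < num_tapes M \<Longrightarrow> fst (ts ! i) h < num_symbols M"
      using ok by (auto simp: ok_def qts state_at_def cell_at_def)
    have rd: "read_at M z t = map tape_read ts"
      unfolding read_at_def using len by (auto simp: qts cell_at_def head_at_def tape_read_def intro!: nth_equalityI)
    obtain q' acts where d: "full_delta M q (map tape_read ts) = (q', acts)"
      by (cases "full_delta M q (map tape_read ts)")
    have "set (map tape_read ts) \<subseteq> {..<num_symbols M}"
    proof -
      have "tape_read (ts ! i) < num_symbols M" if "i < num_tapes M" for i
        using sym[OF that] by (simp add: tape_read_def)
      then have "\<forall>s\<in>set ts. tape_read s < num_symbols M" using len by (metis in_set_conv_nth)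
      then show ?thesis by auto
    qed
    then have wf: "q' \<le> num_states M" "length acts = num_tapes M" "fst ` set acts \<subseteq> {..<num_symbols M}"
      using full_delta_wf[OF assms q _ _ d] len by auto
    have eq: "trace M z (Suc t) = (q', map2 tape_act acts ts)"
    proof (cases "q < num_states M")
      case True
      then show ?thesis using d qts by (simp add: trace_def tm_step_def full_delta_def)
    next
      case False
      then have "q' = q" "acts = map (\<lambda>a. (a, Stay)) (map tape_read ts)" using d by (auto simp: full_delta_def)
      moreover have "map2 tape_act (map (\<lambda>a. (a, Stay)) (map tape_read ts)) ts = ts"
        by (auto simp: tape_act_Stay intro!: nth_equalityI)
      ultimately show ?thesis using False qts by (simp add: trace_def tm_step_def)
    qed
    have nth: "map2 tape_act acts ts ! i = tape_act (acts ! i) (ts ! i)" if "i < num_tapes M" for i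
      using that wf(2) len by simp
    have act: "fst (acts ! i) < num_symbols M" if "i < num_tapes M" for i
      using wf(2,3) that by (metis image_subset_iff lessThan_iff nth_mem)
    have st: "state_at M z t = q" "\<And>i. cell_at M z t i = fst (ts ! i)" "\<And>i. head_at M z t i = snd (ts ! i)"
      by (auto simp: state_at_def cell_at_def head_at_def qts)
    have st': "state_at M z (Suc t) = q'"
      "\<And>i. i < num_tapes M \<Longrightarrow> cell_at M z (Suc t) i = (fst (ts ! i))(snd (ts ! i) := fst (acts ! i))"
      "\<And>i. i < num_tapes M \<Longrightarrow> head_at M z (Suc t) i = move_head (snd (acts ! i)) (snd (ts ! i))"
      using nth by (auto simp: state_at_def cell_at_def head_at_def eq tape_act_def)
    have "ok (Suc t)"
      unfolding ok_def using st'(1,2) wf(1,2) sym act len by (auto simp: eq)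
    then show ?thesis using st st' d rd by auto
  qed
  have "ok t" for t
  proof (induction t)
    case 0
    have "num_tapes M \<ge> 2" "num_symbols M \<ge> 3" using assms by (auto simp: wf_tm_def)
    then show ?case
      by (auto simp: ok_def trace_def state_at_def cell_at_def init_config_def nth_Cons tape_word_def split: nat.split)
  next
    case (Suc t)
    then show ?case using step by blast
  qed
  then have ok: "ok t" for t .
  from ok[of t] show "length (snd (trace M z t)) = num_tapes M" "state_at M z t \<le> num_states M"
    "i < num_tapes M \<Longrightarrow> cell_at M z t i h < num_symbols M" by (auto simp: ok_def)
  from step[OF ok[of t]] show "state_at M z (Suc t) = fst (full_delta M (state_at M z t) (read_at M z t))"
    "i < num_tapes M \<Longrightarrow> cell_at M z (Suc t) i = (cell_at M z t i)(head_at M z t i :=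
      fst (snd (full_delta M (state_at M z t) (read_at M z t)) ! i))"
    "i < num_tapes M \<Longrightarrow> head_at M z (Suc t) i =
      move_head (snd (snd (full_delta M (state_at M z t) (read_at M z t)) ! i)) (head_at M z t i)"
    by auto
qed

lemma trace_0:
  assumes "wf_tm M" "i < num_tapes M"
  shows "state_at M z 0 = 0" "cell_at M z 0 i = tape_word (if i = 0 then z else [])" "head_at M z 0 i = 0"
  using assms by (auto simp: trace_def state_at_def cell_at_def head_at_def init_config_def nth_Cons split: nat.split)

text \<open>A head moves by at most one cell per step. This is why \<open>2 * time x + 1\<close>
  cells around the start suffice for the tableau.\<close>

lemma head_at_bound: "wf_tm M \<Longrightarrow> i < num_tapes M \<Longrightarrow> \<bar>head_at M z t i\<bar> \<le> int t"
proof (induction t)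
  case 0
  then show ?case by (simp add: trace_0)
next
  case (Suc t)
  have mv: "\<bar>move_head d h\<bar> \<le> \<bar>h\<bar> + 1" for d h by (cases d) auto
  have "\<bar>head_at M z (Suc t) i\<bar> \<le> \<bar>head_at M z t i\<bar> + 1"
    unfolding trace_invariant(6)[OF Suc.prems] by (rule mv)
  then show ?case using Suc by simp
qed

lemma halted_stays:
  assumes "state_at M z t = num_states M" "t \<le> t'"
  shows "trace M z t' = trace M z t"
  using assms(2)
proof (induction t' rule: dec_induct)
  case (step t')
  obtain q ts where "trace M z t = (q, ts)" by (cases "trace M z t")
  then show ?case using step assms(1) by (simp add: trace_def tm_step_def state_at_def)
qed simp

text \<open>The symbols in the first \<open>2 * length x + 1\<close> cells of
  \<open>enc_pair x u\<close>: \<open>True\<close> and a bit in turn, then the closing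
  \<open>False\<close>. They are the same for every certificate.\<close>

definition pair_symbol :: "bool list \<Rightarrow> nat \<Rightarrow> nat" where
  "pair_symbol x i = (if i < 2 * length x \<and> (i mod 2 = 0 \<or> bitat x (i div 2)) then 2 else 1)"

lemma length_enc_pair: "length (enc_pair x u) = 2 * length x + 1 + length u"
  by (induction x) (auto simp: enc_pair_def enc_list_def)

lemma nth_enc_pair:
  "i < 2 * length x + 1 \<Longrightarrow> enc_pair x u ! i \<longleftrightarrow> pair_symbol x i = 2"
  "enc_pair x u ! (2 * length x + 1 + j) = u ! j"
proof -
  have "enc_pair x u = concat (map (\<lambda>b. [True, b]) x) @ False # u" by (simp add: enc_pair_def enc_list_def)
  moreover have "length (concat (map (\<lambda>b. [True, b]) x)) = 2 * length x" by (induction x) auto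
  moreover have "concat (map (\<lambda>b. [True, b]) x) ! i \<longleftrightarrow> i mod 2 = 0 \<or> x ! (i div 2)" if "i < 2 * length x" for i
    using that
  proof (induction x arbitrary: i)
    case (Cons b x)
    consider "i = 0" | "i = 1" | k where "i = Suc (Suc k)" by (metis One_nat_def nat.exhaust)
    then show ?case using Cons by cases auto
  qed simp
  ultimately show "i < 2 * length x + 1 \<Longrightarrow> enc_pair x u ! i \<longleftrightarrow> pair_symbol x i = 2"
    "enc_pair x u ! (2 * length x + 1 + j) = u ! j"
    by (auto simp: nth_append pair_symbol_def bitat_def less_Suc_eq)
qed

lemma digit_split: "u < r \<Longrightarrow> (u + r * w) mod r = u" "u < r \<Longrightarrow> (u + r * w) div r = w" for u r w :: nat
  by (simp_all add: div_mult_self2)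

lemma tape_word_int: "tape_word w (int k) = (if k < length w then if w ! k then 2 else 1 else 0)"
  by (simp add: tape_word_def)

lemma tape_word_neg: "h < 0 \<Longrightarrow> tape_word w h = 0"
  by (simp add: tape_word_def)

section \<open>The tableau formula of a verifier\<close>

locale tableau =
  fixes M :: tm and R :: language and T1 T2 :: "nat poly" and trs :: "(nat \<times> nat list) list"
  assumes wf: "wf_tm M" and comp: "computes_in_time M (\<lambda>z. [z \<in> R]) (poly T1)"
    and trs: "set trs = {(q, as). q \<le> num_states M \<and> length as = num_tapes M \<and> set as \<subseteq> {..<num_symbols M}}"
begin

abbreviation "K \<equiv> num_tapes M"
abbreviation "G \<equiv> num_symbols M"
abbreviation "C \<equiv> length trs"

definition old_state where "old_state c = (if c < C then fst (trs ! c) else 0)"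
definition new_state where "new_state c = (if c < C then fst (case_prod (full_delta M) (trs ! c)) else 0)"
definition scan where "scan c i = (if c < C \<and> i < K then snd (trs ! c) ! i else 0)"
definition written where
  "written c i = (if c < C \<and> i < K then fst (snd (case_prod (full_delta M) (trs ! c)) ! i) else 0)"
definition moved where
  "moved c i = (if c < C \<and> i < K then offset (snd (snd (case_prod (full_delta M) (trs ! c)) ! i)) else 0)"

definition cert_len where "cert_len x = poly T2 (length x)"
definition in_len where "in_len x = 2 * length x + 1 + cert_len x"
text \<open>Besides the running time the bound also exceeds the length of the longest input, so the
  input lies within the cells numbered up to \<open>2 * time x\<close>.\<close>

definition time where "time x = poly T1 (in_len x) + in_len x + 1"
text \<open>Larger than every time, tape, cell, symbol, state and transition number, so that all of
  them are digits in this base.\<close>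

definition base where "base x = 2 * time x + K + G + num_states M + C + 5"

text \<open>The propositional variables, with kind 0: the state at time \<open>t\<close> is \<open>a\<close>; 1: symbol \<open>a\<close> is read on
  tape \<open>i\<close> at time \<open>t\<close>; 2: transition \<open>a\<close> is used at time \<open>t\<close>; 3: the head of tape \<open>i\<close> is in
  cell \<open>p\<close>; 4: cell \<open>p\<close> of tape \<open>i\<close> contains \<open>a\<close>. Cell \<open>0\<close> of a tape has the number \<open>time x\<close>.\<close>

definition cd where "cd x kd t i p a = kd + 5 * (t + base x * (i + base x * (p + base x * (a :: nat))))"

definition num_vars where "num_vars x = 5 * base x ^ 4"
definition num_clauses where "num_clauses x = 12 * base x ^ 5"

definition free where "free x i p \<longleftrightarrow> i = (0 :: nat) \<and> time x + 2 * length x + 1 \<le> p \<and> p < time x + in_len x"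
definition start_symbol where
  "start_symbol x i p = (if i = (0 :: nat) \<and> time x \<le> p \<and> p < time x + 2 * length x + 1 then pair_symbol x (p - time x) else 0)"

text \<open>The forms of clauses: 0 initial state, 1 initial heads, 2 initial contents, 3 a blank in
  the certificate area is followed by a blank, 4 scanned symbol, 5 applicable transition, 6 new
  state, 7 new head position, 8 written symbol, 9 preservation of the other cells, 10 the output is
  not \<open>False\<close>. An inactive index yields the tautology with variable 0 in both signs, so
  that every number below \<open>num_clauses x\<close> denotes a clause.\<close>

definition active where
  "active x f t i p p' a \<longleftrightarrow>
    f = (0 :: nat) \<or> (f = 1 \<and> i < K) \<or> (f = 2 \<and> i < K \<and> p \<le> 2 * time x) \<or> (f = 3 \<and> free x 0 p) \<or>
    (f = 4 \<and> t < time x \<and> i < K \<and> p \<le> 2 * time x \<and> a < G) \<or>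
    (f = 5 \<and> t < time x \<and> a < C) \<or> (f = 6 \<and> t < time x \<and> a < C) \<or>
    (f = 7 \<and> t < time x \<and> a < C \<and> i < K \<and> 1 \<le> p \<and> p \<le> 2 * time x) \<or>
    (f = 8 \<and> t < time x \<and> a < C \<and> i < K \<and> p \<le> 2 * time x) \<or>
    (f = 9 \<and> t < time x \<and> i < K \<and> p \<le> 2 * time x \<and> p' \<le> 2 * time x \<and> p \<noteq> p' \<and> a < G) \<or> (f = 10)"

definition posl where
  "posl x f t i p p' a v \<longleftrightarrow>
    (if active x f t i p p' a then
      (f = 0 \<and> v = cd x 0 0 0 0 0) \<or> (f = 1 \<and> v = cd x 3 0 i (time x) 0) \<or>
      (f = 2 \<and> free x i p \<and> (v = cd x 4 0 i p 0 \<or> v = cd x 4 0 i p 1 \<or> v = cd x 4 0 i p 2)) \<or>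
      (f = 2 \<and> \<not> free x i p \<and> v = cd x 4 0 i p (start_symbol x i p)) \<or>
      (f = 3 \<and> v = cd x 4 0 0 (p + 1) 0) \<or> (f = 4 \<and> v = cd x 1 t i 0 a) \<or> (f = 5 \<and> v = cd x 2 t 0 0 a) \<or>
      (f = 6 \<and> v = cd x 0 (t + 1) 0 0 (new_state a)) \<or> (f = 7 \<and> v = cd x 3 (t + 1) i (p + moved a i - 1) 0) \<or>
      (f = 8 \<and> v = cd x 4 (t + 1) i p (written a i)) \<or> (f = 9 \<and> v = cd x 4 (t + 1) i p' a)
    else v = 0)"

definition negl where
  "negl x f t i p p' a v \<longleftrightarrow>
    (if active x f t i p p' a then
      (f = 3 \<and> v = cd x 4 0 0 p 0) \<or> (f = 4 \<and> (v = cd x 3 t i p 0 \<or> v = cd x 4 t i p a)) \<or>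
      (f = 5 \<and> (v = cd x 0 t 0 0 (old_state a) \<or> (\<exists>i'<K. v = cd x 1 t i' 0 (scan a i')))) \<or>
      (f = 6 \<and> v = cd x 2 t 0 0 a) \<or> (f = 7 \<and> (v = cd x 2 t 0 0 a \<or> v = cd x 3 t i p 0)) \<or>
      (f = 8 \<and> (v = cd x 2 t 0 0 a \<or> v = cd x 3 t i p 0)) \<or>
      (f = 9 \<and> (v = cd x 3 t i p 0 \<or> v = cd x 4 t i p' a)) \<or> (f = 10 \<and> v = cd x 4 (time x) 1 (time x) 1)
    else v = 0)"

definition clause_lit where
  "clause_lit x j v s \<longleftrightarrow> (let f = j mod 12; t = j div 12 mod base x; i = j div 12 div base x mod base x;
      p = j div 12 div base x div base x mod base x;
      p' = j div 12 div base x div base x div base x mod base x;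
      a = j div 12 div base x div base x div base x div base x mod base x
    in (s = (1 :: nat) \<and> posl x f t i p p' a v) \<or> (s = 0 \<and> negl x f t i p p' a v))"

lemma time_bounds: "in_len x < time x" "poly T1 (in_len x) \<le> time x" "0 < time x"
  by (auto simp: time_def)

lemma base_bounds: "2 * time x + 1 < base x" "K < base x" "G < base x" "num_states M < base x" "C < base x"
  "4 < base x" "0 < base x" "time x < base x"
  by (auto simp: base_def)

lemma K2: "2 \<le> K" "3 \<le> G" using wf by (auto simp: wf_tm_def)

lemma cd_digits:
  assumes "kd < 5" "t < base x" "i < base x" "p < base x" "a < base x"
  shows "cd x kd t i p a mod 5 = kd" "cd x kd t i p a div 5 mod base x = t"
    "cd x kd t i p a div 5 div base x mod base x = i" "cd x kd t i p a div 5 div base x div base x mod base x = p"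
    "cd x kd t i p a div 5 div base x div base x div base x = a" "cd x kd t i p a < num_vars x"
proof -
  let ?b = "base x"
  have b: "?b > 0" by (rule base_bounds)
  note dm = digit_split[where r = ?b]
  have 5: "cd x kd t i p a mod 5 = kd" "cd x kd t i p a div 5 = t + ?b * (i + ?b * (p + ?b * a))"
    unfolding cd_def by (intro digit_split assms)+
  show "cd x kd t i p a mod 5 = kd" by (rule 5)
  show "cd x kd t i p a div 5 mod ?b = t" "cd x kd t i p a div 5 div ?b mod ?b = i"
    "cd x kd t i p a div 5 div ?b div ?b mod ?b = p" "cd x kd t i p a div 5 div ?b div ?b div ?b = a"
    unfolding 5 dm[OF assms(2)] dm[OF assms(3)] dm[OF assms(4)] by simp_all
  have bound: "u + r * w < r * W" if "u < r" "w < W" for u r w W :: nat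
  proof -
    have "u + r * w < r * (w + 1)" using that by simp
    also have "\<dots> \<le> r * W" using that by (intro mult_le_mono2) simp
    finally show ?thesis .
  qed
  have "cd x kd t i p a < 5 * (?b * (?b * (?b * ?b)))"
    unfolding cd_def by (intro bound assms)
  then show "cd x kd t i p a < num_vars x" by (simp add: num_vars_def eval_nat_numeral)
qed

lemma clause_digits:
  assumes "f < 12" "t < base x" "i < base x" "p < base x" "p' < base x" "a < base x"
  obtains j where "j < num_clauses x" "\<And>v s. clause_lit x j v s \<longleftrightarrow>
    (s = 1 \<and> posl x f t i p p' a v) \<or> (s = 0 \<and> negl x f t i p p' a v)"
proof -
  let ?b = "base x"
  have b: "?b > 0" by (rule base_bounds)
  note dm = digit_split[where r = ?b]
  define j where "j = f + 12 * (t + ?b * (i + ?b * (p + ?b * (p' + ?b * a))))"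
  have j: "j mod 12 = f" "j div 12 = t + ?b * (i + ?b * (p + ?b * (p' + ?b * a)))"
    unfolding j_def by (intro digit_split assms)+
  have bound: "u + r * w < r * W" if "u < r" "w < W" for u r w W :: nat
  proof -
    have "u + r * w < r * (w + 1)" using that by simp
    also have "\<dots> \<le> r * W" using that by (intro mult_le_mono2) simp
    finally show ?thesis .
  qed
  have "j < 12 * (?b * (?b * (?b * (?b * ?b))))"
    unfolding j_def by (intro bound assms)
  then have "j < num_clauses x" by (simp add: num_clauses_def eval_nat_numeral)
  moreover have "clause_lit x j v s \<longleftrightarrow> (s = 1 \<and> posl x f t i p p' a v) \<or> (s = 0 \<and> negl x f t i p p' a v)" for v s
    unfolding clause_lit_def Let_def j dm[OF assms(2)] dm[OF assms(3)] dm[OF assms(4)] dm[OF assms(5)]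
    using assms(6) by simp
  ultimately show thesis by (rule that)
qed

lemma trs_nth:
  assumes "c < C"
  shows "old_state c \<le> num_states M" "length (snd (trs ! c)) = K" "i < K \<Longrightarrow> scan c i < G"
    "new_state c \<le> num_states M" "i < K \<Longrightarrow> written c i < G" "moved c i \<le> 2"
proof -
  obtain q as where c: "trs ! c = (q, as)" by (cases "trs ! c")
  have "(q, as) \<in> set trs" using assms c by (metis nth_mem)
  then have *: "q \<le> num_states M" "length as = K" "set as \<subseteq> {..<G}" unfolding trs by auto
  obtain q' acts where d: "full_delta M q as = (q', acts)" by (cases "full_delta M q as")
  note wfd = full_delta_wf[OF wf * d]
  show "old_state c \<le> num_states M" "length (snd (trs ! c)) = K" "new_state c \<le> num_states M"
    using assms c * d wfd by (auto simp: old_state_def new_state_def)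
  show "i < K \<Longrightarrow> scan c i < G" using assms c * by (auto simp: scan_def subset_iff)
  show "i < K \<Longrightarrow> written c i < G" using assms c d wfd(2,3) by (auto simp: written_def image_subset_iff)
  show "moved c i \<le> 2" by (simp add: moved_def offset_le)
qed

lemma transition_used:
  obtains c where "c < C" "old_state c = state_at M z t" "new_state c = state_at M z (Suc t)"
    "\<And>i. i < K \<Longrightarrow> scan c i = cell_at M z t i (head_at M z t i)"
    "\<And>i. i < K \<Longrightarrow> cell_at M z (Suc t) i = (cell_at M z t i)(head_at M z t i := written c i)"
    "\<And>i. i < K \<Longrightarrow> head_at M z (Suc t) i = head_at M z t i + int (moved c i) - 1"
proof -
  note inv = trace_invariant[OF wf, where z = z and t = t]
  have "(state_at M z t, read_at M z t) \<in> set trs"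
    unfolding trs using inv(2,3) by (auto simp: read_at_def)
  then obtain c where c: "c < C" "trs ! c = (state_at M z t, read_at M z t)" by (auto simp: in_set_conv_nth)
  have rd: "length (read_at M z t) = K" "\<And>i. i < K \<Longrightarrow> read_at M z t ! i = cell_at M z t i (head_at M z t i)"
    by (auto simp: read_at_def)
  show thesis
  proof (rule that[of c])
    show "c < C" "old_state c = state_at M z t" using c by (simp_all add: old_state_def)
    show "new_state c = state_at M z (Suc t)" using c inv(4) by (simp add: new_state_def)
    show "scan c i = cell_at M z t i (head_at M z t i)" if "i < K" for i
      using c rd(2)[OF that] that by (simp add: scan_def)
    show "cell_at M z (Suc t) i = (cell_at M z t i)(head_at M z t i := written c i)" if "i < K" for i
      using c inv(5)[OF that] that by (simp add: written_def)
    show "head_at M z (Suc t) i = head_at M z t i + int (moved c i) - 1" if "i < K" for i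
      using c inv(6)[OF that] that by (simp add: moved_def move_head_offset)
  qed
qed

lemma output_at:
  assumes "length z \<le> in_len x"
  shows "cell_at M z (time x) 1 0 = (if z \<in> R then 2 else 1)"
proof -
  obtain t where t: "t \<le> poly T1 (length z)" "halted_with M [z \<in> R] (trace M z t)"
    using comp unfolding computes_in_time_def trace_def by blast
  have "t \<le> time x" using t(1) poly_nat_mono[OF assms, of T1] time_bounds(2)[of x] by linarith
  then have "trace M z (time x) = trace M z t"
    using t(2) by (intro halted_stays) (auto simp: halted_with_def state_at_def)
  then show ?thesis using t(2) by (simp add: cell_at_def halted_with_def tape_word_def)
qed

lemma in_reach:
  assumes "i < K" "t \<le> time x"
  shows "int (nat (head_at M z t i + int (time x))) = head_at M z t i + int (time x)"
    "nat (head_at M z t i + int (time x)) \<le> 2 * time x"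
    "t < time x \<Longrightarrow> 1 \<le> nat (head_at M z t i + int (time x))"
  using head_at_bound[OF wf assms(1), of z t] assms(2) by auto

text \<open>The clauses are implications along the run. An assignment may make further variables
  true, but it has to make all those true that describe the run of the machine on the certificate
  read off from it; the last form then excludes rejection.\<close>

lemma certificate_from_assignment:
  assumes "satisfiable (num_vars x) (num_clauses x) (clause_lit x)"
  shows "\<exists>u. length u \<le> cert_len x \<and> enc_pair x u \<in> R"
proof -
  from assms[unfolded satisfiable_def]
  obtain \<alpha> where "\<forall>j<num_clauses x. \<exists>v<num_vars x. clause_lit x j v (of_bool (\<alpha> v))" ..
  note \<alpha> = this[rule_format]
  have cl: "\<exists>v. (\<alpha> v \<and> posl x f t i p p' a v) \<or> (\<not> \<alpha> v \<and> negl x f t i p p' a v)"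
    if digits: "f < 12" "t < base x" "i < base x" "p < base x" "p' < base x" "a < base x" for f t i p p' a
  proof -
    obtain j where j: "j < num_clauses x" "\<And>v s. clause_lit x j v s \<longleftrightarrow>
      (s = 1 \<and> posl x f t i p p' a v) \<or> (s = 0 \<and> negl x f t i p p' a v)" using clause_digits[OF digits] by blast
    obtain v where "clause_lit x j v (of_bool (\<alpha> v))" using \<alpha>[OF j(1)] by blast
    then show ?thesis unfolding j(2) by (auto simp: of_bool_def split: if_splits)
  qed
  let ?T = "time x"
  let ?n = "length x"
  note bb = base_bounds[of x]
  have T: "in_len x < ?T" by (rule time_bounds)
  have s0: "\<alpha> (cd x 0 0 0 0 0)" using cl[of 0 0 0 0 0 0] bb by (simp add: posl_def negl_def active_def)
  have h0: "\<alpha> (cd x 3 0 i ?T 0)" if "i < K" for i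
    using cl[of 1 0 i 0 0 0] bb that by (simp add: posl_def negl_def active_def)
  have c0: "\<alpha> (cd x 4 0 i p (start_symbol x i p))" if "i < K" "p \<le> 2 * ?T" "\<not> free x i p" for i p
    using cl[of 2 0 i p 0 0] bb that by (simp add: posl_def negl_def active_def)
  have c1: "\<alpha> (cd x 4 0 0 p 0) \<or> \<alpha> (cd x 4 0 0 p 1) \<or> \<alpha> (cd x 4 0 0 p 2)" if "free x 0 p" for p
  proof -
    have "p \<le> 2 * ?T" "0 < K" using that T K2 by (auto simp: free_def)
    then show ?thesis using cl[of 2 0 0 p 0 0] bb that by (auto simp: posl_def negl_def active_def)
  qed
  have c2: "\<alpha> (cd x 4 0 0 (p + 1) 0)" if "free x 0 p" "\<alpha> (cd x 4 0 0 p 0)" for p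
  proof -
    have "p \<le> 2 * ?T" using that T by (auto simp: free_def)
    then show ?thesis using cl[of 3 0 0 p 0 0] bb that by (auto simp: posl_def negl_def active_def)
  qed
  have rd: "\<alpha> (cd x 1 t i 0 a)" if "t < ?T" "i < K" "p \<le> 2 * ?T" "a < G" "\<alpha> (cd x 3 t i p 0)" "\<alpha> (cd x 4 t i p a)" for t i p a
    using cl[of 4 t i p 0 a] bb that by (auto simp: posl_def negl_def active_def)
  have tr: "\<alpha> (cd x 2 t 0 0 c)" if "t < ?T" "c < C" "\<alpha> (cd x 0 t 0 0 (old_state c))"
    "\<And>i. i < K \<Longrightarrow> \<alpha> (cd x 1 t i 0 (scan c i))" for t c
    using cl[of 5 t 0 0 0 c] bb that by (auto simp: posl_def negl_def active_def)
  have st: "\<alpha> (cd x 0 (t + 1) 0 0 (new_state c))" if "t < ?T" "c < C" "\<alpha> (cd x 2 t 0 0 c)" for t c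
    using cl[of 6 t 0 0 0 c] bb that by (auto simp: posl_def negl_def active_def)
  have hd: "\<alpha> (cd x 3 (t + 1) i (p + moved c i - 1) 0)"
    if "t < ?T" "c < C" "i < K" "1 \<le> p" "p \<le> 2 * ?T" "\<alpha> (cd x 2 t 0 0 c)" "\<alpha> (cd x 3 t i p 0)" for t c i p
    using cl[of 7 t i p 0 c] bb that by (auto simp: posl_def negl_def active_def)
  have wr: "\<alpha> (cd x 4 (t + 1) i p (written c i))"
    if "t < ?T" "c < C" "i < K" "p \<le> 2 * ?T" "\<alpha> (cd x 2 t 0 0 c)" "\<alpha> (cd x 3 t i p 0)" for t c i p
    using cl[of 8 t i p 0 c] bb that by (auto simp: posl_def negl_def active_def)
  have kp: "\<alpha> (cd x 4 (t + 1) i p' a)"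
    if "t < ?T" "i < K" "p \<le> 2 * ?T" "p' \<le> 2 * ?T" "p \<noteq> p'" "a < G" "\<alpha> (cd x 3 t i p 0)" "\<alpha> (cd x 4 t i p' a)" for t i p p' a
    using cl[of 9 t i p p' a] bb that by (auto simp: posl_def negl_def active_def)
  have fin: "\<not> \<alpha> (cd x 4 ?T 1 ?T 1)"
    using cl[of 10 0 0 0 0 0] bb by (auto simp: posl_def negl_def active_def)
  define q where "q i = ?T + 2 * ?n + 1 + i" for i
  have fq: "free x 0 (q i) \<longleftrightarrow> i < cert_len x" for i by (auto simp: free_def q_def in_len_def)
  \<comment> \<open>The certificate ends at the first free cell that may be blank. Earlier cells
    have to hold a bit, and later ones are blank by the clauses of form 3.\<close>
  define l where "l = bmin (cert_len x) (\<lambda>i. \<alpha> (cd x 4 0 0 (q i) 0))"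
  define u where "u = map (\<lambda>i. \<alpha> (cd x 4 0 0 (q i) 2)) [0..<l]"
  have l: "l \<le> cert_len x" unfolding l_def by (rule bmin_le)
  have u1: "\<alpha> (cd x 4 0 0 (q i) (if u ! i then 2 else 1))" if "i < l" for i
  proof -
    have "\<not> \<alpha> (cd x 4 0 0 (q i) 0)" using that bmin_least unfolding l_def by blast
    then show ?thesis using c1[of "q i"] fq[of i] that l by (auto simp: u_def)
  qed
  have u2: "\<alpha> (cd x 4 0 0 (q i) 0)" if "l \<le> i" "i < cert_len x" for i
    using that
  proof (induction i rule: dec_induct)
    case base
    then show ?case using bmin_holds[of "cert_len x"] unfolding l_def by blast
  next
    case (step i)
    then show ?case using c2[of "q i"] fq[of i] by (simp add: q_def)
  qed
  define z where "z = enc_pair x u"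
  have zlen: "length z = 2 * ?n + 1 + l" by (simp add: z_def length_enc_pair u_def)
  have zin: "length z \<le> in_len x" using zlen l by (simp add: in_len_def)
  have cells0: "\<alpha> (cd x 4 0 i p (cell_at M z 0 i (int p - int ?T)))" if i: "i < K" and p: "p \<le> 2 * ?T" for i p
  proof (cases "free x i p")
    case True
    then have i0: "i = 0" by (simp add: free_def)
    define k where "k = p - (?T + 2 * ?n + 1)"
    have pk: "p = q k" "k < cert_len x" using True by (auto simp: free_def k_def q_def in_len_def)
    have ip: "int p - int ?T = int (2 * ?n + 1 + k)" using pk by (simp add: q_def)
    have "cell_at M z 0 i (int p - int ?T) = (if k < l then if u ! k then 2 else 1 else 0)"
    proof -
      have "cell_at M z 0 i (int p - int ?T) = tape_word z (int (2 * ?n + 1 + k))"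
        unfolding ip using trace_0(2)[OF wf i] i0 by simp
      also have "\<dots> = (if k < l then if u ! k then 2 else 1 else 0)"
        unfolding tape_word_int zlen unfolding z_def nth_enc_pair(2) by simp
      finally show ?thesis .
    qed
    then show ?thesis using u1[of k] u2[of k] pk i0 by (auto split: if_splits)
  next
    case False
    have "cell_at M z 0 i (int p - int ?T) = start_symbol x i p"
    proof (cases "i = 0 \<and> ?T \<le> p")
      case True
      define k where "k = p - ?T"
      have ip: "int p - int ?T = int k" using True by (simp add: k_def)
      have "k < 2 * ?n + 1 \<or> 2 * ?n + 1 + cert_len x \<le> k" using False True by (auto simp: free_def k_def in_len_def)
      moreover have "k < 2 * ?n + 1 \<Longrightarrow> pair_symbol x k = (if z ! k then 2 else 1)"
        using nth_enc_pair(1)[of k x u] by (auto simp: z_def pair_symbol_def)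
      moreover have "cell_at M z 0 i (int p - int ?T) = tape_word z (int k)"
        unfolding ip using trace_0(2)[OF wf i] True by simp
      moreover have "start_symbol x i p = (if k < 2 * ?n + 1 then pair_symbol x k else 0)"
        using True by (auto simp: start_symbol_def k_def)
      ultimately show ?thesis using zlen l by (auto simp: tape_word_int)
    next
      case neg: False
      have "cell_at M z 0 i (int p - int ?T) = 0"
      proof (cases "i = 0")
        case True
        then have "int p - int ?T < 0" using neg by simp
        then show ?thesis using trace_0(2)[OF wf i] True by (simp add: tape_word_neg)
      next
        case False
        then show ?thesis using trace_0(2)[OF wf i] by (simp add: tape_word_def)
      qed
      then show ?thesis using neg by (auto simp: start_symbol_def)
    qed
    then show ?thesis using c0[OF i p False] by simp
  qed
  define pos where "pos t i = nat (head_at M z t i + int ?T)" for t i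
  \<comment> \<open>The variables of the actual configuration are propagated from one time to the
    next by the forms 4 to 9.\<close>
  have run: "\<alpha> (cd x 0 t 0 0 (state_at M z t)) \<and> (\<forall>i<K. \<alpha> (cd x 3 t i (pos t i) 0) \<and>
      (\<forall>p\<le>2 * ?T. \<alpha> (cd x 4 t i p (cell_at M z t i (int p - int ?T)))))" if "t \<le> ?T" for t
    using that
  proof (induction t)
    case 0
    have "0 < K" using K2 by simp
    then have "state_at M z 0 = 0" by (rule trace_0(1)[OF wf])
    moreover have "pos 0 i = ?T" if "i < K" for i unfolding pos_def trace_0(3)[OF wf that] by simp
    ultimately show ?case using s0 h0 cells0 by simp
  next
    case (Suc t)
    then have t: "t < ?T" and IH: "\<alpha> (cd x 0 t 0 0 (state_at M z t))" "\<And>i. i < K \<Longrightarrow> \<alpha> (cd x 3 t i (pos t i) 0)"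
      "\<And>i p. i < K \<Longrightarrow> p \<le> 2 * ?T \<Longrightarrow> \<alpha> (cd x 4 t i p (cell_at M z t i (int p - int ?T)))" by auto
    obtain c where c: "c < C" "old_state c = state_at M z t" "new_state c = state_at M z (Suc t)"
      "\<And>i. i < K \<Longrightarrow> scan c i = cell_at M z t i (head_at M z t i)"
      "\<And>i. i < K \<Longrightarrow> cell_at M z (Suc t) i = (cell_at M z t i)(head_at M z t i := written c i)"
      "\<And>i. i < K \<Longrightarrow> head_at M z (Suc t) i = head_at M z t i + int (moved c i) - 1"
      using transition_used[where z = z and t = t] by metis
    have ps: "int (pos t i) = head_at M z t i + int ?T" "pos t i \<le> 2 * ?T" "1 \<le> pos t i" if "i < K" for i
      unfolding pos_def using in_reach[OF that, where t = t and x = x and z = z] t by auto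
    have "\<alpha> (cd x 1 t i 0 (scan c i))" if i: "i < K" for i
    proof (rule rd[OF t i ps(2)[OF i]])
      show "scan c i < G" by (rule trs_nth(3)[OF c(1) i])
      show "\<alpha> (cd x 3 t i (pos t i) 0)" by (rule IH(2)[OF i])
      show "\<alpha> (cd x 4 t i (pos t i) (scan c i))" using IH(3)[OF i ps(2)[OF i]] ps(1)[OF i] c(4)[OF i] by simp
    qed
    then have trc: "\<alpha> (cd x 2 t 0 0 c)" using tr[OF t c(1)] IH(1) c(2) by simp
    have "\<alpha> (cd x 0 (Suc t) 0 0 (state_at M z (Suc t)))" using st[OF t c(1) trc] c(3) by simp
    moreover have "\<alpha> (cd x 3 (Suc t) i (pos (Suc t) i) 0)" if i: "i < K" for i
    proof -
      have "pos (Suc t) i = pos t i + moved c i - 1"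
        using ps(1,3)[OF i] c(6)[OF i] unfolding pos_def[of "Suc t"] by linarith
      then show ?thesis using hd[OF t c(1) i ps(3,2)[OF i] trc IH(2)[OF i]] by simp
    qed
    moreover have "\<alpha> (cd x 4 (Suc t) i p (cell_at M z (Suc t) i (int p - int ?T)))" if i: "i < K" and p: "p \<le> 2 * ?T" for i p
    proof (cases "p = pos t i")
      case True
      then have "int p - int ?T = head_at M z t i" using ps(1)[OF i] by simp
      then show ?thesis using wr[OF t c(1) i ps(2)[OF i] trc IH(2)[OF i]] c(5)[OF i] True by simp
    next
      case False
      then have ne: "int p - int ?T \<noteq> head_at M z t i" using ps(1)[OF i] by linarith
      have "\<alpha> (cd x 4 (t + 1) i p (cell_at M z t i (int p - int ?T)))"
        by (rule kp[OF t i ps(2)[OF i] p False[symmetric] _ IH(2)[OF i] IH(3)[OF i p]])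
          (rule trace_invariant(3)[OF wf i])
      then show ?thesis using c(5)[OF i] ne by simp
    qed
    ultimately show ?case by blast
  qed
  have "\<alpha> (cd x 4 ?T 1 ?T (cell_at M z ?T 1 0))"
  proof -
    have 1: "1 < K" using K2 by simp
    have "\<forall>p\<le>2 * ?T. \<alpha> (cd x 4 ?T 1 p (cell_at M z ?T 1 (int p - int ?T)))"
      using run[OF order_refl] 1 by blast
    from this[rule_format, of ?T] show ?thesis by simp
  qed
  \<comment> \<open>Otherwise the output cell would hold the symbol 1, and the variable saying so
    would be true.\<close>
  then have "z \<in> R" using fin output_at[OF zin] by (auto split: if_splits)
  then show ?thesis using l by (intro exI[of _ u]) (auto simp: z_def u_def)
qed

text \<open>A variable is set to the truth of its meaning in the accepting run, after decoding its
  coordinates; every clause then states a property of the run.\<close>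

lemma assignment_from_certificate:
  assumes u: "length u \<le> cert_len x" "enc_pair x u \<in> R"
  shows "satisfiable (num_vars x) (num_clauses x) (clause_lit x)"
proof -
  define z where "z = enc_pair x u"
  have zlen: "length z = 2 * length x + 1 + length u" by (simp add: z_def length_enc_pair)
  have zin: "length z \<le> in_len x" using zlen u(1) by (simp add: in_len_def)
  let ?T = "time x"
  let ?n = "length x"
  let ?b = "base x"
  note bb = base_bounds[of x]
  have T: "in_len x < ?T" by (rule time_bounds)
  define tr where "tr kd t i p a \<longleftrightarrow> (if kd = 0 then a = state_at M z t
    else if kd = 1 then a = cell_at M z t i (head_at M z t i)
    else if kd = 2 then a < C \<and> trs ! a = (state_at M z t, read_at M z t)
    else if kd = 3 then int p = head_at M z t i + int ?T
    else a = cell_at M z t i (int p - int ?T))" for kd t i p a :: nat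
  define \<alpha> where "\<alpha> v = tr (v mod 5) (v div 5 mod ?b) (v div 5 div ?b mod ?b) (v div 5 div ?b div ?b mod ?b)
    (v div 5 div ?b div ?b div ?b)" for v
  have \<alpha>_cd: "\<alpha> (cd x kd t i p a) \<longleftrightarrow> tr kd t i p a" "cd x kd t i p a < num_vars x"
    if "kd < 5" "t < ?b" "i < ?b" "p < ?b" "a < ?b" for kd t i p a
    unfolding \<alpha>_def cd_digits(1-5)[OF that] using cd_digits(6)[OF that] by auto
  have nv: "0 < num_vars x" using bb(7) by (simp add: num_vars_def)
  have main: "\<exists>v<num_vars x. (\<alpha> v \<and> posl x f t i p p' a v) \<or> (\<not> \<alpha> v \<and> negl x f t i p p' a v)"
    if digits: "f < 12" "t < ?b" "i < ?b" "p < ?b" "p' < ?b" "a < ?b" for f t i p p' a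
  proof (cases "active x f t i p p' a")
    case False
    then have "posl x f t i p p' a 0" "negl x f t i p p' a 0" by (auto simp: posl_def negl_def)
    then show ?thesis using nv by blast
  next
    case True
    have pos: "?thesis" if "\<alpha> v" "posl x f t i p p' a v" "v < num_vars x" for v using that by blast
    have neg: "?thesis" if "\<not> \<alpha> v" "negl x f t i p p' a v" "v < num_vars x" for v using that by blast
    \<comment> \<open>For an implication the clause is assumed to fail. Its negated variables are
      then true by \<open>prem\<close>, from which the positive literal is derived.\<close>
    have imp: "?thesis" if "posl x f t i p p' a v" "v < num_vars x" "\<not> ?thesis \<Longrightarrow> \<alpha> v" for v using that by blast
    have prem: "\<alpha> v" if "\<not> ?thesis" "negl x f t i p p' a v" "v < num_vars x" for v using that by blast
    consider "f = 0" | "f = 1" | "f = 2" | "f = 3" | "f = 4" | "f = 5" | "f = 6" | "f = 7" | "f = 8" | "f = 9" | "f = 10"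
      using True unfolding active_def by blast
    then show ?thesis
    proof cases
      case 1
      show ?thesis
        by (rule pos[of "cd x 0 0 0 0 0"])
          (use True 1 bb K2 trace_0(1)[OF wf, of 0] in \<open>auto simp: \<alpha>_cd tr_def posl_def\<close>)
    next
      case 2
      then have "i < K" using True by (simp add: active_def)
      then show ?thesis
        by (intro pos[of "cd x 3 0 i ?T 0"])
          (use True 2 bb trace_0(3)[OF wf, of i] in \<open>auto simp: \<alpha>_cd tr_def posl_def\<close>)
    next
      case 3
      then have i: "i < K" and p: "p \<le> 2 * ?T" using True by (auto simp: active_def)
      let ?a = "cell_at M z 0 i (int p - int ?T)"
      have "?a \<le> 2" using trace_0(2)[OF wf i, of z] by (simp add: tape_word_def)
      have "posl x f t i p p' a (cd x 4 0 i p ?a)"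
      proof (cases "free x i p")
        case free: True
        from \<open>?a \<le> 2\<close> have "?a = 0 \<or> ?a = 1 \<or> ?a = 2" by linarith
        then show ?thesis using 3 True free by (auto simp: posl_def)
      next
        case False
        have "?a = start_symbol x i p"
        proof (cases "i = 0 \<and> ?T \<le> p")
          case True
          define k where "k = p - ?T"
          have ip: "int p - int ?T = int k" using True by (simp add: k_def)
          have "k < 2 * ?n + 1 \<or> 2 * ?n + 1 + cert_len x \<le> k" using False True by (auto simp: free_def k_def in_len_def)
          moreover have "k < 2 * ?n + 1 \<Longrightarrow> pair_symbol x k = (if z ! k then 2 else 1)"
            using nth_enc_pair(1)[of k x u] by (auto simp: z_def pair_symbol_def)
          moreover have "?a = tape_word z (int k)"
            unfolding ip using trace_0(2)[OF wf i] True by simp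
          moreover have "start_symbol x i p = (if k < 2 * ?n + 1 then pair_symbol x k else 0)"
            using True by (auto simp: start_symbol_def k_def)
          ultimately show ?thesis using zlen u(1) by (auto simp: tape_word_int)
        next
          case neg: False
          have "?a = 0"
          proof (cases "i = 0")
            case True
            then have "int p - int ?T < 0" using neg by simp
            then show ?thesis using trace_0(2)[OF wf i] True by (simp add: tape_word_neg)
          next
            case False
            then show ?thesis using trace_0(2)[OF wf i] by (simp add: tape_word_def)
          qed
          then show ?thesis using neg by (auto simp: start_symbol_def)
        qed
        then show ?thesis using 3 True False by (simp add: posl_def)
      qed
      then show ?thesis
        by (rule pos[rotated]) (use digits bb \<open>?a \<le> 2\<close> in \<open>auto simp: \<alpha>_cd tr_def\<close>)
    next
      case 4
      then have free: "free x 0 p" using True by (simp add: active_def)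
      define k where "k = p - ?T"
      have pk: "p = ?T + k" "2 * ?n + 1 \<le> k" "k < in_len x" using free by (auto simp: free_def k_def)
      have p1: "p + 1 < ?b" using pk T bb by linarith
      show ?thesis
      proof (rule imp[of "cd x 4 0 0 (p + 1) 0"])
        show "posl x f t i p p' a (cd x 4 0 0 (p + 1) 0)" using True 4 by (simp add: posl_def)
        show "cd x 4 0 0 (p + 1) 0 < num_vars x" by (rule \<alpha>_cd) (use p1 bb in auto)
        assume n: "\<not> ?thesis"
        have "\<alpha> (cd x 4 0 0 p 0)"
          by (rule prem[OF n]) (use True 4 digits bb in \<open>auto simp: negl_def intro!: \<alpha>_cd\<close>)
        then have "cell_at M z 0 0 (int k) = 0" using digits bb pk(1) by (simp add: \<alpha>_cd tr_def)
        then have "length z \<le> k" using trace_0(2)[OF wf, of 0] K2 by (auto simp: tape_word_def split: if_splits)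
        then have "cell_at M z 0 0 (int (Suc k)) = 0" using trace_0(2)[OF wf, of 0] K2 by (auto simp: tape_word_def)
        then show "\<alpha> (cd x 4 0 0 (p + 1) 0)" using p1 bb pk(1) by (simp add: \<alpha>_cd tr_def add.commute)
      qed
    next
      case 5
      then have g: "t < ?T" "i < K" "p \<le> 2 * ?T" "a < G" using True by (auto simp: active_def)
      show ?thesis
      proof (rule imp[of "cd x 1 t i 0 a"])
        show "posl x f t i p p' a (cd x 1 t i 0 a)" using True 5 by (simp add: posl_def)
        show "cd x 1 t i 0 a < num_vars x" by (rule \<alpha>_cd) (use digits bb in auto)
        assume n: "\<not> ?thesis"
        have "\<alpha> (cd x 3 t i p 0)" "\<alpha> (cd x 4 t i p a)"
          by (rule prem[OF n]; use True 5 digits bb in \<open>auto simp: negl_def intro!: \<alpha>_cd\<close>)+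
        then show "\<alpha> (cd x 1 t i 0 a)" using digits bb by (simp add: \<alpha>_cd tr_def)
      qed
    next
      case 6
      then have g: "t < ?T" "a < C" using True by (auto simp: active_def)
      have os: "old_state a < ?b" using trs_nth(1)[OF g(2)] bb by simp
      have sc: "scan a i' < ?b" if "i' < K" for i' using trs_nth(3)[OF g(2) that] bb by simp
      show ?thesis
      proof (rule imp[of "cd x 2 t 0 0 a"])
        show "posl x f t i p p' a (cd x 2 t 0 0 a)" using True 6 by (simp add: posl_def)
        show "cd x 2 t 0 0 a < num_vars x" by (rule \<alpha>_cd) (use digits bb in auto)
        assume n: "\<not> ?thesis"
        have "\<alpha> (cd x 0 t 0 0 (old_state a))"
          by (rule prem[OF n]) (use True 6 digits bb os in \<open>auto simp: negl_def intro!: \<alpha>_cd\<close>)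
        then have s: "old_state a = state_at M z t" using digits bb os by (simp add: \<alpha>_cd tr_def)
        have r: "scan a i' = cell_at M z t i' (head_at M z t i')" if "i' < K" for i'
        proof -
          have "\<alpha> (cd x 1 t i' 0 (scan a i'))"
            by (rule prem[OF n]) (use True 6 digits bb that sc[OF that] in \<open>auto simp: negl_def intro!: \<alpha>_cd\<close>)
          then show ?thesis using digits bb that sc[OF that] by (simp add: \<alpha>_cd tr_def)
        qed
        have "snd (trs ! a) = read_at M z t"
          using r trs_nth(2)[OF g(2)] g(2) by (intro nth_equalityI) (auto simp: read_at_def scan_def)
        moreover have "fst (trs ! a) = state_at M z t" using s g(2) by (simp add: old_state_def)
        ultimately have "trs ! a = (state_at M z t, read_at M z t)" by (simp add: prod_eq_iff)
        then show "\<alpha> (cd x 2 t 0 0 a)" using digits bb g(2) by (simp add: \<alpha>_cd tr_def)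
      qed
    next
      case 7
      then have g: "t < ?T" "a < C" using True by (auto simp: active_def)
      have ns: "new_state a < ?b" using trs_nth(4)[OF g(2)] bb by simp
      have t1: "t + 1 < ?b" using g bb by simp
      show ?thesis
      proof (rule imp[of "cd x 0 (t + 1) 0 0 (new_state a)"])
        show "posl x f t i p p' a (cd x 0 (t + 1) 0 0 (new_state a))" using True 7 by (simp add: posl_def)
        show "cd x 0 (t + 1) 0 0 (new_state a) < num_vars x" by (rule \<alpha>_cd) (use t1 ns bb in auto)
        assume n: "\<not> ?thesis"
        have "\<alpha> (cd x 2 t 0 0 a)"
          by (rule prem[OF n]) (use True 7 digits bb in \<open>auto simp: negl_def intro!: \<alpha>_cd\<close>)
        then have "trs ! a = (state_at M z t, read_at M z t)" using digits bb by (simp add: \<alpha>_cd tr_def)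
        then have "new_state a = state_at M z (Suc t)"
          using g(2) trace_invariant(4)[OF wf, of z t] by (simp add: new_state_def)
        then show "\<alpha> (cd x 0 (t + 1) 0 0 (new_state a))" using t1 ns bb by (simp add: \<alpha>_cd tr_def)
      qed
    next
      case 8
      then have g: "t < ?T" "a < C" "i < K" "1 \<le> p" "p \<le> 2 * ?T" using True by (auto simp: active_def)
      have pm: "p + moved a i - 1 < ?b" using trs_nth(6)[OF g(2), of i] g bb by simp
      have t1: "t + 1 < ?b" using g bb by simp
      show ?thesis
      proof (rule imp[of "cd x 3 (t + 1) i (p + moved a i - 1) 0"])
        show "posl x f t i p p' a (cd x 3 (t + 1) i (p + moved a i - 1) 0)" using True 8 by (simp add: posl_def)
        show "cd x 3 (t + 1) i (p + moved a i - 1) 0 < num_vars x" by (rule \<alpha>_cd) (use t1 pm digits bb in auto)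
        assume n: "\<not> ?thesis"
        have "\<alpha> (cd x 2 t 0 0 a)" "\<alpha> (cd x 3 t i p 0)"
          by (rule prem[OF n]; use True 8 digits bb in \<open>auto simp: negl_def intro!: \<alpha>_cd\<close>)+
        then have "trs ! a = (state_at M z t, read_at M z t)" "int p = head_at M z t i + int ?T"
          using digits bb by (simp_all add: \<alpha>_cd tr_def)
        then have "head_at M z (Suc t) i = head_at M z t i + int (moved a i) - 1"
          using g(2,3) trace_invariant(6)[OF wf g(3), of z t] by (simp add: moved_def move_head_offset)
        then have "int (p + moved a i - 1) = head_at M z (Suc t) i + int ?T"
          using \<open>int p = _\<close> g(4) by (simp add: of_nat_diff)
        then show "\<alpha> (cd x 3 (t + 1) i (p + moved a i - 1) 0)" using t1 pm digits bb by (simp add: \<alpha>_cd tr_def)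
      qed
    next
      case 9
      then have g: "t < ?T" "a < C" "i < K" "p \<le> 2 * ?T" using True by (auto simp: active_def)
      have wr: "written a i < ?b" using trs_nth(5)[OF g(2,3)] bb by simp
      have t1: "t + 1 < ?b" using g bb by simp
      show ?thesis
      proof (rule imp[of "cd x 4 (t + 1) i p (written a i)"])
        show "posl x f t i p p' a (cd x 4 (t + 1) i p (written a i))" using True 9 by (simp add: posl_def)
        show "cd x 4 (t + 1) i p (written a i) < num_vars x" by (rule \<alpha>_cd) (use t1 wr digits bb in auto)
        assume n: "\<not> ?thesis"
        have "\<alpha> (cd x 2 t 0 0 a)" "\<alpha> (cd x 3 t i p 0)"
          by (rule prem[OF n]; use True 9 digits bb in \<open>auto simp: negl_def intro!: \<alpha>_cd\<close>)+
        then have *: "trs ! a = (state_at M z t, read_at M z t)" "int p - int ?T = head_at M z t i"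
          using digits bb by (simp_all add: \<alpha>_cd tr_def)
        then have "cell_at M z (Suc t) i (int p - int ?T) = written a i"
          using g(2,3) trace_invariant(5)[OF wf g(3), of z t] by (simp add: written_def)
        then show "\<alpha> (cd x 4 (t + 1) i p (written a i))" using t1 wr digits bb by (simp add: \<alpha>_cd tr_def)
      qed
    next
      case 10
      then have g: "t < ?T" "i < K" "p \<le> 2 * ?T" "p' \<le> 2 * ?T" "p \<noteq> p'" "a < G" using True by (auto simp: active_def)
      have t1: "t + 1 < ?b" using g bb by simp
      show ?thesis
      proof (rule imp[of "cd x 4 (t + 1) i p' a"])
        show "posl x f t i p p' a (cd x 4 (t + 1) i p' a)" using True 10 by (simp add: posl_def)
        show "cd x 4 (t + 1) i p' a < num_vars x" by (rule \<alpha>_cd) (use t1 digits bb in auto)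
        assume n: "\<not> ?thesis"
        have "\<alpha> (cd x 3 t i p 0)" "\<alpha> (cd x 4 t i p' a)"
          by (rule prem[OF n]; use True 10 digits bb in \<open>auto simp: negl_def intro!: \<alpha>_cd\<close>)+
        then have *: "int p = head_at M z t i + int ?T" "a = cell_at M z t i (int p' - int ?T)"
          using digits bb by (simp_all add: \<alpha>_cd tr_def)
        then have "int p' - int ?T \<noteq> head_at M z t i" using g(5) by linarith
        then have "cell_at M z (Suc t) i (int p' - int ?T) = a"
          using * trace_invariant(5)[OF wf g(2), of z t] by simp
        then show "\<alpha> (cd x 4 (t + 1) i p' a)" using t1 digits bb by (simp add: \<alpha>_cd tr_def)
      qed
    next
      case 11
      show ?thesis
      proof (rule neg[of "cd x 4 ?T 1 ?T 1"])
        show "negl x f t i p p' a (cd x 4 ?T 1 ?T 1)" using True 11 by (simp add: negl_def)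
        show "cd x 4 ?T 1 ?T 1 < num_vars x" by (rule \<alpha>_cd) (use bb in auto)
        have "cell_at M z ?T 1 0 = 2" using output_at[OF zin] u(2) by (simp add: z_def)
        then show "\<not> \<alpha> (cd x 4 ?T 1 ?T 1)" using bb by (simp add: \<alpha>_cd tr_def)
      qed
    qed
  qed
  have "\<exists>v<num_vars x. clause_lit x j v (of_bool (\<alpha> v))" for j
  proof -
    let ?p = "\<lambda>v. posl x (j mod 12) (j div 12 mod ?b) (j div 12 div ?b mod ?b) (j div 12 div ?b div ?b mod ?b)
      (j div 12 div ?b div ?b div ?b mod ?b) (j div 12 div ?b div ?b div ?b div ?b mod ?b) v"
    let ?q = "\<lambda>v. negl x (j mod 12) (j div 12 mod ?b) (j div 12 div ?b mod ?b) (j div 12 div ?b div ?b mod ?b)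
      (j div 12 div ?b div ?b div ?b mod ?b) (j div 12 div ?b div ?b div ?b div ?b mod ?b) v"
    obtain v where v: "v < num_vars x" "\<alpha> v \<and> ?p v \<or> \<not> \<alpha> v \<and> ?q v"
      using main[of "j mod 12" "j div 12 mod ?b" "j div 12 div ?b mod ?b" "j div 12 div ?b div ?b mod ?b"
      "j div 12 div ?b div ?b div ?b mod ?b" "j div 12 div ?b div ?b div ?b div ?b mod ?b"] bb(7) by auto
    have "clause_lit x j v (of_bool (\<alpha> v))" unfolding clause_lit_def Let_def using v(2) by (cases "\<alpha> v") auto
    then show ?thesis using v(1) by blast
  qed
  then show ?thesis unfolding satisfiable_def by blast
qed

end


section \<open>Computability of the tableau formula\<close>

context tableau
begin

lemma pt_sizes [pt_intros]:
  "pt (\<lambda>x e. cert_len x)" "pt (\<lambda>x e. in_len x)" "pt (\<lambda>x e. time x)" "pt (\<lambda>x e. base x)"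
  "pt (\<lambda>x e. num_vars x)" "pt (\<lambda>x e. num_clauses x)"
proof -
  show 1: "pt (\<lambda>x e. cert_len x)" unfolding cert_len_def by (intro pt_intros pt_poly)
  show 2: "pt (\<lambda>x e. in_len x)" unfolding in_len_def by (intro pt_intros 1)
  show 3: "pt (\<lambda>x e. time x)" unfolding time_def by (intro pt_intros pt_poly 2)
  show 4: "pt (\<lambda>x e. base x)" unfolding base_def by (intro pt_intros 3)
  show "pt (\<lambda>x e. num_vars x)" unfolding num_vars_def by (intro pt_intros 4)
  show "pt (\<lambda>x e. num_clauses x)" unfolding num_clauses_def by (intro pt_intros 4)
qed

lemma pt_cd [pt_intros]:
  assumes "pt kd" "pt t" "pt i" "pt p" "pt a"
  shows "pt (\<lambda>x e. cd x (kd x e) (t x e) (i x e) (p x e) (a x e))"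
  unfolding cd_def by (intro pt_intros assms)

lemma pt_tables [pt_intros]:
  "pt f \<Longrightarrow> pt (\<lambda>x e. old_state (f x e))"
  "pt f \<Longrightarrow> pt (\<lambda>x e. new_state (f x e))"
  "pt f \<Longrightarrow> pt g \<Longrightarrow> pt (\<lambda>x e. scan (f x e) (g x e))"
  "pt f \<Longrightarrow> pt g \<Longrightarrow> pt (\<lambda>x e. written (f x e) (g x e))"
  "pt f \<Longrightarrow> pt g \<Longrightarrow> pt (\<lambda>x e. moved (f x e) (g x e))"
proof -
  show "pt f \<Longrightarrow> pt (\<lambda>x e. old_state (f x e))" by (rule pt_table[of _ C]) (auto simp: old_state_def)
  show "pt f \<Longrightarrow> pt (\<lambda>x e. new_state (f x e))" by (rule pt_table[of _ C]) (auto simp: new_state_def)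
  show "pt f \<Longrightarrow> pt g \<Longrightarrow> pt (\<lambda>x e. scan (f x e) (g x e))"
    by (rule pt_table2[of _ _ C K]) (auto simp: scan_def)
  show "pt f \<Longrightarrow> pt g \<Longrightarrow> pt (\<lambda>x e. written (f x e) (g x e))"
    by (rule pt_table2[of _ _ C K]) (auto simp: written_def)
  show "pt f \<Longrightarrow> pt g \<Longrightarrow> pt (\<lambda>x e. moved (f x e) (g x e))"
    by (rule pt_table2[of _ _ C K]) (auto simp: moved_def)
qed

lemma pt_free [pt_intros]: "pt i \<Longrightarrow> pt p \<Longrightarrow> pt (\<lambda>x e. of_bool (free x (i x e) (p x e)))"
  unfolding free_def by (intro pt_intros)

lemma pt_start_symbol [pt_intros]: "pt i \<Longrightarrow> pt p \<Longrightarrow> pt (\<lambda>x e. start_symbol x (i x e) (p x e))"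
  unfolding start_symbol_def pair_symbol_def by (intro pt_intros)

lemma pt_active:
  assumes "pt f" "pt t" "pt i" "pt p" "pt p'" "pt a"
  shows "pt (\<lambda>x e. of_bool (active x (f x e) (t x e) (i x e) (p x e) (p' x e) (a x e)))"
  unfolding active_def by (intro pt_intros assms)

lemma pt_literals:
  assumes "pt f" "pt t" "pt i" "pt p" "pt p'" "pt a" "pt v"
  shows "pt (\<lambda>x e. of_bool (posl x (f x e) (t x e) (i x e) (p x e) (p' x e) (a x e) (v x e)))"
    and "pt (\<lambda>x e. of_bool (negl x (f x e) (t x e) (i x e) (p x e) (p' x e) (a x e) (v x e)))"
  unfolding posl_def negl_def
  by (intro pt_intros pt_active assms pt_tl[OF assms(2)] pt_tl[OF assms(6)] pt_tl[OF assms(7)])+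

lemma pt_clause_lit: "pt j \<Longrightarrow> pt v \<Longrightarrow> pt s \<Longrightarrow> pt (\<lambda>x e. of_bool (clause_lit x (j x e) (v x e) (s x e)))"
  unfolding clause_lit_def Let_def by (intro pt_intros pt_literals)

lemma sizes_pos: "0 < num_vars x" "0 < num_clauses x"
  using base_bounds(7)[of x] by (auto simp: num_vars_def num_clauses_def)

text \<open>An inactive clause contains variable 0; in an active one, some literal has all its
  coordinates below \<open>base x\<close>. Without a literal in clause \<open>j\<close>, its class
  could not meet the demand 1 in \<open>dem_le_class\<close>.\<close>

lemma clause_nonempty: "\<exists>v<num_vars x. \<exists>s<2. clause_lit x j v s"
proof -
  let ?b = "base x"
  note bb = base_bounds[of x]
  have main: "\<exists>v<num_vars x. posl x f t i p p' a v \<or> negl x f t i p p' a v"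
    if digits: "t < ?b" "i < ?b" "p < ?b" "p' < ?b" "a < ?b" for f t i p p' a
  proof (cases "active x f t i p p' a")
    case False
    then have "posl x f t i p p' a 0" by (simp add: posl_def)
    then show ?thesis using sizes_pos by blast
  next
    case True
    have lt: "cd x kd t' i' p'' a' < num_vars x" if "kd < 5" "t' < ?b" "i' < ?b" "p'' < ?b" "a' < ?b" for kd t' i' p'' a'
      using cd_digits(6)[OF that] .
    have wit: "?thesis" if "posl x f t i p p' a v \<or> negl x f t i p p' a v" "v < num_vars x" for v
      using that by blast
    have "start_symbol x i p \<le> 2" by (simp add: start_symbol_def pair_symbol_def)
    then have ss: "start_symbol x i p < ?b" using bb by linarith
    consider "f = 0" | "f = 1" | "f = 2" "free x i p" | "f = 2" "\<not> free x i p" | "f = 3" | "f = 4 \<or> f = 9"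
      | "f = 5" | "f = 6 \<or> f = 7 \<or> f = 8" | "f = 10"
      using True unfolding active_def by blast
    then show ?thesis
    proof cases
      case 1
      show ?thesis by (rule wit[of "cd x 0 0 0 0 0"]) (use True 1 bb in \<open>auto simp: posl_def intro!: lt\<close>)
    next
      case 2
      show ?thesis by (rule wit[of "cd x 3 0 i (time x) 0"]) (use True 2 bb digits in \<open>auto simp: posl_def intro!: lt\<close>)
    next
      case 3
      show ?thesis by (rule wit[of "cd x 4 0 i p 0"]) (use True 3 bb digits in \<open>auto simp: posl_def intro!: lt\<close>)
    next
      case 4
      show ?thesis by (rule wit[of "cd x 4 0 i p (start_symbol x i p)"])
          (use True 4 bb digits ss in \<open>auto simp: posl_def intro!: lt\<close>)
    next
      case 5
      show ?thesis by (rule wit[of "cd x 4 0 0 p 0"]) (use True 5 bb digits in \<open>auto simp: negl_def intro!: lt\<close>)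
    next
      case 6
      show ?thesis by (rule wit[of "cd x 3 t i p 0"]) (use True 6 bb digits in \<open>auto simp: negl_def intro!: lt\<close>)
    next
      case 7
      then have "a < C" using True by (auto simp: active_def)
      then have "old_state a < ?b" using trs_nth(1) bb by fastforce
      then show ?thesis by (intro wit[of "cd x 0 t 0 0 (old_state a)"]) (use True 7 bb digits in \<open>auto simp: negl_def intro!: lt\<close>)
    next
      case 8
      show ?thesis by (rule wit[of "cd x 2 t 0 0 a"]) (use True 8 bb digits in \<open>auto simp: negl_def intro!: lt\<close>)
    next
      case 9
      show ?thesis by (rule wit[of "cd x 4 (time x) 1 (time x) 1"]) (use True 9 bb in \<open>auto simp: negl_def intro!: lt\<close>)
    qed
  qed
  obtain v where "v < num_vars x" "posl x (j mod 12) (j div 12 mod ?b) (j div 12 div ?b mod ?b) (j div 12 div ?b div ?b mod ?b)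
      (j div 12 div ?b div ?b div ?b mod ?b) (j div 12 div ?b div ?b div ?b div ?b mod ?b) v \<or>
    negl x (j mod 12) (j div 12 mod ?b) (j div 12 div ?b mod ?b) (j div 12 div ?b div ?b mod ?b)
      (j div 12 div ?b div ?b div ?b mod ?b) (j div 12 div ?b div ?b div ?b div ?b mod ?b) v"
    using main[of "j div 12 mod ?b" "j div 12 div ?b mod ?b" "j div 12 div ?b div ?b mod ?b"
      "j div 12 div ?b div ?b div ?b mod ?b" "j div 12 div ?b div ?b div ?b div ?b mod ?b" "j mod 12"] bb(7) by auto
  then have "clause_lit x j v 1 \<or> clause_lit x j v 0" unfolding clause_lit_def Let_def by auto
  then have "\<exists>s<2. clause_lit x j v s"
  proof
    assume "clause_lit x j v 1"
    then show ?thesis by (intro exI[of _ 1]) simp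
  next
    assume "clause_lit x j v 0"
    then show ?thesis by (intro exI[of _ 0]) simp
  qed
  then show ?thesis using \<open>v < num_vars x\<close> by blast
qed

end

text \<open>The theorem of Cook and Levin, with the formula given by a computable predicate on
  numbered clauses and variables instead of being written out. Only finitely many combinations of
  state and scanned symbols exist for a fixed machine, so \<open>trs\<close> can list them.\<close>

theorem class_NP_to_satisfiable:
  assumes "A \<in> class_NP"
  obtains n m lit where "pt (\<lambda>x e. n x)" "pt (\<lambda>x e. m x)"
    "\<And>j v s. pt j \<Longrightarrow> pt v \<Longrightarrow> pt s \<Longrightarrow> pt (\<lambda>x e. of_bool (lit x (j x e) (v x e) (s x e)))"
    "\<And>x. 0 < n x" "\<And>x. 0 < m x" "\<And>x j. \<exists>v<n x. \<exists>s<2. lit x j v s"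
    "\<And>x. x \<in> A \<longleftrightarrow> satisfiable (n x) (m x) (lit x)"
proof -
  obtain R T2 where R: "R \<in> class_P"
    "\<And>x. x \<in> A \<longleftrightarrow> (\<exists>u. length u \<le> poly T2 (length x) \<and> enc_pair x u \<in> R)"
    using assms unfolding class_NP_def by blast
  obtain M T1 where M: "wf_tm M" "computes_in_time M (\<lambda>z. [z \<in> R]) (poly T1)"
    using R(1) unfolding class_P_def poly_time_computable_def by blast
  let ?S = "{(q, as). q \<le> num_states M \<and> length as = num_tapes M \<and> set as \<subseteq> {..<num_symbols M}}"
  have "?S = {..num_states M} \<times> {as. set as \<subseteq> {..<num_symbols M} \<and> length as = num_tapes M}" by auto
  then have "finite ?S" using finite_lists_length_eq[of "{..<num_symbols M}" "num_tapes M"] by simp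
  from finite_list[OF this] obtain trs where trs: "set trs = ?S" ..
  interpret tableau M R T1 T2 trs by unfold_locales (use M trs in auto)
  show thesis
  proof (rule that[of num_vars num_clauses clause_lit])
    show "x \<in> A \<longleftrightarrow> satisfiable (num_vars x) (num_clauses x) (clause_lit x)" for x
      using certificate_from_assignment[of x] assignment_from_certificate[of _ x] R(2)[of x]
      unfolding cert_len_def by blast
  qed (rule pt_sizes pt_clause_lit sizes_pos clause_nonempty; assumption?)+
qed


section \<open>Hardness\<close>

lemma ptl_concat_map:
  assumes n: "pt n" and F: "ptl (\<lambda>x e. concat (map g (F (e 0) x (\<lambda>i. e (Suc i)))))"
  shows "ptl (\<lambda>x e. concat (map g (concat (map (\<lambda>i. F i x e) [0..<n x e]))))"
proof -
  have "concat (map g (concat (map G ns))) = concat (map (\<lambda>i. concat (map g (G i))) ns)" for G :: "nat \<Rightarrow> 'a list" and ns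
    by (induction ns) auto
  then show ?thesis using ptl_concat[OF n, of "\<lambda>i x e. concat (map g (F i x e))", OF F] by simp
qed

lemma pt_base_vote:
  assumes "pt m" "pt i" "pt r" "pt (\<lambda>x e. of_bool (f x e))"
  shows "pt (\<lambda>x e. base_vote (m x e) (i x e) (swap12 (f x e) (r x e)))"
proof -
  have s: "pt (\<lambda>x e. swap12 (f x e) (r x e))" unfolding swap12_def by (intro pt_intros assms)
  show ?thesis unfolding base_vote_def by (intro pt_intros assms s)
qed

lemma ptl_enc_votes:
  assumes "pt m" "pt i" "pt (\<lambda>x e. of_bool (f x e))"
  shows "ptl (\<lambda>x e. enc_list enc_nat (vote1 (m x e) (i x e) (f x e)))"
    and "ptl (\<lambda>x e. enc_list enc_nat (vote2 (m x e) (i x e) (f x e)))"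
  unfolding vote1_def vote2_def
  by (intro ptl_enc_list ptl_enc_nat pt_base_vote pt_intros assms pt_tl[OF assms(1)] pt_tl[OF assms(2)] pt_tl[OF assms(3)])+

lemma ptl_Cons_concat:
  assumes "ptl (\<lambda>x e. f (a x e))" "ptl (\<lambda>x e. concat (map (\<lambda>v. True # f v) (as x e)))"
  shows "ptl (\<lambda>x e. concat (map (\<lambda>v. True # f v) (a x e # as x e)))"
  using ptl_append[OF ptl_append[OF ptl_single[OF pt_const] assms(1)] assms(2), of True] by simp

lemma ptl_enc_all_votes:
  assumes m: "pt (\<lambda>x e. m x)" and U: "pt (\<lambda>x e. U x)"
    and up: "\<And>i. pt i \<Longrightarrow> pt (\<lambda>x e. up x (i x e))" and dn: "\<And>i. pt i \<Longrightarrow> pt (\<lambda>x e. dn x (i x e))"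
  shows "ptl (\<lambda>x e. enc_list (enc_list enc_nat) (all_votes (m x) (U x) (up x) (dn x)))"
proof -
  have last: "ptl (\<lambda>x e. enc_list enc_nat [0..<Suc (m x)])"
    using ptl_enc_list[where n = "\<lambda>x e. Suc (m x)" and f = enc_nat and g = "\<lambda>i x e. i"]
    by (simp add: ptl_enc_nat pt.var pt.suc m del: upt_Suc)
  have "ptl (\<lambda>x e. concat (map (\<lambda>v. True # enc_list enc_nat v) (fixed_votes (m x) (U x) (up x) (dn x))))"
    unfolding fixed_votes_def
    by (intro ptl_concat_map m U ptl_Cons_concat ptl_enc_votes pt_intros up dn) (simp add: ptl_Nil)
  moreover have "ptl (\<lambda>x e. concat (map (\<lambda>v. True # enc_list enc_nat v) [[0..<Suc (m x)], [0..<Suc (m x)]]))"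
    by (intro ptl_Cons_concat last) (simp add: ptl_Nil)
  ultimately have "ptl (\<lambda>x e. (concat (map (\<lambda>v. True # enc_list enc_nat v) (fixed_votes (m x) (U x) (up x) (dn x))) @
      concat (map (\<lambda>v. True # enc_list enc_nat v) [[0..<Suc (m x)], [0..<Suc (m x)]])) @ [False])"
    by (intro ptl_append ptl_single pt_const)
  then show ?thesis unfolding all_votes_def enc_list_def[of "enc_list enc_nat"] map_append concat_append .
qed

definition reduct :: "(bool list \<Rightarrow> nat) \<Rightarrow> (bool list \<Rightarrow> nat) \<Rightarrow>
    (bool list \<Rightarrow> nat \<Rightarrow> nat \<Rightarrow> nat \<Rightarrow> bool) \<Rightarrow> bool list \<Rightarrow> bribery_input" where
  "reduct n m lit x = \<lparr>candidates = [0..<Suc (num_rivals (n x) (m x))],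
    voters = all_votes (num_rivals (n x) (m x)) (jump (n x) (m x) + 1) (gain (n x) (m x)) (loss (n x) (m x) (lit x)),
    bribe_limit = 2, preferred = num_rivals (n x) (m x)\<rparr>"

text \<open>A cardinality becomes a bounded sum, to which the closure rules apply.\<close>

lemma mark_iff_sum: "mark e r d t \<longleftrightarrow> (\<Sum>t'<t. of_bool (e d t' = e d t)) < r d (e d t)"
proof -
  have "{t'. t' < t \<and> e d t' = e d t} = {t' \<in> {..<t}. e d t' = e d t}" by auto
  then show ?thesis unfolding mark_def using sum_of_bool_card[of "{..<t}" "\<lambda>t'. e d t' = e d t"] by simp
qed

section \<open>Computability of the constructed election\<close>

context
  fixes n m :: "bool list \<Rightarrow> nat" and lit :: "bool list \<Rightarrow> nat \<Rightarrow> nat \<Rightarrow> nat \<Rightarrow> bool"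
  assumes pt_n: "pt (\<lambda>x e. n x)" and pt_m: "pt (\<lambda>x e. m x)"
    and pt_lit: "\<And>j v s. pt j \<Longrightarrow> pt v \<Longrightarrow> pt s \<Longrightarrow> pt (\<lambda>x e. of_bool (lit x (j x e) (v x e) (s x e)))"
begin

lemma pt_el: "pt d \<Longrightarrow> pt t \<Longrightarrow> pt (\<lambda>x e. el (n x) (m x) (lit x) (d x e) (t x e))"
  unfolding el_def by (intro pt_intros pt_n pt_m pt_lit)

lemma pt_dem: "pt d \<Longrightarrow> pt c \<Longrightarrow> pt (\<lambda>x e. dem (n x) (m x) (d x e) (c x e))"
  unfolding dem_def by (intro pt_intros pt_n pt_m)

lemma pt_mark:
  assumes "pt d" "pt t"
  shows "pt (\<lambda>x e. of_bool (mark (el (n x) (m x) (lit x)) (dem (n x) (m x)) (d x e) (t x e)))"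
  unfolding mark_iff_sum
  by (intro pt_intros pt_el pt_dem assms pt_tl[OF assms(1)] pt_tl[OF assms(2)])

lemma pt_num_indices: "pt (\<lambda>x e. num_indices (n x) (m x))"
  unfolding num_indices_def by (intro pt_intros pt_n pt_m)

lemma pt_num_classes: "pt (\<lambda>x e. num_classes (n x) (m x))"
  unfolding num_classes_def by (intro pt_intros pt_n pt_m)

lemma pt_capacity: "pt (\<lambda>x e. capacity (num_classes (n x) (m x)))"
  unfolding capacity_def radix_def by (intro pt_intros pt_num_classes)

lemma pt_digit_id: "pt d \<Longrightarrow> pt i \<Longrightarrow>
    pt (\<lambda>x e. digit_id (num_classes (n x) (m x)) (el (n x) (m x) (lit x)) (d x e) (i x e))"
  unfolding digit_id_def by (intro pt_intros pt_num_classes pt_el)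

lemma pt_digit_mark: "pt i \<Longrightarrow> pt (\<lambda>x e. digit_mark (mark (el (n x) (m x) (lit x)) (dem (n x) (m x))) (i x e))"
  unfolding digit_mark_def by (intro pt_intros pt_mark)

lemma pt_item: "pt i \<Longrightarrow> pt (\<lambda>x e. item (n x) (m x) (lit x) (i x e))"
  unfolding item_def weight_def radix_def
  by (intro pt_intros pt_num_classes pt_digit_id pt_digit_mark)

lemma pt_jump: "pt (\<lambda>x e. jump (n x) (m x))"
  unfolding jump_def by (intro pt_intros pt_num_indices pt_capacity)

lemma pt_num_rivals: "pt (\<lambda>x e. num_rivals (n x) (m x))"
  unfolding num_rivals_def by (intro pt_intros pt_num_indices pt_capacity)

lemma pt_gain: "pt i \<Longrightarrow> pt (\<lambda>x e. gain (n x) (m x) (i x e))"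
  unfolding gain_def by (intro pt_intros pt_num_indices pt_jump)

lemma pt_loss: "pt i \<Longrightarrow> pt (\<lambda>x e. loss (n x) (m x) (lit x) (i x e))"
  unfolding loss_def by (intro pt_intros pt_num_indices pt_item)

lemma poly_time_reduct: "poly_time_computable (\<lambda>x. enc_input (reduct n m lit x))"
proof -
  have "ptl (\<lambda>x e. enc_list enc_nat [0..<Suc (num_rivals (n x) (m x))])"
    using ptl_enc_list[where n = "\<lambda>x e. Suc (num_rivals (n x) (m x))" and f = enc_nat and g = "\<lambda>i x e. i"]
    by (simp add: ptl_enc_nat pt.var pt.suc pt_num_rivals del: upt_Suc)
  moreover have "pt (\<lambda>x e. jump (n x) (m x) + 1)" by (intro pt_intros pt_jump)
  ultimately have "ptl (\<lambda>x e. enc_input (reduct n m lit x))"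
    unfolding enc_input_def reduct_def bribery_input.select_convs
    by (intro ptl_append ptl_enc_all_votes ptl_enc_nat pt_num_rivals pt_gain pt_loss pt_const)
  then show ?thesis by (rule ptl_poly_time)
qed

end

theorem Borda_Bribery_hard:
  assumes "A \<in> class_NP"
  shows "poly_many_one_reducible A (enc_input ` {I \<in> Borda_Bribery. bribe_limit I = 2})"
proof -
  obtain n m lit where pt: "pt (\<lambda>x e. n x)" "pt (\<lambda>x e. m x)"
    "\<And>j v s. pt j \<Longrightarrow> pt v \<Longrightarrow> pt s \<Longrightarrow> pt (\<lambda>x e. of_bool (lit x (j x e) (v x e) (s x e)))"
    and nm: "\<And>x. 0 < n x" "\<And>x. 0 < m x" "\<And>x j. \<exists>v<n x. \<exists>s<2. lit x j v s"
    and A: "\<And>x. x \<in> A \<longleftrightarrow> satisfiable (n x) (m x) (lit x)"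
    using class_NP_to_satisfiable[OF assms] by blast
  have "x \<in> A \<longleftrightarrow> enc_input (reduct n m lit x) \<in> enc_input ` {I \<in> Borda_Bribery. bribe_limit I = 2}" for x
  proof -
    let ?M = "num_rivals (n x) (m x)"
    have M: "3 \<le> ?M"
    proof -
      have "1 \<le> m x * n x" using nm(1,2)[of x] by (simp add: Suc_leI)
      then have "3 * 1 \<le> num_indices (n x) (m x) * (capacity (num_classes (n x) (m x)) + 1)"
        unfolding num_indices_def by (intro mult_le_mono) auto
      then show ?thesis by (simp add: num_rivals_def)
    qed
    have valid: "valid_input (reduct n m lit x)"
      using all_votes_perm[OF M] by (simp add: valid_input_def election_def reduct_def atLeast0LessThan del: upt_Suc)
    have "set [0..<Suc ?M] = {..<Suc ?M}" by (simp add: atLeast0LessThan del: upt_Suc)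
    then have "reduct n m lit x \<in> Borda_Bribery \<longleftrightarrow> satisfiable (n x) (m x) (lit x)"
      using valid borda_bribable_iff_satisfiable[OF nm(1,2,3), of x]
      by (simp add: Borda_Bribery_def reduct_def del: upt_Suc)
    moreover have "bribe_limit (reduct n m lit x) = 2" by (simp add: reduct_def)
    ultimately show ?thesis using A[of x] inj_enc_input by (auto simp: inj_def)
  qed
  moreover have "poly_time_computable (\<lambda>x. enc_input (reduct n m lit x))"
    by (rule poly_time_reduct) (fact pt(1), fact pt(2), erule (2) pt(3))
  ultimately show ?thesis unfolding poly_many_one_reducible_def
    by (intro exI[of _ "\<lambda>x. enc_input (reduct n m lit x)"] conjI allI)
qed


section \<open>Parsing\<close>

text \<open>\<open>E x s\<close> is the position behind the code that starts at \<open>s\<close>.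
  The failure value \<open>length x + 1\<close> lies beyond every position that a successful parse
  can return.\<close>

definition parses :: "(bool list \<Rightarrow> nat \<Rightarrow> nat) \<Rightarrow> ('a \<Rightarrow> bool list) \<Rightarrow> bool" where
  "parses E f \<longleftrightarrow> pt (\<lambda>x e. E x (e 0)) \<and> (\<forall>a. f a \<noteq> []) \<and>
    (\<forall>x s a t. drop s x = f a @ t \<longrightarrow> E x s = s + length (f a)) \<and>
    (\<forall>x s. (\<forall>a t. drop s x \<noteq> f a @ t) \<longrightarrow> E x s = length x + 1)"

definition item_step :: "(bool list \<Rightarrow> nat \<Rightarrow> nat) \<Rightarrow> bool list \<Rightarrow> nat \<Rightarrow> nat" where
  "item_step E x p = (if bitat x p then E x (p + 1) else p)"

definition run :: "(bool list \<Rightarrow> nat \<Rightarrow> nat) \<Rightarrow> bool list \<Rightarrow> nat \<Rightarrow> nat \<Rightarrow> nat" where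
  "run E x s k = ((\<lambda>p. item_step E x p) ^^ k) s"

text \<open>A run of \<open>length x\<close> rounds has come to rest. It rests inside the string
  exactly on the \<open>False\<close> that closes a list; a failed item leaves it at
  \<open>length x + 1\<close>, where \<open>bitat\<close> is false as well.\<close>

definition list_end :: "(bool list \<Rightarrow> nat \<Rightarrow> nat) \<Rightarrow> bool list \<Rightarrow> nat \<Rightarrow> nat" where
  "list_end E x s = (if run E x s (length x) < length x \<and> \<not> bitat x (run E x s (length x))
     then run E x s (length x) + 1 else length x + 1)"

definition count_items :: "(bool list \<Rightarrow> nat \<Rightarrow> nat) \<Rightarrow> bool list \<Rightarrow> nat \<Rightarrow> nat" where
  "count_items E x s = bmin (length x) (\<lambda>i. \<not> bitat x (run E x s i))"

definition item_pos :: "(bool list \<Rightarrow> nat \<Rightarrow> nat) \<Rightarrow> bool list \<Rightarrow> nat \<Rightarrow> nat \<Rightarrow> nat" where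
  "item_pos E x s i = run E x s i + 1"

lemma parsesD:
  assumes "parses E f"
  shows "pt g \<Longrightarrow> pt (\<lambda>x e. E x (g x e))" "f a \<noteq> []" "drop s x = f a @ t \<Longrightarrow> E x s = s + length (f a)"
    "(\<And>a t. drop s x \<noteq> f a @ t) \<Longrightarrow> E x s = length x + 1"
  using assms pt_app1[of E g] unfolding parses_def by blast+

lemma parses_success:
  assumes "parses E f" "E x s \<le> length x"
  obtains a t where "drop s x = f a @ t" "E x s = s + length (f a)" "drop (E x s) x = t" "s < length x"
proof -
  obtain a t where at: "drop s x = f a @ t" using parsesD(4)[OF assms(1), of s x] assms(2) by force
  have E: "E x s = s + length (f a)" by (rule parsesD(3)[OF assms(1) at])
  have "drop (E x s) x = drop (length (f a)) (drop s x)" unfolding E by (simp add: add.commute)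
  then have "drop (E x s) x = t" unfolding at by simp
  moreover have "s < length x" using at parsesD(2)[OF assms(1), of a] by (metis append_is_Nil_conv drop_eq_Nil not_le)
  ultimately show thesis using that at E by blast
qed

lemma parses_le: "parses E f \<Longrightarrow> E x s \<le> length x + 1"
proof -
  assume E: "parses E f"
  show ?thesis
  proof (cases "\<exists>a t. drop s x = f a @ t")
    case True
    then obtain a t where at: "drop s x = f a @ t" by blast
    have "length (f a) \<le> length x - s" using arg_cong[OF at, of length] by simp
    moreover have "s < length x" using at parsesD(2)[OF E, of a] by (metis append_is_Nil_conv drop_eq_Nil not_le)
    ultimately show ?thesis using parsesD(3)[OF E at] by simp
  next
    case False
    then show ?thesis using parsesD(4)[OF E, of s x] by simp
  qed
qed

lemma drop_Cons_bitat:
  assumes "drop s x = b # r"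
  shows "bitat x s = b" "s < length x" "drop (s + 1) x = r"
proof -
  show s: "s < length x" using assms by (metis drop_eq_Nil list.distinct(1) not_le)
  then show "bitat x s = b" using assms by (metis Cons_nth_drop_Suc bitat_def list.inject)
  show "drop (s + 1) x = r" using assms s by (metis Cons_nth_drop_Suc Suc_eq_plus1 list.inject)
qed

lemma drop_pos: "drop p x = w \<Longrightarrow> w \<noteq> [] \<Longrightarrow> p + length w = length x"
  by (cases "p \<le> length x") auto

lemma enc_list_Cons: "enc_list f (a # as) = True # f a @ enc_list f as"
  by (simp add: enc_list_def)

lemma enc_list_Nil: "enc_list f [] = [False]"
  by (simp add: enc_list_def)

lemma run_Suc: "run E x s (Suc k) = item_step E x (run E x s k)"
  by (simp add: run_def)

lemma run_Suc_right: "run E x s (Suc k) = run E x (item_step E x s) k"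
  by (simp add: run_def funpow_Suc_right del: funpow.simps)

lemma run_list:
  assumes E: "parses E f" and d: "drop s x = enc_list f xs @ t"
  shows "i \<le> length xs \<Longrightarrow> drop (run E x s i) x = enc_list f (drop i xs) @ t"
proof (induction i)
  case 0
  then show ?case using d by (simp add: run_def)
next
  case (Suc i)
  let ?p = "run E x s i"
  have "drop i xs = xs ! i # drop (Suc i) xs" using Suc.prems by (simp add: Cons_nth_drop_Suc)
  then have p: "drop ?p x = True # f (xs ! i) @ enc_list f (drop (Suc i) xs) @ t"
    using Suc by (simp add: enc_list_Cons)
  note p' = drop_Cons_bitat[OF p]
  have "item_step E x ?p = ?p + 1 + length (f (xs ! i))"
    using p'(1) parsesD(3)[OF E p'(3)] by (simp add: item_step_def)
  then have "drop (run E x s (Suc i)) x = drop (length (f (xs ! i))) (drop (?p + 1) x)"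
    by (simp add: run_Suc add.commute)
  then show ?case unfolding p'(3) by simp
qed

lemma run_list_end:
  assumes E: "parses E f" and d: "drop s x = enc_list f xs @ t" and k: "length xs \<le> k"
  shows "run E x s k = run E x s (length xs)" "\<not> bitat x (run E x s (length xs))" "run E x s (length xs) < length x"
proof -
  have "drop (run E x s (length xs)) x = False # t"
    using run_list[OF E d, of "length xs"] by (simp add: enc_list_Nil)
  note p = drop_Cons_bitat[OF this]
  show "\<not> bitat x (run E x s (length xs))" "run E x s (length xs) < length x" using p by auto
  show "run E x s k = run E x s (length xs)"
    using k by (induction k rule: dec_induct) (use p in \<open>auto simp: run_Suc item_step_def\<close>)
qed

lemma length_enc_list_ge: "length xs < length (enc_list f xs)"
  by (induction xs) (auto simp: enc_list_Cons enc_list_Nil)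

lemma list_items:
  assumes E: "parses E f" and d: "drop s x = enc_list f xs @ t"
  shows "list_end E x s = s + length (enc_list f xs)" "count_items E x s = length xs"
    "i < length xs \<Longrightarrow> \<exists>t'. drop (item_pos E x s i) x = f (xs ! i) @ t'"
proof -
  have sx: "s + length (enc_list f xs @ t) = length x"
    by (rule drop_pos[OF d]) (simp add: enc_list_def)
  then have lx: "length xs \<le> length x" using length_enc_list_ge[of xs f] by simp
  have pl: "drop (run E x s (length xs)) x = False # t"
    using run_list[OF E d, of "length xs"] by (simp add: enc_list_Nil)
  then have "run E x s (length xs) + length (False # t) = length x" by (rule drop_pos) simp
  then show "list_end E x s = s + length (enc_list f xs)"
    using run_list_end[OF E d lx] sx by (simp add: list_end_def)
  have it: "drop (run E x s i) x = True # f (xs ! i) @ enc_list f (drop (Suc i) xs) @ t" if "i < length xs" for i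
    using run_list[OF E d, of i] that Cons_nth_drop_Suc[OF that] by (metis append_Cons append_assoc enc_list_Cons less_imp_le)
  show "count_items E x s = length xs"
    unfolding count_items_def
  proof (rule bmin_eqI[OF lx])
    show "\<not> \<not> bitat x (run E x s i)" if "i < length xs" for i using drop_Cons_bitat(1)[OF it[OF that]] by simp
    show "length xs = length x \<or> \<not> bitat x (run E x s (length xs))" using run_list_end(2)[OF E d order_refl] by simp
  qed
  show "\<exists>t'. drop (item_pos E x s i) x = f (xs ! i) @ t'" if "i < length xs"
    using drop_Cons_bitat(3)[OF it[OF that]] by (auto simp: item_pos_def)
qed

text \<open>Induction on the rounds, taking off the first item. The list found for the rest starts
  inside \<open>x\<close>, so the parse of that item cannot have failed.\<close>

lemma list_if_run:
  assumes E: "parses E f"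
  shows "run E x s k < length x \<Longrightarrow> \<not> bitat x (run E x s k) \<Longrightarrow> \<exists>xs t. drop s x = enc_list f xs @ t"
proof (induction k arbitrary: s)
  case 0
  then have "s < length x" "x ! s = False" by (auto simp: run_def bitat_def)
  then have "drop s x = False # drop (Suc s) x" using Cons_nth_drop_Suc[of s x] by metis
  then have "drop s x = enc_list f [] @ drop (Suc s) x" unfolding enc_list_Nil by simp
  then show ?case by blast
next
  case (Suc k)
  have IH: "\<exists>xs t. drop (item_step E x s) x = enc_list f xs @ t"
    by (rule Suc.IH) (use Suc.prems in \<open>simp_all add: run_Suc_right\<close>)
  show ?case
  proof (cases "bitat x s")
    case False
    then show ?thesis using IH by (simp add: item_step_def)
  next
    case True
    then have s: "item_step E x s = E x (s + 1)" by (simp add: item_step_def)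
    obtain xs t where xs: "drop (E x (s + 1)) x = enc_list f xs @ t" using IH s by auto
    have "E x (s + 1) + length (enc_list f xs @ t) = length x"
      by (rule drop_pos[OF xs]) (simp add: enc_list_def)
    then have "E x (s + 1) \<le> length x" by simp
    then obtain a t' where a: "drop (s + 1) x = f a @ t'" "drop (E x (s + 1)) x = t'"
      by (rule parses_success[OF E]) blast
    have "s < length x" "x ! s = True" using True by (auto simp: bitat_def)
    then have "drop s x = True # drop (s + 1) x" using Cons_nth_drop_Suc[of s x] by (metis Suc_eq_plus1)
    then have "drop s x = enc_list f (a # xs) @ t" using a xs by (simp add: enc_list_Cons)
    then show ?thesis by blast
  qed
qed

lemma pt_run:
  assumes E: "parses E f" and "pt s" "pt k"
  shows "pt (\<lambda>x e. run E x (s x e) (k x e))"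
proof (rule pt_app2[OF _ assms(2,3)])
  have bound: "run E x s k \<le> s + (length x + 1)" for x s k
  proof (induction k)
    case 0
    then show ?case by (simp add: run_def)
  next
    case (Suc k)
    have "E x (run E x s k + 1) \<le> length x + 1" using parses_le[OF E, of x "run E x s k + 1"] by simp
    then show ?case using Suc unfolding run_Suc item_step_def by auto
  qed
  show "pt (\<lambda>x e. run E x (e 0) (e 1))"
    unfolding run_def
  proof (rule pt_funpow[where h = "\<lambda>x e. e 0 + (length x + 1)"])
    show "pt (\<lambda>x e. item_step E x (e 0))"
      unfolding item_step_def by (intro pt_intros parsesD(1)[OF E])
    show "pb (\<lambda>x e. e 0 + (length x + 1))" by (intro pb_intros)
  qed (use bound in \<open>auto intro: pt_intros simp: run_def\<close>)
qed

lemma pt_list_end: "parses E f \<Longrightarrow> pt s \<Longrightarrow> pt (\<lambda>x e. list_end E x (s x e))"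
  unfolding list_end_def by (intro pt_intros pt_run)

lemma pt_count_items: "parses E f \<Longrightarrow> pt s \<Longrightarrow> pt (\<lambda>x e. count_items E x (s x e))"
  unfolding count_items_def by (intro pt_intros pt_run pt_tl[of s])

lemma pt_item_pos: "parses E f \<Longrightarrow> pt s \<Longrightarrow> pt i \<Longrightarrow> pt (\<lambda>x e. item_pos E x (s x e) (i x e))"
  unfolding item_pos_def by (intro pt_intros pt_run)

lemma parses_list:
  assumes E: "parses E f"
  shows "parses (list_end E) (enc_list f)"
  unfolding parses_def
proof (intro conjI allI impI)
  show "pt (\<lambda>x e. list_end E x (e 0))" by (intro pt_list_end[OF E] pt_intros)
  show "enc_list f a \<noteq> []" for a by (simp add: enc_list_def)
  show "list_end E x s = s + length (enc_list f a)" if "drop s x = enc_list f a @ t" for x s a t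
    by (rule list_items(1)[OF E that])
  show "list_end E x s = length x + 1" if "\<forall>a t. drop s x \<noteq> enc_list f a @ t" for x s
    using list_if_run[OF E, of x s "length x"] that unfolding list_end_def by (auto split: if_splits)
qed

section \<open>Parsers for bits and binary numbers\<close>

definition bit_end :: "bool list \<Rightarrow> nat \<Rightarrow> nat" where
  "bit_end x s = (if s < length x then s + 1 else length x + 1)"

lemma parses_bit: "parses bit_end (\<lambda>b. [b])"
  unfolding parses_def
proof (intro conjI allI impI)
  show "pt (\<lambda>x e. bit_end x (e 0))" unfolding bit_end_def by (intro pt_intros)
  show "bit_end x s = s + length [a]" if "drop s x = [a] @ t" for x s a t
    using drop_Cons_bitat(2)[of s x a t] that by (simp add: bit_end_def)
  show "bit_end x s = length x + 1" if "\<forall>a t. drop s x \<noteq> [a] @ t" for x s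
  proof -
    have "\<not> s < length x"
    proof
      assume "s < length x"
      then have "drop s x = [x ! s] @ drop (Suc s) x" by (simp add: Cons_nth_drop_Suc)
      then show False using that by blast
    qed
    then show ?thesis by (simp add: bit_end_def)
  qed
qed simp

text \<open>A list of bits is the code of a number iff it is empty or its last bit is
  \<open>True\<close>. That bit stands at \<open>e - 2\<close>, before the closing
  \<open>False\<close>; the list is nonempty iff \<open>s + 1 < e\<close>.\<close>

definition nat_end :: "bool list \<Rightarrow> nat \<Rightarrow> nat" where
  "nat_end x s = (let e = list_end bit_end x s in
     if s + 1 < e \<and> e \<le> length x \<and> \<not> bitat x (e - 2) then length x + 1 else e)"

lemma binary_last: "binary n = [] \<or> last (binary n)"
proof (induction n rule: less_induct)
  case (less n)
  show ?case
  proof (cases "n = 0")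
    case False
    then have "binary n = odd n # binary (n div 2)" by (simp add: binary.simps[of n])
    moreover have "n div 2 = 0 \<Longrightarrow> odd n" using False by presburger
    ultimately show ?thesis using less[of "n div 2"] False binary_eq_Nil[of "n div 2"] by auto
  qed (simp add: binary.simps)
qed

lemma binary_of_bits: "bs = [] \<or> last bs \<Longrightarrow> \<exists>n. binary n = bs"
proof (induction bs)
  case Nil
  then show ?case using binary_eq_Nil[of 0] by blast
next
  case (Cons b bs)
  then have "bs = [] \<or> last bs" by (auto split: if_splits)
  then obtain n where n: "binary n = bs" using Cons.IH by blast
  have "n = 0 \<Longrightarrow> b" using Cons.prems n binary_eq_Nil[of n] by auto
  then have "2 * n + of_bool b \<noteq> 0" by auto
  then have "binary (2 * n + of_bool b) = b # bs"
    using n by (subst binary.simps) (auto simp: of_bool_def)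
  then show ?case by blast
qed

lemma parses_nat: "parses nat_end enc_nat"
  unfolding parses_def
proof (intro conjI allI impI)
  note P = parses_list[OF parses_bit]
  show "pt (\<lambda>x e. nat_end x (e 0))"
    unfolding nat_end_def Let_def by (intro pt_intros pt_list_end[OF parses_bit])
  show "enc_nat n \<noteq> []" for n by (simp add: enc_nat_def enc_list_def)
  have last: "bitat x (s + length (enc_list (\<lambda>b. [b]) bs) - 2) = last bs \<and> s + 1 < s + length (enc_list (\<lambda>b. [b]) bs)"
    if d: "drop s x = enc_list (\<lambda>b. [b]) bs @ t" and bs: "bs \<noteq> []" for x s bs t
  proof -
    obtain cs b where cb: "bs = cs @ [b]" using bs by (metis append_butlast_last_id)
    let ?w = "concat (map (\<lambda>b. [True, b]) cs) @ [True]"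
    have e: "enc_list (\<lambda>b. [b]) bs = ?w @ [b, False]" by (simp add: cb enc_list_def)
    have "drop (s + length ?w) x = drop (length ?w) (drop s x)" by (simp add: add.commute)
    also have "\<dots> = b # False # t" unfolding d e by simp
    finally have "bitat x (s + length ?w) = b" by (rule drop_Cons_bitat(1))
    moreover have "s + length (enc_list (\<lambda>b. [b]) bs) - 2 = s + length ?w" "s + 1 < s + length (enc_list (\<lambda>b. [b]) bs)"
      unfolding e by simp_all
    ultimately show ?thesis using cb by simp
  qed
  show "nat_end x s = s + length (enc_nat n)" if d: "drop s x = enc_nat n @ t" for x s n t
  proof -
    have le: "list_end bit_end x s = s + length (enc_nat n)"
      using parsesD(3)[OF P d[unfolded enc_nat_def]] by (simp add: enc_nat_def)
    have "\<not> (s + 1 < s + length (enc_nat n) \<and> \<not> bitat x (s + length (enc_nat n) - 2))"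
    proof (cases "binary n = []")
      case True
      then show ?thesis by (simp add: enc_nat_def enc_list_def)
    next
      case False
      then show ?thesis using last[OF d[unfolded enc_nat_def] False] binary_last[of n] by (simp add: enc_nat_def)
    qed
    then show ?thesis unfolding nat_end_def Let_def le by auto
  qed
  show "nat_end x s = length x + 1" if no: "\<forall>n t. drop s x \<noteq> enc_nat n @ t" for x s
  proof (cases "list_end bit_end x s \<le> length x")
    case False
    then have "list_end bit_end x s = length x + 1" using parses_le[OF P, of x s] by simp
    then show ?thesis by (simp add: nat_end_def)
  next
    case True
    then obtain bs t where bs: "drop s x = enc_list (\<lambda>b. [b]) bs @ t"
      "list_end bit_end x s = s + length (enc_list (\<lambda>b. [b]) bs)"
      by (rule parses_success[OF P]) blast
    have "\<not> (bs = [] \<or> last bs)"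
    proof
      assume "bs = [] \<or> last bs"
      then obtain n where "binary n = bs" using binary_of_bits by blast
      then have "drop s x = enc_nat n @ t" using bs(1) by (simp add: enc_nat_def)
      then show False using no by blast
    qed
    then have "bs \<noteq> []" "\<not> last bs" by auto
    then show ?thesis using last[OF bs(1)] bs(2) True by (simp add: nat_end_def)
  qed
qed

text \<open>Candidate names can be exponential in the length of the input, so they are compared as
  codes instead of being evaluated in unary.\<close>

definition same_nat :: "bool list \<Rightarrow> nat \<Rightarrow> nat \<Rightarrow> bool" where
  "same_nat x s s' \<longleftrightarrow> nat_end x s - s = nat_end x s' - s' \<and>
     (\<forall>k<nat_end x s - s. bitat x (s + k) \<longleftrightarrow> bitat x (s' + k))"

lemma bitat_drop: "drop s x = w @ t \<Longrightarrow> k < length w \<Longrightarrow> bitat x (s + k) \<longleftrightarrow> w ! k"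
proof -
  assume d: "drop s x = w @ t" and k: "k < length w"
  have "s + k < length x" using arg_cong[OF d, of length] k by simp
  moreover have "x ! (s + k) = (w @ t) ! k" unfolding d[symmetric] using calculation by simp
  ultimately show ?thesis using k by (simp add: bitat_def nth_append)
qed

lemma enc_nat_inject: "enc_nat a = enc_nat b \<longleftrightarrow> a = b"
  using prefix_freeD[OF prefix_free_enc_nat, of a "[]" b "[]"] by auto

lemma same_nat_iff:
  assumes "drop s x = enc_nat a @ t" "drop s' x = enc_nat b @ t'"
  shows "same_nat x s s' \<longleftrightarrow> a = b"
proof -
  have "nat_end x s - s = length (enc_nat a)" "nat_end x s' - s' = length (enc_nat b)"
    using parsesD(3)[OF parses_nat assms(1)] parsesD(3)[OF parses_nat assms(2)] by auto
  then have "same_nat x s s' \<longleftrightarrow> length (enc_nat a) = length (enc_nat b) \<and>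
      (\<forall>k<length (enc_nat a). enc_nat a ! k \<longleftrightarrow> enc_nat b ! k)"
    unfolding same_nat_def using bitat_drop[OF assms(1)] bitat_drop[OF assms(2)] by auto
  also have "\<dots> \<longleftrightarrow> enc_nat a = enc_nat b" by (auto simp: list_eq_iff_nth_eq)
  finally show ?thesis unfolding enc_nat_inject .
qed

lemma pt_same_nat:
  assumes "pt s" "pt s'"
  shows "pt (\<lambda>x e. of_bool (same_nat x (s x e) (s' x e)))"
  unfolding same_nat_def
  by (intro pt_intros parsesD(1)[OF parses_nat] assms pt_tl[OF assms(1)] pt_tl[OF assms(2)])


section \<open>Reading an instance off its encoding\<close>

definition names_end where "names_end x = list_end nat_end x 0"
definition votes_end where "votes_end x = list_end (list_end nat_end) x (names_end x)"
definition limit_end where "limit_end x = nat_end x (votes_end x)"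

text \<open>A failure at some stage returns a position behind the string, where no code starts, so
  the later stages fail too and the final position differs from \<open>length x\<close>.\<close>

definition is_encoding :: "bool list \<Rightarrow> bool" where
  "is_encoding x \<longleftrightarrow> nat_end x (limit_end x) = length x"

definition num_cands where "num_cands x = count_items nat_end x 0"
definition num_votes where "num_votes x = count_items (list_end nat_end) x (names_end x)"
definition cand_pos where "cand_pos x i = item_pos nat_end x 0 i"
definition vote_pos where "vote_pos x v = item_pos (list_end nat_end) x (names_end x) v"
definition vote_len where "vote_len x v = count_items nat_end x (vote_pos x v)"

definition rank_of :: "bool list \<Rightarrow> nat \<Rightarrow> nat \<Rightarrow> nat" where
  "rank_of x v i = bmin (num_cands x) (\<lambda>r. same_nat x (item_pos nat_end x (vote_pos x v) r) (cand_pos x i))"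

definition pref :: "bool list \<Rightarrow> nat" where
  "pref x = bmin (num_cands x) (\<lambda>i. same_nat x (cand_pos x i) (limit_end x))"

text \<open>The bribe limit, too, may be exponentially large, so it is compared with the five bits
  of \<open>enc_nat 2\<close>, which are \<open>[True, False, True, True, False]\<close>.\<close>

definition limit_two :: "bool list \<Rightarrow> bool" where
  "limit_two x \<longleftrightarrow> limit_end x = votes_end x + 5 \<and> bitat x (votes_end x) \<and> \<not> bitat x (votes_end x + 1) \<and>
     bitat x (votes_end x + 2) \<and> bitat x (votes_end x + 3) \<and> \<not> bitat x (votes_end x + 4)"

definition valid_encoding :: "bool list \<Rightarrow> bool" where
  "valid_encoding x \<longleftrightarrow> is_encoding x \<and> limit_two x \<and> pref x < num_cands x \<and>
     (\<forall>i<num_cands x. \<forall>j<num_cands x. i \<noteq> j \<longrightarrow> \<not> same_nat x (cand_pos x i) (cand_pos x j)) \<and>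
     (\<forall>v<num_votes x. vote_len x v = num_cands x \<and> (\<forall>i<num_cands x. rank_of x v i < num_cands x))"

lemma pt_instance [pt_intros]:
  "pt (\<lambda>x e. names_end x)" "pt (\<lambda>x e. votes_end x)" "pt (\<lambda>x e. limit_end x)"
  "pt (\<lambda>x e. num_cands x)" "pt (\<lambda>x e. num_votes x)"
  "pt i \<Longrightarrow> pt (\<lambda>x e. cand_pos x (i x e))" "pt v \<Longrightarrow> pt (\<lambda>x e. vote_pos x (v x e))"
  "pt v \<Longrightarrow> pt (\<lambda>x e. vote_len x (v x e))"
  "pt v \<Longrightarrow> pt i \<Longrightarrow> pt (\<lambda>x e. rank_of x (v x e) (i x e))" "pt (\<lambda>x e. pref x)"
  "pt (\<lambda>x e. of_bool (valid_encoding x))"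
proof -
  note N = parses_nat and L = parses_list[OF parses_nat]
  show 1: "pt (\<lambda>x e. names_end x)" unfolding names_end_def by (intro pt_list_end[OF N] pt_intros)
  show 2: "pt (\<lambda>x e. votes_end x)" unfolding votes_end_def by (intro pt_list_end[OF L] 1)
  show 3: "pt (\<lambda>x e. limit_end x)" unfolding limit_end_def by (intro parsesD(1)[OF N] 2)
  show 4: "pt (\<lambda>x e. num_cands x)" unfolding num_cands_def by (intro pt_count_items[OF N] pt_intros)
  show 5: "pt (\<lambda>x e. num_votes x)" unfolding num_votes_def by (intro pt_count_items[OF L] 1)
  show 6: "pt (\<lambda>x e. cand_pos x (i x e))" if "pt i" for i
    unfolding cand_pos_def by (intro pt_item_pos[OF N] pt_intros that)
  show 7: "pt (\<lambda>x e. vote_pos x (v x e))" if "pt v" for v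
    unfolding vote_pos_def by (intro pt_item_pos[OF L] 1 that)
  show 8: "pt (\<lambda>x e. vote_len x (v x e))" if "pt v" for v
    unfolding vote_len_def by (intro pt_count_items[OF N] 7 that)
  show 9: "pt (\<lambda>x e. rank_of x (v x e) (i x e))" if "pt v" "pt i" for v i
    unfolding rank_of_def by (intro pt_intros pt_same_nat pt_item_pos[OF N] 4 6 7 pt_tl[OF that(1)] pt_tl[OF that(2)])
  show 10: "pt (\<lambda>x e. pref x)"
    unfolding pref_def by (intro pt_intros pt_same_nat 3 4 6)
  show "pt (\<lambda>x e. of_bool (valid_encoding x))"
    unfolding valid_encoding_def is_encoding_def limit_two_def
    by (intro pt_intros pt_same_nat parsesD(1)[OF N] 2 3 4 5 6 8 9 10)
qed

section \<open>Correctness of reading an instance\<close>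

lemma parse_drop:
  assumes E: "parses E f" and d: "drop s x = f a @ t"
  shows "drop (E x s) x = t"
proof -
  have "drop (s + length (f a)) x = drop (length (f a)) (drop s x)" by (simp add: add.commute)
  then show ?thesis unfolding parsesD(3)[OF E d] d by simp
qed

text \<open>From left to right the stages are traversed backwards: success of a stage means that it
  starts inside the string, and its start is the end of the preceding stage, which therefore
  succeeded.\<close>

lemma is_encoding_iff: "is_encoding x \<longleftrightarrow> (\<exists>I. x = enc_input I)"
proof
  note N = parses_nat and L = parses_list[OF parses_nat] and V = parses_list[OF parses_list[OF parses_nat]]
  assume "is_encoding x"
  then have 4: "nat_end x (limit_end x) = length x" by (simp add: is_encoding_def)
  then have le: "nat_end x (limit_end x) \<le> length x" by simp
  obtain p t4 where p: "drop (limit_end x) x = enc_nat p @ t4" "drop (nat_end x (limit_end x)) x = t4" "limit_end x < length x"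
    by (rule parses_success[OF N le]) blast
  have "nat_end x (votes_end x) \<le> length x" using p(3) by (simp add: limit_end_def)
  then obtain k t3 where k: "drop (votes_end x) x = enc_nat k @ t3" "drop (limit_end x) x = t3" "votes_end x < length x"
    by (rule parses_success[OF N]) (auto simp: limit_end_def)
  have "list_end (list_end nat_end) x (names_end x) \<le> length x" using k(3) by (simp add: votes_end_def)
  then obtain vs t2 where vs: "drop (names_end x) x = enc_list (enc_list enc_nat) vs @ t2" "drop (votes_end x) x = t2" "names_end x < length x"
    by (rule parses_success[OF V]) (auto simp: votes_end_def)
  have "list_end nat_end x 0 \<le> length x" using vs(3) by (simp add: names_end_def)
  then obtain cs t1 where cs: "drop 0 x = enc_list enc_nat cs @ t1" "drop (names_end x) x = t1"
    by (rule parses_success[OF L]) (auto simp: names_end_def)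
  have "x = enc_input \<lparr>candidates = cs, voters = vs, bribe_limit = k, preferred = p\<rparr>"
    using cs vs(1,2) k(1,2) p(1,2) 4 by (simp add: enc_input_def)
  then show "\<exists>I. x = enc_input I" by blast
next
  assume "\<exists>I. x = enc_input I"
  then obtain I where x: "x = enc_input I" by blast
  have n: "names_end x = length (enc_list enc_nat (candidates I))"
    using parsesD(3)[OF parses_list[OF parses_nat], of 0 x "candidates I"] by (simp add: names_end_def x enc_input_def)
  have "drop (names_end x) x = enc_list (enc_list enc_nat) (voters I) @ enc_nat (bribe_limit I) @ enc_nat (preferred I)"
    unfolding n by (simp add: x enc_input_def)
  note v = parse_drop[OF parses_list[OF parses_list[OF parses_nat]] this, folded votes_end_def]
  note l = parse_drop[OF parses_nat v, folded limit_end_def]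
  note q = parse_drop[OF parses_nat, of "limit_end x" x "preferred I" "[]"]
  have "limit_end x \<le> length x"
    using drop_pos[OF l] by (simp add: enc_nat_def enc_list_def)
  moreover have "drop (nat_end x (limit_end x)) x = []" "nat_end x (limit_end x) = limit_end x + length (enc_nat (preferred I))"
    using q l parsesD(3)[OF parses_nat, of "limit_end x" x "preferred I" "[]"] by simp_all
  moreover have "limit_end x + length (enc_nat (preferred I)) = length x"
    using drop_pos[OF l] by (simp add: enc_nat_def enc_list_def)
  ultimately show "is_encoding x" by (simp add: is_encoding_def)
qed

lemma instance_positions:
  assumes x: "x = enc_input I"
  shows "num_cands x = length (candidates I)" "num_votes x = length (voters I)"
    "i < length (candidates I) \<Longrightarrow> \<exists>t. drop (cand_pos x i) x = enc_nat (candidates I ! i) @ t"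
    "v < length (voters I) \<Longrightarrow> vote_len x v = length (voters I ! v)"
    "v < length (voters I) \<Longrightarrow> r < length (voters I ! v) \<Longrightarrow>
      \<exists>t. drop (item_pos nat_end x (vote_pos x v) r) x = enc_nat (voters I ! v ! r) @ t"
    "\<exists>t. drop (limit_end x) x = enc_nat (preferred I) @ t"
    "limit_two x \<longleftrightarrow> bribe_limit I = 2"
proof -
  note N = parses_nat and L = parses_list[OF parses_nat] and V = parses_list[OF parses_list[OF parses_nat]]
  let ?t1 = "enc_list (enc_list enc_nat) (voters I) @ enc_nat (bribe_limit I) @ enc_nat (preferred I)"
  have d0: "drop 0 x = enc_list enc_nat (candidates I) @ ?t1" by (simp add: x enc_input_def)
  have n: "names_end x = length (enc_list enc_nat (candidates I))"
    using parsesD(3)[OF L d0] by (simp add: names_end_def)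
  have d1: "drop (names_end x) x = enc_list (enc_list enc_nat) (voters I) @ enc_nat (bribe_limit I) @ enc_nat (preferred I)"
    unfolding n by (simp add: x enc_input_def)
  note d2 = parse_drop[OF V d1, folded votes_end_def]
  note d3 = parse_drop[OF N d2, folded limit_end_def]
  have le: "limit_end x = votes_end x + length (enc_nat (bribe_limit I))"
    unfolding limit_end_def by (rule parsesD(3)[OF N d2])
  show "num_cands x = length (candidates I)" unfolding num_cands_def by (rule list_items(2)[OF N d0])
  show "num_votes x = length (voters I)" unfolding num_votes_def by (rule list_items(2)[OF L d1])
  show "\<exists>t. drop (cand_pos x i) x = enc_nat (candidates I ! i) @ t" if "i < length (candidates I)"
    unfolding cand_pos_def by (rule list_items(3)[OF N d0 that])
  have v: "\<exists>t. drop (vote_pos x v) x = enc_list enc_nat (voters I ! v) @ t" if "v < length (voters I)"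
    unfolding vote_pos_def by (rule list_items(3)[OF L d1 that])
  show "vote_len x v = length (voters I ! v)" if vl: "v < length (voters I)"
  proof -
    from v[OF vl] obtain t where "drop (vote_pos x v) x = enc_list enc_nat (voters I ! v) @ t" ..
    then show ?thesis unfolding vote_len_def by (rule list_items(2)[OF N])
  qed
  show "\<exists>t. drop (item_pos nat_end x (vote_pos x v) r) x = enc_nat (voters I ! v ! r) @ t"
    if vl: "v < length (voters I)" and r: "r < length (voters I ! v)"
  proof -
    from v[OF vl] obtain t where "drop (vote_pos x v) x = enc_list enc_nat (voters I ! v) @ t" ..
    then show ?thesis by (rule list_items(3)[OF N _ r])
  qed
  show "\<exists>t. drop (limit_end x) x = enc_nat (preferred I) @ t" using d3 by (intro exI[of _ "[]"]) simp
  have b2: "binary 2 = [False, True]" by (simp add: binary.simps)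
  have e2: "enc_nat 2 = [True, False, True, True, False]" by (simp add: enc_nat_def enc_list_def b2)
  show "limit_two x \<longleftrightarrow> bribe_limit I = 2"
  proof
    let ?k = "enc_nat (bribe_limit I)"
    assume lt: "limit_two x"
    have len: "length ?k = 5" using lt le by (simp add: limit_two_def)
    note b = bitat_drop[OF d2, unfolded len]
    have "?k ! 0" "\<not> ?k ! 1" "?k ! 2" "?k ! 3" "\<not> ?k ! 4"
      using lt b[of 0] b[of 1] b[of 2] b[of 3] b[of 4] by (simp_all add: limit_two_def)
    then have "?k = enc_nat 2"
      using len unfolding e2 by (intro nth_equalityI) (auto simp: less_Suc_eq numeral_eq_Suc)
    then show "bribe_limit I = 2" by (simp add: enc_nat_inject)
  next
    assume k: "bribe_limit I = 2"
    note b = bitat_drop[OF d2, unfolded k e2]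
    show "limit_two x" unfolding limit_two_def using le b[of 0] b[of 1] b[of 2] b[of 3] b[of 4]
      by (simp add: k e2)
  qed
qed

lemma bmin_less_iff: "bmin n P < n \<longleftrightarrow> (\<exists>i<n. P i)"
  using bmin_holds[of n P] bmin_least[of _ n P] bmin_le[of n P] by (metis le_neq_implies_less)

text \<open>A list of the right length in which every candidate occurs has no room for repetitions
  or other names.\<close>

lemma permutation_iff:
  assumes "distinct C"
  shows "v \<in> permutations_of_set (set C) \<longleftrightarrow> length v = length C \<and> (\<forall>i<length C. \<exists>r<length C. v ! r = C ! i)"
proof
  assume "v \<in> permutations_of_set (set C)"
  note v = perm_facts[OF this]
  have len: "length v = length C" using v(3) assms by (simp add: distinct_card)
  have "\<exists>r<length C. v ! r = C ! i" if "i < length C" for i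
  proof -
    have "C ! i \<in> set v" using that v(1) by simp
    then show ?thesis using len by (auto simp: in_set_conv_nth)
  qed
  with len show "length v = length C \<and> (\<forall>i<length C. \<exists>r<length C. v ! r = C ! i)" by blast
next
  assume *: "length v = length C \<and> (\<forall>i<length C. \<exists>r<length C. v ! r = C ! i)"
  have sub: "set C \<subseteq> set v"
  proof
    fix c assume "c \<in> set C"
    then obtain i where "i < length C" "c = C ! i" by (auto simp: in_set_conv_nth)
    with * show "c \<in> set v" by (metis nth_mem)
  qed
  have "card (set v) \<le> card (set C)" using * card_length[of v] assms by (simp add: distinct_card)
  then have "set v = set C" using card_seteq[OF _ sub] by simp
  moreover have "distinct v" using * \<open>set v = set C\<close> assms by (metis card_distinct distinct_card)
  ultimately show "v \<in> permutations_of_set (set C)" by (simp add: permutations_of_set_def)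
qed

lemma div_mod_add_mult:
  fixes n :: nat
  assumes "v < n"
  shows "(j * n + v) div n = j" "(j * n + v) mod n = v"
  using assms by auto

lemma valid_encoding_iff:
  assumes x: "x = enc_input I"
  shows "valid_encoding x \<longleftrightarrow> valid_input I \<and> bribe_limit I = 2"
    and "valid_input I \<Longrightarrow> v < length (voters I) \<Longrightarrow> i < length (candidates I) \<Longrightarrow>
      vote_rank (voters I ! v) (candidates I ! i) = Suc (rank_of x v i)"
    and "valid_input I \<Longrightarrow> pref x < length (candidates I) \<and> candidates I ! pref x = preferred I"
proof -
  note pos = instance_positions[OF x]
  let ?C = "candidates I" and ?V = "voters I"
  have same_c: "same_nat x (cand_pos x i) (cand_pos x j) \<longleftrightarrow> ?C ! i = ?C ! j" if "i < length ?C" "j < length ?C" for i j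
    using pos(3)[OF that(1)] pos(3)[OF that(2)] same_nat_iff by blast
  have same_p: "same_nat x (cand_pos x i) (limit_end x) \<longleftrightarrow> ?C ! i = preferred I" if "i < length ?C" for i
    using pos(3)[OF that] pos(6) same_nat_iff by blast
  have same_v: "same_nat x (item_pos nat_end x (vote_pos x v) r) (cand_pos x i) \<longleftrightarrow> ?V ! v ! r = ?C ! i"
    if "v < length ?V" "r < length (?V ! v)" "i < length ?C" for v r i
    using pos(5)[OF that(1,2)] pos(3)[OF that(3)] same_nat_iff by blast
  have pref: "pref x < length ?C \<longleftrightarrow> preferred I \<in> set ?C"
    unfolding pref_def pos(1) bmin_less_iff using same_p by (auto simp: in_set_conv_nth)
  have dist: "(\<forall>i<length ?C. \<forall>j<length ?C. i \<noteq> j \<longrightarrow> \<not> same_nat x (cand_pos x i) (cand_pos x j)) \<longleftrightarrow> distinct ?C"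
    unfolding distinct_conv_nth using same_c by blast
  have vote: "(vote_len x v = length ?C \<and> (\<forall>i<length ?C. rank_of x v i < length ?C)) \<longleftrightarrow> ?V ! v \<in> permutations_of_set (set ?C)"
    if "distinct ?C" "v < length ?V" for v
    unfolding permutation_iff[OF that(1)] rank_of_def pos(1) bmin_less_iff pos(4)[OF that(2)]
  proof (rule conj_cong[OF refl])
    assume len: "length (?V ! v) = length ?C"
    have "same_nat x (item_pos nat_end x (vote_pos x v) r) (cand_pos x i) \<longleftrightarrow> ?V ! v ! r = ?C ! i"
      if "i < length ?C" "r < length ?C" for i r
      using same_v[OF \<open>v < length ?V\<close>, of r i] that len by simp
    then show "(\<forall>i<length ?C. \<exists>r<length ?C. same_nat x (item_pos nat_end x (vote_pos x v) r) (cand_pos x i)) \<longleftrightarrow>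
        (\<forall>i<length ?C. \<exists>r<length ?C. ?V ! v ! r = ?C ! i)" by (simp cong: conj_cong)
  qed
  have set: "set ?V \<subseteq> permutations_of_set (set ?C) \<longleftrightarrow> (\<forall>v<length ?V. ?V ! v \<in> permutations_of_set (set ?C))"
    by (auto simp: in_set_conv_nth subset_iff)
  have enc: "is_encoding x" using is_encoding_iff x by blast
  show "valid_encoding x \<longleftrightarrow> valid_input I \<and> bribe_limit I = 2"
    unfolding valid_encoding_def valid_input_def election_def pos(1,2,7) pref dist set
    using vote enc by auto
  show "vote_rank (?V ! v) (?C ! i) = Suc (rank_of x v i)"
    if valid: "valid_input I" and v: "v < length ?V" and i: "i < length ?C"
  proof -
    have vp: "?V ! v \<in> permutations_of_set (set ?C)" and d: "distinct ?C"
      using valid v unfolding valid_input_def election_def by auto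
    note vf = perm_facts[OF vp]
    have len: "length (?V ! v) = length ?C" using vf(3) d by (simp add: distinct_card)
    obtain r where r: "r < length ?C" "?V ! v ! r = ?C ! i" using vp i unfolding permutation_iff[OF d] by blast
    have "rank_of x v i = r"
      unfolding rank_of_def pos(1)
    proof (rule bmin_eqI)
      show "\<not> same_nat x (item_pos nat_end x (vote_pos x v) r') (cand_pos x i)" if "r' < r" for r'
      proof -
        have "?V ! v ! r' \<noteq> ?V ! v ! r"
          using nth_eq_iff_index_eq[OF vf(2), of r' r] that r(1) len by simp
        then show ?thesis using same_v[OF v _ i, of r'] that r len by simp
      qed
      show "r = length ?C \<or> same_nat x (item_pos nat_end x (vote_pos x v) r) (cand_pos x i)"
        using same_v[OF v _ i, of r] r len by simp
    qed (use r in simp)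
    then show ?thesis using vote_rank_nth[OF vf(2), of r] r len by simp
  qed
  show "pref x < length ?C \<and> ?C ! pref x = preferred I" if valid: "valid_input I"
  proof -
    have p: "pref x < length ?C" using pref valid by (simp add: valid_input_def)
    have "same_nat x (cand_pos x (pref x)) (limit_end x)"
      using bmin_holds[of "length ?C" "\<lambda>i. same_nat x (cand_pos x i) (limit_end x)"] p unfolding pref_def pos(1) by simp
    then show ?thesis using p same_p[OF p] by simp
  qed
qed

lemma borda_winners_iff_index:
  assumes "p = C ! k" "k < length C"
    and "\<And>i. i < length C \<Longrightarrow> borda_score (set C) W (C ! i) = S i"
  shows "p \<in> borda_winners (set C) W \<longleftrightarrow> (\<forall>i<length C. S i \<le> S k)"
proof -
  have "p \<in> set C" using assms(1,2) by simp
  moreover have "(\<forall>d\<in>set C. borda_score (set C) W d \<le> S k) \<longleftrightarrow> (\<forall>i<length C. S i \<le> S k)"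
    unfolding all_set_conv_all_nth by (simp add: assms(3))
  ultimately show ?thesis
    unfolding borda_winners_def using assms(1) assms(3)[OF assms(2)] by simp
qed

lemma borda_score_nth: "borda_score C W c = (\<Sum>v<length W. card C - vote_rank (W ! v) c)"
  by (simp add: borda_score_def sum_list_sum_nth atLeast0LessThan)


section \<open>Conformant bribery is in P\<close>

text \<open>\<open>b\<close> is tested before \<open>a\<close> because the second update wins in
  \<open>V[a := _, b := _]\<close> if the positions coincide.\<close>

definition conformant_score :: "bool list \<Rightarrow> nat \<Rightarrow> nat \<Rightarrow> nat \<Rightarrow> nat \<Rightarrow> nat \<Rightarrow> nat" where
  "conformant_score x a b c d i = (\<Sum>v<num_votes x.
     num_cands x - Suc (rank_of x (if v = b then d else if v = a then c else v) i))"

text \<open>Without voters there is no quadruple of voters, but all scores are 0 and every candidate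
  wins.\<close>

definition conformant_test :: "bool list \<Rightarrow> bool" where
  "conformant_test x \<longleftrightarrow> valid_encoding x \<and> (num_votes x = 0 \<or>
     (\<exists>a<num_votes x. \<exists>b<num_votes x. \<exists>c<num_votes x. \<exists>d<num_votes x. \<forall>i<num_cands x.
       conformant_score x a b c d i \<le> conformant_score x a b c d (pref x)))"

lemma pt_conformant_score:
  assumes "pt a" "pt b" "pt c" "pt d" "pt i"
  shows "pt (\<lambda>x e. conformant_score x (a x e) (b x e) (c x e) (d x e) (i x e))"
  unfolding conformant_score_def
  by (intro pt_intros pt_tl[OF assms(1)] pt_tl[OF assms(2)] pt_tl[OF assms(3)] pt_tl[OF assms(4)] pt_tl[OF assms(5)])

lemma pt_conformant_test: "pt (\<lambda>x e. of_bool (conformant_test x))"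
  unfolding conformant_test_def by (intro pt_intros pt_conformant_score)

lemma no_voters:
  assumes "V = []" "p \<in> C"
  shows "\<exists>W\<in>bribed A k V. p \<in> borda_winners C W"
proof
  show "V \<in> bribed A k V" unfolding bribed_def by (auto intro!: exI[of _ "{}"])
  show "p \<in> borda_winners C V" using assms by (simp add: borda_winners_def borda_score_def)
qed

lemma conformant_test_iff:
  "conformant_test x \<longleftrightarrow> x \<in> enc_input ` {I \<in> Borda_Conformant_Bribery. bribe_limit I = 2}"
proof (cases "\<exists>I. x = enc_input I")
  case False
  then have "\<not> valid_encoding x" using is_encoding_iff by (simp add: valid_encoding_def)
  then show ?thesis using False by (auto simp: conformant_test_def)
next
  case True
  then obtain I where x: "x = enc_input I" by blast
  let ?C = "candidates I" and ?V = "voters I"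
  note pos = instance_positions[OF x] and vi = valid_encoding_iff[OF x]
  have mem: "x \<in> enc_input ` {I \<in> Borda_Conformant_Bribery. bribe_limit I = 2} \<longleftrightarrow>
      I \<in> Borda_Conformant_Bribery \<and> bribe_limit I = 2"
    using x inj_enc_input by (auto simp: inj_def)
  show ?thesis
  proof (cases "valid_input I \<and> bribe_limit I = 2")
    case False
    then show ?thesis using vi(1) mem by (auto simp: conformant_test_def Borda_Conformant_Bribery_def)
  next
    case ok: True
    then have valid: "valid_input I" by simp
    have dC: "card (set ?C) = length ?C" using valid by (simp add: valid_input_def distinct_card)
    have main: "(\<exists>W\<in>bribed (set ?V) 2 ?V. preferred I \<in> borda_winners (set ?C) W) \<longleftrightarrow>
      (num_votes x = 0 \<or> (\<exists>a<num_votes x. \<exists>b<num_votes x. \<exists>c<num_votes x. \<exists>d<num_votes x. \<forall>i<num_cands x.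
       conformant_score x a b c d i \<le> conformant_score x a b c d (pref x)))"
    proof (cases "?V = []")
      case True
      then show ?thesis using no_voters[OF True, of "preferred I" "set ?C"] valid pos(2)
        by (auto simp: valid_input_def)
    next
      case False
      have win: "preferred I \<in> borda_winners (set ?C) (?V[a := ?V ! c, b := ?V ! d]) \<longleftrightarrow>
        (\<forall>i<length ?C. conformant_score x a b c d i \<le> conformant_score x a b c d (pref x))"
        if abcd: "a < length ?V" "b < length ?V" "c < length ?V" "d < length ?V" for a b c d
      proof (rule borda_winners_iff_index)
        show "preferred I = ?C ! pref x" "pref x < length ?C" using vi(3)[OF valid] by auto
        fix i assume i: "i < length ?C"
        have "vote_rank (?V[a := ?V ! c, b := ?V ! d] ! v) (?C ! i) =
            Suc (rank_of x (if v = b then d else if v = a then c else v) i)" if "v < length ?V" for v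
          using vi(2)[OF valid _ i] abcd that by (auto simp: nth_list_update)
        then show "borda_score (set ?C) (?V[a := ?V ! c, b := ?V ! d]) (?C ! i) = conformant_score x a b c d i"
          unfolding borda_score_nth conformant_score_def pos(1,2) dC by simp
      qed
      have "(\<exists>W\<in>bribed (set ?V) 2 ?V. preferred I \<in> borda_winners (set ?C) W) \<longleftrightarrow>
        (\<exists>a<length ?V. \<exists>b<length ?V. \<exists>c<length ?V. \<exists>d<length ?V. \<forall>i<length ?C.
          conformant_score x a b c d i \<le> conformant_score x a b c d (pref x))" (is "?L \<longleftrightarrow> ?R")
      proof
        assume ?L
        then obtain W where "W \<in> bribed (set ?V) 2 ?V" and W: "preferred I \<in> borda_winners (set ?C) W" ..
        from this(1) obtain a b w1 w2 where ab: "a < length ?V" "b < length ?V"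
          and w: "w1 \<in> set ?V" "w2 \<in> set ?V" and eq: "W = ?V[a := w1, b := w2]"
          unfolding bribed_two[OF False order_refl] by blast
        obtain c d where cd: "c < length ?V" "d < length ?V" and w: "w1 = ?V ! c" "w2 = ?V ! d"
          using w by (metis in_set_conv_nth)
        show ?R using W[unfolded eq w] unfolding win[OF ab cd] using ab cd by blast
      next
        assume ?R
        then obtain a b c d where ab: "a < length ?V" "b < length ?V" and cd: "c < length ?V" "d < length ?V"
          and "\<forall>i<length ?C. conformant_score x a b c d i \<le> conformant_score x a b c d (pref x)" by blast
        then have "preferred I \<in> borda_winners (set ?C) (?V[a := ?V ! c, b := ?V ! d])"
          unfolding win[OF ab cd] by blast
        moreover have "?V[a := ?V ! c, b := ?V ! d] \<in> bribed (set ?V) 2 ?V"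
          unfolding bribed_two[OF False order_refl] using ab cd nth_mem by blast
        ultimately show ?L by blast
      qed
      then show ?thesis using False pos(1,2) by simp
    qed
    then show ?thesis
      unfolding mem conformant_test_def using ok vi(1)
      by (simp add: Borda_Conformant_Bribery_def borda_conformant_bribable_def)
  qed
qed

theorem Borda_Conformant_Bribery_in_P:
  "enc_input ` {I \<in> Borda_Conformant_Bribery. bribe_limit I = 2} \<in> class_P"
  using pt_class_P[of "enc_input ` {I \<in> Borda_Conformant_Bribery. bribe_limit I = 2}"] pt_conformant_test
  unfolding conformant_test_iff .


section \<open>Bribery is in NP\<close>

text \<open>A certificate consists of two bit matrices, whose entry \<open>(i, r)\<close> tells whether the new vote
  has candidate \<open>i\<close> at position \<open>r\<close>.\<close>

definition left_len :: "bool list \<Rightarrow> nat" where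
  "left_len z = bmin (length z) (\<lambda>i. \<not> bitat z (2 * i))"

text \<open>The first component of a pair: flags stand at the even positions, the bits at the odd
  ones.\<close>

definition left :: "bool list \<Rightarrow> bool list" where
  "left z = map (\<lambda>i. bitat z (2 * i + 1)) [0..<left_len z]"

text \<open>Only the first set bit of a row counts, and a row without one gives the illegal rank
  \<open>num_cands (left z)\<close>.\<close>

definition new_rank :: "bool list \<Rightarrow> nat \<Rightarrow> nat \<Rightarrow> nat" where
  "new_rank z h i = bmin (num_cands (left z)) (\<lambda>r. bitat z (2 * left_len z + 1 +
     ((h * num_cands (left z) + i) * num_cands (left z) + r)))"

definition new_votes_valid :: "bool list \<Rightarrow> bool" where
  "new_votes_valid z \<longleftrightarrow> (\<forall>h<2. \<forall>i<num_cands (left z). new_rank z h i < num_cands (left z) \<and>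
     (\<forall>j<num_cands (left z). i \<noteq> j \<longrightarrow> new_rank z h i \<noteq> new_rank z h j))"

definition bribed_score :: "bool list \<Rightarrow> nat \<Rightarrow> nat \<Rightarrow> nat \<Rightarrow> nat" where
  "bribed_score z a b i = (\<Sum>v<num_votes (left z). num_cands (left z) -
     Suc (if v = b then new_rank z 1 i else if v = a then new_rank z 0 i else rank_of (left z) v i))"

definition bribery_test :: "bool list \<Rightarrow> bool" where
  "bribery_test z \<longleftrightarrow> valid_encoding (left z) \<and> (num_votes (left z) = 0 \<or> (new_votes_valid z \<and>
     (\<exists>a<num_votes (left z). \<exists>b<num_votes (left z). \<forall>i<num_cands (left z).
       bribed_score z a b i \<le> bribed_score z a b (pref (left z)))))"

lemma ptl_left: "ptl (\<lambda>z e. left z)"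
  unfolding left_def left_len_def by (intro ptl_map pt_intros)

lemma pt_left [pt_intros]:
  "pt (\<lambda>z e. num_cands (left z))" "pt (\<lambda>z e. num_votes (left z))" "pt (\<lambda>z e. pref (left z))"
  "pt (\<lambda>z e. of_bool (valid_encoding (left z)))"
  "pt v \<Longrightarrow> pt i \<Longrightarrow> pt (\<lambda>z e. rank_of (left z) (v z e) (i z e))"
proof -
  show "pt (\<lambda>z e. num_cands (left z))" "pt (\<lambda>z e. num_votes (left z))" "pt (\<lambda>z e. pref (left z))"
    "pt (\<lambda>z e. of_bool (valid_encoding (left z)))"
    by (rule pt_input[OF _ ptl_left, of "\<lambda>x e. _ x"], intro pt_intros)+
  have "pt (\<lambda>z e. rank_of (left z) (e 0) (e 1))"
    by (rule pt_input[OF _ ptl_left, of "\<lambda>x e. rank_of x (e 0) (e 1)"]) (intro pt_intros)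
  then show "pt v \<Longrightarrow> pt i \<Longrightarrow> pt (\<lambda>z e. rank_of (left z) (v z e) (i z e))"
    by (rule pt_app2[of "\<lambda>z. rank_of (left z)"])
qed

lemma pt_new_rank [pt_intros]: "pt h \<Longrightarrow> pt i \<Longrightarrow> pt (\<lambda>z e. new_rank z (h z e) (i z e))"
  unfolding new_rank_def left_len_def by (intro pt_intros pt_tl[of h] pt_tl[of i])

lemma pt_bribed_score:
  assumes "pt a" "pt b" "pt i"
  shows "pt (\<lambda>z e. bribed_score z (a z e) (b z e) (i z e))"
  unfolding bribed_score_def
  by (intro pt_intros pt_tl[OF assms(1)] pt_tl[OF assms(2)] pt_tl[OF assms(3)])

lemma pt_bribery_test: "pt (\<lambda>z e. of_bool (bribery_test z))"
  unfolding bribery_test_def new_votes_valid_def by (intro pt_intros pt_bribed_score)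

lemma left_enc_pair: "left_len (enc_pair x u) = length x" "left (enc_pair x u) = x"
  "bitat (enc_pair x u) (2 * length x + 1 + k) \<longleftrightarrow> bitat u k"
proof -
  have len: "length (enc_pair x u) = 2 * length x + 1 + length u" by (rule length_enc_pair)
  have ev: "bitat (enc_pair x u) (2 * i) \<longleftrightarrow> i < length x" if "i \<le> length x" for i
    using nth_enc_pair(1)[of "2 * i" x u] that len by (auto simp: bitat_def pair_symbol_def)
  show 1: "left_len (enc_pair x u) = length x"
    unfolding left_len_def by (rule bmin_eqI) (use len ev in auto)
  have od: "bitat (enc_pair x u) (2 * i + 1) \<longleftrightarrow> x ! i" if "i < length x" for i
    using nth_enc_pair(1)[of "2 * i + 1" x u] that len by (auto simp: bitat_def pair_symbol_def)
  show "left (enc_pair x u) = x"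
    unfolding left_def 1 by (rule nth_equalityI) (use od in auto)
  show "bitat (enc_pair x u) (2 * length x + 1 + k) \<longleftrightarrow> bitat u k"
    using nth_enc_pair(2)[of x u k] len by (simp add: bitat_def)
qed

text \<open>Two matrices of order \<open>n\<close> take \<open>2 * n ^ 2\<close> bits, and
  \<open>n\<close> is at most \<open>length x\<close>. In one direction, distinct ranks below
  \<open>n\<close> form a bijection and hence a vote; in the other, the matrices are filled with the
  ranks in the two new votes.\<close>

lemma bribery_test_iff:
  assumes x: "x = enc_input I" and ok: "valid_input I" "bribe_limit I = 2"
  shows "(\<exists>u. length u \<le> 2 * length x ^ 2 \<and> bribery_test (enc_pair x u)) \<longleftrightarrow>
    borda_bribable (set (candidates I)) (voters I) 2 (preferred I)"
proof -
  let ?C = "candidates I" and ?V = "voters I"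
  let ?n = "length ?C"
  note pos = instance_positions[OF x] and vi = valid_encoding_iff[OF x]
  have valid: "valid_encoding x" using vi(1) ok by simp
  have dist: "distinct ?C" and dC: "card (set ?C) = ?n" and pC: "preferred I \<in> set ?C"
    and VP: "set ?V \<subseteq> permutations_of_set (set ?C)"
    using ok(1) by (auto simp: valid_input_def election_def distinct_card)
  have nx: "?n \<le> length x" using pos(1) bmin_le unfolding num_cands_def count_items_def by metis
  show ?thesis
  proof (cases "?V = []")
    case True
    then have "bribery_test (enc_pair x [])" using valid pos(2) by (simp add: bribery_test_def left_enc_pair)
    then show ?thesis using no_voters[OF True pC] unfolding borda_bribable_def
      by (auto intro!: exI[of _ "[]"])
  next
    case False
    have rank: "new_rank (enc_pair x u) h i = bmin ?n (\<lambda>r. bitat u ((h * ?n + i) * ?n + r))" for u h i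
      unfolding new_rank_def left_enc_pair pos(1) ..
    have win: "preferred I \<in> borda_winners (set ?C) (?V[a := w1, b := w2]) \<longleftrightarrow>
        (\<forall>i<?n. bribed_score (enc_pair x u) a b i \<le> bribed_score (enc_pair x u) a b (pref x))"
      if ab: "a < length ?V" "b < length ?V"
        and w1: "\<And>i. i < ?n \<Longrightarrow> vote_rank w1 (?C ! i) = Suc (new_rank (enc_pair x u) 0 i)"
        and w2: "\<And>i. i < ?n \<Longrightarrow> vote_rank w2 (?C ! i) = Suc (new_rank (enc_pair x u) 1 i)" for a b w1 w2 u
    proof (rule borda_winners_iff_index)
      show "preferred I = ?C ! pref x" "pref x < ?n" using vi(3)[OF ok(1)] by auto
      fix i assume i: "i < ?n"
      have "vote_rank (?V[a := w1, b := w2] ! v) (?C ! i) =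
          Suc (if v = b then new_rank (enc_pair x u) 1 i else if v = a then new_rank (enc_pair x u) 0 i else rank_of x v i)"
        if "v < length ?V" for v
        using vi(2)[OF ok(1) that i] w1[OF i] w2[OF i] ab that by (auto simp: nth_list_update)
      then show "borda_score (set ?C) (?V[a := w1, b := w2]) (?C ! i) = bribed_score (enc_pair x u) a b i"
        unfolding borda_score_nth bribed_score_def left_enc_pair pos(1,2) dC by simp
    qed
    show ?thesis
    proof
      assume "\<exists>u. length u \<le> 2 * length x ^ 2 \<and> bribery_test (enc_pair x u)"
      then obtain u where "bribery_test (enc_pair x u)" by blast
      then obtain a b where nv: "new_votes_valid (enc_pair x u)" and ab: "a < length ?V" "b < length ?V"
        and sc: "\<forall>i<?n. bribed_score (enc_pair x u) a b i \<le> bribed_score (enc_pair x u) a b (pref x)"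
        using False unfolding bribery_test_def left_enc_pair pos(1,2) by auto
      have "\<exists>w\<in>permutations_of_set (set ?C). \<forall>i<?n. vote_rank w (?C ! i) = Suc (new_rank (enc_pair x u) h i)"
        if h: "h < 2" for h
      proof -
        let ?r = "new_rank (enc_pair x u) h"
        have r: "?r i < ?n" "\<And>j. j < ?n \<Longrightarrow> i \<noteq> j \<Longrightarrow> ?r i \<noteq> ?r j" if "i < ?n" for i
          using nv h that unfolding new_votes_valid_def left_enc_pair pos(1) by auto
        define idx where "idx = inv_into {..<?n} ((!) ?C)"
        have bC: "bij_betw ((!) ?C) {..<?n} (set ?C)" by (rule bij_betw_nth[OF dist]) auto
        have idx: "idx (?C ! i) = i" if "i < ?n" for i
          unfolding idx_def using bij_betw_inv_into_left[OF bC, of i] that by simp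
        have "inj_on ?r {..<?n}" by (rule inj_onI) (use r in auto)
        moreover have "?r ` {..<?n} \<subseteq> {..<?n}" using r(1) by auto
        ultimately have "bij_betw ?r {..<?n} {..<?n}"
          using endo_inj_surj[of "{..<?n}" ?r] by (simp add: bij_betw_def)
        moreover have "bij_betw idx (set ?C) {..<?n}" unfolding idx_def by (rule bij_betw_inv_into[OF bC])
        ultimately have "bij_betw (?r \<circ> idx) (set ?C) {..<card (set ?C)}" unfolding dC by (rule bij_betw_trans[rotated])
        then obtain w where "w \<in> permutations_of_set (set ?C)" "\<And>c. c \<in> set ?C \<Longrightarrow> vote_rank w c = Suc ((?r \<circ> idx) c)"
          by (rule vote_of_ranks) auto
        then show ?thesis using idx by (intro bexI[of _ w]) auto
      qed
      from this[of 0] this[of 1] obtain w1 w2 where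
        w1: "w1 \<in> permutations_of_set (set ?C)" "\<And>i. i < ?n \<Longrightarrow> vote_rank w1 (?C ! i) = Suc (new_rank (enc_pair x u) 0 i)"
        and w2: "w2 \<in> permutations_of_set (set ?C)" "\<And>i. i < ?n \<Longrightarrow> vote_rank w2 (?C ! i) = Suc (new_rank (enc_pair x u) 1 i)"
        by auto
      have "preferred I \<in> borda_winners (set ?C) (?V[a := w1, b := w2])" using win[OF ab w1(2) w2(2)] sc by blast
      moreover have "?V[a := w1, b := w2] \<in> bribed (permutations_of_set (set ?C)) 2 ?V"
        unfolding bribed_two[OF False VP] using ab w1(1) w2(1) by blast
      ultimately show "borda_bribable (set ?C) ?V 2 (preferred I)" unfolding borda_bribable_def by blast
    next
      assume "borda_bribable (set ?C) ?V 2 (preferred I)"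
      then obtain W where "W \<in> bribed (permutations_of_set (set ?C)) 2 ?V" and W: "preferred I \<in> borda_winners (set ?C) W"
        unfolding borda_bribable_def by (elim bexE)
      from this(1) obtain a b w1 w2 where ab: "a < length ?V" "b < length ?V"
        and w: "w1 \<in> permutations_of_set (set ?C)" "w2 \<in> permutations_of_set (set ?C)"
        and eq: "W = ?V[a := w1, b := w2]"
        unfolding bribed_two[OF False VP] by blast
      note p = W[unfolded eq]
      \<comment> \<open>The index \<open>k\<close> is decoded as matrix, row and column, inverse to
        the offset \<open>(h * n + i) * n + r\<close> used by \<open>new_rank\<close>.\<close>
      define u where "u = map (\<lambda>k. vote_rank (if k div ?n div ?n = 0 then w1 else w2) (?C ! (k div ?n mod ?n)) = Suc (k mod ?n))
        [0..<2 * ?n * ?n]"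
      have ub: "bitat u ((h * ?n + i) * ?n + r) \<longleftrightarrow> vote_rank (if h = 0 then w1 else w2) (?C ! i) = Suc r"
        if "h < 2" "i < ?n" "r < ?n" for h i r
      proof -
        let ?k = "(h * ?n + i) * ?n + r"
        have 1: "?k div ?n = h * ?n + i" "?k mod ?n = r"
          by (rule div_mod_add_mult[OF that(3)])+
        have 2: "(h * ?n + i) div ?n = h" "(h * ?n + i) mod ?n = i" by (rule div_mod_add_mult[OF that(2)])+
        have "h * ?n + i < 2 * ?n" by (rule pair_less) (use that in auto)
        then have "?k < 2 * ?n * ?n" by (intro pair_less) (use that in auto)
        then have "bitat u ?k \<longleftrightarrow>
            vote_rank (if ?k div ?n div ?n = 0 then w1 else w2) (?C ! (?k div ?n mod ?n)) = Suc (?k mod ?n)"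
          unfolding u_def bitat_def by simp
        then show ?thesis unfolding 1 2 .
      qed
      have rk: "vote_rank (if h = 0 then w1 else w2) (?C ! i) = Suc (new_rank (enc_pair x u) h i) \<and>
          new_rank (enc_pair x u) h i < ?n" if "h < 2" "i < ?n" for h i
      proof -
        have "(if h = 0 then w1 else w2) \<in> permutations_of_set (set ?C)" using w by simp
        then obtain r where r: "r < card (set ?C)" "vote_rank (if h = 0 then w1 else w2) (?C ! i) = Suc r"
          by (rule vote_rank_bounds[OF _ nth_mem[OF \<open>i < ?n\<close>]])
        have rn: "r < ?n" using r(1) dC by simp
        have "new_rank (enc_pair x u) h i = r"
          unfolding rank by (rule bmin_eqI) (use ub[OF that] r(2) rn in auto)
        then show ?thesis using r(2) rn by simp
      qed
      have "new_votes_valid (enc_pair x u)"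
        unfolding new_votes_valid_def left_enc_pair pos(1)
      proof (intro allI impI conjI)
        fix h i :: nat assume hi: "h < 2" "i < ?n"
        show "new_rank (enc_pair x u) h i < ?n" using rk[OF hi] by simp
        fix j :: nat assume j: "j < ?n" "i \<noteq> j"
        have "?C ! i \<noteq> ?C ! j" using dist hi j by (simp add: nth_eq_iff_index_eq)
        moreover have "(if h = 0 then w1 else w2) \<in> permutations_of_set (set ?C)" using w by simp
        ultimately have "vote_rank (if h = 0 then w1 else w2) (?C ! i) \<noteq> vote_rank (if h = 0 then w1 else w2) (?C ! j)"
          using vote_rank_inject[OF _ nth_mem[OF hi(2)] nth_mem[OF j(1)]] by blast
        then show "new_rank (enc_pair x u) h i \<noteq> new_rank (enc_pair x u) h j"
          using rk[OF hi] rk[OF hi(1) j(1)] by auto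
      qed
      moreover have "\<forall>i<?n. bribed_score (enc_pair x u) a b i \<le> bribed_score (enc_pair x u) a b (pref x)"
        using win[OF ab, of w1 u w2] rk[of 0] rk[of 1] p by simp
      ultimately have "bribery_test (enc_pair x u)"
        unfolding bribery_test_def left_enc_pair pos(1,2) using valid ab by blast
      moreover have "length u \<le> 2 * length x ^ 2"
        using mult_le_mono[OF nx nx] by (simp add: u_def power2_eq_square)
      ultimately show "\<exists>u. length u \<le> 2 * length x ^ 2 \<and> bribery_test (enc_pair x u)" by blast
    qed
  qed
qed

theorem Borda_Bribery_in_NP: "enc_input ` {I \<in> Borda_Bribery. bribe_limit I = 2} \<in> class_NP"
proof -
  let ?L = "enc_input ` {I \<in> Borda_Bribery. bribe_limit I = 2}"
  have "{z. bribery_test z} \<in> class_P" by (rule pt_class_P) (simp add: pt_bribery_test)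
  moreover have "x \<in> ?L \<longleftrightarrow> (\<exists>u. length u \<le> poly [:0, 0, 2:] (length x) \<and> enc_pair x u \<in> {z. bribery_test z})" for x
  proof (cases "\<exists>I. x = enc_input I \<and> valid_input I \<and> bribe_limit I = 2")
    case True
    then obtain I where I: "x = enc_input I" "valid_input I" "bribe_limit I = 2" by blast
    have "x \<in> ?L \<longleftrightarrow> I \<in> Borda_Bribery" using I inj_enc_input by (auto simp: inj_def)
    moreover have "I \<in> Borda_Bribery \<longleftrightarrow> borda_bribable (set (candidates I)) (voters I) 2 (preferred I)"
      using I by (simp add: Borda_Bribery_def)
    moreover have "\<dots> \<longleftrightarrow> (\<exists>u. length u \<le> 2 * length x ^ 2 \<and> bribery_test (enc_pair x u))"
      using bribery_test_iff[OF I] by simp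
    moreover have "poly [:0, 0, 2:] (length x) = 2 * length x ^ 2" by (simp add: power2_eq_square)
    ultimately show ?thesis by (simp only: mem_Collect_eq)
  next
    case False
    \<comment> \<open>The test checks the first component of the pair, so a string that is no valid
      instance has no certificate.\<close>
    have "\<not> valid_encoding x"
    proof
      assume v: "valid_encoding x"
      then obtain I where "x = enc_input I" using is_encoding_iff by (auto simp: valid_encoding_def)
      with v valid_encoding_iff(1)[of x I] False show False by blast
    qed
    then show ?thesis using False by (auto simp: Borda_Bribery_def bribery_test_def left_enc_pair)
  qed
  ultimately show ?thesis unfolding class_NP_def by blast
qed

theorem corollary2:
  shows "NP_complete (enc_input ` {I \<in> Borda_Bribery. bribe_limit I = 2}) \<and>
    enc_input ` {I \<in> Borda_Conformant_Bribery. bribe_limit I = 2} \<in> class_P"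
  using Borda_Bribery_in_NP Borda_Bribery_hard Borda_Conformant_Bribery_in_P
  unfolding NP_complete_def by blast

end
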